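(* Let $\mathcal{C}$ be a groupoidant 2-category and suppose $X\in\mathcal{C}$ is an internal elementary topos. Then there exist a covariant power morphism $X\to X$ and a contravariant power morphism $X^{\mathrm{op}}\to X$ for $X$, and they are each unique up to isomorphism.
   Context: Conventions. 2-categories are strict. Composition is in diagrammatic order: $fg$ means first $f$, then $g$ (also for functors and whiskerings). $|\mathcal{C}|$ is the underlying 1-category of $\mathcal{C}$. For $f:X\to Y$ and an object $A$, $f_*:\mathcal{C}(A,X)\to\mathcal{C}(A,Y)$ and $f^*:\mathcal{C}(Y,A)\to\mathcal{C}(X,A)$ are given by composition with $f$. $[k]$ is the linear order $\{0<\dots<k\}$ viewed as a category, and $\delta_{a_0\dots a_k}:[k]\to[l]$ is the functor $j\mapsto a_j$. Limits. A functor $F$ is an isofibration if every isomorphism $Fx\to b$ lifts to an isomorphism with domain $x$; it is a discrete opfibration (DOF) if every morphism $Fx\to b$ has a unique lift with domain $x$. A morphism $f$ of $\mathcal{C}$ is an isofibration (resp. DOF) if $f_*:\mathcal{C}(A,X)\to\mathcal{C}(A,Y)$ is one for all $A$. A commutative square with vertex $P$ over a cospan $X\to Z\leftarrow Y$ is a strict pullback if $\mathcal{C}(B,P)\to\mathcal{C}(B,X)\times_{\mathcal{C}(B,Z)}\mathcal{C}(B,Y)$ is an isomorphism of categories for all $B$. A strict terminal object has all $\mathcal{C}(A,\mathbf 1)$ equal to the one-morphism category. A strict cotensor of $X$ with a category $J$ is an object $X^J$ with a functor $\mathrm{ev}:J\to\mathcal{C}(X^J,X)$ inducing isomorphisms of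 categories $\mathcal{C}(A,X^J)\cong\mathrm{Fun}(J,\mathcal{C}(A,X))$ for all $A$; functors $J\to J'$ induce $X^{J'}\to X^J$. The arrow object is $X^\to=X^{[1]}$, with universal 2-cell $\partial:\partial_0\Rightarrow\partial_1:X^\to\to X$. $\mathcal{C}$ is pita if it has a strict terminal object, strict arrow objects, and strict pullbacks of isofibrations along arbitrary morphisms (it then has cotensors with finite categories). Groupoids and cores. $X$ is a groupoid if every $\mathcal{C}(A,X)$ is a groupoid. $f:A\to X$ is an arrow-wise iso if $\alpha f$ is invertible for every 2-cell $\alpha$ between morphisms into $A$. A core of $X$ is an object $X^{\mathrm{iso}}$ with an arrow-wise iso $i:X^{\mathrm{iso}}\to X$ such that for all $A$, $i_*$ is an isomorphism from $\mathcal{C}(A,X^{\mathrm{iso}})$ onto the subcategory of $\mathcal{C}(A,X)$ of arrow-wise isos and invertible 2-cells. Any $f:X\to Y$ induces $f^{\mathrm{iso}}:X^{\mathrm{iso}}\to Y^{\mathrm{iso}}$ with $f^{\mathrm{iso}}i=if$; if $A$ is a groupoid and $f:A\to X$, write $f^{\mathrm{iso}}:A\to X^{\mathrm{iso}}$ for the unique morphism with $f^{\mathrm{iso}}i=f$. Congruences. An internal category $C$ in a 1-category has objects $C_0,C_1,C_2$ and morphisms $\pi_0,\pi_1:C_1\to C_0$ (source, target), $e:C_0\to C_1$ (identities), $\pi_{01},\pi_{12},\pi_{02}:C_2\to C_1$ (first arrow, second arrow, composite), with $C_2=C_1\times_{C_0}C_1$ via $\pi_{01}\pi_1=\pi_{12}\pi_0$,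 satisfying the usual axioms. $C_3=C_2\times_{C_1}C_2$ (along $\pi_{12},\pi_{01}$) is the object of composable triples; $\langle a,b,c\rangle:A\to C_3$ is the morphism with consecutive components $a,b,c:A\to C_1$, and $\pi_{02},\pi_{13}:C_3\to C_1$ give the composite of the first two, resp. last two, arrows. In a pita 2-category $\mathcal{C}$, an internal double category is an internal category in $|\mathcal{C}|$ with $\langle\pi_0,\pi_1\rangle:C_1\to C_0\times C_0$ an isofibration. It is a gbo-congruence if $C_0,C_1,C_2$ are groupoids and $\langle\pi_0,\pi_1\rangle$ is a DOF. Then there is a unique $r:C_0^\to\to C_1$ (the reflection morphism) for which there exists a 2-cell $\bar\rho:r\Rightarrow\partial_1e$ with $\bar\rho\langle\pi_0,\pi_1\rangle=\langle\partial,\mathrm{id}_{\partial_1}\rangle$. Let $\tau:C_0^\to\to C_0^\to$ be the morphism with $\tau\partial=\partial^{-1}$. A gbo-congruence $C$ is complete (a complete congruence) if the square with top $\langle r,\tau r,r\rangle:C_0^\to\to C_3$, left $\langle\partial_0,\partial_1\rangle:C_0^\to\to C_0\times C_0$, right $\langle\pi_{02},\pi_{13}\rangle:C_3\to C_1\times C_1$ and bottom $e\times e$ is a strict pullback. Nerves and quotients. A nerve $\mathrm{Nv}(X)$ of $X$ is the internal double category with objects $X^{\mathrm{iso}},(X^\to)^{\mathrm{iso}},(X^{[2]})^{\mathrm{iso}}$ (for some choice of cores and cotensors) and structure maps $\pi_{jk}=(X^{\delta_{jk}})^{\mathrm{iso}}$, $\pi_j=(X^{\delta_j})^{\mathrm{iso}}=\partial_j^{\mathrm{iso}}$,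 $e=(X^{\delta_{00}})^{\mathrm{iso}}$. A cocone under $C$ with vertex $Y$ is a morphism $\gamma:C_0\to Y$ and a 2-cell $\gamma_{01}:\pi_0\gamma\Rightarrow\pi_1\gamma$ with $e\gamma_{01}=\mathrm{id}_\gamma$ and $\pi_{02}\gamma_{01}=(\pi_{01}\gamma_{01})(\pi_{12}\gamma_{01})$; a morphism $(\gamma,\gamma_{01})\to(\gamma',\gamma'_{01})$ is a 2-cell $\alpha:\gamma\Rightarrow\gamma'$ with $(\pi_0\alpha)\gamma'_{01}=\gamma_{01}(\pi_1\alpha)$. A cocone with vertex $X$ is a strict quotient of $C$ if the induced functor $\mathcal{C}(X,Y)\to\mathrm{Cocone}(C,Y)$ is an isomorphism for all $Y$. The tautological cocone under $\mathrm{Nv}(X)$ is $\gamma=i:X^{\mathrm{iso}}\to X$, $\gamma_{01}=i\partial$ (with $i:(X^\to)^{\mathrm{iso}}\to X^\to$). $\mathcal{C}$ is groupoidant if: it is pita; every object has a core; every complete congruence is a nerve (of some object); and the tautological cocone under any nerve is a strict quotient. Opposites. The opposite $C^{\mathrm{op}}$ of an internal double category $C$ is obtained by exchanging $\pi_0$ with $\pi_1$ and $\pi_{01}$ with $\pi_{12}$. An opposition between $X$ and $X^{\mathrm{op}}$ is a complete congruence $C$ with a quotient cocone $(X,\gamma,\gamma_{01})$ of $C$ and a quotient cocone $(X^{\mathrm{op}},\gamma^{\mathrm{op}}:C_0\to X^{\mathrm{op}},\gamma^{\mathrm{op}}_{01}:\pi_1\gamma^{\mathrm{op}}\Rightarrow\pi_0\gamma^{\mathrm{op}})$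 of $C^{\mathrm{op}}$. In a groupoidant 2-category every $X$ has such an opposite $X^{\mathrm{op}}$, unique up to isomorphism, and $C$ with $(\gamma,\gamma_{01})$ is a nerve of $X$ with its tautological cocone. For a groupoid $A$ and $f:A\to X$, $f^{\mathrm{op}}:A\to X^{\mathrm{op}}$ is $\bar f\gamma^{\mathrm{op}}$, where $\bar f:A\to C_0$ is the unique morphism with $\bar f\gamma=f$; for a 2-cell $\alpha:f\Rightarrow g:A\to X$, $\alpha^{\mathrm{op}}:g^{\mathrm{op}}\Rightarrow f^{\mathrm{op}}$ is $a\gamma_{01}^{\mathrm{op}}$, where $a:A\to C_1$ is the unique morphism with $a\gamma_{01}=\alpha$. Internal topoi. $X\in\mathcal{C}$ has finite limits if each $\mathcal{C}(A,X)$ has finite limits and each $f^*:\mathcal{C}(A,X)\to\mathcal{C}(A',X)$, $f:A'\to A$, preserves them. In a category with finite limits, a power object of $a$ is an object $P(a)$ with a monomorphism $\epsilon_a\rightarrowtail a\times P(a)$ such that for each monomorphism $R\rightarrowtail a\times y$ there is a unique $r:y\to P(a)$ such that $R$ is a pullback of $\epsilon_a$ along $\mathrm{id}\times r$. A finite-limit-preserving functor preserves $P(a)$ if it carries $\epsilon_a\rightarrowtail a\times P(a)$ to a power object of the image of $a$. $X$ is an internal elementary topos if it has finite limits, $\mathcal{C}(A,X)$ has power objects for every groupoid $A$, and $f^*:\mathcal{C}(A,X)\to\mathcal{C}(A',X)$ preserves finite limits and power objects for every $f:A'\to A$ between groupoids. Power object diagrams. Let $\check K$ be the preorder generated by $3\to2$,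 $2\to0$, $2\to1$. For $X$ with finite limits, $X^{\check K}$ denotes an object with a functor $\check K\to\mathcal{C}(X^{\check K},X)$ inducing, for all $A$, an isomorphism from $\mathcal{C}(A,X^{\check K})$ onto the full subcategory of $\mathrm{Fun}(\check K,\mathcal{C}(A,X))$ of diagrams in which $0\leftarrow2\to1$ is a product diagram and $3\to2$ is a monomorphism, both preserved by $h^*$ for all $h:A'\to A$. (It exists when $\mathcal{C}$ is pita.) Let $X^{\iota}:X^{\check K}\to X$ be the morphism restricting a diagram to its value at the object $0$. A morphism $A\to X^{\check K}$ is called a power object diagram if, in the corresponding diagram in $\mathcal{C}(A,X)$, the monomorphism $3\rightarrowtail 2$ (with $2$ the product of $0$ and $1$) makes the value at $1$ a power object of the value at $0$; the value at $1$ is then the underlying power object. Given power object diagrams on objects $a,b$ of an elementary topos, a morphism $k:a\to b$ induces the direct image morphism $k_*:P(a)\to P(b)$ (classifying the image of $\epsilon_a\to a\times P(a)\to b\times P(a)$) and the inverse image morphism $k^*:P(b)\to P(a)$ (classifying the pullback of $\epsilon_b$ along $k\times\mathrm{id}:a\times P(b)\to b\times P(b)$). Power morphisms. Consider morphisms $P:X^{\mathrm{iso}}\to(X^{\check K})^{\mathrm{iso}}$ with $P(X^\iota)^{\mathrm{iso}}=\mathrm{id}_{X^{\mathrm{iso}}}$ such that for each groupoid $A$ and $f:A\to X$, $f^{\mathrm{iso}}Pi:A\to X^{\check K}$ is a power object diagram (on $f$). A morphism $\mathcal P:X\to X$ is a covariant power morphism if there is such a $P$ for which: (i) for each groupoid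 $A$ and $f:A\to X$, $f\mathcal P\in\mathcal{C}(A,X)$ is the power object underlying $f^{\mathrm{iso}}Pi$; (ii) for each groupoid $A$ and 2-cell $\alpha:f\Rightarrow g:A\to X$, $\alpha\mathcal P:f\mathcal P\to g\mathcal P$ is the covariant (direct image) morphism induced by $\alpha$ and the power object diagrams $f^{\mathrm{iso}}Pi$, $g^{\mathrm{iso}}Pi$. A morphism $\mathcal P:X^{\mathrm{op}}\to X$ is a contravariant power morphism if there is such a $P$ for which $f^{\mathrm{op}}\mathcal P$ is the power object underlying $f^{\mathrm{iso}}Pi$ and $\alpha^{\mathrm{op}}\mathcal P:g^{\mathrm{op}}\mathcal P\to f^{\mathrm{op}}\mathcal P$ is the contravariant (inverse image) morphism induced by $\alpha$, $f^{\mathrm{iso}}Pi$, $g^{\mathrm{iso}}Pi$, for all groupoids $A$ and all such $f,g,\alpha$. *)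

theory Defs
  imports Main "HOL-Library.FuncSet"
begin

section \<open>Categories\<close>

text \<open>Composition is written in diagrammatic order throughout: \<open>f \<cdot> g\<close> is first \<open>f\<close>, then \<open>g\<close>.
  Only the restriction of the operations to the carriers \<open>Obj\<close>, \<open>Arr\<close> is meaningful.\<close>

record ('o, 'm) cat =
  Obj :: "'o set"
  Arr :: "'m set"
  Dom :: "'m \<Rightarrow> 'o"
  Cod :: "'m \<Rightarrow> 'o"
  ide :: "'o \<Rightarrow> 'm"
  cmp :: "'m \<Rightarrow> 'm \<Rightarrow> 'm" (infixl "\<cdot>\<index>" 70)

definition in_hom :: "('o, 'm) cat \<Rightarrow> 'm \<Rightarrow> 'o \<Rightarrow> 'o \<Rightarrow> bool" where
  "in_hom D f a b \<longleftrightarrow> f \<in> Arr D \<and> Dom D f = a \<and> Cod D f = b"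

locale category =
  fixes D :: "('o, 'm) cat" (structure)
  assumes Dom_Obj: "f \<in> Arr D \<Longrightarrow> Dom D f \<in> Obj D"
    and Cod_Obj: "f \<in> Arr D \<Longrightarrow> Cod D f \<in> Obj D"
    and ide_in_hom: "a \<in> Obj D \<Longrightarrow> in_hom D (ide D a) a a"
    and cmp_in_hom: "in_hom D f a b \<Longrightarrow> in_hom D g b c \<Longrightarrow> in_hom D (f \<cdot> g) a c"
    and ide_cmp: "f \<in> Arr D \<Longrightarrow> ide D (Dom D f) \<cdot> f = f"
    and cmp_ide: "f \<in> Arr D \<Longrightarrow> f \<cdot> ide D (Cod D f) = f"
    and cmp_assoc: "in_hom D f a b \<Longrightarrow> in_hom D g b c \<Longrightarrow> in_hom D h c d
      \<Longrightarrow> (f \<cdot> g) \<cdot> h = f \<cdot> (g \<cdot> h)"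

definition inverse_arrows :: "('o, 'm) cat \<Rightarrow> 'm \<Rightarrow> 'm \<Rightarrow> bool" where
  "inverse_arrows D f g \<longleftrightarrow> f \<in> Arr D \<and> in_hom D g (Cod D f) (Dom D f)
     \<and> f \<cdot>\<^bsub>D\<^esub> g = ide D (Dom D f) \<and> g \<cdot>\<^bsub>D\<^esub> f = ide D (Cod D f)"

definition is_iso :: "('o, 'm) cat \<Rightarrow> 'm \<Rightarrow> bool" where
  "is_iso D f \<longleftrightarrow> (\<exists>g. inverse_arrows D f g)"

definition isomorphic :: "('o, 'm) cat \<Rightarrow> 'o \<Rightarrow> 'o \<Rightarrow> bool" where
  "isomorphic D a b \<longleftrightarrow> (\<exists>f. in_hom D f a b \<and> is_iso D f)"

definition groupoid_cat :: "('o, 'm) cat \<Rightarrow> bool" where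
  "groupoid_cat D \<longleftrightarrow> (\<forall>f \<in> Arr D. is_iso D f)"

definition subcat :: "('o, 'm) cat \<Rightarrow> 'o set \<Rightarrow> 'm set \<Rightarrow> ('o, 'm) cat" where
  "subcat D S T = D\<lparr>Obj := S, Arr := T\<rparr>"

definition full_subcat :: "('o, 'm) cat \<Rightarrow> 'o set \<Rightarrow> ('o, 'm) cat" where
  "full_subcat D S = subcat D S {f \<in> Arr D. Dom D f \<in> S \<and> Cod D f \<in> S}"

definition prod_cat :: "('o, 'm) cat \<Rightarrow> ('p, 'n) cat \<Rightarrow> ('o \<times> 'p, 'm \<times> 'n) cat" where
  "prod_cat D E = \<lparr>Obj = Obj D \<times> Obj E, Arr = Arr D \<times> Arr E,
     Dom = map_prod (Dom D) (Dom E), Cod = map_prod (Cod D) (Cod E),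
     ide = map_prod (ide D) (ide E),
     cmp = (\<lambda>(f, g) (f', g'). (f \<cdot>\<^bsub>D\<^esub> f', g \<cdot>\<^bsub>E\<^esub> g'))\<rparr>"

subsection \<open>Functors\<close>

record ('o, 'm, 'p, 'n) ftor =
  fobj :: "'o \<Rightarrow> 'p"
  farr :: "'m \<Rightarrow> 'n"

definition is_functor :: "('o, 'm) cat \<Rightarrow> ('p, 'n) cat \<Rightarrow> ('o, 'm, 'p, 'n) ftor \<Rightarrow> bool" where
  "is_functor D E F \<longleftrightarrow>
     (\<forall>a \<in> Obj D. fobj F a \<in> Obj E \<and> farr F (ide D a) = ide E (fobj F a))
   \<and> (\<forall>f \<in> Arr D. in_hom E (farr F f) (fobj F (Dom D f)) (fobj F (Cod D f)))
   \<and> (\<forall>f \<in> Arr D. \<forall>g \<in> Arr D. Cod D f = Dom D g \<longrightarrow>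
        farr F (f \<cdot>\<^bsub>D\<^esub> g) = farr F f \<cdot>\<^bsub>E\<^esub> farr F g)"

definition ftor_comp ::
    "('o, 'm, 'p, 'n) ftor \<Rightarrow> ('p, 'n, 'q, 'l) ftor \<Rightarrow> ('o, 'm, 'q, 'l) ftor" where
  "ftor_comp F G = \<lparr>fobj = (\<lambda>a. fobj G (fobj F a)), farr = (\<lambda>f. farr G (farr F f))\<rparr>"

text \<open>Functors out of \<open>J\<close> are compared by their values on \<open>J\<close> only; this picks the
  representative that is \<open>undefined\<close> off the carriers.\<close>

definition ftor_restrict ::
    "('o, 'm) cat \<Rightarrow> ('o, 'm, 'p, 'n) ftor \<Rightarrow> ('o, 'm, 'p, 'n) ftor" where
  "ftor_restrict J F = \<lparr>fobj = restrict (fobj F) (Obj J), farr = restrict (farr F) (Arr J)\<rparr>"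

definition cat_isomorphism :: "('o, 'm) cat \<Rightarrow> ('p, 'n) cat \<Rightarrow> ('o, 'm, 'p, 'n) ftor \<Rightarrow> bool" where
  "cat_isomorphism D E F \<longleftrightarrow> is_functor D E F
     \<and> bij_betw (fobj F) (Obj D) (Obj E) \<and> bij_betw (farr F) (Arr D) (Arr E)"

definition isofibration_functor ::
    "('o, 'm) cat \<Rightarrow> ('p, 'n) cat \<Rightarrow> ('o, 'm, 'p, 'n) ftor \<Rightarrow> bool" where
  "isofibration_functor D E F \<longleftrightarrow> is_functor D E F
     \<and> (\<forall>x \<in> Obj D. \<forall>v. is_iso E v \<and> Dom E v = fobj F x \<longrightarrow>
          (\<exists>u. is_iso D u \<and> Dom D u = x \<and> farr F u = v))"

definition dof_functor ::
    "('o, 'm) cat \<Rightarrow> ('p, 'n) cat \<Rightarrow> ('o, 'm, 'p, 'n) ftor \<Rightarrow> bool" where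
  "dof_functor D E F \<longleftrightarrow> is_functor D E F
     \<and> (\<forall>x \<in> Obj D. \<forall>v \<in> Arr E. Dom E v = fobj F x \<longrightarrow>
          (\<exists>!u. u \<in> Arr D \<and> Dom D u = x \<and> farr F u = v))"

definition fibre_product_cat :: "('o, 'm) cat \<Rightarrow> ('p, 'n) cat \<Rightarrow>
    ('o, 'm, 'q, 'l) ftor \<Rightarrow> ('p, 'n, 'q, 'l) ftor \<Rightarrow> ('o \<times> 'p, 'm \<times> 'n) cat" where
  "fibre_product_cat D E F G = subcat (prod_cat D E)
     {(x, y). x \<in> Obj D \<and> y \<in> Obj E \<and> fobj F x = fobj G y}
     {(u, v). u \<in> Arr D \<and> v \<in> Arr E \<and> farr F u = farr G v}"

definition pair_functor ::
    "('o, 'm, 'p, 'n) ftor \<Rightarrow> ('o, 'm, 'q, 'l) ftor \<Rightarrow> ('o, 'm, 'p \<times> 'q, 'n \<times> 'l) ftor" where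
  "pair_functor F G = \<lparr>fobj = (\<lambda>a. (fobj F a, fobj G a)), farr = (\<lambda>f. (farr F f, farr G f))\<rparr>"

definition natural_transformation :: "('j, 'k) cat \<Rightarrow> ('o, 'm) cat \<Rightarrow>
    ('j, 'k, 'o, 'm) ftor \<Rightarrow> ('j, 'k, 'o, 'm) ftor \<Rightarrow> ('j \<Rightarrow> 'm) \<Rightarrow> bool" where
  "natural_transformation J D F G \<eta> \<longleftrightarrow>
     (\<forall>j \<in> Obj J. in_hom D (\<eta> j) (fobj F j) (fobj G j))
   \<and> (\<forall>u \<in> Arr J. farr F u \<cdot>\<^bsub>D\<^esub> \<eta> (Cod J u) = \<eta> (Dom J u) \<cdot>\<^bsub>D\<^esub> farr G u)"

definition fun_cat :: "('j, 'k) cat \<Rightarrow> ('o, 'm) cat \<Rightarrow>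
    (('j, 'k, 'o, 'm) ftor,
     ('j, 'k, 'o, 'm) ftor \<times> ('j, 'k, 'o, 'm) ftor \<times> ('j \<Rightarrow> 'm)) cat" where
  "fun_cat J D = \<lparr>
     Obj = {F. is_functor J D F \<and> ftor_restrict J F = F},
     Arr = {(F, G, \<eta>). is_functor J D F \<and> ftor_restrict J F = F
              \<and> is_functor J D G \<and> ftor_restrict J G = G
              \<and> natural_transformation J D F G \<eta> \<and> \<eta> \<in> extensional (Obj J)},
     Dom = (\<lambda>(F, G, \<eta>). F),
     Cod = (\<lambda>(F, G, \<eta>). G),
     ide = (\<lambda>F. (F, F, \<lambda>j \<in> Obj J. ide D (fobj F j))),
     cmp = (\<lambda>(F, G, \<eta>) (G', H, \<theta>). (F, H, \<lambda>j \<in> Obj J. \<eta> j \<cdot>\<^bsub>D\<^esub> \<theta> j))\<rparr>"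

subsection \<open>Preorders as categories\<close>

definition preorder_cat :: "'i set \<Rightarrow> ('i \<times> 'i) set \<Rightarrow> ('i, 'i \<times> 'i) cat" where
  "preorder_cat S R = \<lparr>Obj = S, Arr = {(i, j). i \<in> S \<and> j \<in> S \<and> (i, j) \<in> R},
     Dom = fst, Cod = snd, ide = (\<lambda>i. (i, i)), cmp = (\<lambda>(i, j) (j', k). (i, k))\<rparr>"

text \<open>The linear order \<open>[k] = {0 < ... < k}\<close>, and \<open>\<delta>\<close> for a list of values.\<close>

definition ord_cat :: "nat \<Rightarrow> (nat, nat \<times> nat) cat" where
  "ord_cat k = preorder_cat {0..k} {(i, j). i \<le> j}"

definition delta :: "nat list \<Rightarrow> (nat, nat \<times> nat, nat, nat \<times> nat) ftor" where
  "delta as = \<lparr>fobj = (\<lambda>j. as ! j), farr = (\<lambda>(i, j). (as ! i, as ! j))\<rparr>"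

definition K_check :: "(nat, nat \<times> nat) cat" where
  "K_check = preorder_cat {0, 1, 2, 3} ({(3, 2), (2, 0), (2, 1)}\<^sup>*)"

subsection \<open>Limits in a category\<close>

definition is_mono :: "('o, 'm) cat \<Rightarrow> 'm \<Rightarrow> bool" where
  "is_mono D f \<longleftrightarrow> f \<in> Arr D \<and> (\<forall>x \<in> Arr D. \<forall>y \<in> Arr D.
     Dom D x = Dom D y \<and> Cod D x = Dom D f \<and> Cod D y = Dom D f \<and> x \<cdot>\<^bsub>D\<^esub> f = y \<cdot>\<^bsub>D\<^esub> f
     \<longrightarrow> x = y)"

text \<open>\<open>p\<close> and \<open>q\<close> are the projections of a product of \<open>Cod p\<close> and \<open>Cod q\<close>.\<close>

definition is_product :: "('o, 'm) cat \<Rightarrow> 'm \<Rightarrow> 'm \<Rightarrow> bool" where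
  "is_product D p q \<longleftrightarrow> p \<in> Arr D \<and> q \<in> Arr D \<and> Dom D p = Dom D q
   \<and> (\<forall>x \<in> Arr D. \<forall>y \<in> Arr D. Dom D x = Dom D y \<and> Cod D x = Cod D p \<and> Cod D y = Cod D q \<longrightarrow>
        (\<exists>!h. in_hom D h (Dom D x) (Dom D p) \<and> h \<cdot>\<^bsub>D\<^esub> p = x \<and> h \<cdot>\<^bsub>D\<^esub> q = y))"

text \<open>\<open>h\<close> is \<open>u \<times> v\<close>, from the product with projections \<open>s0, s1\<close> to the one with
  projections \<open>q0, q1\<close>.\<close>

definition is_product_map :: "('o, 'm) cat \<Rightarrow> 'm \<Rightarrow> 'm \<Rightarrow> 'm \<Rightarrow> 'm \<Rightarrow> 'm \<Rightarrow> 'm \<Rightarrow> 'm \<Rightarrow> bool" where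
  "is_product_map D s0 s1 q0 q1 u v h \<longleftrightarrow>
     in_hom D u (Cod D s0) (Cod D q0) \<and> in_hom D v (Cod D s1) (Cod D q1)
   \<and> in_hom D h (Dom D s0) (Dom D q0)
   \<and> h \<cdot>\<^bsub>D\<^esub> q0 = s0 \<cdot>\<^bsub>D\<^esub> u \<and> h \<cdot>\<^bsub>D\<^esub> q1 = s1 \<cdot>\<^bsub>D\<^esub> v"

text \<open>\<open>p, q\<close> are the projections of a pullback of the cospan \<open>f, g\<close>, with \<open>p f = q g\<close>.\<close>

definition is_pullback :: "('o, 'm) cat \<Rightarrow> 'm \<Rightarrow> 'm \<Rightarrow> 'm \<Rightarrow> 'm \<Rightarrow> bool" where
  "is_pullback D p q f g \<longleftrightarrow> p \<in> Arr D \<and> q \<in> Arr D \<and> f \<in> Arr D \<and> g \<in> Arr D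
   \<and> Dom D p = Dom D q \<and> Cod D p = Dom D f \<and> Cod D q = Dom D g \<and> Cod D f = Cod D g
   \<and> p \<cdot>\<^bsub>D\<^esub> f = q \<cdot>\<^bsub>D\<^esub> g
   \<and> (\<forall>x \<in> Arr D. \<forall>y \<in> Arr D. Dom D x = Dom D y \<and> Cod D x = Dom D f \<and> Cod D y = Dom D g
        \<and> x \<cdot>\<^bsub>D\<^esub> f = y \<cdot>\<^bsub>D\<^esub> g \<longrightarrow>
        (\<exists>!h. in_hom D h (Dom D x) (Dom D p) \<and> h \<cdot>\<^bsub>D\<^esub> p = x \<and> h \<cdot>\<^bsub>D\<^esub> q = y))"

definition is_cone :: "('j, 'k) cat \<Rightarrow> ('o, 'm) cat \<Rightarrow> ('j, 'k, 'o, 'm) ftor \<Rightarrow>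
    'o \<Rightarrow> ('j \<Rightarrow> 'm) \<Rightarrow> bool" where
  "is_cone J D F L l \<longleftrightarrow> L \<in> Obj D
   \<and> (\<forall>j \<in> Obj J. in_hom D (l j) L (fobj F j))
   \<and> (\<forall>u \<in> Arr J. l (Dom J u) \<cdot>\<^bsub>D\<^esub> farr F u = l (Cod J u))"

definition is_limit :: "('j, 'k) cat \<Rightarrow> ('o, 'm) cat \<Rightarrow> ('j, 'k, 'o, 'm) ftor \<Rightarrow>
    'o \<Rightarrow> ('j \<Rightarrow> 'm) \<Rightarrow> bool" where
  "is_limit J D F L l \<longleftrightarrow> is_cone J D F L l
   \<and> (\<forall>M m. is_cone J D F M m \<longrightarrow>
        (\<exists>!h. in_hom D h M L \<and> (\<forall>j \<in> Obj J. h \<cdot>\<^bsub>D\<^esub> l j = m j)))"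

text \<open>Every finite category is isomorphic to one whose objects and arrows are natural numbers, so
  quantifying over \<open>(nat, nat) cat\<close> covers all finite diagram shapes.\<close>

definition finite_category :: "('j, 'k) cat \<Rightarrow> bool" where
  "finite_category J \<longleftrightarrow> category J \<and> finite (Obj J) \<and> finite (Arr J)"

definition has_finite_limits :: "('o, 'm) cat \<Rightarrow> bool" where
  "has_finite_limits D \<longleftrightarrow> (\<forall>(J :: (nat, nat) cat) F.
     finite_category J \<and> is_functor J D F \<longrightarrow> (\<exists>L l. is_limit J D F L l))"

definition preserves_finite_limits ::
    "('o, 'm) cat \<Rightarrow> ('p, 'n) cat \<Rightarrow> ('o, 'm, 'p, 'n) ftor \<Rightarrow> bool" where
  "preserves_finite_limits D E G \<longleftrightarrow> (\<forall>(J :: (nat, nat) cat) F L l.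
     finite_category J \<and> is_functor J D F \<and> is_limit J D F L l \<longrightarrow>
     is_limit J E (ftor_comp F G) (fobj G L) (\<lambda>j. farr G (l j)))"

text \<open>The image of \<open>f\<close>: the least subobject through which \<open>f\<close> factors.\<close>

definition factors_through :: "('o, 'm) cat \<Rightarrow> 'm \<Rightarrow> 'm \<Rightarrow> bool" where
  "factors_through D f n \<longleftrightarrow> (\<exists>t. in_hom D t (Dom D f) (Dom D n) \<and> t \<cdot>\<^bsub>D\<^esub> n = f)"

definition is_image :: "('o, 'm) cat \<Rightarrow> 'm \<Rightarrow> 'm \<Rightarrow> bool" where
  "is_image D f n \<longleftrightarrow> f \<in> Arr D \<and> is_mono D n \<and> Cod D n = Cod D f \<and> factors_through D f n
   \<and> (\<forall>n'. is_mono D n' \<and> Cod D n' = Cod D f \<and> factors_through D f n' \<longrightarrow> factors_through D n n')"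

subsection \<open>Power objects\<close>

text \<open>A candidate power object of \<open>a\<close> is given by the projections \<open>q0 : a \<times> P(a) \<rightarrow> a\<close>,
  \<open>q1 : a \<times> P(a) \<rightarrow> P(a)\<close> and the arrow \<open>m : \<epsilon> \<rightarrow> a \<times> P(a)\<close>; so \<open>a = Cod q0\<close> and \<open>P(a) = Cod q1\<close>.
  Likewise \<open>R\<close> is given by \<open>s0 : a \<times> y \<rightarrow> a\<close>, \<open>s1 : a \<times> y \<rightarrow> y\<close> and \<open>n : R \<rightarrow> a \<times> y\<close>.
  The arrow \<open>r : y \<rightarrow> P(a)\<close> classifies \<open>n\<close> if \<open>n\<close> is a pullback of \<open>m\<close> along \<open>id \<times> r\<close>.\<close>

definition classifies :: "('o, 'm) cat \<Rightarrow> 'm \<Rightarrow> 'm \<Rightarrow> 'm \<Rightarrow> 'm \<Rightarrow> 'm \<Rightarrow> 'm \<Rightarrow> 'm \<Rightarrow> bool" where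
  "classifies D q0 q1 m s0 s1 n r \<longleftrightarrow>
     (\<exists>h t. is_product_map D s0 s1 q0 q1 (ide D (Cod D q0)) r h \<and> is_pullback D n t h m)"

definition is_power_object :: "('o, 'm) cat \<Rightarrow> 'm \<Rightarrow> 'm \<Rightarrow> 'm \<Rightarrow> bool" where
  "is_power_object D q0 q1 m \<longleftrightarrow> is_product D q0 q1 \<and> is_mono D m \<and> Cod D m = Dom D q0
   \<and> (\<forall>s0 s1 n. is_product D s0 s1 \<and> Cod D s0 = Cod D q0 \<and> is_mono D n \<and> Cod D n = Dom D s0 \<longrightarrow>
        (\<exists>!r. classifies D q0 q1 m s0 s1 n r))"

definition has_power_objects :: "('o, 'm) cat \<Rightarrow> bool" where
  "has_power_objects D \<longleftrightarrow>
     (\<forall>a \<in> Obj D. \<exists>q0 q1 m. is_power_object D q0 q1 m \<and> Cod D q0 = a)"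

definition preserves_power_objects ::
    "('o, 'm) cat \<Rightarrow> ('p, 'n) cat \<Rightarrow> ('o, 'm, 'p, 'n) ftor \<Rightarrow> bool" where
  "preserves_power_objects D E G \<longleftrightarrow> (\<forall>q0 q1 m. is_power_object D q0 q1 m \<longrightarrow>
     is_power_object E (farr G q0) (farr G q1) (farr G m))"

text \<open>For a diagram \<open>F\<close> of shape \<open>K_check\<close>: \<open>F 2\<close> is to be the product of \<open>F 0\<close> and \<open>F 1\<close>, and
  \<open>F 3 \<rightarrow> F 2\<close> the universal relation; \<open>F 1\<close> is the underlying power object.\<close>

definition power_object_functor ::
    "('o, 'm) cat \<Rightarrow> (nat, nat \<times> nat, 'o, 'm) ftor \<Rightarrow> bool" where
  "power_object_functor D F \<longleftrightarrow> is_functor K_check D F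
     \<and> is_power_object D (farr F (2, 0)) (farr F (2, 1)) (farr F (3, 2))"

definition is_direct_image :: "('o, 'm) cat \<Rightarrow>
    (nat, nat \<times> nat, 'o, 'm) ftor \<Rightarrow> (nat, nat \<times> nat, 'o, 'm) ftor \<Rightarrow> 'm \<Rightarrow> 'm \<Rightarrow> bool" where
  "is_direct_image D F G k d \<longleftrightarrow> in_hom D k (fobj F 0) (fobj G 0)
   \<and> (\<exists>s0 s1 w n. is_product D s0 s1 \<and> Cod D s0 = fobj G 0 \<and> Cod D s1 = fobj F 1
        \<and> is_product_map D (farr F (2, 0)) (farr F (2, 1)) s0 s1 k (ide D (fobj F 1)) w
        \<and> is_image D (farr F (3, 2) \<cdot>\<^bsub>D\<^esub> w) n
        \<and> classifies D (farr G (2, 0)) (farr G (2, 1)) (farr G (3, 2)) s0 s1 n d)"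

definition is_inverse_image :: "('o, 'm) cat \<Rightarrow>
    (nat, nat \<times> nat, 'o, 'm) ftor \<Rightarrow> (nat, nat \<times> nat, 'o, 'm) ftor \<Rightarrow> 'm \<Rightarrow> 'm \<Rightarrow> bool" where
  "is_inverse_image D F G k d \<longleftrightarrow> in_hom D k (fobj F 0) (fobj G 0)
   \<and> (\<exists>s0 s1 w n t. is_product D s0 s1 \<and> Cod D s0 = fobj F 0 \<and> Cod D s1 = fobj G 1
        \<and> is_product_map D s0 s1 (farr G (2, 0)) (farr G (2, 1)) k (ide D (fobj G 1)) w
        \<and> is_pullback D n t w (farr G (3, 2))
        \<and> classifies D (farr F (2, 0)) (farr F (2, 1)) (farr F (3, 2)) s0 s1 n d)"

section \<open>Strict 2-categories\<close>

record ('o, 'm, 'c) twocat =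
  Ob :: "'o set"
  Mor :: "'m set"
  Src :: "'m \<Rightarrow> 'o"
  Tgt :: "'m \<Rightarrow> 'o"
  Id1 :: "'o \<Rightarrow> 'm"
  comp1 :: "'m \<Rightarrow> 'm \<Rightarrow> 'm" (infixl "\<bullet>\<index>" 70)
  Cell :: "'c set"
  Dom2 :: "'c \<Rightarrow> 'm"
  Cod2 :: "'c \<Rightarrow> 'm"
  Id2 :: "'m \<Rightarrow> 'c"
  vcomp :: "'c \<Rightarrow> 'c \<Rightarrow> 'c" (infixl "\<odot>\<index>" 65)
  hcomp :: "'c \<Rightarrow> 'c \<Rightarrow> 'c" (infixl "\<star>\<index>" 70)

definition und :: "('o, 'm, 'c) twocat \<Rightarrow> ('o, 'm) cat" where
  "und C = \<lparr>Obj = Ob C, Arr = Mor C, Dom = Src C, Cod = Tgt C, ide = Id1 C, cmp = comp1 C\<rparr>"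

definition vert :: "('o, 'm, 'c) twocat \<Rightarrow> ('m, 'c) cat" where
  "vert C = \<lparr>Obj = Mor C, Arr = Cell C, Dom = Dom2 C, Cod = Cod2 C, ide = Id2 C, cmp = vcomp C\<rparr>"

definition in_mor :: "('o, 'm, 'c) twocat \<Rightarrow> 'm \<Rightarrow> 'o \<Rightarrow> 'o \<Rightarrow> bool" where
  "in_mor C f A B \<longleftrightarrow> f \<in> Mor C \<and> Src C f = A \<and> Tgt C f = B"

definition in_cell :: "('o, 'm, 'c) twocat \<Rightarrow> 'c \<Rightarrow> 'm \<Rightarrow> 'm \<Rightarrow> bool" where
  "in_cell C \<alpha> f g \<longleftrightarrow> \<alpha> \<in> Cell C \<and> Dom2 C \<alpha> = f \<and> Cod2 C \<alpha> = g"

definition hcomposable :: "('o, 'm, 'c) twocat \<Rightarrow> 'c \<Rightarrow> 'c \<Rightarrow> bool" where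
  "hcomposable C \<alpha> \<beta> \<longleftrightarrow> \<alpha> \<in> Cell C \<and> \<beta> \<in> Cell C \<and> Tgt C (Dom2 C \<alpha>) = Src C (Dom2 C \<beta>)"

locale two_category =
  fixes C :: "('o, 'm, 'c) twocat" (structure)
  assumes category_und: "category (und C)"
    and category_vert: "category (vert C)"
    and parallel: "\<alpha> \<in> Cell C \<Longrightarrow>
      Src C (Dom2 C \<alpha>) = Src C (Cod2 C \<alpha>) \<and> Tgt C (Dom2 C \<alpha>) = Tgt C (Cod2 C \<alpha>)"
    and hcomp_cell: "hcomposable C \<alpha> \<beta> \<Longrightarrow>
      in_cell C (\<alpha> \<star> \<beta>) (Dom2 C \<alpha> \<bullet> Dom2 C \<beta>) (Cod2 C \<alpha> \<bullet> Cod2 C \<beta>)"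
    and hcomp_assoc: "hcomposable C \<alpha> \<beta> \<Longrightarrow> hcomposable C \<beta> \<gamma> \<Longrightarrow>
      (\<alpha> \<star> \<beta>) \<star> \<gamma> = \<alpha> \<star> (\<beta> \<star> \<gamma>)"
    and Id_hcomp: "\<alpha> \<in> Cell C \<Longrightarrow> Id2 C (Id1 C (Src C (Dom2 C \<alpha>))) \<star> \<alpha> = \<alpha>"
    and hcomp_Id: "\<alpha> \<in> Cell C \<Longrightarrow> \<alpha> \<star> Id2 C (Id1 C (Tgt C (Dom2 C \<alpha>))) = \<alpha>"
    and hcomp_Id2: "f \<in> Mor C \<Longrightarrow> g \<in> Mor C \<Longrightarrow> Tgt C f = Src C g \<Longrightarrow>
      Id2 C f \<star> Id2 C g = Id2 C (f \<bullet> g)"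
    and interchange: "hcomposable C \<alpha> \<beta> \<Longrightarrow> hcomposable C \<alpha>' \<beta>' \<Longrightarrow>
      Cod2 C \<alpha> = Dom2 C \<alpha>' \<Longrightarrow> Cod2 C \<beta> = Dom2 C \<beta>' \<Longrightarrow>
      (\<alpha> \<odot> \<alpha>') \<star> (\<beta> \<odot> \<beta>') = (\<alpha> \<star> \<beta>) \<odot> (\<alpha>' \<star> \<beta>')"

text \<open>Whiskerings: \<open>f \<rhd> \<alpha>\<close> is \<open>f\<alpha>\<close>, \<open>\<alpha> \<lhd> f\<close> is \<open>\<alpha>f\<close>.\<close>

definition lwhisker :: "('o, 'm, 'c) twocat \<Rightarrow> 'm \<Rightarrow> 'c \<Rightarrow> 'c" (infixl "\<rhd>\<index>" 70) where
  "f \<rhd>\<^bsub>C\<^esub> \<alpha> = Id2 C f \<star>\<^bsub>C\<^esub> \<alpha>"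

definition rwhisker :: "('o, 'm, 'c) twocat \<Rightarrow> 'c \<Rightarrow> 'm \<Rightarrow> 'c" (infixl "\<lhd>\<index>" 70) where
  "\<alpha> \<lhd>\<^bsub>C\<^esub> f = \<alpha> \<star>\<^bsub>C\<^esub> Id2 C f"

definition hom :: "('o, 'm, 'c) twocat \<Rightarrow> 'o \<Rightarrow> 'o \<Rightarrow> ('m, 'c) cat" where
  "hom C A B = full_subcat (vert C) {f. in_mor C f A B}"

definition post :: "('o, 'm, 'c) twocat \<Rightarrow> 'm \<Rightarrow> ('m, 'c, 'm, 'c) ftor" where
  "post C f = \<lparr>fobj = (\<lambda>h. h \<bullet>\<^bsub>C\<^esub> f), farr = (\<lambda>\<alpha>. \<alpha> \<lhd>\<^bsub>C\<^esub> f)\<rparr>"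

definition pre :: "('o, 'm, 'c) twocat \<Rightarrow> 'm \<Rightarrow> ('m, 'c, 'm, 'c) ftor" where
  "pre C f = \<lparr>fobj = (\<lambda>h. f \<bullet>\<^bsub>C\<^esub> h), farr = (\<lambda>\<alpha>. f \<rhd>\<^bsub>C\<^esub> \<alpha>)\<rparr>"

subsection \<open>Limits in a 2-category\<close>

definition isofibration :: "('o, 'm, 'c) twocat \<Rightarrow> 'm \<Rightarrow> bool" where
  "isofibration C f \<longleftrightarrow> f \<in> Mor C \<and> (\<forall>A \<in> Ob C.
     isofibration_functor (hom C A (Src C f)) (hom C A (Tgt C f)) (post C f))"

definition DOF :: "('o, 'm, 'c) twocat \<Rightarrow> 'm \<Rightarrow> bool" where
  "DOF C f \<longleftrightarrow> f \<in> Mor C \<and> (\<forall>A \<in> Ob C.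
     dof_functor (hom C A (Src C f)) (hom C A (Tgt C f)) (post C f))"

definition strict_terminal :: "('o, 'm, 'c) twocat \<Rightarrow> 'o \<Rightarrow> bool" where
  "strict_terminal C T \<longleftrightarrow> T \<in> Ob C
     \<and> (\<forall>A \<in> Ob C. (\<exists>!f. f \<in> Obj (hom C A T)) \<and> (\<exists>!\<alpha>. \<alpha> \<in> Arr (hom C A T)))"

text \<open>\<open>p, q\<close> are the projections of a strict pullback of the cospan \<open>f, g\<close>, with \<open>p f = q g\<close>.\<close>

definition strict_pullback :: "('o, 'm, 'c) twocat \<Rightarrow> 'm \<Rightarrow> 'm \<Rightarrow> 'm \<Rightarrow> 'm \<Rightarrow> bool" where
  "strict_pullback C p q f g \<longleftrightarrow> p \<in> Mor C \<and> q \<in> Mor C \<and> f \<in> Mor C \<and> g \<in> Mor C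
   \<and> Src C p = Src C q \<and> Tgt C p = Src C f \<and> Tgt C q = Src C g \<and> Tgt C f = Tgt C g
   \<and> p \<bullet>\<^bsub>C\<^esub> f = q \<bullet>\<^bsub>C\<^esub> g
   \<and> (\<forall>B \<in> Ob C. cat_isomorphism (hom C B (Src C p))
        (fibre_product_cat (hom C B (Src C f)) (hom C B (Src C g)) (post C f) (post C g))
        (pair_functor (post C p) (post C q)))"

text \<open>Strict binary product with projections \<open>p, q\<close> (a strict pullback over the terminal object).\<close>

definition strict_product :: "('o, 'm, 'c) twocat \<Rightarrow> 'm \<Rightarrow> 'm \<Rightarrow> bool" where
  "strict_product C p q \<longleftrightarrow> p \<in> Mor C \<and> q \<in> Mor C \<and> Src C p = Src C q
   \<and> (\<forall>B \<in> Ob C. cat_isomorphism (hom C B (Src C p))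
        (prod_cat (hom C B (Tgt C p)) (hom C B (Tgt C q)))
        (pair_functor (post C p) (post C q)))"

text \<open>\<open>h\<close> is \<open>\<langle>f, g\<rangle>\<close>, into the product with projections \<open>p, q\<close>.\<close>

definition is_tuple :: "('o, 'm, 'c) twocat \<Rightarrow> 'm \<Rightarrow> 'm \<Rightarrow> 'm \<Rightarrow> 'm \<Rightarrow> 'm \<Rightarrow> bool" where
  "is_tuple C p q f g h \<longleftrightarrow> in_mor C h (Src C f) (Src C p) \<and> h \<bullet>\<^bsub>C\<^esub> p = f \<and> h \<bullet>\<^bsub>C\<^esub> q = g"

text \<open>Restriction along \<open>f : A \<rightarrow> X\<^sup>J\<close> of the evaluation \<open>ev : J \<rightarrow> C(X\<^sup>J, X)\<close>, and the functor
  \<open>C(A, X\<^sup>J) \<rightarrow> Fun(J, C(A, X))\<close> it induces.\<close>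

definition diagram_of :: "('o, 'm, 'c) twocat \<Rightarrow> ('j, 'k) cat \<Rightarrow> ('j, 'k, 'm, 'c) ftor \<Rightarrow> 'm
    \<Rightarrow> ('j, 'k, 'm, 'c) ftor" where
  "diagram_of C J ev f = ftor_restrict J (ftor_comp ev (pre C f))"

definition cotensor_functor :: "('o, 'm, 'c) twocat \<Rightarrow> ('j, 'k) cat \<Rightarrow> ('j, 'k, 'm, 'c) ftor \<Rightarrow>
    ('m, 'c, ('j, 'k, 'm, 'c) ftor,
     ('j, 'k, 'm, 'c) ftor \<times> ('j, 'k, 'm, 'c) ftor \<times> ('j \<Rightarrow> 'c)) ftor" where
  "cotensor_functor C J ev = \<lparr>fobj = diagram_of C J ev,
     farr = (\<lambda>\<alpha>. (diagram_of C J ev (Dom2 C \<alpha>), diagram_of C J ev (Cod2 C \<alpha>),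
                  \<lambda>j \<in> Obj J. \<alpha> \<lhd>\<^bsub>C\<^esub> fobj ev j))\<rparr>"

definition is_cotensor :: "('o, 'm, 'c) twocat \<Rightarrow> ('j, 'k) cat \<Rightarrow> 'o \<Rightarrow> 'o \<Rightarrow>
    ('j, 'k, 'm, 'c) ftor \<Rightarrow> bool" where
  "is_cotensor C J X XJ ev \<longleftrightarrow> X \<in> Ob C \<and> XJ \<in> Ob C \<and> is_functor J (hom C XJ X) ev
   \<and> (\<forall>A \<in> Ob C. cat_isomorphism (hom C A XJ) (fun_cat J (hom C A X)) (cotensor_functor C J ev))"

text \<open>\<open>X\<^sup>F : X\<^sup>J\<^sup>' \<rightarrow> X\<^sup>J\<close> for a functor \<open>F : J \<rightarrow> J'\<close>.\<close>

definition cotensor_map :: "('o, 'm, 'c) twocat \<Rightarrow>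
    'o \<Rightarrow> ('j2, 'k2, 'm, 'c) ftor \<Rightarrow> ('j, 'k) cat \<Rightarrow> 'o \<Rightarrow> ('j, 'k, 'm, 'c) ftor \<Rightarrow>
    ('j, 'k, 'j2, 'k2) ftor \<Rightarrow> 'm" where
  "cotensor_map C XJ' ev' J XJ ev F =
     (THE h. in_mor C h XJ' XJ \<and> diagram_of C J ev h = ftor_restrict J (ftor_comp F ev'))"

definition pita :: "('o, 'm, 'c) twocat \<Rightarrow> bool" where
  "pita C \<longleftrightarrow> two_category C
   \<and> (\<exists>T. strict_terminal C T)
   \<and> (\<forall>X \<in> Ob C. \<exists>XA ev. is_cotensor C (ord_cat 1) X XA ev)
   \<and> (\<forall>f \<in> Mor C. \<forall>g \<in> Mor C. isofibration C f \<and> Tgt C f = Tgt C g \<longrightarrow>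
        (\<exists>p q. strict_pullback C p q f g))"

subsection \<open>Groupoids and cores\<close>

definition groupoid_ob :: "('o, 'm, 'c) twocat \<Rightarrow> 'o \<Rightarrow> bool" where
  "groupoid_ob C X \<longleftrightarrow> X \<in> Ob C \<and> (\<forall>A \<in> Ob C. groupoid_cat (hom C A X))"

definition arrowwise_iso :: "('o, 'm, 'c) twocat \<Rightarrow> 'm \<Rightarrow> bool" where
  "arrowwise_iso C f \<longleftrightarrow> f \<in> Mor C
     \<and> (\<forall>\<alpha> \<in> Cell C. Tgt C (Dom2 C \<alpha>) = Src C f \<longrightarrow> is_iso (vert C) (\<alpha> \<lhd>\<^bsub>C\<^esub> f))"

definition arrowwise_iso_cat :: "('o, 'm, 'c) twocat \<Rightarrow> 'o \<Rightarrow> 'o \<Rightarrow> ('m, 'c) cat" where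
  "arrowwise_iso_cat C A X = subcat (hom C A X)
     {f \<in> Obj (hom C A X). arrowwise_iso C f}
     {\<alpha> \<in> Arr (hom C A X). is_iso (hom C A X) \<alpha>
        \<and> arrowwise_iso C (Dom2 C \<alpha>) \<and> arrowwise_iso C (Cod2 C \<alpha>)}"

definition is_core :: "('o, 'm, 'c) twocat \<Rightarrow> 'o \<Rightarrow> 'o \<Rightarrow> 'm \<Rightarrow> bool" where
  "is_core C X K i \<longleftrightarrow> in_mor C i K X \<and> arrowwise_iso C i
   \<and> (\<forall>A \<in> Ob C. cat_isomorphism (hom C A K) (arrowwise_iso_cat C A X) (post C i))"

text \<open>The unique \<open>h\<close> with \<open>h i = f\<close>: this is \<open>f\<^sup>i\<^sup>s\<^sup>o\<close> when \<open>i\<close> is a core and the domain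
  of \<open>f\<close> is a groupoid.\<close>

definition lift_along :: "('o, 'm, 'c) twocat \<Rightarrow> 'm \<Rightarrow> 'm \<Rightarrow> 'm" where
  "lift_along C i f = (THE h. in_mor C h (Src C f) (Src C i) \<and> h \<bullet>\<^bsub>C\<^esub> i = f)"

text \<open>\<open>f\<^sup>i\<^sup>s\<^sup>o : X\<^sup>i\<^sup>s\<^sup>o \<rightarrow> Y\<^sup>i\<^sup>s\<^sup>o\<close> for \<open>f : X \<rightarrow> Y\<close> and cores \<open>i\<close>, \<open>i'\<close> of \<open>X\<close>, \<open>Y\<close>.\<close>

definition core_map :: "('o, 'm, 'c) twocat \<Rightarrow> 'm \<Rightarrow> 'm \<Rightarrow> 'm \<Rightarrow> 'm" where
  "core_map C i i' f = lift_along C i' (i \<bullet>\<^bsub>C\<^esub> f)"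

subsection \<open>Internal categories and congruences\<close>

record ('o, 'm) icat =
  ic0 :: 'o
  ic1 :: 'o
  ic2 :: 'o
  pi0 :: 'm
  pi1 :: 'm
  ie :: 'm
  pi01 :: 'm
  pi12 :: 'm
  pi02 :: 'm

text \<open>The unit and associativity laws are stated for generalized elements: in the last clause
  \<open>(u, v)\<close> is an arbitrary morphism into \<open>C\<^sub>3\<close>, i.e. a composable triple of generalized arrows, and
  \<open>s\<close>, \<open>t\<close> are the two composable pairs obtained by composing the first, resp. last, two of them.\<close>

definition internal_category :: "('o, 'm) cat \<Rightarrow> ('o, 'm) icat \<Rightarrow> bool" where
  "internal_category B D \<longleftrightarrow>
     ic0 D \<in> Obj B \<and> ic1 D \<in> Obj B \<and> ic2 D \<in> Obj B
   \<and> in_hom B (pi0 D) (ic1 D) (ic0 D) \<and> in_hom B (pi1 D) (ic1 D) (ic0 D)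
   \<and> in_hom B (ie D) (ic0 D) (ic1 D)
   \<and> in_hom B (pi01 D) (ic2 D) (ic1 D) \<and> in_hom B (pi12 D) (ic2 D) (ic1 D)
   \<and> in_hom B (pi02 D) (ic2 D) (ic1 D)
   \<and> is_pullback B (pi01 D) (pi12 D) (pi1 D) (pi0 D)
   \<and> ie D \<cdot>\<^bsub>B\<^esub> pi0 D = ide B (ic0 D) \<and> ie D \<cdot>\<^bsub>B\<^esub> pi1 D = ide B (ic0 D)
   \<and> pi02 D \<cdot>\<^bsub>B\<^esub> pi0 D = pi01 D \<cdot>\<^bsub>B\<^esub> pi0 D
   \<and> pi02 D \<cdot>\<^bsub>B\<^esub> pi1 D = pi12 D \<cdot>\<^bsub>B\<^esub> pi1 D
   \<and> (\<forall>h. in_hom B h (ic1 D) (ic2 D)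
        \<and> h \<cdot>\<^bsub>B\<^esub> pi01 D = pi0 D \<cdot>\<^bsub>B\<^esub> ie D \<and> h \<cdot>\<^bsub>B\<^esub> pi12 D = ide B (ic1 D)
        \<longrightarrow> h \<cdot>\<^bsub>B\<^esub> pi02 D = ide B (ic1 D))
   \<and> (\<forall>h. in_hom B h (ic1 D) (ic2 D)
        \<and> h \<cdot>\<^bsub>B\<^esub> pi01 D = ide B (ic1 D) \<and> h \<cdot>\<^bsub>B\<^esub> pi12 D = pi1 D \<cdot>\<^bsub>B\<^esub> ie D
        \<longrightarrow> h \<cdot>\<^bsub>B\<^esub> pi02 D = ide B (ic1 D))
   \<and> (\<forall>A u v s t. in_hom B u A (ic2 D) \<and> in_hom B v A (ic2 D)
        \<and> u \<cdot>\<^bsub>B\<^esub> pi12 D = v \<cdot>\<^bsub>B\<^esub> pi01 D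
        \<and> in_hom B s A (ic2 D) \<and> s \<cdot>\<^bsub>B\<^esub> pi01 D = u \<cdot>\<^bsub>B\<^esub> pi02 D \<and> s \<cdot>\<^bsub>B\<^esub> pi12 D = v \<cdot>\<^bsub>B\<^esub> pi12 D
        \<and> in_hom B t A (ic2 D) \<and> t \<cdot>\<^bsub>B\<^esub> pi01 D = u \<cdot>\<^bsub>B\<^esub> pi01 D \<and> t \<cdot>\<^bsub>B\<^esub> pi12 D = v \<cdot>\<^bsub>B\<^esub> pi02 D
        \<longrightarrow> s \<cdot>\<^bsub>B\<^esub> pi02 D = t \<cdot>\<^bsub>B\<^esub> pi02 D)"

text \<open>Here and in \<open>complete_congruence\<close>, auxiliary universal objects (products, arrow objects,
  \<open>C\<^sub>3\<close>) are existentially quantified; they exist in a pita 2-category and the conditions do not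
  depend on the choice.\<close>

definition internal_double_category :: "('o, 'm, 'c) twocat \<Rightarrow> ('o, 'm) icat \<Rightarrow> bool" where
  "internal_double_category C D \<longleftrightarrow> internal_category (und C) D
   \<and> (\<exists>p q h. strict_product C p q \<and> Tgt C p = ic0 D \<and> Tgt C q = ic0 D
        \<and> is_tuple C p q (pi0 D) (pi1 D) h \<and> isofibration C h)"

definition gbo_congruence :: "('o, 'm, 'c) twocat \<Rightarrow> ('o, 'm) icat \<Rightarrow> bool" where
  "gbo_congruence C D \<longleftrightarrow> internal_double_category C D
   \<and> groupoid_ob C (ic0 D) \<and> groupoid_ob C (ic1 D) \<and> groupoid_ob C (ic2 D)
   \<and> (\<exists>p q h. strict_product C p q \<and> Tgt C p = ic0 D \<and> Tgt C q = ic0 D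
        \<and> is_tuple C p q (pi0 D) (pi1 D) h \<and> DOF C h)"

text \<open>\<open>r : C\<^sub>0\<^sup>\<rightarrow> \<rightarrow> C\<^sub>1\<close> is the reflection morphism, for the arrow object \<open>(XA, ev)\<close> of
  \<open>C\<^sub>0\<close>. The equation \<open>\<rho>\<langle>\<pi>\<^sub>0, \<pi>\<^sub>1\<rangle> = \<langle>\<partial>, id\<rangle>\<close> is given by its two components.\<close>

definition is_reflection :: "('o, 'm, 'c) twocat \<Rightarrow> ('o, 'm) icat \<Rightarrow> 'o \<Rightarrow>
    (nat, nat \<times> nat, 'm, 'c) ftor \<Rightarrow> 'm \<Rightarrow> bool" where
  "is_reflection C D XA ev r \<longleftrightarrow> in_mor C r XA (ic1 D)
   \<and> (\<exists>\<rho>. in_cell C \<rho> r (fobj ev 1 \<bullet>\<^bsub>C\<^esub> ie D)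
        \<and> \<rho> \<lhd>\<^bsub>C\<^esub> pi0 D = farr ev (0, 1) \<and> \<rho> \<lhd>\<^bsub>C\<^esub> pi1 D = Id2 C (fobj ev 1))"

definition complete_congruence :: "('o, 'm, 'c) twocat \<Rightarrow> ('o, 'm) icat \<Rightarrow> bool" where
  "complete_congruence C D \<longleftrightarrow> gbo_congruence C D
   \<and> (\<exists>XA ev r \<tau> q012 q123 t p q p' q' d c b.
        is_cotensor C (ord_cat 1) (ic0 D) XA ev
      \<and> is_reflection C D XA ev r
      \<and> in_mor C \<tau> XA XA \<and> inverse_arrows (vert C) (farr ev (0, 1)) (\<tau> \<rhd>\<^bsub>C\<^esub> farr ev (0, 1))
      \<comment> \<open>\<open>C\<^sub>3\<close>, and \<open>t = \<langle>r, \<tau>r, r\<rangle>\<close>\<close>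
      \<and> is_pullback (und C) q012 q123 (pi12 D) (pi01 D)
      \<and> in_mor C t XA (Src C q012)
      \<and> t \<bullet>\<^bsub>C\<^esub> q012 \<bullet>\<^bsub>C\<^esub> pi01 D = r
      \<and> t \<bullet>\<^bsub>C\<^esub> q012 \<bullet>\<^bsub>C\<^esub> pi12 D = \<tau> \<bullet>\<^bsub>C\<^esub> r
      \<and> t \<bullet>\<^bsub>C\<^esub> q123 \<bullet>\<^bsub>C\<^esub> pi12 D = r
      \<comment> \<open>\<open>C\<^sub>0 \<times> C\<^sub>0\<close> with projections \<open>p, q\<close>, and \<open>C\<^sub>1 \<times> C\<^sub>1\<close> with projections \<open>p', q'\<close>\<close>
      \<and> strict_product C p q \<and> Tgt C p = ic0 D \<and> Tgt C q = ic0 D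
      \<and> strict_product C p' q' \<and> Tgt C p' = ic1 D \<and> Tgt C q' = ic1 D
      \<and> is_tuple C p q (fobj ev 0) (fobj ev 1) d
      \<and> is_tuple C p' q' (q012 \<bullet>\<^bsub>C\<^esub> pi02 D) (q123 \<bullet>\<^bsub>C\<^esub> pi02 D) c
      \<and> is_tuple C p' q' (p \<bullet>\<^bsub>C\<^esub> ie D) (q \<bullet>\<^bsub>C\<^esub> ie D) b
      \<and> strict_pullback C t d c b)"

subsection \<open>Nerves and quotients\<close>

text \<open>\<open>X\<close> as a cotensor of itself with \<open>[0]\<close>.\<close>

definition trivial_ev :: "('o, 'm, 'c) twocat \<Rightarrow> 'o \<Rightarrow> (nat, nat \<times> nat, 'm, 'c) ftor" where
  "trivial_ev C X = \<lparr>fobj = (\<lambda>_. Id1 C X), farr = (\<lambda>_. Id2 C (Id1 C X))\<rparr>"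

text \<open>\<open>N\<close> is a nerve of \<open>X\<close> with tautological cocone \<open>(g, g01)\<close>.\<close>

definition is_nerve :: "('o, 'm, 'c) twocat \<Rightarrow> 'o \<Rightarrow> ('o, 'm) icat \<Rightarrow> 'm \<Rightarrow> 'c \<Rightarrow> bool" where
  "is_nerve C X N g g01 \<longleftrightarrow> (\<exists>X1 ev1 X2 ev2 i1 i2.
     is_cotensor C (ord_cat 1) X X1 ev1 \<and> is_cotensor C (ord_cat 2) X X2 ev2
   \<and> is_core C X (ic0 N) g \<and> is_core C X1 (ic1 N) i1 \<and> is_core C X2 (ic2 N) i2
   \<and> pi0 N = core_map C i1 g (cotensor_map C X1 ev1 (ord_cat 0) X (trivial_ev C X) (delta [0]))
   \<and> pi1 N = core_map C i1 g (cotensor_map C X1 ev1 (ord_cat 0) X (trivial_ev C X) (delta [1]))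
   \<and> ie N = core_map C g i1 (cotensor_map C X (trivial_ev C X) (ord_cat 1) X1 ev1 (delta [0, 0]))
   \<and> pi01 N = core_map C i2 i1 (cotensor_map C X2 ev2 (ord_cat 1) X1 ev1 (delta [0, 1]))
   \<and> pi12 N = core_map C i2 i1 (cotensor_map C X2 ev2 (ord_cat 1) X1 ev1 (delta [1, 2]))
   \<and> pi02 N = core_map C i2 i1 (cotensor_map C X2 ev2 (ord_cat 1) X1 ev1 (delta [0, 2]))
   \<and> g01 = i1 \<rhd>\<^bsub>C\<^esub> farr ev1 (0, 1))"

definition is_cocone :: "('o, 'm, 'c) twocat \<Rightarrow> ('o, 'm) icat \<Rightarrow> 'o \<Rightarrow> 'm \<Rightarrow> 'c \<Rightarrow> bool" where
  "is_cocone C D Y g g01 \<longleftrightarrow> in_mor C g (ic0 D) Y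
   \<and> in_cell C g01 (pi0 D \<bullet>\<^bsub>C\<^esub> g) (pi1 D \<bullet>\<^bsub>C\<^esub> g)
   \<and> ie D \<rhd>\<^bsub>C\<^esub> g01 = Id2 C g
   \<and> pi02 D \<rhd>\<^bsub>C\<^esub> g01 = (pi01 D \<rhd>\<^bsub>C\<^esub> g01) \<odot>\<^bsub>C\<^esub> (pi12 D \<rhd>\<^bsub>C\<^esub> g01)"

definition cocone_cat :: "('o, 'm, 'c) twocat \<Rightarrow> ('o, 'm) icat \<Rightarrow> 'o \<Rightarrow>
    ('m \<times> 'c, ('m \<times> 'c) \<times> ('m \<times> 'c) \<times> 'c) cat" where
  "cocone_cat C D Y = \<lparr>
     Obj = {(g, g01). is_cocone C D Y g g01},
     Arr = {((g, g01), (k, k01), \<alpha>). is_cocone C D Y g g01 \<and> is_cocone C D Y k k01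
              \<and> in_cell C \<alpha> g k
              \<and> (pi0 D \<rhd>\<^bsub>C\<^esub> \<alpha>) \<odot>\<^bsub>C\<^esub> k01 = g01 \<odot>\<^bsub>C\<^esub> (pi1 D \<rhd>\<^bsub>C\<^esub> \<alpha>)},
     Dom = (\<lambda>(c, c', \<alpha>). c),
     Cod = (\<lambda>(c, c', \<alpha>). c'),
     ide = (\<lambda>(g, g01). ((g, g01), (g, g01), Id2 C g)),
     cmp = (\<lambda>(c, c', \<alpha>) (d, d', \<beta>). (c, d', \<alpha> \<odot>\<^bsub>C\<^esub> \<beta>))\<rparr>"

definition quotient_functor :: "('o, 'm, 'c) twocat \<Rightarrow> 'm \<Rightarrow> 'c \<Rightarrow>
    ('m, 'c, 'm \<times> 'c, ('m \<times> 'c) \<times> ('m \<times> 'c) \<times> 'c) ftor" where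
  "quotient_functor C g g01 = \<lparr>fobj = (\<lambda>h. (g \<bullet>\<^bsub>C\<^esub> h, g01 \<lhd>\<^bsub>C\<^esub> h)),
     farr = (\<lambda>\<alpha>. ((g \<bullet>\<^bsub>C\<^esub> Dom2 C \<alpha>, g01 \<lhd>\<^bsub>C\<^esub> Dom2 C \<alpha>),
                  (g \<bullet>\<^bsub>C\<^esub> Cod2 C \<alpha>, g01 \<lhd>\<^bsub>C\<^esub> Cod2 C \<alpha>), g \<rhd>\<^bsub>C\<^esub> \<alpha>))\<rparr>"

definition strict_quotient :: "('o, 'm, 'c) twocat \<Rightarrow> ('o, 'm) icat \<Rightarrow> 'o \<Rightarrow> 'm \<Rightarrow> 'c \<Rightarrow> bool" where
  "strict_quotient C D X g g01 \<longleftrightarrow> X \<in> Ob C \<and> is_cocone C D X g g01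
   \<and> (\<forall>Y \<in> Ob C. cat_isomorphism (hom C X Y) (cocone_cat C D Y) (quotient_functor C g g01))"

definition groupoidant :: "('o, 'm, 'c) twocat \<Rightarrow> bool" where
  "groupoidant C \<longleftrightarrow> pita C
   \<and> (\<forall>X \<in> Ob C. \<exists>K i. is_core C X K i)
   \<and> (\<forall>D. complete_congruence C D \<longrightarrow> (\<exists>X \<in> Ob C. \<exists>g g01. is_nerve C X D g g01))
   \<and> (\<forall>X \<in> Ob C. \<forall>N g g01. is_nerve C X N g g01 \<longrightarrow> strict_quotient C N X g g01)"

subsection \<open>Opposites\<close>

definition icat_op :: "('o, 'm) icat \<Rightarrow> ('o, 'm) icat" where
  "icat_op D = D\<lparr>pi0 := pi1 D, pi1 := pi0 D, pi01 := pi12 D, pi12 := pi01 D\<rparr>"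

text \<open>\<open>D\<close> with its quotients \<open>X\<close> and \<open>Xop\<close>; note \<open>gop01 : \<pi>\<^sub>1 gop \<Rightarrow> \<pi>\<^sub>0 gop\<close> in terms of \<open>D\<close>.\<close>

definition opposition :: "('o, 'm, 'c) twocat \<Rightarrow> ('o, 'm) icat \<Rightarrow>
    'o \<Rightarrow> 'm \<Rightarrow> 'c \<Rightarrow> 'o \<Rightarrow> 'm \<Rightarrow> 'c \<Rightarrow> bool" where
  "opposition C D X g g01 Xop gop gop01 \<longleftrightarrow> complete_congruence C D
   \<and> strict_quotient C D X g g01 \<and> strict_quotient C (icat_op D) Xop gop gop01"

text \<open>\<open>f\<^sup>o\<^sup>p\<close> and \<open>\<alpha>\<^sup>o\<^sup>p\<close> for \<open>f : A \<rightarrow> X\<close> and \<open>\<alpha> : f \<Rightarrow> f' : A \<rightarrow> X\<close> with \<open>A\<close> a groupoid.\<close>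

definition op_mor :: "('o, 'm, 'c) twocat \<Rightarrow> 'm \<Rightarrow> 'm \<Rightarrow> 'm \<Rightarrow> 'm" where
  "op_mor C g gop f = lift_along C g f \<bullet>\<^bsub>C\<^esub> gop"

definition op_cell :: "('o, 'm, 'c) twocat \<Rightarrow> ('o, 'm) icat \<Rightarrow> 'c \<Rightarrow> 'c \<Rightarrow> 'c \<Rightarrow> 'c" where
  "op_cell C D g01 gop01 \<alpha> =
     (THE a. in_mor C a (Src C (Dom2 C \<alpha>)) (ic1 D) \<and> a \<rhd>\<^bsub>C\<^esub> g01 = \<alpha>) \<rhd>\<^bsub>C\<^esub> gop01"

section \<open>Internal elementary topoi and power morphisms\<close>

definition ob_has_finite_limits :: "('o, 'm, 'c) twocat \<Rightarrow> 'o \<Rightarrow> bool" where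
  "ob_has_finite_limits C X \<longleftrightarrow> X \<in> Ob C
   \<and> (\<forall>A \<in> Ob C. has_finite_limits (hom C A X))
   \<and> (\<forall>A \<in> Ob C. \<forall>A' \<in> Ob C. \<forall>f. in_mor C f A' A \<longrightarrow>
        preserves_finite_limits (hom C A X) (hom C A' X) (pre C f))"

definition internal_elementary_topos :: "('o, 'm, 'c) twocat \<Rightarrow> 'o \<Rightarrow> bool" where
  "internal_elementary_topos C X \<longleftrightarrow> ob_has_finite_limits C X
   \<and> (\<forall>A. groupoid_ob C A \<longrightarrow> has_power_objects (hom C A X))
   \<and> (\<forall>A A' f. groupoid_ob C A \<and> groupoid_ob C A' \<and> in_mor C f A' A \<longrightarrow>
        preserves_finite_limits (hom C A X) (hom C A' X) (pre C f)
      \<and> preserves_power_objects (hom C A X) (hom C A' X) (pre C f))"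

text \<open>The diagrams of shape \<open>K_check\<close> in \<open>C(A, X)\<close> classified by \<open>X\<close> to the power \<open>K_check\<close>.\<close>

definition stable_relation_diagrams :: "('o, 'm, 'c) twocat \<Rightarrow> 'o \<Rightarrow> 'o \<Rightarrow>
    (nat, nat \<times> nat, 'm, 'c) ftor set" where
  "stable_relation_diagrams C A X = {F \<in> Obj (fun_cat K_check (hom C A X)).
     is_product (hom C A X) (farr F (2, 0)) (farr F (2, 1))
   \<and> is_mono (hom C A X) (farr F (3, 2))
   \<and> (\<forall>A' \<in> Ob C. \<forall>h. in_mor C h A' A \<longrightarrow>
        is_product (hom C A' X) (h \<rhd>\<^bsub>C\<^esub> farr F (2, 0)) (h \<rhd>\<^bsub>C\<^esub> farr F (2, 1))
      \<and> is_mono (hom C A' X) (h \<rhd>\<^bsub>C\<^esub> farr F (3, 2)))}"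

definition is_K_check_power :: "('o, 'm, 'c) twocat \<Rightarrow> 'o \<Rightarrow> 'o \<Rightarrow>
    (nat, nat \<times> nat, 'm, 'c) ftor \<Rightarrow> bool" where
  "is_K_check_power C X XK ev \<longleftrightarrow> X \<in> Ob C \<and> XK \<in> Ob C \<and> is_functor K_check (hom C XK X) ev
   \<and> (\<forall>A \<in> Ob C. cat_isomorphism (hom C A XK)
        (full_subcat (fun_cat K_check (hom C A X)) (stable_relation_diagrams C A X))
        (cotensor_functor C K_check ev))"

text \<open>Power object diagrams \<open>k : A \<rightarrow> X\<^sup>K\<close> in \<open>C(A, X)\<close>.\<close>

definition power_object_diagram :: "('o, 'm, 'c) twocat \<Rightarrow> 'o \<Rightarrow> 'o \<Rightarrow>
    (nat, nat \<times> nat, 'm, 'c) ftor \<Rightarrow> 'm \<Rightarrow> bool" where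
  "power_object_diagram C X XK ev k \<longleftrightarrow> k \<in> Mor C \<and> Tgt C k = XK
     \<and> power_object_functor (hom C (Src C k) X) (diagram_of C K_check ev k)"

text \<open>\<open>P : X\<^sup>i\<^sup>s\<^sup>o \<rightarrow> (X\<^sup>K)\<^sup>i\<^sup>s\<^sup>o\<close> chooses power object diagrams, for a choice of \<open>(XK, ev)\<close> and of
  cores \<open>i\<close> of \<open>X\<close> and \<open>j\<close> of \<open>XK\<close>. The restriction to the value at the object \<open>0\<close> is
  \<open>fobj ev 0\<close>.\<close>

definition power_choice :: "('o, 'm, 'c) twocat \<Rightarrow> 'o \<Rightarrow> 'm \<Rightarrow> 'o \<Rightarrow>
    (nat, nat \<times> nat, 'm, 'c) ftor \<Rightarrow> 'm \<Rightarrow> 'm \<Rightarrow> bool" where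
  "power_choice C X i XK ev j P \<longleftrightarrow>
     is_K_check_power C X XK ev \<and> is_core C X (Src C i) i \<and> is_core C XK (Src C j) j
   \<and> in_mor C P (Src C i) (Src C j)
   \<and> P \<bullet>\<^bsub>C\<^esub> core_map C j i (fobj ev 0) = Id1 C (Src C i)
   \<and> (\<forall>A f. groupoid_ob C A \<and> in_mor C f A X \<longrightarrow>
        power_object_diagram C X XK ev (lift_along C i f \<bullet>\<^bsub>C\<^esub> P \<bullet>\<^bsub>C\<^esub> j))"

text \<open>The diagram in \<open>C(A, X)\<close> corresponding to \<open>f\<^sup>i\<^sup>s\<^sup>o P j : A \<rightarrow> X\<^sup>K\<close>.\<close>

definition chosen_diagram :: "('o, 'm, 'c) twocat \<Rightarrow> 'm \<Rightarrow> (nat, nat \<times> nat, 'm, 'c) ftor \<Rightarrow>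
    'm \<Rightarrow> 'm \<Rightarrow> 'm \<Rightarrow> (nat, nat \<times> nat, 'm, 'c) ftor" where
  "chosen_diagram C i ev j P f =
     diagram_of C K_check ev (lift_along C i f \<bullet>\<^bsub>C\<^esub> P \<bullet>\<^bsub>C\<^esub> j)"

definition covariant_power_morphism :: "('o, 'm, 'c) twocat \<Rightarrow> 'o \<Rightarrow> 'm \<Rightarrow> bool" where
  "covariant_power_morphism C X Q \<longleftrightarrow> in_mor C Q X X
   \<and> (\<exists>i XK ev j P. power_choice C X i XK ev j P
      \<and> (\<forall>A f. groupoid_ob C A \<and> in_mor C f A X \<longrightarrow>
           f \<bullet>\<^bsub>C\<^esub> Q = fobj (chosen_diagram C i ev j P f) 1)
      \<and> (\<forall>A f f' \<alpha>. groupoid_ob C A \<and> in_mor C f A X \<and> in_mor C f' A X \<and> in_cell C \<alpha> f f' \<longrightarrow>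
           is_direct_image (hom C A X)
             (chosen_diagram C i ev j P f) (chosen_diagram C i ev j P f') \<alpha> (\<alpha> \<lhd>\<^bsub>C\<^esub> Q)))"

definition contravariant_power_morphism :: "('o, 'm, 'c) twocat \<Rightarrow> ('o, 'm) icat \<Rightarrow>
    'o \<Rightarrow> 'm \<Rightarrow> 'c \<Rightarrow> 'o \<Rightarrow> 'm \<Rightarrow> 'c \<Rightarrow> 'm \<Rightarrow> bool" where
  "contravariant_power_morphism C D X g g01 Xop gop gop01 Q \<longleftrightarrow> in_mor C Q Xop X
   \<and> (\<exists>i XK ev j P. power_choice C X i XK ev j P
      \<and> (\<forall>A f. groupoid_ob C A \<and> in_mor C f A X \<longrightarrow>
           op_mor C g gop f \<bullet>\<^bsub>C\<^esub> Q = fobj (chosen_diagram C i ev j P f) 1)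
      \<and> (\<forall>A f f' \<alpha>. groupoid_ob C A \<and> in_mor C f A X \<and> in_mor C f' A X \<and> in_cell C \<alpha> f f' \<longrightarrow>
           is_inverse_image (hom C A X)
             (chosen_diagram C i ev j P f) (chosen_diagram C i ev j P f') \<alpha>
             (op_cell C D g01 gop01 \<alpha> \<lhd>\<^bsub>C\<^esub> Q)))"

end

(* Morphisms and 2-cells out of a nerve of X are prescribed by the quotient property: a morphism
   X -> X is a cocone under the nerve. On the core of X, power objects can be chosen, since
   the core is a groupoid; on the object of arrows, the source and target of the universal 2-cell have
   power objects by pullback, and the universal 2-cell has a direct (or inverse) image between them.
   The cocone conditions, and hence existence, say that images are functorial and stable under pullback
   along morphisms of groupoids. Uniqueness follows since any two choices of power objects are
   isomorphic through the image of an identity, which is compatible with all images.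

   Stability of direct images needs an argument, as images are not finite limits. The direct
   image along k is the internal left adjoint of the inverse image along k. Its existence is shown
   impredicatively: the image of S is the intersection of all T with S contained in the preimage of T,
   which needs only finite limits and power objects. The adjointness is witnessed by two generic
   instances, which are finite limit data and so preserved by every logical functor.

   The object of stable relations exists since being a product is an inverse to the comparison with a
   chosen product, and being monic an equality of the two kernel pair projections: both are solved by
   inserters and equifiers, which are pullbacks of isofibrations. *)
theory Submission
  imports Defs
begin

section \<open>Generalised elements and power objects\<close>

text \<open>Relations are jointly monic spans, and \<open>rel e0 e1 x S\<close> is read as x \<in> S
  for generalised elements at the stage Dom x; so the calculus needs no chosen product a x P(a). The
  adjunction \<open>dimg\<close> is demanded at every stage Z, since only in this form does it
  compose. The direct image of the statement says less: leastness of an image is the adjunction at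
  the single generic stage S = id of P(a). Uniqueness closes the gap: an adjoint exists by the
  impredicative construction, it is also a direct image in the narrow sense, and the generic stage
  determines the arrow. The intersection ranges over P(b), so a power object of P(b) enters, and the
  universal quantifier becomes an equation between two maps into it. Chosen power objects commute
  strictly with restriction because all are restrictions of one power object over the core; so the
  cocone laws are equations, not isomorphisms to be made coherent. The congruence of an opposition
  is only given as a nerve of some object Y; what is known of nerves must be carried to X along the
  isomorphism of the two quotients.\<close>

definition rel :: "('o, 'm) cat \<Rightarrow> 'm \<Rightarrow> 'm \<Rightarrow> 'm \<Rightarrow> 'm \<Rightarrow> bool" where
  "rel D n0 n1 x y \<longleftrightarrow>
     (\<exists>e. in_hom D e (Dom D x) (Dom D n0) \<and> e \<cdot>\<^bsub>D\<^esub> n0 = x \<and> e \<cdot>\<^bsub>D\<^esub> n1 = y)"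

text \<open>A pair of legs replaces a mono into a product, so that a relation makes sense before any
  product of its two ends is chosen.\<close>

definition jointly_monic :: "('o, 'm) cat \<Rightarrow> 'm \<Rightarrow> 'm \<Rightarrow> bool" where
  "jointly_monic D n0 n1 \<longleftrightarrow> n0 \<in> Arr D \<and> n1 \<in> Arr D \<and> Dom D n0 = Dom D n1
   \<and> (\<forall>V e e'. in_hom D e V (Dom D n0) \<and> in_hom D e' V (Dom D n0)
        \<and> e \<cdot>\<^bsub>D\<^esub> n0 = e' \<cdot>\<^bsub>D\<^esub> n0 \<and> e \<cdot>\<^bsub>D\<^esub> n1 = e' \<cdot>\<^bsub>D\<^esub> n1 \<longrightarrow> e = e')"

text \<open>The arrow \<open>r\<close> : y \<rightarrow> P(a) is the transpose of the relation.
  Testing it on generalised elements replaces the pullback along id x \<open>r\<close>; agreement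
  with \<open>classifies\<close> is \<open>classifies_iff_rel\<close>.\<close>

definition classifies_rel :: "('o, 'm) cat \<Rightarrow> 'm \<Rightarrow> 'm \<Rightarrow> 'm \<Rightarrow> 'm \<Rightarrow> 'm \<Rightarrow> bool" where
  "classifies_rel D e0 e1 n0 n1 r \<longleftrightarrow> in_hom D r (Cod D n1) (Cod D e1)
   \<and> (\<forall>V x t. in_hom D x V (Cod D e0) \<and> in_hom D t V (Cod D n1) \<longrightarrow>
        (rel D n0 n1 x t \<longleftrightarrow> rel D e0 e1 x (t \<cdot>\<^bsub>D\<^esub> r)))"

definition power_rel :: "('o, 'm) cat \<Rightarrow> 'm \<Rightarrow> 'm \<Rightarrow> bool" where
  "power_rel D e0 e1 \<longleftrightarrow> jointly_monic D e0 e1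
   \<and> (\<forall>n0 n1. jointly_monic D n0 n1 \<and> Cod D n0 = Cod D e0 \<longrightarrow>
        (\<exists>!r. classifies_rel D e0 e1 n0 n1 r))"

text \<open>\<open>incl k S T\<close> says that \<open>k\<close> maps the subobject \<open>S\<close> of \<open>a\<close> into the subobject \<open>T\<close> of \<open>b\<close>,
  and \<open>dimg k\<close> that \<open>d\<close> is the left adjoint to taking preimages. Unlike the construction by
  images, this is evidently functorial in \<open>k\<close>.\<close>

definition incl :: "('o, 'm) cat \<Rightarrow> 'm \<Rightarrow> 'm \<Rightarrow> 'm \<Rightarrow> 'm \<Rightarrow> 'm \<Rightarrow> 'm \<Rightarrow> 'm \<Rightarrow> bool" where
  "incl D e0 e1 f0 f1 k S T \<longleftrightarrow>
     (\<forall>V x t. in_hom D x V (Cod D e0) \<and> in_hom D t V (Dom D S) \<and> rel D e0 e1 x (t \<cdot>\<^bsub>D\<^esub> S) \<longrightarrow>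
        rel D f0 f1 (x \<cdot>\<^bsub>D\<^esub> k) (t \<cdot>\<^bsub>D\<^esub> T))"

definition dimg :: "('o, 'm) cat \<Rightarrow> 'm \<Rightarrow> 'm \<Rightarrow> 'm \<Rightarrow> 'm \<Rightarrow> 'm \<Rightarrow> 'm \<Rightarrow> bool" where
  "dimg D e0 e1 f0 f1 k d \<longleftrightarrow> in_hom D d (Cod D e1) (Cod D f1)
   \<and> (\<forall>Z S T. in_hom D S Z (Cod D e1) \<and> in_hom D T Z (Cod D f1) \<longrightarrow>
        (incl D e0 e1 f0 f1 k S T \<longleftrightarrow> incl D f0 f1 f0 f1 (ide D (Cod D f0)) (S \<cdot>\<^bsub>D\<^esub> d) T))"

text \<open>Membership alone characterises the inverse image, where \<open>dimg\<close> has to speak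
  of inclusions. It is the simple half of the adjunction and serves as the intermediate right
  adjoint when direct images are composed.\<close>

definition iimg :: "('o, 'm) cat \<Rightarrow> 'm \<Rightarrow> 'm \<Rightarrow> 'm \<Rightarrow> 'm \<Rightarrow> 'm \<Rightarrow> 'm \<Rightarrow> bool" where
  "iimg D e0 e1 f0 f1 k d \<longleftrightarrow> in_hom D d (Cod D f1) (Cod D e1)
   \<and> (\<forall>Z x T. in_hom D x Z (Cod D e0) \<and> in_hom D T Z (Cod D f1) \<longrightarrow>
        (rel D e0 e1 x (T \<cdot>\<^bsub>D\<^esub> d) \<longleftrightarrow> rel D f0 f1 (x \<cdot>\<^bsub>D\<^esub> k) T))"

lemma in_homD: "in_hom D f a b \<Longrightarrow> f \<in> Arr D" "in_hom D f a b \<Longrightarrow> Dom D f = a"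
    "in_hom D f a b \<Longrightarrow> Cod D f = b"
  by (simp_all add: in_hom_def)

lemma is_monoD:
  assumes "is_mono D n" "in_hom D x V (Dom D n)" "in_hom D y V (Dom D n)" "x \<cdot>\<^bsub>D\<^esub> n = y \<cdot>\<^bsub>D\<^esub> n"
  shows "x = y"
proof -
  have "x \<in> Arr D" "y \<in> Arr D" "Dom D x = Dom D y \<and> Cod D x = Dom D n \<and> Cod D y = Dom D n \<and> x \<cdot>\<^bsub>D\<^esub> n = y \<cdot>\<^bsub>D\<^esub> n"
    using assms by (simp_all add: in_hom_def)
  then show ?thesis using assms(1) unfolding is_mono_def by blast
qed

lemma jointly_monic_arr:
  assumes "jointly_monic D n0 n1"
  shows "n0 \<in> Arr D" "n1 \<in> Arr D" "Dom D n1 = Dom D n0"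
  using assms unfolding jointly_monic_def by auto

lemma jointly_monicD:
  assumes "jointly_monic D n0 n1" "in_hom D e V (Dom D n0)" "in_hom D e' V (Dom D n0)"
    "e \<cdot>\<^bsub>D\<^esub> n0 = e' \<cdot>\<^bsub>D\<^esub> n0" "e \<cdot>\<^bsub>D\<^esub> n1 = e' \<cdot>\<^bsub>D\<^esub> n1"
  shows "e = e'"
  using assms(1)[unfolded jointly_monic_def, THEN conjunct2, THEN conjunct2, THEN conjunct2, rule_format,
      of e V e'] assms(2-) by simp

lemma is_product_ex1:
  assumes "is_product D p q" "in_hom D x V (Cod D p)" "in_hom D y V (Cod D q)"
  shows "\<exists>!h. in_hom D h V (Dom D p) \<and> h \<cdot>\<^bsub>D\<^esub> p = x \<and> h \<cdot>\<^bsub>D\<^esub> q = y"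
proof -
  have "x \<in> Arr D" "y \<in> Arr D" and V: "V = Dom D x" and *: "Dom D x = Dom D y \<and> Cod D x = Cod D p \<and> Cod D y = Cod D q"
    using assms(2,3) by (simp_all add: in_hom_def)
  then show ?thesis using assms(1) unfolding is_product_def V by blast
qed

lemma is_pullback_ex1:
  assumes "is_pullback D p q f g" "in_hom D x V (Dom D f)" "in_hom D y V (Dom D g)"
    "x \<cdot>\<^bsub>D\<^esub> f = y \<cdot>\<^bsub>D\<^esub> g"
  shows "\<exists>!h. in_hom D h V (Dom D p) \<and> h \<cdot>\<^bsub>D\<^esub> p = x \<and> h \<cdot>\<^bsub>D\<^esub> q = y"
proof -
  have "x \<in> Arr D" "y \<in> Arr D" and V: "V = Dom D x"
    and *: "Dom D x = Dom D y \<and> Cod D x = Dom D f \<and> Cod D y = Dom D g \<and> x \<cdot>\<^bsub>D\<^esub> f = y \<cdot>\<^bsub>D\<^esub> g"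
    using assms(2-) by (simp_all add: in_hom_def)
  then show ?thesis using assms(1) unfolding is_pullback_def V by blast
qed

lemma is_productD:
  assumes "is_product D p q"
  shows "p \<in> Arr D" "q \<in> Arr D" "Dom D q = Dom D p"
  using assms by (simp_all add: is_product_def)

lemma is_product_pair:
  assumes "is_product D p q" "in_hom D x V (Cod D p)" "in_hom D y V (Cod D q)"
  obtains h where "in_hom D h V (Dom D p)" "h \<cdot>\<^bsub>D\<^esub> p = x" "h \<cdot>\<^bsub>D\<^esub> q = y"
  using is_product_ex1[OF assms] that by blast

lemma is_pullbackD:
  assumes "is_pullback D p q f g"
  shows "p \<in> Arr D" "q \<in> Arr D" "f \<in> Arr D" "g \<in> Arr D" "Dom D q = Dom D p"
    "Cod D p = Dom D f" "Cod D q = Dom D g" "Cod D g = Cod D f" "p \<cdot>\<^bsub>D\<^esub> f = q \<cdot>\<^bsub>D\<^esub> g"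
  using assms by (simp_all add: is_pullback_def)

lemma is_pullback_pair:
  assumes "is_pullback D p q f g" "in_hom D x V (Dom D f)" "in_hom D y V (Dom D g)"
    "x \<cdot>\<^bsub>D\<^esub> f = y \<cdot>\<^bsub>D\<^esub> g"
  obtains h where "in_hom D h V (Dom D p)" "h \<cdot>\<^bsub>D\<^esub> p = x" "h \<cdot>\<^bsub>D\<^esub> q = y"
  using is_pullback_ex1[OF assms] that by blast

lemma is_pullbackI:
  assumes "p \<in> Arr D" "q \<in> Arr D" "f \<in> Arr D" "g \<in> Arr D" "Dom D q = Dom D p"
    "Cod D p = Dom D f" "Cod D q = Dom D g" "Cod D g = Cod D f" "p \<cdot>\<^bsub>D\<^esub> f = q \<cdot>\<^bsub>D\<^esub> g"
    and "\<And>V x y. in_hom D x V (Dom D f) \<Longrightarrow> in_hom D y V (Dom D g) \<Longrightarrow> x \<cdot>\<^bsub>D\<^esub> f = y \<cdot>\<^bsub>D\<^esub> g \<Longrightarrow>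
      \<exists>h. in_hom D h V (Dom D p) \<and> h \<cdot>\<^bsub>D\<^esub> p = x \<and> h \<cdot>\<^bsub>D\<^esub> q = y"
    and "jointly_monic D p q"
  shows "is_pullback D p q f g"
  unfolding is_pullback_def
proof (intro conjI ballI impI)
  fix x y assume "x \<in> Arr D" "y \<in> Arr D"
    and *: "Dom D x = Dom D y \<and> Cod D x = Dom D f \<and> Cod D y = Dom D g \<and> x \<cdot>\<^bsub>D\<^esub> f = y \<cdot>\<^bsub>D\<^esub> g"
  then have "\<exists>h. in_hom D h (Dom D x) (Dom D p) \<and> h \<cdot>\<^bsub>D\<^esub> p = x \<and> h \<cdot>\<^bsub>D\<^esub> q = y"
    by (intro assms(10)) (auto simp: in_hom_def)
  then obtain h where h: "in_hom D h (Dom D x) (Dom D p) \<and> h \<cdot>\<^bsub>D\<^esub> p = x \<and> h \<cdot>\<^bsub>D\<^esub> q = y" ..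
  show "\<exists>!h. in_hom D h (Dom D x) (Dom D p) \<and> h \<cdot>\<^bsub>D\<^esub> p = x \<and> h \<cdot>\<^bsub>D\<^esub> q = y"
    by (rule ex1I[of _ h], rule h, rule jointly_monicD[OF assms(11)]) (use h in auto)
qed (use assms in simp_all)

lemma relI:
  "in_hom D e (Dom D x) (Dom D n0) \<Longrightarrow> e \<cdot>\<^bsub>D\<^esub> n0 = x \<Longrightarrow> e \<cdot>\<^bsub>D\<^esub> n1 = y \<Longrightarrow> rel D n0 n1 x y"
  by (auto simp: rel_def)

lemma relE:
  assumes "rel D n0 n1 x y" "in_hom D x V a"
  obtains e where "in_hom D e V (Dom D n0)" "e \<cdot>\<^bsub>D\<^esub> n0 = x" "e \<cdot>\<^bsub>D\<^esub> n1 = y"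
  using assms(1) that unfolding rel_def in_homD(2)[OF assms(2)] by blast

lemma classifies_relD:
  "classifies_rel D e0 e1 n0 n1 r \<Longrightarrow> in_hom D x V (Cod D e0) \<Longrightarrow> in_hom D t V (Cod D n1) \<Longrightarrow>
     rel D n0 n1 x t \<longleftrightarrow> rel D e0 e1 x (t \<cdot>\<^bsub>D\<^esub> r)"
  "classifies_rel D e0 e1 n0 n1 r \<Longrightarrow> in_hom D r (Cod D n1) (Cod D e1)"
  by (auto simp: classifies_rel_def)

lemma inclD:
  "incl D e0 e1 f0 f1 k S T \<Longrightarrow> in_hom D x V (Cod D e0) \<Longrightarrow> in_hom D t V (Dom D S) \<Longrightarrow>
     rel D e0 e1 x (t \<cdot>\<^bsub>D\<^esub> S) \<Longrightarrow> rel D f0 f1 (x \<cdot>\<^bsub>D\<^esub> k) (t \<cdot>\<^bsub>D\<^esub> T)"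
  by (auto simp: incl_def)

lemma inclI:
  "(\<And>V x t. in_hom D x V (Cod D e0) \<Longrightarrow> in_hom D t V (Dom D S) \<Longrightarrow> rel D e0 e1 x (t \<cdot>\<^bsub>D\<^esub> S) \<Longrightarrow>
     rel D f0 f1 (x \<cdot>\<^bsub>D\<^esub> k) (t \<cdot>\<^bsub>D\<^esub> T)) \<Longrightarrow> incl D e0 e1 f0 f1 k S T"
  by (auto simp: incl_def)

context category
begin

lemma ide_simps [simp]:
  "a \<in> Obj D \<Longrightarrow> ide D a \<in> Arr D" "a \<in> Obj D \<Longrightarrow> Dom D (ide D a) = a"
  "a \<in> Obj D \<Longrightarrow> Cod D (ide D a) = a"
  using ide_in_hom by (simp_all add: in_hom_def)

lemma Obj_simps [simp]: "f \<in> Arr D \<Longrightarrow> Dom D f \<in> Obj D" "f \<in> Arr D \<Longrightarrow> Cod D f \<in> Obj D"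
  by (simp_all add: Dom_Obj Cod_Obj)

lemma cmp_simps [simp]:
  assumes "f \<in> Arr D" "g \<in> Arr D" "Cod D f = Dom D g"
  shows "f \<cdot> g \<in> Arr D" "Dom D (f \<cdot> g) = Dom D f" "Cod D (f \<cdot> g) = Cod D g"
  using cmp_in_hom[of f "Dom D f" "Dom D g" g "Cod D g"] assms by (simp_all add: in_hom_def)

lemma cmp_assoc_simp [simp]:
  "f \<in> Arr D \<Longrightarrow> g \<in> Arr D \<Longrightarrow> h \<in> Arr D \<Longrightarrow> Cod D f = Dom D g \<Longrightarrow> Cod D g = Dom D h \<Longrightarrow>
     (f \<cdot> g) \<cdot> h = f \<cdot> (g \<cdot> h)"
  using cmp_assoc by (simp add: in_hom_def)

lemma ide_cmp_simp [simp]: "f \<in> Arr D \<Longrightarrow> Dom D f = a \<Longrightarrow> ide D a \<cdot> f = f"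
  using ide_cmp by auto

lemma cmp_ide_simp [simp]: "f \<in> Arr D \<Longrightarrow> Cod D f = a \<Longrightarrow> f \<cdot> ide D a = f"
  using cmp_ide by auto

lemma cmp_eq_assoc:
  assumes "f \<cdot> g = h \<cdot> k" "f \<in> Arr D" "g \<in> Arr D" "h \<in> Arr D" "k \<in> Arr D" "l \<in> Arr D"
    "Cod D f = Dom D g" "Cod D h = Dom D k" "Cod D g = Dom D l" "Cod D k = Dom D l"
  shows "f \<cdot> (g \<cdot> l) = h \<cdot> (k \<cdot> l)"
  using assms cmp_assoc_simp by metis

lemma cmp_eq_assoc1:
  assumes "f \<cdot> g = h" "f \<in> Arr D" "g \<in> Arr D" "l \<in> Arr D" "Cod D f = Dom D g" "Cod D g = Dom D l"
  shows "f \<cdot> (g \<cdot> l) = h \<cdot> l"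
  using assms cmp_assoc_simp by metis

lemma rel_nat:
  assumes "rel D n0 n1 x y" "in_hom D u V (Dom D x)" "n0 \<in> Arr D" "n1 \<in> Arr D" "Dom D n1 = Dom D n0"
    "x \<in> Arr D"
  shows "rel D n0 n1 (u \<cdot> x) (u \<cdot> y)"
proof -
  obtain e where e: "in_hom D e (Dom D x) (Dom D n0)" "e \<cdot> n0 = x" "e \<cdot> n1 = y"
    using assms(1) by (auto simp: rel_def)
  show ?thesis
    by (rule relI[where e = "u \<cdot> e"]) (use e assms in \<open>auto simp: in_hom_def\<close>)
qed

lemma product_jointly_monic:
  assumes "is_product D p q"
  shows "jointly_monic D p q"
  unfolding jointly_monic_def
proof (intro conjI allI impI)
  fix V e e'
  assume a: "in_hom D e V (Dom D p) \<and> in_hom D e' V (Dom D p) \<and> e \<cdot> p = e' \<cdot> p \<and> e \<cdot> q = e' \<cdot> q"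
  have "e \<cdot> p = e \<cdot> p" "in_hom D (e \<cdot> p) V (Cod D p)" "in_hom D (e \<cdot> q) V (Cod D q)"
    using a is_productD[OF assms] by (auto simp: in_hom_def)
  then show "e = e'" using is_product_ex1[OF assms, of "e \<cdot> p" V "e \<cdot> q"] a by metis
qed (use is_productD[OF assms] in simp_all)

lemma pullback_jointly_monic:
  assumes "is_pullback D p q f g"
  shows "jointly_monic D p q"
  unfolding jointly_monic_def
proof (intro conjI allI impI)
  note pb = is_pullbackD[OF assms]
  fix V e e'
  assume a: "in_hom D e V (Dom D p) \<and> in_hom D e' V (Dom D p) \<and> e \<cdot> p = e' \<cdot> p \<and> e \<cdot> q = e' \<cdot> q"
  have "(e \<cdot> p) \<cdot> f = (e \<cdot> q) \<cdot> g" using a pb by (simp add: in_hom_def)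
  moreover have "in_hom D (e \<cdot> p) V (Dom D f)" "in_hom D (e \<cdot> q) V (Dom D g)"
    using a pb by (auto simp: in_hom_def)
  ultimately show "e = e'" using is_pullback_ex1[OF assms, of "e \<cdot> p" V "e \<cdot> q"] a by metis
qed (use is_pullbackD[OF assms] in simp_all)

lemma mono_jointly_monic:
  assumes "is_product D s0 s1" "is_mono D n" "Cod D n = Dom D s0"
  shows "jointly_monic D (n \<cdot> s0) (n \<cdot> s1)"
proof -
  note s = is_productD[OF assms(1)]
  have n: "n \<in> Arr D" using assms(2) by (simp add: is_mono_def)
  show ?thesis
    unfolding jointly_monic_def
  proof (intro conjI allI impI)
    fix V e e'
    assume a: "in_hom D e V (Dom D (n \<cdot> s0)) \<and> in_hom D e' V (Dom D (n \<cdot> s0))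
       \<and> e \<cdot> (n \<cdot> s0) = e' \<cdot> (n \<cdot> s0) \<and> e \<cdot> (n \<cdot> s1) = e' \<cdot> (n \<cdot> s1)"
    have "e \<cdot> n = e' \<cdot> n"
      by (rule jointly_monicD[OF product_jointly_monic[OF assms(1)], of _ V])
        (use a n s assms in \<open>auto simp: in_hom_def\<close>)
    then show "e = e'" using is_monoD[OF assms(2), of e V e'] a n s assms(3) by simp
  qed (use n s assms in simp_all)
qed

lemma jointly_monic_mono:
  assumes "is_product D s0 s1" "n \<in> Arr D" "Cod D n = Dom D s0" "jointly_monic D (n \<cdot> s0) (n \<cdot> s1)"
  shows "is_mono D n"
  unfolding is_mono_def
proof (intro conjI ballI impI)
  note s = is_productD[OF assms(1)]
  fix x y assume xy: "x \<in> Arr D" "y \<in> Arr D"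
    "Dom D x = Dom D y \<and> Cod D x = Dom D n \<and> Cod D y = Dom D n \<and> x \<cdot> n = y \<cdot> n"
  have "x \<cdot> (n \<cdot> s0) = y \<cdot> (n \<cdot> s0)" "x \<cdot> (n \<cdot> s1) = y \<cdot> (n \<cdot> s1)"
    using xy s assms by (auto intro!: cmp_eq_assoc)
  then show "x = y"
    using jointly_monicD[OF assms(4), of x "Dom D x" y] xy s assms by (simp add: in_hom_def)
qed (use assms in simp)

text \<open>The arrow id x \<open>r\<close> leaves the first coordinate alone. A pullback square
  over it is therefore a pullback square over \<open>r\<close> together with an equation between
  first coordinates.\<close>

lemma classifies_iff_pullback:
  assumes q: "is_product D q0 q1" and m: "is_mono D m" "Cod D m = Dom D q0"
    and s: "is_product D s0 s1" "Cod D s0 = Cod D q0" and n: "is_mono D n" "Cod D n = Dom D s0"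
  shows "classifies D q0 q1 m s0 s1 n r \<longleftrightarrow> in_hom D r (Cod D s1) (Cod D q1)
    \<and> (\<exists>c. is_pullback D (n \<cdot> s1) c r (m \<cdot> q1) \<and> c \<cdot> (m \<cdot> q0) = n \<cdot> s0)"
proof -
  have [simp]: "m \<in> Arr D" "n \<in> Arr D" using m n by (simp_all add: is_mono_def)
  note [simp] = is_productD[OF q] is_productD[OF s(1)] m(2) n(2) s(2)
  note jq = jointly_monicD[OF product_jointly_monic[OF q]]
  note js = jointly_monicD[OF product_jointly_monic[OF s(1)]]
  show ?thesis
  proof
    assume "classifies D q0 q1 m s0 s1 n r"
    then obtain h t where h: "in_hom D r (Cod D s1) (Cod D q1)" "in_hom D h (Dom D s0) (Dom D q0)"
      "h \<cdot> q0 = s0 \<cdot> ide D (Cod D q0)" "h \<cdot> q1 = s1 \<cdot> r" and pb: "is_pullback D n t h m"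
      by (auto simp: classifies_def is_product_map_def)
    note [simp] = in_homD[OF h(1)] in_homD[OF h(2)]
    note p = is_pullbackD[OF pb]
    note [simp] = p(2,5,7)
    have h0: "h \<cdot> q0 = s0" using h(3) by simp
    have e0: "t \<cdot> (m \<cdot> q0) = n \<cdot> s0"
      using cmp_eq_assoc[OF p(9), of q0] h0 by simp
    have e1: "t \<cdot> (m \<cdot> q1) = n \<cdot> (s1 \<cdot> r)"
      using cmp_eq_assoc[OF p(9), of q1] h(4) by simp
    have "is_pullback D (n \<cdot> s1) t r (m \<cdot> q1)"
    proof (rule is_pullbackI)
      show "(n \<cdot> s1) \<cdot> r = t \<cdot> (m \<cdot> q1)" using e1 by simp
      fix V x y assume x: "in_hom D x V (Dom D r)" and y: "in_hom D y V (Dom D (m \<cdot> q1))"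
        and xy: "x \<cdot> r = y \<cdot> (m \<cdot> q1)"
      note [simp] = in_homD[OF x] in_homD[OF y]
      \<comment> \<open>A point of the pullback over \<open>r\<close> has no coordinate in a; the
        one of \<open>y\<close> is used.\<close>
      obtain z where z: "in_hom D z V (Dom D s0)" "z \<cdot> s0 = y \<cdot> (m \<cdot> q0)" "z \<cdot> s1 = x"
        by (rule is_product_pair[OF s(1), of "y \<cdot> (m \<cdot> q0)" V x]) (simp_all add: in_hom_def)
      note [simp] = in_homD[OF z(1)]
      have "z \<cdot> h = y \<cdot> m"
        by (rule jq[of _ V])
          (simp_all add: in_hom_def h0 h(4) z xy cmp_eq_assoc1[OF z(3)])
      then obtain e where e: "in_hom D e V (Dom D n)" "e \<cdot> n = z" "e \<cdot> t = y"
        by (elim is_pullback_pair[OF pb, rotated -1]) (simp_all add: in_hom_def)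
      note [simp] = in_homD[OF e(1)]
      have "e \<cdot> (n \<cdot> s1) = x" using cmp_eq_assoc1[OF e(2), of s1] z(3) by simp
      then show "\<exists>e. in_hom D e V (Dom D (n \<cdot> s1)) \<and> e \<cdot> (n \<cdot> s1) = x \<and> e \<cdot> t = y"
        using e by (intro exI[of _ e]) (simp add: in_hom_def)
    next
      show "jointly_monic D (n \<cdot> s1) t"
        unfolding jointly_monic_def
      proof (intro conjI allI impI)
        fix V e e'
        assume a: "in_hom D e V (Dom D (n \<cdot> s1)) \<and> in_hom D e' V (Dom D (n \<cdot> s1)) \<and>
           e \<cdot> (n \<cdot> s1) = e' \<cdot> (n \<cdot> s1) \<and> e \<cdot> t = e' \<cdot> t"
        then have [simp]: "e \<in> Arr D" "e' \<in> Arr D" "Dom D e = V" "Dom D e' = V"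
          "Cod D e = Dom D n" "Cod D e' = Dom D n" by (simp_all add: in_hom_def)
        have "e \<cdot> (n \<cdot> s0) = e' \<cdot> (n \<cdot> s0)"
          unfolding e0[symmetric] by (rule cmp_eq_assoc) (use a in simp_all)
        then show "e = e'"
          using jointly_monicD[OF mono_jointly_monic[OF s(1) n], of e V e'] a by (simp add: in_hom_def)
      qed simp_all
    qed simp_all
    then show "in_hom D r (Cod D s1) (Cod D q1)
        \<and> (\<exists>c. is_pullback D (n \<cdot> s1) c r (m \<cdot> q1) \<and> c \<cdot> (m \<cdot> q0) = n \<cdot> s0)"
      using h(1) e0 by blast
  next
    assume "in_hom D r (Cod D s1) (Cod D q1)
        \<and> (\<exists>c. is_pullback D (n \<cdot> s1) c r (m \<cdot> q1) \<and> c \<cdot> (m \<cdot> q0) = n \<cdot> s0)"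
    then obtain c where r: "in_hom D r (Cod D s1) (Cod D q1)"
      and pb: "is_pullback D (n \<cdot> s1) c r (m \<cdot> q1)" and c: "c \<cdot> (m \<cdot> q0) = n \<cdot> s0" by blast
    note [simp] = in_homD[OF r]
    have [simp]: "c \<in> Arr D" "Dom D c = Dom D n" "Cod D c = Dom D m"
      using is_pullbackD[OF pb] by simp_all
    have c1: "c \<cdot> (m \<cdot> q1) = n \<cdot> (s1 \<cdot> r)"
      using is_pullbackD(9)[OF pb] by simp
    obtain h where h: "in_hom D h (Dom D s0) (Dom D q0)" "h \<cdot> q0 = s0" "h \<cdot> q1 = s1 \<cdot> r"
      by (rule is_product_pair[OF q, of s0 "Dom D s0" "s1 \<cdot> r"]) (simp_all add: in_hom_def)
    note [simp] = in_homD[OF h(1)]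
    have "is_pullback D n c h m"
    proof (rule is_pullbackI)
      show "n \<cdot> h = c \<cdot> m"
        by (rule jq[of _ "Dom D n"]) (simp_all add: in_hom_def h c c1)
      fix V x y assume x: "in_hom D x V (Dom D h)" and y: "in_hom D y V (Dom D m)"
        and xy: "x \<cdot> h = y \<cdot> m"
      note [simp] = in_homD[OF x] in_homD[OF y]
      have "x \<cdot> (s1 \<cdot> r) = y \<cdot> (m \<cdot> q1)"
        using cmp_eq_assoc[OF xy, of q1] h(3) by simp
      then have "(x \<cdot> s1) \<cdot> r = y \<cdot> (m \<cdot> q1)" by simp
      then obtain e where e: "in_hom D e V (Dom D (n \<cdot> s1))" "e \<cdot> (n \<cdot> s1) = x \<cdot> s1" "e \<cdot> c = y"
        by (elim is_pullback_pair[OF pb, rotated -1]) (simp_all add: in_hom_def)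
      have [simp]: "e \<in> Arr D" "Dom D e = V" "Cod D e = Dom D n" using in_homD[OF e(1)] by simp_all
      have *: "e \<cdot> (n \<cdot> s0) = x \<cdot> s0"
        using cmp_eq_assoc1[OF e(3), of "m \<cdot> q0"] c cmp_eq_assoc[OF xy, of q0] h(2) by simp
      have "e \<cdot> n = x"
        by (rule js[of _ V]) (use e * in \<open>simp_all add: in_hom_def\<close>)
      then show "\<exists>e. in_hom D e V (Dom D n) \<and> e \<cdot> n = x \<and> e \<cdot> c = y"
        using e by (intro exI[of _ e]) (simp add: in_hom_def)
    next
      show "jointly_monic D n c"
        unfolding jointly_monic_def using is_monoD[OF n(1)] by simp blast
    qed simp_all
    then show "classifies D q0 q1 m s0 s1 n r"
      unfolding classifies_def is_product_map_def
      by (intro exI[of _ h] exI[of _ c] conjI) (use h r in \<open>simp_all add: in_hom_def\<close>)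
  qed
qed

text \<open>A Yoneda argument: a generalised element of the pullback of \<open>r\<close> and
  \<open>e1\<close> is some t with a witness of x \<in> r(t), x being the \<open>e0\<close> leg of
  the witness. Joint monicity makes the witness unique, so comparing the pullback with the span
  \<open>n0\<close>, \<open>n1\<close> is comparing two relations between x and t.\<close>

lemma pullback_iff_rel:
  assumes e: "jointly_monic D e0 e1" and n: "jointly_monic D n0 n1" and co: "Cod D n0 = Cod D e0"
    and r: "in_hom D r (Cod D n1) (Cod D e1)"
  shows "(\<exists>c. is_pullback D n1 c r e1 \<and> c \<cdot> e0 = n0) \<longleftrightarrow> classifies_rel D e0 e1 n0 n1 r"
proof -
  have [simp]: "e0 \<in> Arr D" "e1 \<in> Arr D" "Dom D e1 = Dom D e0"
    "n0 \<in> Arr D" "n1 \<in> Arr D" "Dom D n1 = Dom D n0"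
    using jointly_monic_arr[OF e] jointly_monic_arr[OF n] by simp_all
  note [simp] = in_homD[OF r] co
  show ?thesis
  proof
    assume "\<exists>c. is_pullback D n1 c r e1 \<and> c \<cdot> e0 = n0"
    then obtain c where pb: "is_pullback D n1 c r e1" and c: "c \<cdot> e0 = n0" by blast
    have [simp]: "c \<in> Arr D" "Dom D c = Dom D n0" "Cod D c = Dom D e0"
      using is_pullbackD[OF pb] by simp_all
    show "classifies_rel D e0 e1 n0 n1 r"
      unfolding classifies_rel_def
    proof (intro conjI allI impI iffI)
      fix V x t assume xt: "in_hom D x V (Cod D e0) \<and> in_hom D t V (Cod D n1)"
      note [simp] = in_homD[OF xt[THEN conjunct1]] in_homD[OF xt[THEN conjunct2]]
      { assume "rel D n0 n1 x t"
        then obtain u where u: "in_hom D u V (Dom D n0)" "u \<cdot> n0 = x" "u \<cdot> n1 = t"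
          using xt by (blast elim: relE)
        note [simp] = in_homD[OF u(1)]
        show "rel D e0 e1 x (t \<cdot> r)"
          by (rule relI[where e = "u \<cdot> c"])
            (simp_all add: in_hom_def c u is_pullbackD(9)[OF pb, symmetric] cmp_eq_assoc1[OF u(3)])
      }
      { assume "rel D e0 e1 x (t \<cdot> r)"
        then obtain u where u: "in_hom D u V (Dom D e0)" "u \<cdot> e0 = x" "u \<cdot> e1 = t \<cdot> r"
          using xt by (blast elim: relE)
        note [simp] = in_homD[OF u(1)]
        obtain w where w: "in_hom D w V (Dom D n1)" "w \<cdot> n1 = t" "w \<cdot> c = u"
          by (rule is_pullback_pair[OF pb, of t V u]) (simp_all add: in_hom_def u)
        have [simp]: "w \<in> Arr D" "Dom D w = V" "Cod D w = Dom D n0"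
          using in_homD[OF w(1)] by simp_all
        show "rel D n0 n1 x t"
          by (rule relI[where e = w])
            (simp_all add: in_hom_def w u cmp_eq_assoc1[OF w(3), of e0, simplified c])
      }
    qed (use r in simp)
  next
    assume cl: "classifies_rel D e0 e1 n0 n1 r"
    \<comment> \<open>The condition is applied to the generic related pair, the legs themselves; the
      factorisation that it returns is the projection \<open>c\<close>.\<close>
    have "rel D n0 n1 n0 n1"
      by (rule relI[where e = "ide D (Dom D n0)"]) (simp_all add: in_hom_def)
    then have "rel D e0 e1 n0 (n1 \<cdot> r)"
      using classifies_relD(1)[OF cl, of n0 "Dom D n0" n1] by (simp add: in_hom_def)
    then obtain c where c: "in_hom D c (Dom D n0) (Dom D e0)" "c \<cdot> e0 = n0" "c \<cdot> e1 = n1 \<cdot> r"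
      by (auto simp: rel_def)
    note [simp] = in_homD[OF c(1)]
    have "is_pullback D n1 c r e1"
    proof (rule is_pullbackI)
      fix V x y assume x: "in_hom D x V (Dom D r)" and y: "in_hom D y V (Dom D e1)"
        and xy: "x \<cdot> r = y \<cdot> e1"
      have [simp]: "x \<in> Arr D" "Dom D x = V" "Cod D x = Cod D n1"
        "y \<in> Arr D" "Dom D y = V" "Cod D y = Dom D e0" using in_homD[OF x] in_homD[OF y] by simp_all
      have "rel D e0 e1 (y \<cdot> e0) (x \<cdot> r)"
        by (rule relI[where e = y]) (simp_all add: in_hom_def xy)
      then have "rel D n0 n1 (y \<cdot> e0) x"
        using classifies_relD(1)[OF cl, of "y \<cdot> e0" V x] by (simp add: in_hom_def)
      then obtain w where w: "in_hom D w V (Dom D n0)" "w \<cdot> n0 = y \<cdot> e0" "w \<cdot> n1 = x"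
        by (auto simp: rel_def)
      note [simp] = in_homD[OF w(1)]
      have "w \<cdot> c = y"
        by (rule jointly_monicD[OF e, of _ V])
          (simp_all add: in_hom_def c w xy[symmetric] cmp_eq_assoc1[OF w(3), symmetric])
      then show "\<exists>w. in_hom D w V (Dom D n1) \<and> w \<cdot> n1 = x \<and> w \<cdot> c = y"
        using w by auto
    next
      show "jointly_monic D n1 c"
        unfolding jointly_monic_def
      proof (intro conjI allI impI)
        fix V u u' assume a: "in_hom D u V (Dom D n1) \<and> in_hom D u' V (Dom D n1)
           \<and> u \<cdot> n1 = u' \<cdot> n1 \<and> u \<cdot> c = u' \<cdot> c"
        then have [simp]: "u \<in> Arr D" "u' \<in> Arr D" "Cod D u = Dom D n0" "Cod D u' = Dom D n0"
          by (simp_all add: in_hom_def)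
        have "u \<cdot> n0 = u' \<cdot> n0"
          unfolding c(2)[symmetric] by (rule cmp_eq_assoc) (use a in simp_all)
        then show "u = u'" using jointly_monicD[OF n, of u V u'] a by simp
      qed simp_all
    qed (simp_all add: c)
    then show "\<exists>c. is_pullback D n1 c r e1 \<and> c \<cdot> e0 = n0" using c by blast
  qed
qed

lemma classifies_iff_rel:
  assumes q: "is_product D q0 q1" and m: "is_mono D m" "Cod D m = Dom D q0"
    and s: "is_product D s0 s1" "Cod D s0 = Cod D q0" and n: "is_mono D n" "Cod D n = Dom D s0"
  shows "classifies D q0 q1 m s0 s1 n r \<longleftrightarrow>
    classifies_rel D (m \<cdot> q0) (m \<cdot> q1) (n \<cdot> s0) (n \<cdot> s1) r"
proof -
  have [simp]: "m \<in> Arr D" "n \<in> Arr D" using m n by (simp_all add: is_mono_def)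
  note [simp] = is_productD[OF q] is_productD[OF s(1)] m(2) n(2) s(2)
  show ?thesis
    unfolding classifies_iff_pullback[OF assms]
    using pullback_iff_rel[OF mono_jointly_monic[OF q m] mono_jointly_monic[OF s(1) n], of r]
    by (auto simp: classifies_rel_def)
qed

end

section \<open>Categories with binary products and pullbacks\<close>

locale lex_category = category +
  assumes has_products: "a \<in> Obj D \<Longrightarrow> b \<in> Obj D \<Longrightarrow>
      \<exists>p q. is_product D p q \<and> Cod D p = a \<and> Cod D q = b"
    and has_pullbacks: "f \<in> Arr D \<Longrightarrow> g \<in> Arr D \<Longrightarrow> Cod D f = Cod D g \<Longrightarrow>
      \<exists>p q. is_pullback D p q f g"
begin

lemma obtain_product:
  assumes "a \<in> Obj D" "b \<in> Obj D"
  obtains p q where "is_product D p q" "Cod D p = a" "Cod D q = b" "p \<in> Arr D" "q \<in> Arr D"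
    "Dom D q = Dom D p"
proof -
  obtain p q where pq: "is_product D p q" "Cod D p = a" "Cod D q = b"
    using has_products[OF assms] by blast
  show thesis by (rule that[OF pq is_productD[OF pq(1)]])
qed

lemma obtain_pullback:
  assumes "f \<in> Arr D" "g \<in> Arr D" "Cod D f = Cod D g"
  obtains p q where "is_pullback D p q f g" "p \<in> Arr D" "q \<in> Arr D" "Dom D q = Dom D p"
    "Cod D p = Dom D f" "Cod D q = Dom D g" "p \<cdot> f = q \<cdot> g"
proof -
  obtain p q where pq: "is_pullback D p q f g"
    using has_pullbacks[OF assms] by blast
  show thesis by (rule that[OF pq is_pullbackD(1,2,5,6,7,9)[OF pq]])
qed

text \<open>The equalizer is the pullback of the pairing of \<open>f\<close> and \<open>g\<close>
  along the diagonal of \<open>b\<close>. Its universal property is put as a test for factorisation,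
  the form in which it later meets \<open>rel_mono_iff\<close>.\<close>

lemma obtain_equalizer:
  assumes "in_hom D f a b" "in_hom D g a b"
  obtains l where "is_mono D l" "Cod D l = a"
    "\<And>V z. in_hom D z V a \<Longrightarrow> (\<exists>h. in_hom D h V (Dom D l) \<and> h \<cdot> l = z) \<longleftrightarrow> z \<cdot> f = z \<cdot> g"
proof -
  note [simp] = in_homD[OF assms(1)] in_homD[OF assms(2)]
  have [simp]: "b \<in> Obj D" using Obj_simps(2)[of f] by simp
  obtain p q where pq: "is_product D p q" and [simp]: "Cod D p = b" "Cod D q = b"
      "p \<in> Arr D" "q \<in> Arr D" "Dom D q = Dom D p"
    by (rule obtain_product[of b b]) simp_all
  note jp = jointly_monicD[OF product_jointly_monic[OF pq]]
  obtain h where h: "in_hom D h a (Dom D p)" "h \<cdot> p = f" "h \<cdot> q = g"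
    by (rule is_product_pair[OF pq, of f a g]) (simp_all add: in_hom_def)
  \<comment> \<open>The diagonal of \<open>b\<close>.\<close>
  obtain k where k: "in_hom D k b (Dom D p)" "k \<cdot> p = ide D b" "k \<cdot> q = ide D b"
    by (rule is_product_pair[OF pq, of "ide D b" b "ide D b"]) (simp_all add: in_hom_def)
  note [simp] = in_homD[OF h(1)] in_homD[OF k(1)]
  obtain l m where lm: "is_pullback D l m h k" and [simp]: "l \<in> Arr D" "m \<in> Arr D"
      "Dom D m = Dom D l" "Cod D l = a" "Cod D m = b" and e: "l \<cdot> h = m \<cdot> k"
    by (rule obtain_pullback[of h k]) simp_all
  have m: "l \<cdot> f = m" "l \<cdot> g = m"
    using cmp_eq_assoc[OF e, of p] cmp_eq_assoc[OF e, of q] h k by simp_all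
  show thesis
  proof (rule that)
    show "is_mono D l"
      unfolding is_mono_def
    proof (intro conjI ballI impI)
      fix x y assume xy: "x \<in> Arr D" "y \<in> Arr D"
        "Dom D x = Dom D y \<and> Cod D x = Dom D l \<and> Cod D y = Dom D l \<and> x \<cdot> l = y \<cdot> l"
      have "x \<cdot> (l \<cdot> f) = y \<cdot> (l \<cdot> f)" by (rule cmp_eq_assoc) (use xy in simp_all)
      then show "x = y"
        by (intro jointly_monicD[OF pullback_jointly_monic[OF lm], of x "Dom D x" y])
          (use xy m in \<open>simp_all add: in_hom_def\<close>)
    qed simp
    fix V z assume z: "in_hom D z V a"
    note [simp] = in_homD[OF z]
    show "(\<exists>h. in_hom D h V (Dom D l) \<and> h \<cdot> l = z) \<longleftrightarrow> z \<cdot> f = z \<cdot> g"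
    proof
      assume "\<exists>h. in_hom D h V (Dom D l) \<and> h \<cdot> l = z"
      then obtain u where u: "in_hom D u V (Dom D l)" "u \<cdot> l = z" by blast
      note [simp] = in_homD[OF u(1)]
      show "z \<cdot> f = z \<cdot> g" by (simp add: u(2)[symmetric] m)
    next
      assume zz: "z \<cdot> f = z \<cdot> g"
      \<comment> \<open>Equal composites mean that the pairing, restricted along \<open>z\<close>,
        lies on the diagonal.\<close>
      have *: "z \<cdot> h = (z \<cdot> f) \<cdot> k"
        by (rule jp[of _ V]) (simp_all add: in_hom_def h k zz)
      obtain u where "in_hom D u V (Dom D l)" "u \<cdot> l = z"
        by (rule is_pullback_pair[OF lm _ _ *]) (simp_all add: in_hom_def)
      then show "\<exists>h. in_hom D h V (Dom D l) \<and> h \<cdot> l = z" by blast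
    qed
  qed simp
qed

text \<open>Products exist, so every jointly monic span over a comes from a mono into some product a
  x y; unique classification of monos thus gives that of spans.\<close>

lemma power_object_power_rel:
  assumes "is_power_object D q0 q1 m"
  shows "power_rel D (m \<cdot> q0) (m \<cdot> q1)"
proof -
  have q: "is_product D q0 q1" and m: "is_mono D m" "Cod D m = Dom D q0"
    and u: "\<And>s0 s1 n. is_product D s0 s1 \<Longrightarrow> Cod D s0 = Cod D q0 \<Longrightarrow> is_mono D n \<Longrightarrow>
      Cod D n = Dom D s0 \<Longrightarrow> \<exists>!r. classifies D q0 q1 m s0 s1 n r"
    using assms unfolding is_power_object_def by blast+
  have [simp]: "m \<in> Arr D" using m by (simp add: is_mono_def)
  note [simp] = is_productD[OF q] m(2)
  show ?thesis
    unfolding power_rel_def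
  proof (intro conjI allI impI)
    show "jointly_monic D (m \<cdot> q0) (m \<cdot> q1)" by (rule mono_jointly_monic[OF q m])
    fix n0 n1 assume "jointly_monic D n0 n1 \<and> Cod D n0 = Cod D (m \<cdot> q0)"
    then have jn: "jointly_monic D n0 n1" and [simp]: "Cod D n0 = Cod D q0" by simp_all
    note [simp] = jointly_monic_arr[OF jn]
    obtain s0 s1 where s: "is_product D s0 s1" "Cod D s0 = Cod D q0" "Cod D s1 = Cod D n1"
      and [simp]: "s0 \<in> Arr D" "s1 \<in> Arr D" "Dom D s1 = Dom D s0"
      by (rule obtain_product[of "Cod D q0" "Cod D n1"]) simp_all
    obtain n where n: "in_hom D n (Dom D n0) (Dom D s0)" "n \<cdot> s0 = n0" "n \<cdot> s1 = n1"
      by (rule is_product_pair[OF s(1), of n0 "Dom D n0" n1]) (simp_all add: in_hom_def s)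
    note nn = in_homD[OF n(1)]
    have mono: "is_mono D n"
      by (rule jointly_monic_mono[OF s(1) nn(1,3)]) (simp add: n jn)
    show "\<exists>!r. classifies_rel D (m \<cdot> q0) (m \<cdot> q1) n0 n1 r"
      using u[OF s(1,2) mono nn(3)]
      unfolding classifies_iff_rel[OF q m s(1,2) mono nn(3)] n(2,3) .
  qed
qed

end

section \<open>Inverse and direct images as adjoints between power objects\<close>

lemma iimgD:
  "iimg D e0 e1 f0 f1 k d \<Longrightarrow> in_hom D x Z (Cod D e0) \<Longrightarrow> in_hom D T Z (Cod D f1) \<Longrightarrow>
     rel D e0 e1 x (T \<cdot>\<^bsub>D\<^esub> d) \<longleftrightarrow> rel D f0 f1 (x \<cdot>\<^bsub>D\<^esub> k) T"
  unfolding iimg_def by blast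

lemma dimgD:
  "dimg D e0 e1 f0 f1 k d \<Longrightarrow> in_hom D S Z (Cod D e1) \<Longrightarrow> in_hom D T Z (Cod D f1) \<Longrightarrow>
     incl D e0 e1 f0 f1 k S T \<longleftrightarrow> incl D f0 f1 f0 f1 (ide D (Cod D f0)) (S \<cdot>\<^bsub>D\<^esub> d) T"
  unfolding dimg_def by blast

context category
begin

text \<open>Extensionality of P(a). The relation x \<in> S(t) is classified by \<open>S\<close>, by
  the hypothesis on elements also by \<open>S'\<close>, and classifying arrows are unique.\<close>

lemma power_ext:
  assumes lex: "lex_category D" and pe: "power_rel D e0 e1"
    and S: "in_hom D S Z (Cod D e1)" and S': "in_hom D S' Z (Cod D e1)"
    and eq: "\<And>V x t. in_hom D x V (Cod D e0) \<Longrightarrow> in_hom D t V Z \<Longrightarrow>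
      rel D e0 e1 x (t \<cdot> S) \<longleftrightarrow> rel D e0 e1 x (t \<cdot> S')"
  shows "S = S'"
proof -
  have je: "jointly_monic D e0 e1" using pe unfolding power_rel_def by blast
  note [simp] = jointly_monic_arr[OF je] in_homD[OF S] in_homD[OF S']
  \<comment> \<open>Membership pulled back along \<open>S\<close>: the span with legs
    \<open>c \<cdot> e0\<close> and \<open>n1\<close> presents the relation x \<in> S(t).\<close>
  obtain n1 c where pb: "is_pullback D n1 c S e1" and [simp]: "n1 \<in> Arr D" "c \<in> Arr D"
      "Dom D c = Dom D n1" "Cod D n1 = Z" "Cod D c = Dom D e0" and nc: "n1 \<cdot> S = c \<cdot> e1"
    by (rule lex_category.obtain_pullback[OF lex, of S e1]) simp_all
  have jn: "jointly_monic D (c \<cdot> e0) n1"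
    unfolding jointly_monic_def
  proof (intro conjI allI impI)
    fix V u u' assume a: "in_hom D u V (Dom D (c \<cdot> e0)) \<and> in_hom D u' V (Dom D (c \<cdot> e0))
       \<and> u \<cdot> (c \<cdot> e0) = u' \<cdot> (c \<cdot> e0) \<and> u \<cdot> n1 = u' \<cdot> n1"
    then have [simp]: "u \<in> Arr D" "u' \<in> Arr D" "Dom D u = V" "Dom D u' = V"
      "Cod D u = Dom D n1" "Cod D u' = Dom D n1"
      by (simp_all add: in_hom_def)
    have "u \<cdot> (n1 \<cdot> S) = u' \<cdot> (n1 \<cdot> S)" by (rule cmp_eq_assoc) (use a in simp_all)
    then have *: "u \<cdot> (c \<cdot> e1) = u' \<cdot> (c \<cdot> e1)" by (simp add: nc)
    have "u \<cdot> c = u' \<cdot> c"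
      by (rule jointly_monicD[OF je, of _ V]) (use a * in \<open>simp_all add: in_hom_def\<close>)
    then show "u = u'"
      using jointly_monicD[OF pullback_jointly_monic[OF pb], of u V u'] a by (simp add: in_hom_def)
  qed simp_all
  have 1: "classifies_rel D e0 e1 (c \<cdot> e0) n1 S"
    by (rule iffD1[OF pullback_iff_rel[OF je jn]])
      (use pb in \<open>auto simp: in_hom_def\<close>)
  have 2: "classifies_rel D e0 e1 (c \<cdot> e0) n1 S'"
    unfolding classifies_rel_def
  proof (intro conjI allI impI)
    fix V x t assume "in_hom D x V (Cod D e0) \<and> in_hom D t V (Cod D n1)"
    then have xt: "in_hom D x V (Cod D e0)" "in_hom D t V Z" by simp_all
    then show "rel D (c \<cdot> e0) n1 x t \<longleftrightarrow> rel D e0 e1 x (t \<cdot> S')"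
      using classifies_relD(1)[OF 1, of x V t] eq[OF xt] by simp
  qed (simp add: in_hom_def)
  have "\<exists>!r. classifies_rel D e0 e1 (c \<cdot> e0) n1 r"
    using pe jn unfolding power_rel_def by simp
  then show ?thesis using 1 2 by blast
qed

lemma power_rel_jm: "power_rel D e0 e1 \<Longrightarrow> jointly_monic D e0 e1"
  unfolding power_rel_def by blast

lemma obtain_classifier:
  assumes "power_rel D e0 e1" "jointly_monic D n0 n1" "Cod D n0 = Cod D e0"
  obtains r where "classifies_rel D e0 e1 n0 n1 r"
  using assms unfolding power_rel_def by blast

lemma incl_refl: "incl D f0 f1 f0 f1 (ide D (Cod D f0)) S S"
  by (rule inclI) (simp add: in_hom_def)

lemma incl_antisym:
  assumes lex: "lex_category D" and pe: "power_rel D f0 f1"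
    and S: "in_hom D S Z (Cod D f1)" and S': "in_hom D S' Z (Cod D f1)"
    and "incl D f0 f1 f0 f1 (ide D (Cod D f0)) S S'" "incl D f0 f1 f0 f1 (ide D (Cod D f0)) S' S"
  shows "S = S'"
proof (rule power_ext[OF lex pe S S'])
  note [simp] = in_homD[OF S] in_homD[OF S']
  fix V x t assume xt: "in_hom D x V (Cod D f0)" "in_hom D t V Z"
  show "rel D f0 f1 x (t \<cdot> S) \<longleftrightarrow> rel D f0 f1 x (t \<cdot> S')"
    using inclD[OF assms(5) xt(1), of t] inclD[OF assms(6) xt(1), of t] xt
    by (auto simp: in_hom_def)
qed

text \<open>The adjunction at the stage S = id shows that \<open>d\<close> and \<open>d'\<close> are
  contained in the same T. Taking for T each of the two gives equality by antisymmetry.\<close>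

lemma dimg_unique:
  assumes lex: "lex_category D" and pe: "power_rel D e0 e1" and pf: "power_rel D f0 f1"
    and "dimg D e0 e1 f0 f1 k d" "dimg D e0 e1 f0 f1 k d'"
  shows "d = d'"
proof -
  note je = power_rel_jm[OF pe] and jf = power_rel_jm[OF pf]
  note [simp] = jointly_monic_arr[OF je] jointly_monic_arr[OF jf]
  have d: "in_hom D d (Cod D e1) (Cod D f1)" and d': "in_hom D d' (Cod D e1) (Cod D f1)"
    and u: "\<And>T. in_hom D T (Cod D e1) (Cod D f1) \<Longrightarrow> incl D f0 f1 f0 f1 (ide D (Cod D f0)) d T
       \<longleftrightarrow> incl D f0 f1 f0 f1 (ide D (Cod D f0)) d' T"
  proof -
    show d: "in_hom D d (Cod D e1) (Cod D f1)" and d': "in_hom D d' (Cod D e1) (Cod D f1)"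
      using assms(4,5) unfolding dimg_def by blast+
    fix T assume "in_hom D T (Cod D e1) (Cod D f1)"
    moreover have "in_hom D (ide D (Cod D e1)) (Cod D e1) (Cod D e1)" by (simp add: in_hom_def)
    ultimately have "incl D f0 f1 f0 f1 (ide D (Cod D f0)) (ide D (Cod D e1) \<cdot> d) T
       \<longleftrightarrow> incl D f0 f1 f0 f1 (ide D (Cod D f0)) (ide D (Cod D e1) \<cdot> d') T"
      using assms(4,5) unfolding dimg_def by blast
    then show "incl D f0 f1 f0 f1 (ide D (Cod D f0)) d T
       \<longleftrightarrow> incl D f0 f1 f0 f1 (ide D (Cod D f0)) d' T"
      using in_homD[OF d] in_homD[OF d'] by simp
  qed
  show ?thesis
    by (rule incl_antisym[OF lex pf d d']) (use u[OF d] u[OF d'] incl_refl in auto)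
qed

lemma iimg_unique:
  assumes lex: "lex_category D" and pe: "power_rel D e0 e1" and pf: "power_rel D f0 f1"
    and d: "iimg D e0 e1 f0 f1 k d" and d': "iimg D e0 e1 f0 f1 k d'"
  shows "d = d'"
proof (rule power_ext[OF lex pe])
  show "in_hom D d (Cod D f1) (Cod D e1)" "in_hom D d' (Cod D f1) (Cod D e1)"
    using d d' unfolding iimg_def by blast+
  fix V x t assume "in_hom D x V (Cod D e0)" "in_hom D t V (Cod D f1)"
  then show "rel D e0 e1 x (t \<cdot> d) \<longleftrightarrow> rel D e0 e1 x (t \<cdot> d')"
    using d d' unfolding iimg_def by blast
qed

lemma dimg_ide:
  assumes pe: "power_rel D e0 e1"
  shows "dimg D e0 e1 e0 e1 (ide D (Cod D e0)) (ide D (Cod D e1))"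
proof -
  note [simp] = jointly_monic_arr[OF power_rel_jm[OF pe]]
  show ?thesis unfolding dimg_def by (auto simp: in_hom_def)
qed

lemma iimg_ide:
  assumes pe: "power_rel D e0 e1"
  shows "iimg D e0 e1 e0 e1 (ide D (Cod D e0)) (ide D (Cod D e1))"
proof -
  note [simp] = jointly_monic_arr[OF power_rel_jm[OF pe]]
  show ?thesis unfolding iimg_def by (auto simp: in_hom_def)
qed

lemma iimg_comp:
  assumes je: "jointly_monic D e0 e1" and jf: "jointly_monic D f0 f1"
    and jg: "jointly_monic D g0 g1"
    and k: "in_hom D k (Cod D e0) (Cod D f0)" and l: "in_hom D l (Cod D f0) (Cod D g0)"
    and d: "iimg D e0 e1 f0 f1 k d" and d': "iimg D f0 f1 g0 g1 l d'"
  shows "iimg D e0 e1 g0 g1 (k \<cdot> l) (d' \<cdot> d)"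
proof -
  note [simp] = jointly_monic_arr[OF je] jointly_monic_arr[OF jf] jointly_monic_arr[OF jg]
    in_homD[OF k] in_homD[OF l]
  have dd: "in_hom D d (Cod D f1) (Cod D e1)" "in_hom D d' (Cod D g1) (Cod D f1)"
    using d d' unfolding iimg_def by blast+
  note [simp] = in_homD[OF dd(1)] in_homD[OF dd(2)]
  show ?thesis
    unfolding iimg_def
  proof (intro conjI allI impI)
    fix Z x T assume "in_hom D x Z (Cod D e0) \<and> in_hom D T Z (Cod D g1)"
    then have x: "in_hom D x Z (Cod D e0)" and T: "in_hom D T Z (Cod D g1)" by simp_all
    note [simp] = in_homD[OF x] in_homD[OF T]
    have "rel D e0 e1 x ((T \<cdot> d') \<cdot> d) \<longleftrightarrow> rel D f0 f1 (x \<cdot> k) (T \<cdot> d')"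
      by (rule iimgD[OF d x]) (simp add: in_hom_def)
    also have "\<dots> \<longleftrightarrow> rel D g0 g1 ((x \<cdot> k) \<cdot> l) T"
      by (rule iimgD[OF d' _ T]) (simp add: in_hom_def)
    finally show "rel D e0 e1 x (T \<cdot> (d' \<cdot> d)) \<longleftrightarrow> rel D g0 g1 (x \<cdot> (k \<cdot> l)) T" by simp
  qed (simp add: in_hom_def)
qed

text \<open>Elementwise, l(k(x)) \<in> T says that k(x) lies in the preimage of T under l. This
  moves the second factor of a composite to the other side of an inclusion.\<close>

lemma iimg_incl:
  assumes je: "jointly_monic D e0 e1" and jf: "jointly_monic D f0 f1"
    and jg: "jointly_monic D g0 g1"
    and k: "in_hom D k (Cod D e0) (Cod D f0)" and l: "in_hom D l (Cod D f0) (Cod D g0)"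
    and d: "iimg D f0 f1 g0 g1 l d"
    and S: "in_hom D S Z (Cod D e1)" and T: "in_hom D T Z (Cod D g1)"
  shows "incl D e0 e1 g0 g1 (k \<cdot> l) S T \<longleftrightarrow> incl D e0 e1 f0 f1 k S (T \<cdot> d)"
proof -
  note [simp] = jointly_monic_arr[OF je] jointly_monic_arr[OF jf] jointly_monic_arr[OF jg]
    in_homD[OF k] in_homD[OF l] in_homD[OF S] in_homD[OF T]
  have dd: "in_hom D d (Cod D g1) (Cod D f1)"
    using d unfolding iimg_def by blast
  note [simp] = in_homD[OF dd]
  have *: "rel D f0 f1 (x \<cdot> k) (t \<cdot> (T \<cdot> d)) \<longleftrightarrow> rel D g0 g1 (x \<cdot> (k \<cdot> l)) (t \<cdot> T)"
    if xt: "in_hom D x V (Cod D e0)" "in_hom D t V Z" for V x t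
  proof -
    note [simp] = in_homD[OF xt(1)] in_homD[OF xt(2)]
    have "rel D f0 f1 (x \<cdot> k) ((t \<cdot> T) \<cdot> d) \<longleftrightarrow> rel D g0 g1 ((x \<cdot> k) \<cdot> l) (t \<cdot> T)"
      by (rule iimgD[OF d, of _ V]) (simp_all add: in_hom_def)
    then show ?thesis by simp
  qed
  show ?thesis unfolding incl_def using * by simp blast
qed

text \<open>Left adjoints compose. The inclusion of S in the preimage of T under k l becomes one of
  S in the preimage of i(T) under k, passes across \<open>d\<close>, turns back into an inclusion
  along \<open>l\<close>, and passes across \<open>d'\<close>.\<close>

lemma dimg_comp:
  assumes je: "jointly_monic D e0 e1" and jf: "jointly_monic D f0 f1"
    and jg: "jointly_monic D g0 g1"
    and k: "in_hom D k (Cod D e0) (Cod D f0)" and l: "in_hom D l (Cod D f0) (Cod D g0)"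
    and d: "dimg D e0 e1 f0 f1 k d" and d': "dimg D f0 f1 g0 g1 l d'"
    and i: "iimg D f0 f1 g0 g1 l i"
  shows "dimg D e0 e1 g0 g1 (k \<cdot> l) (d \<cdot> d')"
proof -
  note [simp] = jointly_monic_arr[OF je] jointly_monic_arr[OF jf] jointly_monic_arr[OF jg]
    in_homD[OF k] in_homD[OF l]
  have dd: "in_hom D d (Cod D e1) (Cod D f1)" "in_hom D d' (Cod D f1) (Cod D g1)"
    "in_hom D i (Cod D g1) (Cod D f1)"
    using d d' i unfolding dimg_def iimg_def by blast+
  note [simp] = in_homD[OF dd(1)] in_homD[OF dd(2)] in_homD[OF dd(3)]
  show ?thesis
    unfolding dimg_def
  proof (intro conjI allI impI)
    fix Z S T assume "in_hom D S Z (Cod D e1) \<and> in_hom D T Z (Cod D g1)"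
    then have S: "in_hom D S Z (Cod D e1)" and T: "in_hom D T Z (Cod D g1)" by simp_all
    note [simp] = in_homD[OF S] in_homD[OF T]
    have Ti: "in_hom D (T \<cdot> i) Z (Cod D f1)" and Sd: "in_hom D (S \<cdot> d) Z (Cod D f1)"
      by (simp_all add: in_hom_def)
    have "incl D e0 e1 g0 g1 (k \<cdot> l) S T \<longleftrightarrow> incl D e0 e1 f0 f1 k S (T \<cdot> i)"
      by (rule iimg_incl[OF je jf jg k l i S T])
    also have "\<dots> \<longleftrightarrow> incl D f0 f1 f0 f1 (ide D (Cod D f0)) (S \<cdot> d) (T \<cdot> i)"
      using d S Ti unfolding dimg_def by blast
    also have "\<dots> \<longleftrightarrow> incl D f0 f1 g0 g1 (ide D (Cod D f0) \<cdot> l) (S \<cdot> d) T"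
      by (rule iimg_incl[OF jf jf jg _ l i Sd T, symmetric]) (simp add: in_hom_def)
    also have "\<dots> \<longleftrightarrow> incl D g0 g1 g0 g1 (ide D (Cod D g0)) ((S \<cdot> d) \<cdot> d') T"
      using d' Sd T unfolding dimg_def by simp
    finally show "incl D e0 e1 g0 g1 (k \<cdot> l) S T \<longleftrightarrow>
        incl D g0 g1 g0 g1 (ide D (Cod D g0)) (S \<cdot> (d \<cdot> d')) T" by simp
  qed (simp add: in_hom_def)
qed

end

text \<open>\<open>u : P(a) \<times> P(b) \<rightarrow> P(a)\<close> is \<open>(S, T) \<mapsto> S \<inter> k\<^sup>-\<^sup>1 T\<close>; it is described by finite limits only, so
  that it is preserved by functors that preserve these.\<close>

definition meet_data :: "('o, 'm) cat \<Rightarrow> 'm \<Rightarrow> 'm \<Rightarrow> 'm \<Rightarrow> 'm \<Rightarrow> 'm \<Rightarrow> 'm \<Rightarrow> 'm \<Rightarrow> 'm \<Rightarrow> bool" where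
  "meet_data D e0 e1 f0 f1 k p0 p1 u \<longleftrightarrow> is_product D p0 p1 \<and> Cod D p0 = Cod D e1 \<and> Cod D p1 = Cod D f1
   \<and> (\<exists>p p' n c. is_pullback D p p' (e0 \<cdot>\<^bsub>D\<^esub> k) f0 \<and> in_hom D n (Dom D p) (Dom D p0)
        \<and> n \<cdot>\<^bsub>D\<^esub> p0 = p \<cdot>\<^bsub>D\<^esub> e1 \<and> n \<cdot>\<^bsub>D\<^esub> p1 = p' \<cdot>\<^bsub>D\<^esub> f1
        \<and> is_pullback D n c u e1 \<and> c \<cdot>\<^bsub>D\<^esub> e0 = p \<cdot>\<^bsub>D\<^esub> e0)"

text \<open>Unit and counit at their generic instances. The first \<open>rel\<close> is the unit:
  k(x) \<in> d(S) for the universal pair x \<in> S. In the second, (\<open>p0\<close>,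
  \<open>p1\<close>) is the universal pair (S, T), and (\<open>l\<close>, \<open>v\<close>) carries
  the universal element of d(S \<inter> k^-1 T), which has to lie in T.\<close>

definition dimg_data :: "('o, 'm) cat \<Rightarrow> 'm \<Rightarrow> 'm \<Rightarrow> 'm \<Rightarrow> 'm \<Rightarrow> 'm \<Rightarrow> 'm \<Rightarrow> bool" where
  "dimg_data D e0 e1 f0 f1 k d \<longleftrightarrow> in_hom D d (Cod D e1) (Cod D f1)
   \<and> rel D f0 f1 (e0 \<cdot>\<^bsub>D\<^esub> k) (e1 \<cdot>\<^bsub>D\<^esub> d)
   \<and> (\<exists>p0 p1 u l v. meet_data D e0 e1 f0 f1 k p0 p1 u
        \<and> is_pullback D l v (u \<cdot>\<^bsub>D\<^esub> d) f1 \<and> rel D f0 f1 (v \<cdot>\<^bsub>D\<^esub> f0) (l \<cdot>\<^bsub>D\<^esub> p1))"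

text \<open>The legs \<open>n\<close> and \<open>c \<cdot> f1\<close> present the relation k(x)
  \<in> T, and the second pullback says that \<open>d\<close> is its transpose.\<close>

definition iimg_data :: "('o, 'm) cat \<Rightarrow> 'm \<Rightarrow> 'm \<Rightarrow> 'm \<Rightarrow> 'm \<Rightarrow> 'm \<Rightarrow> 'm \<Rightarrow> bool" where
  "iimg_data D e0 e1 f0 f1 k d \<longleftrightarrow> in_hom D d (Cod D f1) (Cod D e1)
   \<and> (\<exists>n c c'. is_pullback D n c k f0 \<and> is_pullback D (c \<cdot>\<^bsub>D\<^esub> f1) c' d e1 \<and> c' \<cdot>\<^bsub>D\<^esub> e0 = n)"

section \<open>Images along one arrow as finite-limit data\<close>

locale power_map = lex_category +
  fixes e0 e1 f0 f1 k
  assumes pe: "power_rel D e0 e1" and pf: "power_rel D f0 f1"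
    and k: "in_hom D k (Cod D e0) (Cod D f0)"
begin

lemma lex: "lex_category D" by unfold_locales

lemmas je = power_rel_jm[OF pe] and jf = power_rel_jm[OF pf]

lemmas arrs [simp] = jointly_monic_arr[OF je] jointly_monic_arr[OF jf] in_homD[OF k]

text \<open>The pullback of \<open>k\<close> and \<open>f0\<close> presents the relation k(x) \<in>
  T, with legs \<open>n\<close> to a and \<open>c \<cdot> f1\<close> to P(b).\<close>

lemma preimage_jm:
  assumes pb: "is_pullback D n c k f0"
  shows "jointly_monic D n (c \<cdot> f1)"
  unfolding jointly_monic_def
proof (intro conjI allI impI)
  note [simp] = is_pullbackD(1,2,5,6,7)[OF pb]
  fix V u u' assume a: "in_hom D u V (Dom D n) \<and> in_hom D u' V (Dom D n)
     \<and> u \<cdot> n = u' \<cdot> n \<and> u \<cdot> (c \<cdot> f1) = u' \<cdot> (c \<cdot> f1)"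
  then have [simp]: "u \<in> Arr D" "u' \<in> Arr D" "Dom D u = V" "Dom D u' = V"
    "Cod D u = Dom D n" "Cod D u' = Dom D n"
    by (simp_all add: in_hom_def)
  have *: "u \<cdot> (c \<cdot> f0) = u' \<cdot> (c \<cdot> f0)"
    unfolding is_pullbackD(9)[OF pb, symmetric] by (rule cmp_eq_assoc) (use a in simp_all)
  have "u \<cdot> c = u' \<cdot> c"
    by (rule jointly_monicD[OF jf, of _ V]) (use a * in \<open>simp_all add: in_hom_def\<close>)
  then show "u = u'"
    using jointly_monicD[OF pullback_jointly_monic[OF pb], of u V u'] a by (simp add: in_hom_def)
qed (use is_pullbackD[OF pb] in simp_all)

lemma preimage_rel:
  assumes pb: "is_pullback D n c k f0" and x: "in_hom D x V (Cod D e0)"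
    and T: "in_hom D T V (Cod D f1)"
  shows "rel D n (c \<cdot> f1) x T \<longleftrightarrow> rel D f0 f1 (x \<cdot> k) T"
proof
  note [simp] = is_pullbackD(1,2,5,6,7)[OF pb] in_homD[OF x] in_homD[OF T]
  { assume "rel D n (c \<cdot> f1) x T"
    then obtain w where w: "in_hom D w V (Dom D n)" "w \<cdot> n = x" "w \<cdot> (c \<cdot> f1) = T"
      using x by (blast elim: relE)
    note [simp] = in_homD[OF w(1)]
    show "rel D f0 f1 (x \<cdot> k) T"
      by (rule relI[where e = "w \<cdot> c"])
        (simp_all add: in_hom_def w is_pullbackD(9)[OF pb, symmetric] cmp_eq_assoc1[OF w(2)]) }
  { assume "rel D f0 f1 (x \<cdot> k) T"
    then obtain w where w: "in_hom D w V (Dom D f0)" "w \<cdot> f0 = x \<cdot> k" "w \<cdot> f1 = T"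
      by (auto simp: rel_def)
    note [simp] = in_homD[OF w(1)]
    obtain z where z: "in_hom D z V (Dom D n)" "z \<cdot> n = x" "z \<cdot> c = w"
      by (rule is_pullback_pair[OF pb, of x V w]) (simp_all add: in_hom_def w)
    note [simp] = in_homD[OF z(1)]
    show "rel D n (c \<cdot> f1) x T"
      by (rule relI[where e = z]) (simp_all add: in_hom_def z w cmp_eq_assoc1[OF z(3)]) }
qed

text \<open>By \<open>preimage_rel\<close> any pullback of \<open>k\<close> and \<open>f0\<close>
  presents the same relation, so a condition on all stages becomes one about two pullback squares,
  which a functor can carry over.\<close>

lemma iimg_iff_data: "iimg D e0 e1 f0 f1 k d \<longleftrightarrow> iimg_data D e0 e1 f0 f1 k d"
proof -
  obtain n c where pb: "is_pullback D n c k f0" and [simp]: "n \<in> Arr D" "c \<in> Arr D"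
      "Dom D c = Dom D n" "Cod D n = Cod D e0" "Cod D c = Dom D f0" "n \<cdot> k = c \<cdot> f0"
    by (rule obtain_pullback[of k f0]) simp_all
  \<comment> \<open>Proved for an arbitrary pullback, because the data bring their own.\<close>
  have *: "iimg D e0 e1 f0 f1 k d \<longleftrightarrow> (\<exists>c'. is_pullback D (c \<cdot> f1) c' d e1 \<and> c' \<cdot> e0 = n)"
    if pb: "is_pullback D n c k f0" and d: "in_hom D d (Cod D f1) (Cod D e1)" for n c
  proof -
    note [simp] = is_pullbackD(1,2,5,6,7)[OF pb] in_homD[OF d]
    have "(\<exists>c'. is_pullback D (c \<cdot> f1) c' d e1 \<and> c' \<cdot> e0 = n) \<longleftrightarrow> classifies_rel D e0 e1 n (c \<cdot> f1) d"
      by (rule pullback_iff_rel[OF je preimage_jm[OF pb]]) (simp_all add: in_hom_def)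
    also have "\<dots> \<longleftrightarrow> iimg D e0 e1 f0 f1 k d"
    proof
      assume c: "classifies_rel D e0 e1 n (c \<cdot> f1) d"
      show "iimg D e0 e1 f0 f1 k d"
        unfolding iimg_def
      proof (intro conjI allI impI d)
        fix Z x T assume "in_hom D x Z (Cod D e0) \<and> in_hom D T Z (Cod D f1)"
        then show "rel D e0 e1 x (T \<cdot> d) \<longleftrightarrow> rel D f0 f1 (x \<cdot> k) T"
          using classifies_relD(1)[OF c, of x Z T] preimage_rel[OF pb, of x Z T] by simp
      qed
    next
      assume i: "iimg D e0 e1 f0 f1 k d"
      show "classifies_rel D e0 e1 n (c \<cdot> f1) d"
        unfolding classifies_rel_def
      proof (intro conjI allI impI)
        fix V x t assume "in_hom D x V (Cod D e0) \<and> in_hom D t V (Cod D (c \<cdot> f1))"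
        then show "rel D n (c \<cdot> f1) x t \<longleftrightarrow> rel D e0 e1 x (t \<cdot> d)"
          using iimgD[OF i, of x V t] preimage_rel[OF pb, of x V t] by simp
      qed (simp add: in_hom_def)
    qed
    finally show ?thesis by simp
  qed
  show ?thesis
  proof
    assume i: "iimg D e0 e1 f0 f1 k d"
    then have d: "in_hom D d (Cod D f1) (Cod D e1)" by (simp add: iimg_def)
    show "iimg_data D e0 e1 f0 f1 k d"
      using *[OF pb d] i d pb unfolding iimg_data_def by blast
  next
    assume "iimg_data D e0 e1 f0 f1 k d"
    then obtain n c c' where d: "in_hom D d (Cod D f1) (Cod D e1)" and pb: "is_pullback D n c k f0"
      and "is_pullback D (c \<cdot> f1) c' d e1 \<and> c' \<cdot> e0 = n" unfolding iimg_data_def by blast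
    then show "iimg D e0 e1 f0 f1 k d" using *[OF pb d] by blast
  qed
qed

text \<open>Nothing impredicative happens here: the relation k(x) \<in> T is a pullback and has only
  to be classified.\<close>

lemma obtain_iimg: obtains d where "iimg D e0 e1 f0 f1 k d"
proof -
  obtain n c where pb: "is_pullback D n c k f0" and [simp]: "n \<in> Arr D" "c \<in> Arr D"
      "Dom D c = Dom D n" "Cod D n = Cod D e0" "Cod D c = Dom D f0" "n \<cdot> k = c \<cdot> f0"
    by (rule obtain_pullback[of k f0]) simp_all
  obtain d where d: "classifies_rel D e0 e1 n (c \<cdot> f1) d"
    by (rule obtain_classifier[OF pe preimage_jm[OF pb]]) simp_all
  have dh: "in_hom D d (Cod D f1) (Cod D e1)" using classifies_relD(2)[OF d] by simp
  have "\<exists>c'. is_pullback D (c \<cdot> f1) c' d e1 \<and> c' \<cdot> e0 = n"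
    using pullback_iff_rel[OF je preimage_jm[OF pb], of d] d dh by simp
  then have "iimg_data D e0 e1 f0 f1 k d"
    unfolding iimg_data_def using dh pb by blast
  then show thesis using that iimg_iff_data by blast
qed

text \<open>A point of the pullback of \<open>e0 \<cdot> k\<close> and \<open>f0\<close> is an
  element x of some S together with a witness that k(x) lies in some T. It thus witnesses x \<in> S
  \<inter> k^-1 T, and \<open>n\<close> records the pair (S, T).\<close>

lemma meet_pair:
  assumes p: "is_product D p0 p1" "Cod D p0 = Cod D e1" "Cod D p1 = Cod D f1"
    and pb: "is_pullback D p p' (e0 \<cdot> k) f0" and n: "in_hom D n (Dom D p) (Dom D p0)"
    and n0: "n \<cdot> p0 = p \<cdot> e1" and n1: "n \<cdot> p1 = p' \<cdot> f1"
  shows "jointly_monic D (p \<cdot> e0) n"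
    and "in_hom D x V (Cod D e0) \<Longrightarrow> in_hom D z V (Dom D p0) \<Longrightarrow>
      rel D (p \<cdot> e0) n x z \<longleftrightarrow> rel D e0 e1 x (z \<cdot> p0) \<and> rel D f0 f1 (x \<cdot> k) (z \<cdot> p1)"
proof -
  note [simp] = is_productD[OF p(1)] p(2,3) in_homD[OF n]
  have [simp]: "p \<in> Arr D" "p' \<in> Arr D" "Dom D p' = Dom D p" "Cod D p = Dom D e0" "Cod D p' = Dom D f0"
    using is_pullbackD[OF pb] by simp_all
  have pf0: "p \<cdot> (e0 \<cdot> k) = p' \<cdot> f0" by (rule is_pullbackD(9)[OF pb])
  show "jointly_monic D (p \<cdot> e0) n"
    unfolding jointly_monic_def
  proof (intro conjI allI impI)
    fix V u u' assume a: "in_hom D u V (Dom D (p \<cdot> e0)) \<and> in_hom D u' V (Dom D (p \<cdot> e0))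
       \<and> u \<cdot> (p \<cdot> e0) = u' \<cdot> (p \<cdot> e0) \<and> u \<cdot> n = u' \<cdot> n"
    then have [simp]: "u \<in> Arr D" "u' \<in> Arr D" "Dom D u = V" "Dom D u' = V"
      "Cod D u = Dom D p" "Cod D u' = Dom D p"
      by (simp_all add: in_hom_def)
    have 1: "u \<cdot> (p \<cdot> e1) = u' \<cdot> (p \<cdot> e1)"
      unfolding n0[symmetric] by (rule cmp_eq_assoc) (use a in simp_all)
    have 2: "u \<cdot> (p' \<cdot> f1) = u' \<cdot> (p' \<cdot> f1)"
      unfolding n1[symmetric] by (rule cmp_eq_assoc) (use a in simp_all)
    have 3: "u \<cdot> p = u' \<cdot> p"
      by (rule jointly_monicD[OF je, of _ V]) (use a 1 in \<open>simp_all add: in_hom_def\<close>)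
    have 4: "u \<cdot> (p' \<cdot> f0) = u' \<cdot> (p' \<cdot> f0)"
      unfolding pf0[symmetric] by (rule cmp_eq_assoc[OF 3]) simp_all
    have 5: "u \<cdot> p' = u' \<cdot> p'"
      by (rule jointly_monicD[OF jf, of _ V]) (use 2 4 in \<open>simp_all add: in_hom_def\<close>)
    show "u = u'"
      by (rule jointly_monicD[OF pullback_jointly_monic[OF pb], of u V u'])
        (simp_all add: in_hom_def 3 5)
  qed simp_all
  assume x: "in_hom D x V (Cod D e0)" and z: "in_hom D z V (Dom D p0)"
  note [simp] = in_homD[OF x] in_homD[OF z]
  show "rel D (p \<cdot> e0) n x z \<longleftrightarrow> rel D e0 e1 x (z \<cdot> p0) \<and> rel D f0 f1 (x \<cdot> k) (z \<cdot> p1)"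
  proof (intro iffI conjI)
    assume "rel D (p \<cdot> e0) n x z"
    then obtain w where w: "in_hom D w V (Dom D p)" "w \<cdot> (p \<cdot> e0) = x" "w \<cdot> n = z"
      using x by (auto simp: rel_def)
    note [simp] = in_homD[OF w(1)]
    show "rel D e0 e1 x (z \<cdot> p0)"
      by (rule relI[where e = "w \<cdot> p"])
        (simp_all add: in_hom_def w n0[symmetric] cmp_eq_assoc1[OF w(3)])
    have "w \<cdot> (p \<cdot> (e0 \<cdot> k)) = x \<cdot> k" using cmp_eq_assoc1[OF w(2), of k] by simp
    then show "rel D f0 f1 (x \<cdot> k) (z \<cdot> p1)"
      by (intro relI[where e = "w \<cdot> p'"])
        (simp_all add: in_hom_def w pf0[symmetric] n1[symmetric] cmp_eq_assoc1[OF w(3)])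
  next
    assume "rel D e0 e1 x (z \<cdot> p0) \<and> rel D f0 f1 (x \<cdot> k) (z \<cdot> p1)"
    then obtain a b where a: "in_hom D a V (Dom D e0)" "a \<cdot> e0 = x" "a \<cdot> e1 = z \<cdot> p0"
      and b: "in_hom D b V (Dom D f0)" "b \<cdot> f0 = x \<cdot> k" "b \<cdot> f1 = z \<cdot> p1"
      by (auto simp: rel_def)
    note [simp] = in_homD[OF a(1)] in_homD[OF b(1)]
    obtain w where w: "in_hom D w V (Dom D p)" "w \<cdot> p = a" "w \<cdot> p' = b"
      by (rule is_pullback_pair[OF pb, of a V b])
        (simp_all add: in_hom_def b cmp_eq_assoc1[OF a(2)])
    note [simp] = in_homD[OF w(1)]
    have "w \<cdot> n = z"
      by (rule jointly_monicD[OF product_jointly_monic[OF p(1)], of _ V])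
        (simp_all add: in_hom_def n0 n1 cmp_eq_assoc1[OF w(2)] cmp_eq_assoc1[OF w(3)] a b)
    then show "rel D (p \<cdot> e0) n x z"
      by (intro relI[where e = w]) (simp_all add: in_hom_def cmp_eq_assoc1[OF w(2)] a)
  qed
qed

lemma meet_dataD:
  assumes "meet_data D e0 e1 f0 f1 k p0 p1 u"
  shows "in_hom D u (Dom D p0) (Cod D e1)"
    and "in_hom D x V (Cod D e0) \<Longrightarrow> in_hom D z V (Dom D p0) \<Longrightarrow>
      rel D e0 e1 x (z \<cdot> u) \<longleftrightarrow> rel D e0 e1 x (z \<cdot> p0) \<and> rel D f0 f1 (x \<cdot> k) (z \<cdot> p1)"
proof -
  obtain p p' n c where p: "is_product D p0 p1" "Cod D p0 = Cod D e1" "Cod D p1 = Cod D f1"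
    and pb: "is_pullback D p p' (e0 \<cdot> k) f0" and n: "in_hom D n (Dom D p) (Dom D p0)"
    and n0: "n \<cdot> p0 = p \<cdot> e1" and n1: "n \<cdot> p1 = p' \<cdot> f1"
    and c: "is_pullback D n c u e1" "c \<cdot> e0 = p \<cdot> e0"
    using assms unfolding meet_data_def by blast
  note [simp] = in_homD[OF n]
  have [simp]: "p \<in> Arr D" "Cod D p = Dom D e0"
    using is_pullbackD[OF pb] by simp_all
  show uh: "in_hom D u (Dom D p0) (Cod D e1)"
    using is_pullbackD[OF c(1)] by (simp add: in_hom_def)
  have "classifies_rel D e0 e1 (p \<cdot> e0) n u"
    using pullback_iff_rel[OF je meet_pair(1)[OF p pb n n0 n1], of u] c uh by auto
  then show "in_hom D x V (Cod D e0) \<Longrightarrow> in_hom D z V (Dom D p0) \<Longrightarrow>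
      rel D e0 e1 x (z \<cdot> u) \<longleftrightarrow> rel D e0 e1 x (z \<cdot> p0) \<and> rel D f0 f1 (x \<cdot> k) (z \<cdot> p1)"
    using meet_pair(2)[OF p pb n n0 n1, of x V z] classifies_relD(1)[of D e0 e1 "p \<cdot> e0" n u x V z]
    by simp
qed

lemma obtain_meet_data: obtains p0 p1 u where "meet_data D e0 e1 f0 f1 k p0 p1 u"
proof -
  obtain p0 p1 where p: "is_product D p0 p1" "Cod D p0 = Cod D e1" "Cod D p1 = Cod D f1"
    and [simp]: "p0 \<in> Arr D" "p1 \<in> Arr D" "Dom D p1 = Dom D p0"
    by (rule obtain_product[of "Cod D e1" "Cod D f1"]) simp_all
  obtain q q' where pb: "is_pullback D q q' (e0 \<cdot> k) f0" and q[simp]: "q \<in> Arr D" "q' \<in> Arr D"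
      "Dom D q' = Dom D q" "Cod D q = Dom D (e0 \<cdot> k)" "Cod D q' = Dom D f0"
    by (rule obtain_pullback[of "e0 \<cdot> k" f0]) simp_all
  have [simp]: "Cod D q = Dom D e0" by simp
  obtain n where n: "in_hom D n (Dom D q) (Dom D p0)" "n \<cdot> p0 = q \<cdot> e1" "n \<cdot> p1 = q' \<cdot> f1"
    by (rule is_product_pair[OF p(1), of "q \<cdot> e1" "Dom D q" "q' \<cdot> f1"]) (simp_all add: in_hom_def p)
  note [simp] = in_homD[OF n(1)]
  note jm = meet_pair(1)[OF p pb n]
  obtain u where u: "classifies_rel D e0 e1 (q \<cdot> e0) n u"
    by (rule obtain_classifier[OF pe jm]) simp
  have "\<exists>c. is_pullback D n c u e1 \<and> c \<cdot> e0 = q \<cdot> e0"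
    using pullback_iff_rel[OF je jm, of u] u classifies_relD(2)[OF u] by simp
  then have "meet_data D e0 e1 f0 f1 k p0 p1 u"
    unfolding meet_data_def using p pb n by blast
  then show thesis by (rule that)
qed

text \<open>S is contained in k^-1 T exactly if S = S \<inter> k^-1 T. An inclusion, which
  quantifies over all elements, becomes an equation of two arrows, and such an equation is
  represented by an equalizer.\<close>

lemma incl_iff_meet:
  assumes m: "meet_data D e0 e1 f0 f1 k p0 p1 u" and z: "in_hom D z Z (Dom D p0)"
  shows "incl D e0 e1 f0 f1 k (z \<cdot> p0) (z \<cdot> p1) \<longleftrightarrow> z \<cdot> p0 = z \<cdot> u"
proof -
  have p: "is_product D p0 p1" and pc [simp]: "Cod D p0 = Cod D e1" "Cod D p1 = Cod D f1"
    using m unfolding meet_data_def by blast+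
  note [simp] = is_productD[OF p] in_homD[OF z] in_homD[OF meet_dataD(1)[OF m]]
  have *: "rel D e0 e1 x (t \<cdot> (z \<cdot> u)) \<longleftrightarrow>
      rel D e0 e1 x (t \<cdot> (z \<cdot> p0)) \<and> rel D f0 f1 (x \<cdot> k) (t \<cdot> (z \<cdot> p1))"
    if x: "in_hom D x V (Cod D e0)" and t: "in_hom D t V Z" for V x t
  proof -
    note [simp] = in_homD[OF x] in_homD[OF t]
    show ?thesis using meet_dataD(2)[OF m x, of "t \<cdot> z"] by (simp add: in_hom_def)
  qed
  show ?thesis
  proof
    assume i: "incl D e0 e1 f0 f1 k (z \<cdot> p0) (z \<cdot> p1)"
    show "z \<cdot> p0 = z \<cdot> u"
    proof (rule power_ext[OF lex pe])
      fix V x t assume xt: "in_hom D x V (Cod D e0)" "in_hom D t V Z"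
      show "rel D e0 e1 x (t \<cdot> (z \<cdot> p0)) \<longleftrightarrow> rel D e0 e1 x (t \<cdot> (z \<cdot> u))"
        using *[OF xt] inclD[OF i xt(1), of t] xt(2) by auto
    qed (simp_all add: in_hom_def)
  next
    assume "z \<cdot> p0 = z \<cdot> u"
    then show "incl D e0 e1 f0 f1 k (z \<cdot> p0) (z \<cdot> p1)"
      using * by (intro inclI) (simp, blast)
  qed
qed

text \<open>As for any adjunction of ordered sets, unit and counit suffice; being natural in the
  stage, they suffice at their generic instances, of which all others are restrictions.\<close>

lemma dimg_iff_data: "dimg D e0 e1 f0 f1 k d \<longleftrightarrow> dimg_data D e0 e1 f0 f1 k d"
proof
  assume d: "dimg D e0 e1 f0 f1 k d"
  then have dh: "in_hom D d (Cod D e1) (Cod D f1)" by (simp add: dimg_def)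
  note [simp] = in_homD[OF dh]
  obtain p0 p1 u where m: "meet_data D e0 e1 f0 f1 k p0 p1 u" by (rule obtain_meet_data)
  have p: "is_product D p0 p1" and pc [simp]: "Cod D p0 = Cod D e1" "Cod D p1 = Cod D f1"
    using m unfolding meet_data_def by blast+
  note [simp] = is_productD[OF p] in_homD[OF meet_dataD(1)[OF m]]
  \<comment> \<open>The unit, as transpose of the trivial inclusion of \<open>d\<close> in itself;
    it is then evaluated at the universal pair (\<open>e0\<close>, \<open>e1\<close>).\<close>
  have "incl D e0 e1 f0 f1 k (ide D (Cod D e1)) d"
    using dimgD[OF d, of "ide D (Cod D e1)" "Cod D e1" d] incl_refl[of f0 f1 d]
    by (simp add: in_hom_def)
  moreover have "rel D e0 e1 e0 e1"
    by (rule relI[where e = "ide D (Dom D e0)"]) (simp_all add: in_hom_def)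
  ultimately have 1: "rel D f0 f1 (e0 \<cdot> k) (e1 \<cdot> d)"
    using inclD[of D e0 e1 f0 f1 k "ide D (Cod D e1)" d e0 "Dom D e0" e1]
    by (simp add: in_hom_def)
  obtain l v where lv: "is_pullback D l v (u \<cdot> d) f1" and l: "l \<in> Arr D" "v \<in> Arr D" "Dom D v = Dom D l"
    "Cod D l = Dom D (u \<cdot> d)" "Cod D v = Dom D f1" and eq: "l \<cdot> (u \<cdot> d) = v \<cdot> f1"
    by (rule obtain_pullback[of "u \<cdot> d" f1]) simp_all
  have [simp]: "l \<in> Arr D" "v \<in> Arr D" "Dom D v = Dom D l" "Cod D l = Dom D p0" "Cod D v = Dom D f0"
    using l by simp_all
  \<comment> \<open>S \<inter> k^-1 T is contained in k^-1 T; the transpose of this inclusion is the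
    counit.\<close>
  have "incl D e0 e1 f0 f1 k u p1"
    using meet_dataD(2)[OF m] by (intro inclI) simp
  then have i: "incl D f0 f1 f0 f1 (ide D (Cod D f0)) (u \<cdot> d) p1"
    using dimgD[OF d, of u "Dom D p0" p1] by (simp add: in_hom_def)
  have "rel D f0 f1 (v \<cdot> f0) (v \<cdot> f1)" by (rule relI[where e = v]) (simp_all add: in_hom_def)
  then have 2: "rel D f0 f1 (v \<cdot> f0) (l \<cdot> p1)"
    using inclD[OF i, of "v \<cdot> f0" "Dom D l" l] by (simp add: in_hom_def eq)
  show "dimg_data D e0 e1 f0 f1 k d"
    unfolding dimg_data_def using dh 1 m lv 2 by blast
next
  assume "dimg_data D e0 e1 f0 f1 k d"
  then obtain p0 p1 u l v where dh: "in_hom D d (Cod D e1) (Cod D f1)"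
    and 1: "rel D f0 f1 (e0 \<cdot> k) (e1 \<cdot> d)" and m: "meet_data D e0 e1 f0 f1 k p0 p1 u"
    and lv: "is_pullback D l v (u \<cdot> d) f1" and 2: "rel D f0 f1 (v \<cdot> f0) (l \<cdot> p1)"
    unfolding dimg_data_def by blast
  note [simp] = in_homD[OF dh]
  have p: "is_product D p0 p1" and pc [simp]: "Cod D p0 = Cod D e1" "Cod D p1 = Cod D f1"
    using m unfolding meet_data_def by blast+
  note [simp] = is_productD[OF p] in_homD[OF meet_dataD(1)[OF m]]
  have [simp]: "l \<in> Arr D" "v \<in> Arr D" "Dom D v = Dom D l" "Cod D l = Dom D p0" "Cod D v = Dom D f0"
    using is_pullbackD[OF lv] by simp_all
  show "dimg D e0 e1 f0 f1 k d"
    unfolding dimg_def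
  proof (intro conjI allI impI dh iffI)
    fix Z S T assume "in_hom D S Z (Cod D e1) \<and> in_hom D T Z (Cod D f1)"
    then have S: "in_hom D S Z (Cod D e1)" and T: "in_hom D T Z (Cod D f1)" by simp_all
    note [simp] = in_homD[OF S] in_homD[OF T]
    { assume i: "incl D e0 e1 f0 f1 k S T"
      \<comment> \<open>The pair (S, T) as a point of P(a) x P(b). Since S is contained in k^-1 T, z
        u = S; hence an element of d(S) is one of d(u(z)) and is a restriction of the universal
        element carried by (\<open>l\<close>, \<open>v\<close>).\<close>
      obtain z where z: "in_hom D z Z (Dom D p0)" "z \<cdot> p0 = S" "z \<cdot> p1 = T"
        by (rule is_product_pair[OF p, of S Z T]) (simp_all add: S T)
      note [simp] = in_homD[OF z(1)]
      have zu: "z \<cdot> u = S" using incl_iff_meet[OF m z(1)] i by (simp add: z(2,3))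
      show "incl D f0 f1 f0 f1 (ide D (Cod D f0)) (S \<cdot> d) T"
      proof (rule inclI)
        fix V y t assume y: "in_hom D y V (Cod D f0)" and t: "in_hom D t V (Dom D (S \<cdot> d))"
          and r: "rel D f0 f1 y (t \<cdot> (S \<cdot> d))"
        have [simp]: "y \<in> Arr D" "Dom D y = V" "Cod D y = Cod D f0" "t \<in> Arr D" "Dom D t = V" "Cod D t = Z"
          using y t by (simp_all add: in_hom_def)
        obtain b where b: "in_hom D b V (Dom D f0)" "b \<cdot> f0 = y" "b \<cdot> f1 = t \<cdot> (S \<cdot> d)"
          using r by (auto simp: rel_def)
        note [simp] = in_homD[OF b(1)]
        obtain w where w: "in_hom D w V (Dom D l)" "w \<cdot> l = t \<cdot> z" "w \<cdot> v = b"
          by (rule is_pullback_pair[OF lv, of "t \<cdot> z" V b])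
            (simp_all add: in_hom_def b(3) cmp_eq_assoc1[OF zu])
        note [simp] = in_homD[OF w(1)]
        have "rel D f0 f1 (w \<cdot> (v \<cdot> f0)) (w \<cdot> (l \<cdot> p1))"
          by (rule rel_nat[OF 2]) (simp_all add: in_hom_def)
        then show "rel D f0 f1 (y \<cdot> ide D (Cod D f0)) (t \<cdot> T)"
          by (simp add: cmp_eq_assoc1[OF w(3)] cmp_eq_assoc1[OF w(2)] b z)
      qed }
    { assume i: "incl D f0 f1 f0 f1 (ide D (Cod D f0)) (S \<cdot> d) T"
      show "incl D e0 e1 f0 f1 k S T"
      proof (rule inclI)
        fix V x t assume x: "in_hom D x V (Cod D e0)" and t: "in_hom D t V (Dom D S)"
          and r: "rel D e0 e1 x (t \<cdot> S)"
        have [simp]: "x \<in> Arr D" "Dom D x = V" "Cod D x = Cod D e0" "t \<in> Arr D" "Dom D t = V" "Cod D t = Z"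
          using x t by (simp_all add: in_hom_def)
        obtain w where w: "in_hom D w V (Dom D e0)" "w \<cdot> e0 = x" "w \<cdot> e1 = t \<cdot> S"
          using r by (auto simp: rel_def)
        note [simp] = in_homD[OF w(1)]
        \<comment> \<open>The unit, restricted along the witness \<open>w\<close> of x \<in>
          S.\<close>
        have "rel D f0 f1 (w \<cdot> (e0 \<cdot> k)) (w \<cdot> (e1 \<cdot> d))"
          by (rule rel_nat[OF 1]) (simp_all add: in_hom_def)
        then have "rel D f0 f1 (x \<cdot> k) (t \<cdot> (S \<cdot> d))"
          by (simp add: cmp_eq_assoc1[OF w(2)] cmp_eq_assoc1[OF w(3)])
        then show "rel D f0 f1 (x \<cdot> k) (t \<cdot> T)"
          using inclD[OF i, of "x \<cdot> k" V t] by (simp add: in_hom_def)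
      qed }
  qed
qed

end

context category
begin

text \<open>Lets a set of pairs (S, T) be read as a relation from P(b) to P(a), which is the form
  that a power object of P(b) classifies.\<close>

lemma jointly_monic_sym:
  assumes "jointly_monic D n0 n1" shows "jointly_monic D n1 n0"
  unfolding jointly_monic_def
proof (intro conjI allI impI)
  note [simp] = jointly_monic_arr[OF assms]
  fix V e e' assume "in_hom D e V (Dom D n1) \<and> in_hom D e' V (Dom D n1)
     \<and> e \<cdot> n1 = e' \<cdot> n1 \<and> e \<cdot> n0 = e' \<cdot> n0"
  then show "e = e'" by (intro jointly_monicD[OF assms, of e V e']) simp_all
qed (simp_all add: jointly_monic_arr[OF assms])

lemma rel_mono_iff:
  assumes s: "is_product D s0 s1" and n: "is_mono D n" "Cod D n = Dom D s0"
    and z: "in_hom D z V (Dom D s0)"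
  shows "rel D (n \<cdot> s0) (n \<cdot> s1) (z \<cdot> s0) (z \<cdot> s1) \<longleftrightarrow> (\<exists>h. in_hom D h V (Dom D n) \<and> h \<cdot> n = z)"
proof -
  have [simp]: "n \<in> Arr D" using n by (simp add: is_mono_def)
  note [simp] = is_productD[OF s] n(2) in_homD[OF z]
  show ?thesis
  proof
    assume "rel D (n \<cdot> s0) (n \<cdot> s1) (z \<cdot> s0) (z \<cdot> s1)"
    then obtain h where h: "in_hom D h V (Dom D n)" "h \<cdot> (n \<cdot> s0) = z \<cdot> s0" "h \<cdot> (n \<cdot> s1) = z \<cdot> s1"
      by (auto simp: rel_def)
    note [simp] = in_homD[OF h(1)]
    have "h \<cdot> n = z"
      by (rule jointly_monicD[OF product_jointly_monic[OF s], of _ V]) (simp_all add: in_hom_def h)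
    then show "\<exists>h. in_hom D h V (Dom D n) \<and> h \<cdot> n = z" using h by blast
  next
    assume "\<exists>h. in_hom D h V (Dom D n) \<and> h \<cdot> n = z"
    then obtain h where h: "in_hom D h V (Dom D n)" "h \<cdot> n = z" by blast
    note [simp] = in_homD[OF h(1)]
    show "rel D (n \<cdot> s0) (n \<cdot> s1) (z \<cdot> s0) (z \<cdot> s1)"
      by (rule relI[where e = h]) (simp_all add: in_hom_def cmp_eq_assoc1[OF h(2)])
  qed
qed

lemma pullback_mono:
  assumes pb: "is_pullback D n t w m" and m: "is_mono D m"
  shows "is_mono D n"
  unfolding is_mono_def
proof (intro conjI ballI impI)
  note p = is_pullbackD[OF pb]
  show "n \<in> Arr D" by (rule p)
  fix x y assume xy: "x \<in> Arr D" "y \<in> Arr D"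
    "Dom D x = Dom D y \<and> Cod D x = Dom D n \<and> Cod D y = Dom D n \<and> x \<cdot> n = y \<cdot> n"
  have "x \<cdot> (n \<cdot> w) = y \<cdot> (n \<cdot> w)" by (rule cmp_eq_assoc) (use xy p in simp_all)
  then have *: "(x \<cdot> t) \<cdot> m = (y \<cdot> t) \<cdot> m" using xy p by simp
  have "x \<cdot> t = y \<cdot> t"
    by (rule is_monoD[OF m _ _ *, of "Dom D x"]) (use xy p in \<open>simp_all add: in_hom_def\<close>)
  then show "x = y"
    using jointly_monicD[OF pullback_jointly_monic[OF pb], of x "Dom D x" y] xy
    by (simp add: in_hom_def)
qed

lemma rel_pullback_mono:
  assumes s: "is_product D s0 s1" and q: "is_product D q0 q1" and m: "is_mono D m" "Cod D m = Dom D q0"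
    and pb: "is_pullback D n t w m" and w: "in_hom D w (Dom D s0) (Dom D q0)"
    and z: "in_hom D z V (Dom D s0)"
  shows "rel D (n \<cdot> s0) (n \<cdot> s1) (z \<cdot> s0) (z \<cdot> s1) \<longleftrightarrow>
    rel D (m \<cdot> q0) (m \<cdot> q1) (z \<cdot> (w \<cdot> q0)) (z \<cdot> (w \<cdot> q1))"
proof -
  note [simp] = is_productD[OF s] is_productD[OF q] m(2) in_homD[OF w] in_homD[OF z]
  note [simp] = is_pullbackD(1,2,4-7)[OF pb]
  have zw: "in_hom D (z \<cdot> w) V (Dom D q0)" by (simp add: in_hom_def)
  have "rel D (n \<cdot> s0) (n \<cdot> s1) (z \<cdot> s0) (z \<cdot> s1) \<longleftrightarrow> (\<exists>h. in_hom D h V (Dom D n) \<and> h \<cdot> n = z)"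
    by (rule rel_mono_iff[OF s pullback_mono[OF pb m(1)] _ z]) simp
  also have "\<dots> \<longleftrightarrow> (\<exists>h. in_hom D h V (Dom D m) \<and> h \<cdot> m = z \<cdot> w)"
  proof
    assume "\<exists>h. in_hom D h V (Dom D n) \<and> h \<cdot> n = z"
    then obtain h where h: "in_hom D h V (Dom D n)" "h \<cdot> n = z" by blast
    note [simp] = in_homD[OF h(1)]
    have "(h \<cdot> t) \<cdot> m = z \<cdot> w"
      by (simp add: is_pullbackD(9)[OF pb, symmetric] cmp_eq_assoc1[OF h(2)])
    then show "\<exists>h. in_hom D h V (Dom D m) \<and> h \<cdot> m = z \<cdot> w"
      by (intro exI[of _ "h \<cdot> t"]) (simp add: in_hom_def)
  next
    assume "\<exists>h. in_hom D h V (Dom D m) \<and> h \<cdot> m = z \<cdot> w"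
    then obtain h where h: "in_hom D h V (Dom D m)" "z \<cdot> w = h \<cdot> m" by auto
    obtain k where "in_hom D k V (Dom D n)" "k \<cdot> n = z"
      by (rule is_pullback_pair[OF pb _ h(1,2)]) (simp add: in_hom_def)
    then show "\<exists>h. in_hom D h V (Dom D n) \<and> h \<cdot> n = z" by blast
  qed
  also have "\<dots> \<longleftrightarrow> rel D (m \<cdot> q0) (m \<cdot> q1) ((z \<cdot> w) \<cdot> q0) ((z \<cdot> w) \<cdot> q1)"
    by (rule rel_mono_iff[OF q m zw, symmetric])
  finally show ?thesis by simp
qed

end

section \<open>Impredicative construction of direct images\<close>

context power_map
begin

text \<open>An inclusion at the stage \<open>Z\<close> speaks of all elements at all stages over
  \<open>Z\<close>, so it restricts along \<open>t\<close>.\<close>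

lemma incl_nat:
  assumes i: "incl D e0 e1 f0 f1 k S T" and S: "in_hom D S Z (Cod D e1)"
    and T: "in_hom D T Z (Cod D f1)" and t: "in_hom D t V Z"
  shows "incl D e0 e1 f0 f1 k (t \<cdot> S) (t \<cdot> T)"
proof (rule inclI)
  note [simp] = in_homD[OF S] in_homD[OF T] in_homD[OF t]
  fix W x s assume x: "in_hom D x W (Cod D e0)" and s: "in_hom D s W (Dom D (t \<cdot> S))"
    and r: "rel D e0 e1 x (s \<cdot> (t \<cdot> S))"
  have [simp]: "s \<in> Arr D" "Dom D s = W" "Cod D s = V" using in_homD[OF s] by simp_all
  show "rel D f0 f1 (x \<cdot> k) (s \<cdot> (t \<cdot> T))"
    using inclD[OF i x, of "s \<cdot> t"] r by (simp add: in_hom_def)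
qed

text \<open>The image of \<open>S\<close> is formed as the intersection of all \<open>T\<close> with \<open>S \<subseteq> k\<^sup>-\<^sup>1 T\<close>.\<close>

lemma obtain_dimg_mem:
  assumes pg: "power_rel D g0 g1" and g0: "Cod D g0 = Cod D f1"
  obtains d where "in_hom D d (Cod D e1) (Cod D f1)"
    "\<And>V y S. in_hom D y V (Cod D f0) \<Longrightarrow> in_hom D S V (Cod D e1) \<Longrightarrow>
      rel D f0 f1 y (S \<cdot> d) \<longleftrightarrow> (\<forall>W t T. in_hom D t W V \<longrightarrow> in_hom D T W (Cod D f1) \<longrightarrow>
         incl D e0 e1 f0 f1 k (t \<cdot> S) T \<longrightarrow> rel D f0 f1 (t \<cdot> y) T)"
proof -
  note [simp] = jointly_monic_arr[OF power_rel_jm[OF pg]] g0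
  obtain p0 p1 u where m: "meet_data D e0 e1 f0 f1 k p0 p1 u" by (rule obtain_meet_data)
  have p: "is_product D p0 p1" and pc [simp]: "Cod D p0 = Cod D e1" "Cod D p1 = Cod D f1"
    using m unfolding meet_data_def by blast+
  note uh = meet_dataD(1)[OF m]
  note [simp] = is_productD[OF p] in_homD[OF uh]
  \<comment> \<open>The subobject of P(a) x P(b) of the pairs (S, T) with S contained in k^-1 T, by
    \<open>incl_iff_meet\<close>.\<close>
  obtain l where lm: "is_mono D l" and lc[simp]: "Cod D l = Dom D p0"
    and l: "\<And>V z. in_hom D z V (Dom D p0) \<Longrightarrow> (\<exists>h. in_hom D h V (Dom D l) \<and> h \<cdot> l = z) \<longleftrightarrow> z \<cdot> p0 = z \<cdot> u"
    by (rule obtain_equalizer[of p0 "Dom D p0" "Cod D e1" u]) (simp_all add: in_hom_def)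
  have [simp]: "l \<in> Arr D" using lm by (simp add: is_mono_def)
  note jl = mono_jointly_monic[OF p lm lc]
  have rl: "rel D (l \<cdot> p0) (l \<cdot> p1) S T \<longleftrightarrow> incl D e0 e1 f0 f1 k S T"
    if S: "in_hom D S V (Cod D e1)" and T: "in_hom D T V (Cod D f1)" for V S T
  proof -
    obtain z where z: "in_hom D z V (Dom D p0)" "z \<cdot> p0 = S" "z \<cdot> p1 = T"
      by (rule is_product_pair[OF p, of S V T]) (simp_all add: S T)
    show ?thesis
      using rel_mono_iff[OF p lm lc z(1)] l[OF z(1)] incl_iff_meet[OF m z(1)] by (simp add: z(2,3))
  qed
  have rl': "rel D (l \<cdot> p1) (l \<cdot> p0) T S \<longleftrightarrow> incl D e0 e1 f0 f1 k S T"
    if S: "in_hom D S V (Cod D e1)" and T: "in_hom D T V (Cod D f1)" for V S T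
  proof -
    have "rel D (l \<cdot> p1) (l \<cdot> p0) T S \<longleftrightarrow> rel D (l \<cdot> p0) (l \<cdot> p1) S T"
      unfolding rel_def using in_homD[OF S] in_homD[OF T] by auto
    then show ?thesis using rl[OF S T] by simp
  qed
  \<comment> \<open>\<open>c1\<close> : P(a) \<rightarrow> P(P(b)) sends S to the set of all T with
    S contained in k^-1 T.\<close>
  obtain c1 where c1: "classifies_rel D g0 g1 (l \<cdot> p1) (l \<cdot> p0) c1"
    by (rule obtain_classifier[OF pg jointly_monic_sym[OF jl]]) simp
  have [simp]: "c1 \<in> Arr D" "Dom D c1 = Cod D e1" "Cod D c1 = Cod D g1"
    using in_homD[OF classifies_relD(2)[OF c1]] by simp_all
  obtain r0 r1 where r: "is_product D r0 r1" and [simp]: "Cod D r0 = Cod D f0" "Cod D r1 = Cod D e1"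
      "r0 \<in> Arr D" "r1 \<in> Arr D" "Dom D r1 = Dom D r0"
    by (rule obtain_product[of "Cod D f0" "Cod D e1"]) simp_all
  \<comment> \<open>Triples (S, T, y) with S contained in k^-1 T and y \<in> T; the arrow
    \<open>n1\<close> below keeps (y, S).\<close>
  obtain a b where ab: "is_pullback D a b (l \<cdot> p1) f1" and abs: "a \<in> Arr D" "b \<in> Arr D"
      "Dom D b = Dom D a" "Cod D a = Dom D (l \<cdot> p1)" "Cod D b = Dom D f1" "a \<cdot> (l \<cdot> p1) = b \<cdot> f1"
    by (rule obtain_pullback[of "l \<cdot> p1" f1]) simp_all
  have [simp]: "a \<in> Arr D" "b \<in> Arr D" "Dom D b = Dom D a" "Cod D a = Dom D l" "Cod D b = Dom D f0"
    using abs by simp_all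
  obtain n1 where n1: "in_hom D n1 (Dom D a) (Dom D r0)" "n1 \<cdot> r0 = b \<cdot> f0" "n1 \<cdot> r1 = a \<cdot> (l \<cdot> p0)"
    by (rule is_product_pair[OF r, of "b \<cdot> f0" "Dom D a" "a \<cdot> (l \<cdot> p0)"]) (simp_all add: in_hom_def)
  note [simp] = in_homD[OF n1(1)]
  have jn: "jointly_monic D (b \<cdot> f1) n1"
    unfolding jointly_monic_def
  proof (intro conjI allI impI)
    fix V v v' assume as: "in_hom D v V (Dom D (b \<cdot> f1)) \<and> in_hom D v' V (Dom D (b \<cdot> f1))
       \<and> v \<cdot> (b \<cdot> f1) = v' \<cdot> (b \<cdot> f1) \<and> v \<cdot> n1 = v' \<cdot> n1"
    then have [simp]: "v \<in> Arr D" "v' \<in> Arr D" "Dom D v = V" "Dom D v' = V"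
      "Cod D v = Dom D a" "Cod D v' = Dom D a"
      by (simp_all add: in_hom_def)
    have 1: "v \<cdot> (a \<cdot> (l \<cdot> p0)) = v' \<cdot> (a \<cdot> (l \<cdot> p0))"
      unfolding n1(3)[symmetric] by (rule cmp_eq_assoc) (use as in simp_all)
    have 2: "v \<cdot> (b \<cdot> f0) = v' \<cdot> (b \<cdot> f0)"
      unfolding n1(2)[symmetric] by (rule cmp_eq_assoc) (use as in simp_all)
    have 3: "v \<cdot> (a \<cdot> (l \<cdot> p1)) = v' \<cdot> (a \<cdot> (l \<cdot> p1))" using as abs(6) by simp
    have 4: "v \<cdot> a = v' \<cdot> a"
      by (rule jointly_monicD[OF jl, of _ V]) (use 1 3 in \<open>simp_all add: in_hom_def\<close>)
    have 5: "v \<cdot> b = v' \<cdot> b"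
      by (rule jointly_monicD[OF jf, of _ V]) (use 2 as in \<open>simp_all add: in_hom_def\<close>)
    show "v = v'"
      by (rule jointly_monicD[OF pullback_jointly_monic[OF ab], of v V v'])
        (simp_all add: in_hom_def 4 5)
  qed simp_all
  have rn: "rel D (b \<cdot> f1) n1 T z \<longleftrightarrow> incl D e0 e1 f0 f1 k (z \<cdot> r1) T \<and> rel D f0 f1 (z \<cdot> r0) T"
    if z: "in_hom D z V (Dom D r0)" and T: "in_hom D T V (Cod D f1)" for V z T
  proof -
    note [simp] = in_homD[OF z] in_homD[OF T]
    have zr: "in_hom D (z \<cdot> r1) V (Cod D e1)" by (simp add: in_hom_def)
    show ?thesis
      unfolding rl[OF zr T, symmetric]
    proof (intro iffI conjI)
      assume "rel D (b \<cdot> f1) n1 T z"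
      then obtain w where w: "in_hom D w V (Dom D a)" "w \<cdot> (b \<cdot> f1) = T" "w \<cdot> n1 = z"
        by (auto simp: rel_def)
      note [simp] = in_homD[OF w(1)]
      show "rel D (l \<cdot> p0) (l \<cdot> p1) (z \<cdot> r1) T"
        by (rule relI[where e = "w \<cdot> a"])
          (simp_all add: in_hom_def abs(6) w(2) n1(3)[symmetric] cmp_eq_assoc1[OF w(3)])
      show "rel D f0 f1 (z \<cdot> r0) T"
        by (rule relI[where e = "w \<cdot> b"])
          (simp_all add: in_hom_def w(2) n1(2)[symmetric] cmp_eq_assoc1[OF w(3)])
    next
      assume "rel D (l \<cdot> p0) (l \<cdot> p1) (z \<cdot> r1) T \<and> rel D f0 f1 (z \<cdot> r0) T"
      then obtain v w where v: "in_hom D v V (Dom D l)" "v \<cdot> (l \<cdot> p0) = z \<cdot> r1" "v \<cdot> (l \<cdot> p1) = T"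
        and w: "in_hom D w V (Dom D f0)" "w \<cdot> f0 = z \<cdot> r0" "w \<cdot> f1 = T"
        by (auto simp: rel_def)
      note [simp] = in_homD[OF v(1)] in_homD[OF w(1)]
      obtain x where x: "in_hom D x V (Dom D a)" "x \<cdot> a = v" "x \<cdot> b = w"
        by (rule is_pullback_pair[OF ab, of v V w]) (simp_all add: in_hom_def v w)
      note [simp] = in_homD[OF x(1)]
      have "x \<cdot> n1 = z"
        by (rule jointly_monicD[OF product_jointly_monic[OF r], of _ V])
          (simp_all add: in_hom_def n1 cmp_eq_assoc1[OF x(2)] cmp_eq_assoc1[OF x(3)] v w)
      then show "rel D (b \<cdot> f1) n1 T z"
        by (intro relI[where e = x]) (simp_all add: in_hom_def cmp_eq_assoc1[OF x(3)] w)
    qed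
  qed
  \<comment> \<open>\<open>c2\<close> goes from the product of b and P(a) to P(P(b)) and sends (y,
    S) to the set of those T in c1(S) that contain y.\<close>
  obtain c2 where c2: "classifies_rel D g0 g1 (b \<cdot> f1) n1 c2"
    by (rule obtain_classifier[OF pg jn]) simp
  have [simp]: "c2 \<in> Arr D" "Dom D c2 = Dom D r0" "Cod D c2 = Cod D g1"
    using in_homD[OF classifies_relD(2)[OF c2]] by simp_all
  \<comment> \<open>That y lies in every T of c1(S) is the equation c1(S) = c2(y, S); in this way
    the universal quantifier is an equalizer. Its transpose is the image.\<close>
  obtain n where nm: "is_mono D n" and nc[simp]: "Cod D n = Dom D r0"
    and n: "\<And>V z. in_hom D z V (Dom D r0) \<Longrightarrow> (\<exists>h. in_hom D h V (Dom D n) \<and> h \<cdot> n = z)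
       \<longleftrightarrow> z \<cdot> (r1 \<cdot> c1) = z \<cdot> c2"
    by (rule obtain_equalizer[of "r1 \<cdot> c1" "Dom D r0" "Cod D g1" c2]) (simp_all add: in_hom_def)
  have [simp]: "n \<in> Arr D" using nm by (simp add: is_mono_def)
  obtain d where d: "classifies_rel D f0 f1 (n \<cdot> r0) (n \<cdot> r1) d"
    by (rule obtain_classifier[OF pf mono_jointly_monic[OF r nm nc]]) simp
  show thesis
  proof (rule that)
    show "in_hom D d (Cod D e1) (Cod D f1)" using classifies_relD(2)[OF d] by simp
    fix V y S assume y: "in_hom D y V (Cod D f0)" and S: "in_hom D S V (Cod D e1)"
    note [simp] = in_homD[OF y] in_homD[OF S]
    obtain z where z: "in_hom D z V (Dom D r0)" "z \<cdot> r0 = y" "z \<cdot> r1 = S"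
      by (rule is_product_pair[OF r, of y V S]) (simp_all add: y S)
    note [simp] = in_homD[OF z(1)]
    have "rel D f0 f1 y (S \<cdot> d) \<longleftrightarrow> rel D (n \<cdot> r0) (n \<cdot> r1) y S"
      using classifies_relD(1)[OF d y, of S] S by simp
    also have "\<dots> \<longleftrightarrow> z \<cdot> (r1 \<cdot> c1) = z \<cdot> c2"
      using rel_mono_iff[OF r nm nc z(1)] n[OF z(1)] by (simp add: z(2,3))
    \<comment> \<open>The equation between maps into P(P(b)) is read elementwise by extensionality;
      its elements are the subobjects T at all later stages.\<close>
    also have "\<dots> \<longleftrightarrow> (\<forall>W t T. in_hom D t W V \<longrightarrow> in_hom D T W (Cod D f1) \<longrightarrow>
         (rel D g0 g1 T (t \<cdot> (z \<cdot> (r1 \<cdot> c1))) \<longleftrightarrow> rel D g0 g1 T (t \<cdot> (z \<cdot> c2))))" (is "_ \<longleftrightarrow> ?R")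
    proof
      assume ?R
      show "z \<cdot> (r1 \<cdot> c1) = z \<cdot> c2"
        by (rule power_ext[OF lex pg, of _ V]) (use \<open>?R\<close> in \<open>auto simp: in_hom_def\<close>)
    qed simp
    also have "\<dots> \<longleftrightarrow> (\<forall>W t T. in_hom D t W V \<longrightarrow> in_hom D T W (Cod D f1) \<longrightarrow>
         incl D e0 e1 f0 f1 k (t \<cdot> S) T \<longrightarrow> rel D f0 f1 (t \<cdot> y) T)"
    proof -
      have "(rel D g0 g1 T (t \<cdot> (z \<cdot> (r1 \<cdot> c1))) \<longleftrightarrow> rel D g0 g1 T (t \<cdot> (z \<cdot> c2))) \<longleftrightarrow>
         (incl D e0 e1 f0 f1 k (t \<cdot> S) T \<longrightarrow> rel D f0 f1 (t \<cdot> y) T)"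
        if t: "in_hom D t W V" and T: "in_hom D T W (Cod D f1)" for W t T
      proof -
        note [simp] = in_homD[OF t] in_homD[OF T]
        have "rel D g0 g1 T ((t \<cdot> S) \<cdot> c1) \<longleftrightarrow> rel D (l \<cdot> p1) (l \<cdot> p0) T (t \<cdot> S)"
          by (rule classifies_relD(1)[OF c1, of T W "t \<cdot> S", symmetric]) (simp_all add: in_hom_def)
        also have "\<dots> \<longleftrightarrow> incl D e0 e1 f0 f1 k (t \<cdot> S) T"
          by (rule rl'[of _ W]) (simp_all add: in_hom_def)
        finally have 1: "rel D g0 g1 T (t \<cdot> (z \<cdot> (r1 \<cdot> c1))) \<longleftrightarrow> incl D e0 e1 f0 f1 k (t \<cdot> S) T"
          by (simp add: cmp_eq_assoc1[OF z(3)])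
        have "rel D g0 g1 T ((t \<cdot> z) \<cdot> c2) \<longleftrightarrow> rel D (b \<cdot> f1) n1 T (t \<cdot> z)"
          by (rule classifies_relD(1)[OF c2, of T W "t \<cdot> z", symmetric]) (simp_all add: in_hom_def)
        also have "\<dots> \<longleftrightarrow> incl D e0 e1 f0 f1 k (t \<cdot> S) T \<and> rel D f0 f1 (t \<cdot> y) T"
          using rn[of "t \<cdot> z" W T] T by (simp add: in_hom_def z)
        finally have 2: "rel D g0 g1 T (t \<cdot> (z \<cdot> c2)) \<longleftrightarrow>
          incl D e0 e1 f0 f1 k (t \<cdot> S) T \<and> rel D f0 f1 (t \<cdot> y) T" by simp
        show ?thesis using 1 2 by blast
      qed
      then show ?thesis by meson
    qed
    finally show "rel D f0 f1 y (S \<cdot> d) \<longleftrightarrow> (\<forall>W t T. in_hom D t W V \<longrightarrow> in_hom D T W (Cod D f1) \<longrightarrow>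
         incl D e0 e1 f0 f1 k (t \<cdot> S) T \<longrightarrow> rel D f0 f1 (t \<cdot> y) T)" .
  qed
qed

text \<open>An intersection is contained in each of its members, which gives one half of the
  adjunction; and if x \<in> S then k(x) lies in all members, which gives the other.\<close>

lemma obtain_dimg:
  assumes pg: "power_rel D g0 g1" and g0: "Cod D g0 = Cod D f1"
  obtains d where "dimg D e0 e1 f0 f1 k d"
proof -
  obtain d where d: "in_hom D d (Cod D e1) (Cod D f1)"
    and mem: "\<And>V y S. in_hom D y V (Cod D f0) \<Longrightarrow> in_hom D S V (Cod D e1) \<Longrightarrow>
      rel D f0 f1 y (S \<cdot> d) \<longleftrightarrow> (\<forall>W t T. in_hom D t W V \<longrightarrow> in_hom D T W (Cod D f1) \<longrightarrow>
         incl D e0 e1 f0 f1 k (t \<cdot> S) T \<longrightarrow> rel D f0 f1 (t \<cdot> y) T)"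
    by (rule obtain_dimg_mem[OF assms]) blast
  note [simp] = in_homD[OF d]
  have "dimg D e0 e1 f0 f1 k d"
    unfolding dimg_def
  proof (intro conjI allI impI d iffI)
    fix Z S T assume "in_hom D S Z (Cod D e1) \<and> in_hom D T Z (Cod D f1)"
    then have S: "in_hom D S Z (Cod D e1)" and T: "in_hom D T Z (Cod D f1)" by simp_all
    note [simp] = in_homD[OF S] in_homD[OF T]
    { assume i: "incl D e0 e1 f0 f1 k S T"
      show "incl D f0 f1 f0 f1 (ide D (Cod D f0)) (S \<cdot> d) T"
      proof (rule inclI)
        fix V y t assume y: "in_hom D y V (Cod D f0)" and t: "in_hom D t V (Dom D (S \<cdot> d))"
          and r: "rel D f0 f1 y (t \<cdot> (S \<cdot> d))"
        have t': "in_hom D t V Z" using t by simp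
        note [simp] = in_homD[OF y] in_homD[OF t']
        have "rel D f0 f1 y ((t \<cdot> S) \<cdot> d)" using r by simp
        \<comment> \<open>T, restricted to the stage \<open>V\<close>, is itself one of the sets
          that are intersected; no further change of stage is made.\<close>
        moreover have "incl D e0 e1 f0 f1 k (ide D V \<cdot> (t \<cdot> S)) (t \<cdot> T)"
          using incl_nat[OF i S T t'] by simp
        moreover have "in_hom D (ide D V) V V" using Obj_simps(1)[of y] by (simp add: in_hom_def)
        moreover have "in_hom D (t \<cdot> T) V (Cod D f1)" "in_hom D (t \<cdot> S) V (Cod D e1)"
          by (simp_all add: in_hom_def)
        ultimately have "rel D f0 f1 (ide D V \<cdot> y) (t \<cdot> T)" using mem[OF y] by blast
        then show "rel D f0 f1 (y \<cdot> ide D (Cod D f0)) (t \<cdot> T)" by simp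
      qed }
    { assume i: "incl D f0 f1 f0 f1 (ide D (Cod D f0)) (S \<cdot> d) T"
      show "incl D e0 e1 f0 f1 k S T"
      proof (rule inclI)
        fix V x t assume x: "in_hom D x V (Cod D e0)" and t: "in_hom D t V (Dom D S)"
          and r: "rel D e0 e1 x (t \<cdot> S)"
        have t': "in_hom D t V Z" using t by simp
        note [simp] = in_homD[OF x] in_homD[OF t']
        have "rel D f0 f1 (x \<cdot> k) ((t \<cdot> S) \<cdot> d)"
        proof (rule mem[THEN iffD2, of _ V], goal_cases)
          case 3
          show ?case
          proof (intro allI impI)
            fix W s T' assume s: "in_hom D s W V" and T': "in_hom D T' W (Cod D f1)"
              and i': "incl D e0 e1 f0 f1 k (s \<cdot> (t \<cdot> S)) T'"
            note [simp] = in_homD[OF s] in_homD[OF T']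
            have [simp]: "W \<in> Obj D" using Obj_simps(1)[of s] by simp
            have "rel D e0 e1 (s \<cdot> x) (s \<cdot> (t \<cdot> S))"
              by (rule rel_nat[OF r]) (simp_all add: in_hom_def)
            then show "rel D f0 f1 (s \<cdot> (x \<cdot> k)) T'"
              using inclD[OF i', of "s \<cdot> x" W "ide D W"] by (simp add: in_hom_def)
          qed
        qed (simp_all add: in_hom_def)
        then show "rel D f0 f1 (x \<cdot> k) (t \<cdot> T)"
          using inclD[OF i, of "x \<cdot> k" V t] by (simp add: in_hom_def)
      qed }
  qed
  then show thesis by (rule that)
qed

end

section \<open>Direct and inverse images of the statement against the adjoints\<close>

definition direct_image_arrows ::
    "('o, 'm) cat \<Rightarrow> 'm \<Rightarrow> 'm \<Rightarrow> 'm \<Rightarrow> 'm \<Rightarrow> 'm \<Rightarrow> 'm \<Rightarrow> 'm \<Rightarrow> 'm \<Rightarrow> bool" where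
  "direct_image_arrows D q0 q1 m q0' q1' m' k d \<longleftrightarrow>
     (\<exists>s0 s1 w n. is_product D s0 s1 \<and> Cod D s0 = Cod D q0' \<and> Cod D s1 = Cod D q1
        \<and> is_product_map D q0 q1 s0 s1 k (ide D (Cod D q1)) w
        \<and> is_image D (m \<cdot>\<^bsub>D\<^esub> w) n \<and> classifies D q0' q1' m' s0 s1 n d)"

text \<open>As in \<open>direct_image_arrows\<close>, the body of the corresponding predicate on
  diagrams, with the arrows (2, 0), (2, 1), (3, 2) of each diagram as arguments and the typing of
  \<open>k\<close> left to the context.\<close>

definition inverse_image_arrows ::
    "('o, 'm) cat \<Rightarrow> 'm \<Rightarrow> 'm \<Rightarrow> 'm \<Rightarrow> 'm \<Rightarrow> 'm \<Rightarrow> 'm \<Rightarrow> 'm \<Rightarrow> 'm \<Rightarrow> bool" where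
  "inverse_image_arrows D q0 q1 m q0' q1' m' k d \<longleftrightarrow>
     (\<exists>s0 s1 w n t. is_product D s0 s1 \<and> Cod D s0 = Cod D q0 \<and> Cod D s1 = Cod D q1'
        \<and> is_product_map D s0 s1 q0' q1' k (ide D (Cod D q1')) w
        \<and> is_pullback D n t w m' \<and> classifies D q0 q1 m s0 s1 n d)"

locale power_category = lex_category +
  assumes has_power: "has_power_objects D"
begin

lemma power_map:
  assumes "is_power_object D q0 q1 m" "is_power_object D q0' q1' m'"
    and k: "in_hom D k (Cod D q0) (Cod D q0')"
  shows "power_map D (m \<cdot> q0) (m \<cdot> q1) (m' \<cdot> q0') (m' \<cdot> q1') k"
proof unfold_locales
  have q: "is_product D q0 q1" "is_mono D m" "Cod D m = Dom D q0"
    and q': "is_product D q0' q1'" "is_mono D m'" "Cod D m' = Dom D q0'"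
    using assms unfolding is_power_object_def by blast+
  show "power_rel D (m \<cdot> q0) (m \<cdot> q1)" "power_rel D (m' \<cdot> q0') (m' \<cdot> q1')"
    by (rule power_object_power_rel; fact)+
  show "in_hom D k (Cod D (m \<cdot> q0)) (Cod D (m' \<cdot> q0'))"
    using k q q' is_productD[OF q(1)] is_productD[OF q'(1)] by (simp add: is_mono_def)
qed

end

locale power_objects_map = power_category +
  fixes q0 q1 m q0' q1' m' k
  assumes po: "is_power_object D q0 q1 m" and po': "is_power_object D q0' q1' m'"
    and kh: "in_hom D k (Cod D q0) (Cod D q0')"
begin

lemma q: "is_product D q0 q1" "is_mono D m" "Cod D m = Dom D q0"
  and q': "is_product D q0' q1'" "is_mono D m'" "Cod D m' = Dom D q0'"
  using po po' unfolding is_power_object_def by blast+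

lemma ma [simp]: "m \<in> Arr D" "m' \<in> Arr D" using q q' by (simp_all add: is_mono_def)

lemmas [simp] = is_productD[OF q(1)] is_productD[OF q'(1)] q(3) q'(3) in_homD[OF kh]

sublocale pm: power_map D "m \<cdot> q0" "m \<cdot> q1" "m' \<cdot> q0'" "m' \<cdot> q1'" k
  by (rule power_map[OF po po' kh])

text \<open>Supplies the power object of P(b) over which the intersection is formed.\<close>

lemma dimg_ex: "\<exists>d. dimg D (m \<cdot> q0) (m \<cdot> q1) (m' \<cdot> q0') (m' \<cdot> q1') k d"
proof -
  obtain g0 g1 n where g: "is_power_object D g0 g1 n" "Cod D g0 = Cod D q1'"
  proof -
    have "Cod D q1' \<in> Obj D" using Obj_simps(2)[of q1'] by simp
    then show thesis using has_power that unfolding has_power_objects_def by blast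
  qed
  have 1: "is_product D g0 g1" "is_mono D n" "Cod D n = Dom D g0"
    using g unfolding is_power_object_def by blast+
  have "n \<in> Arr D" using 1 by (simp add: is_mono_def)
  then have "Cod D (n \<cdot> g0) = Cod D (m' \<cdot> q1')" using is_productD[OF 1(1)] 1 g by simp
  then show ?thesis
    using pm.obtain_dimg[OF power_object_power_rel[OF g(1)]] by blast
qed

text \<open>The inverse of classification: membership in subobjects of b is pulled back along id x
  \<open>T\<close>.\<close>

lemma obtain_subobject:
  assumes s: "is_product D s0 s1" "Cod D s0 = Cod D q0'" and T: "in_hom D T (Cod D s1) (Cod D q1')"
  obtains n where "is_mono D n" "Cod D n = Dom D s0" "classifies D q0' q1' m' s0 s1 n T"
proof -
  note [simp] = is_productD[OF s(1)] s(2) in_homD[OF T]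
  obtain h where h: "in_hom D h (Dom D s0) (Dom D q0')" "h \<cdot> q0' = s0" "h \<cdot> q1' = s1 \<cdot> T"
    by (rule is_product_pair[OF q'(1), of s0 "Dom D s0" "s1 \<cdot> T"]) (simp_all add: in_hom_def)
  note [simp] = in_homD[OF h(1)]
  obtain n t where n: "is_pullback D n t h m'" and [simp]: "n \<in> Arr D" "Cod D n = Dom D s0"
    by (rule obtain_pullback[of h m']) simp_all
  have "is_product_map D s0 s1 q0' q1' (ide D (Cod D q0')) T h"
    unfolding is_product_map_def using h T by (simp add: in_hom_def)
  then have "classifies D q0' q1' m' s0 s1 n T"
    unfolding classifies_def using n by blast
  then show thesis using that[of n] pullback_mono[OF n q'(2)] by simp
qed

text \<open>\<open>m \<cdot> w\<close> is the universal pair x \<in> S with x replaced by k(x). That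
  it factors through the subobject classified by \<open>T\<close> concerns this universal element,
  and by restriction all elements: it is the inclusion with S = id.\<close>

lemma product_map_incl:
  assumes s: "is_product D s0 s1" "Cod D s0 = Cod D q0'" "Cod D s1 = Cod D q1"
    and w: "is_product_map D q0 q1 s0 s1 k (ide D (Cod D q1)) w"
    and n: "is_mono D n" "Cod D n = Dom D s0" and c: "classifies D q0' q1' m' s0 s1 n T"
  shows "factors_through D (m \<cdot> w) n \<longleftrightarrow>
    incl D (m \<cdot> q0) (m \<cdot> q1) (m' \<cdot> q0') (m' \<cdot> q1') k (ide D (Cod D q1)) T"
proof -
  have wh: "in_hom D w (Dom D q0) (Dom D s0)" "w \<cdot> s0 = q0 \<cdot> k" "w \<cdot> s1 = q1"
    using w unfolding is_product_map_def by simp_all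
  have cr: "classifies_rel D (m' \<cdot> q0') (m' \<cdot> q1') (n \<cdot> s0) (n \<cdot> s1) T"
    using c unfolding classifies_iff_rel[OF q' s(1,2) n] .
  have [simp]: "n \<in> Arr D" using n by (simp add: is_mono_def)
  note [simp] = is_productD[OF s(1)] s(2,3) in_homD[OF wh(1)] n(2)
  have [simp]: "T \<in> Arr D" "Dom D T = Cod D q1" "Cod D T = Cod D q1'"
    using classifies_relD(2)[OF cr] by (simp_all add: in_hom_def)
  have mw: "in_hom D (m \<cdot> w) (Dom D m) (Dom D s0)" by (simp add: in_hom_def)
  have "factors_through D (m \<cdot> w) n \<longleftrightarrow> rel D (n \<cdot> s0) (n \<cdot> s1) ((m \<cdot> w) \<cdot> s0) ((m \<cdot> w) \<cdot> s1)"
    unfolding rel_mono_iff[OF s(1) n mw] factors_through_def by simp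
  also have "\<dots> \<longleftrightarrow> rel D (m' \<cdot> q0') (m' \<cdot> q1') (m \<cdot> (q0 \<cdot> k)) (m \<cdot> (q1 \<cdot> T))"
    using classifies_relD(1)[OF cr, of "m \<cdot> (q0 \<cdot> k)" "Dom D m" "m \<cdot> q1"]
    by (simp add: in_hom_def wh)
  also have "\<dots> \<longleftrightarrow> incl D (m \<cdot> q0) (m \<cdot> q1) (m' \<cdot> q0') (m' \<cdot> q1') k (ide D (Cod D q1)) T"
  proof
    assume r: "rel D (m' \<cdot> q0') (m' \<cdot> q1') (m \<cdot> (q0 \<cdot> k)) (m \<cdot> (q1 \<cdot> T))"
    show "incl D (m \<cdot> q0) (m \<cdot> q1) (m' \<cdot> q0') (m' \<cdot> q1') k (ide D (Cod D q1)) T"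
    proof (rule inclI)
      fix V x t assume x: "in_hom D x V (Cod D (m \<cdot> q0))" and t: "in_hom D t V (Dom D (ide D (Cod D q1)))"
        and "rel D (m \<cdot> q0) (m \<cdot> q1) x (t \<cdot> ide D (Cod D q1))"
      then obtain u where u: "in_hom D u V (Dom D m)" "u \<cdot> (m \<cdot> q0) = x" "u \<cdot> (m \<cdot> q1) = t"
        by (auto simp: rel_def in_hom_def)
      note [simp] = in_homD[OF u(1)]
      have "rel D (m' \<cdot> q0') (m' \<cdot> q1') (u \<cdot> (m \<cdot> (q0 \<cdot> k))) (u \<cdot> (m \<cdot> (q1 \<cdot> T)))"
        by (rule rel_nat[OF r]) (simp_all add: in_hom_def)
      then show "rel D (m' \<cdot> q0') (m' \<cdot> q1') (x \<cdot> k) (t \<cdot> T)"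
        using cmp_eq_assoc1[OF u(2), of k] cmp_eq_assoc1[OF u(3), of T] by simp
    qed
  next
    assume i: "incl D (m \<cdot> q0) (m \<cdot> q1) (m' \<cdot> q0') (m' \<cdot> q1') k (ide D (Cod D q1)) T"
    have "rel D (m \<cdot> q0) (m \<cdot> q1) (m \<cdot> q0) (m \<cdot> q1)"
      by (rule relI[where e = "ide D (Dom D m)"]) (simp_all add: in_hom_def)
    then show "rel D (m' \<cdot> q0') (m' \<cdot> q1') (m \<cdot> (q0 \<cdot> k)) (m \<cdot> (q1 \<cdot> T))"
      using inclD[OF i, of "m \<cdot> q0" "Dom D m" "m \<cdot> q1"] by (simp add: in_hom_def)
  qed
  finally show ?thesis .
qed

text \<open>Tested on the generic element of \<open>n\<close>. It turns the order of subobjects, in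
  which an image is least, into the order of classifying arrows.\<close>

lemma factors_incl:
  assumes s: "is_product D s0 s1" "Cod D s0 = Cod D q0'" "Cod D s1 = Cod D q1"
    and n: "is_mono D n" "Cod D n = Dom D s0" and c: "classifies D q0' q1' m' s0 s1 n T"
    and n': "is_mono D n'" "Cod D n' = Dom D s0" and c': "classifies D q0' q1' m' s0 s1 n' T'"
  shows "factors_through D n n' \<longleftrightarrow>
    incl D (m' \<cdot> q0') (m' \<cdot> q1') (m' \<cdot> q0') (m' \<cdot> q1') (ide D (Cod D q0')) T T'"
proof -
  have cr: "classifies_rel D (m' \<cdot> q0') (m' \<cdot> q1') (n \<cdot> s0) (n \<cdot> s1) T"
    using c unfolding classifies_iff_rel[OF q' s(1,2) n] .
  have cr': "classifies_rel D (m' \<cdot> q0') (m' \<cdot> q1') (n' \<cdot> s0) (n' \<cdot> s1) T'"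
    using c' unfolding classifies_iff_rel[OF q' s(1,2) n'] .
  have [simp]: "n \<in> Arr D" "n' \<in> Arr D" using n n' by (simp_all add: is_mono_def)
  note [simp] = is_productD[OF s(1)] s(2,3) n(2) n'(2)
  have [simp]: "T \<in> Arr D" "Dom D T = Cod D q1" "Cod D T = Cod D q1'"
    "T' \<in> Arr D" "Dom D T' = Cod D q1" "Cod D T' = Cod D q1'"
    using classifies_relD(2)[OF cr] classifies_relD(2)[OF cr'] by (simp_all add: in_hom_def)
  have nh: "in_hom D n (Dom D n) (Dom D s0)" by (simp add: in_hom_def)
  have "factors_through D n n' \<longleftrightarrow> rel D (n' \<cdot> s0) (n' \<cdot> s1) (n \<cdot> s0) (n \<cdot> s1)"
    unfolding rel_mono_iff[OF s(1) n' nh] factors_through_def by simp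
  also have "\<dots> \<longleftrightarrow> incl D (m' \<cdot> q0') (m' \<cdot> q1') (m' \<cdot> q0') (m' \<cdot> q1') (ide D (Cod D q0')) T T'"
  proof
    assume r: "rel D (n' \<cdot> s0) (n' \<cdot> s1) (n \<cdot> s0) (n \<cdot> s1)"
    show "incl D (m' \<cdot> q0') (m' \<cdot> q1') (m' \<cdot> q0') (m' \<cdot> q1') (ide D (Cod D q0')) T T'"
    proof (rule inclI)
      fix V x t assume x: "in_hom D x V (Cod D (m' \<cdot> q0'))" and t: "in_hom D t V (Dom D T)"
        and rr: "rel D (m' \<cdot> q0') (m' \<cdot> q1') x (t \<cdot> T)"
      note [simp] = in_homD[OF x] in_homD[OF t]
      have "rel D (n \<cdot> s0) (n \<cdot> s1) x t"
        using classifies_relD(1)[OF cr x, of t] rr by (simp add: in_hom_def)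
      then obtain u where u: "in_hom D u V (Dom D n)" "u \<cdot> (n \<cdot> s0) = x" "u \<cdot> (n \<cdot> s1) = t"
        by (auto simp: rel_def)
      note [simp] = in_homD[OF u(1)]
      have "rel D (n' \<cdot> s0) (n' \<cdot> s1) (u \<cdot> (n \<cdot> s0)) (u \<cdot> (n \<cdot> s1))"
        by (rule rel_nat[OF r]) (simp_all add: in_hom_def)
      then show "rel D (m' \<cdot> q0') (m' \<cdot> q1') (x \<cdot> ide D (Cod D q0')) (t \<cdot> T')"
        using classifies_relD(1)[OF cr' x, of t] by (simp add: in_hom_def u)
    qed
  next
    assume i: "incl D (m' \<cdot> q0') (m' \<cdot> q1') (m' \<cdot> q0') (m' \<cdot> q1') (ide D (Cod D q0')) T T'"
    have "rel D (n \<cdot> s0) (n \<cdot> s1) (n \<cdot> s0) (n \<cdot> s1)"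
      by (rule relI[where e = "ide D (Dom D n)"]) (simp_all add: in_hom_def)
    then have "rel D (m' \<cdot> q0') (m' \<cdot> q1') (n \<cdot> s0) ((n \<cdot> s1) \<cdot> T)"
      using classifies_relD(1)[OF cr, of "n \<cdot> s0" "Dom D n" "n \<cdot> s1"] by (simp add: in_hom_def)
    then have "rel D (m' \<cdot> q0') (m' \<cdot> q1') ((n \<cdot> s0) \<cdot> ide D (Cod D q0')) ((n \<cdot> s1) \<cdot> T')"
      by (intro inclD[OF i, of _ "Dom D n"]) (simp_all add: in_hom_def)
    then show "rel D (n' \<cdot> s0) (n' \<cdot> s1) (n \<cdot> s0) (n \<cdot> s1)"
      using classifies_relD(1)[OF cr', of "n \<cdot> s0" "Dom D n" "n \<cdot> s1"] by (simp add: in_hom_def)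
  qed
  finally show ?thesis .
qed

text \<open>The order-theoretic content of an image: its classifying arrow is the least T into which
  the generic S is carried. This is the adjunction at the generic stage, not yet at all
  stages.\<close>

lemma direct_image_univ:
  assumes "direct_image_arrows D q0 q1 m q0' q1' m' k d"
  shows "in_hom D d (Cod D q1) (Cod D q1')"
    "in_hom D T (Cod D q1) (Cod D q1') \<Longrightarrow>
      incl D (m \<cdot> q0) (m \<cdot> q1) (m' \<cdot> q0') (m' \<cdot> q1') k (ide D (Cod D q1)) T \<longleftrightarrow>
      incl D (m' \<cdot> q0') (m' \<cdot> q1') (m' \<cdot> q0') (m' \<cdot> q1') (ide D (Cod D q0')) d T"
proof -
  obtain s0 s1 w n where s: "is_product D s0 s1" "Cod D s0 = Cod D q0'" "Cod D s1 = Cod D q1"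
    and w: "is_product_map D q0 q1 s0 s1 k (ide D (Cod D q1)) w"
    and im: "is_image D (m \<cdot> w) n" and c: "classifies D q0' q1' m' s0 s1 n d"
    using assms unfolding direct_image_arrows_def by blast
  have wh: "in_hom D w (Dom D q0) (Dom D s0)" using w unfolding is_product_map_def by blast
  note [simp] = in_homD[OF wh]
  have n: "is_mono D n" "Cod D n = Dom D s0" using im unfolding is_image_def by simp_all
  show "in_hom D d (Cod D q1) (Cod D q1')"
    using c s unfolding classifies_def is_product_map_def by auto
  assume T: "in_hom D T (Cod D q1) (Cod D q1')"
  \<comment> \<open>An arrow \<open>T\<close> is realised by a mono, so that leastness of the image
    among monos applies to it.\<close>
  obtain n' where n': "is_mono D n'" "Cod D n' = Dom D s0" and c': "classifies D q0' q1' m' s0 s1 n' T"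
    by (rule obtain_subobject[OF s(1,2), of T]) (simp_all add: T s)
  have "factors_through D (m \<cdot> w) n' \<longleftrightarrow> factors_through D n n'"
  proof
    assume "factors_through D (m \<cdot> w) n'"
    then show "factors_through D n n'" using im n' unfolding is_image_def by simp
  next
    assume "factors_through D n n'"
    then obtain t where t: "in_hom D t (Dom D n) (Dom D n')" "t \<cdot> n' = n"
      unfolding factors_through_def by blast
    obtain u where u: "in_hom D u (Dom D (m \<cdot> w)) (Dom D n)" "u \<cdot> n = m \<cdot> w"
      using im unfolding is_image_def factors_through_def by blast
    have [simp]: "n' \<in> Arr D" using n' by (simp add: is_mono_def)
    note [simp] = in_homD[OF u(1)] in_homD[OF t(1)]
    show "factors_through D (m \<cdot> w) n'"
      unfolding factors_through_def by (intro exI[of _ "u \<cdot> t"]) (simp add: in_hom_def t u)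
  qed
  then show "incl D (m \<cdot> q0) (m \<cdot> q1) (m' \<cdot> q0') (m' \<cdot> q1') k (ide D (Cod D q1)) T \<longleftrightarrow>
      incl D (m' \<cdot> q0') (m' \<cdot> q1') (m' \<cdot> q0') (m' \<cdot> q1') (ide D (Cod D q0')) d T"
    unfolding product_map_incl[OF s w n' c'] factors_incl[OF s n c n' c'] .
qed

text \<open>An adjoint is a direct image because leastness is one instance of the adjunction.
  Conversely, some adjoint \<open>d'\<close> exists and is a direct image by the first half;
  \<open>d\<close> and \<open>d'\<close> share the universal property at the generic stage, and
  antisymmetry gives d = d'.\<close>

lemma direct_image_iff:
  "direct_image_arrows D q0 q1 m q0' q1' m' k d \<longleftrightarrow>
     dimg D (m \<cdot> q0) (m \<cdot> q1) (m' \<cdot> q0') (m' \<cdot> q1') k d"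
proof -
  have *: "direct_image_arrows D q0 q1 m q0' q1' m' k d"
    if d: "dimg D (m \<cdot> q0) (m \<cdot> q1) (m' \<cdot> q0') (m' \<cdot> q1') k d" for d
  proof -
    have dh: "in_hom D d (Cod D q1) (Cod D q1')" using d unfolding dimg_def by simp
    note [simp] = in_homD[OF dh]
    have [simp]: "Cod D q1 \<in> Obj D" using Obj_simps(2)[of q1] by simp
    have u: "incl D (m \<cdot> q0) (m \<cdot> q1) (m' \<cdot> q0') (m' \<cdot> q1') k (ide D (Cod D q1)) T \<longleftrightarrow>
      incl D (m' \<cdot> q0') (m' \<cdot> q1') (m' \<cdot> q0') (m' \<cdot> q1') (ide D (Cod D q0')) d T"
      if T: "in_hom D T (Cod D q1) (Cod D q1')" for T
      using dimgD[OF d, of "ide D (Cod D q1)" "Cod D q1" T] T by (simp add: in_hom_def)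
    obtain s0 s1 where s: "is_product D s0 s1" "Cod D s0 = Cod D q0'" "Cod D s1 = Cod D q1"
      and [simp]: "s0 \<in> Arr D" "s1 \<in> Arr D" "Dom D s1 = Dom D s0"
      by (rule obtain_product[of "Cod D q0'" "Cod D q1"]) (simp_all add: Obj_simps(2))
    obtain w where w: "in_hom D w (Dom D q0) (Dom D s0)" "w \<cdot> s0 = q0 \<cdot> k" "w \<cdot> s1 = q1"
      by (rule is_product_pair[OF s(1), of "q0 \<cdot> k" "Dom D q0" q1]) (simp_all add: in_hom_def s)
    note [simp] = in_homD[OF w(1)]
    have wp: "is_product_map D q0 q1 s0 s1 k (ide D (Cod D q1)) w"
      unfolding is_product_map_def using w s kh by (simp add: in_hom_def)
    obtain n where n: "is_mono D n" "Cod D n = Dom D s0" and c: "classifies D q0' q1' m' s0 s1 n d"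
      by (rule obtain_subobject[OF s(1,2), of d]) (simp_all add: dh s)
    have "is_image D (m \<cdot> w) n"
      unfolding is_image_def
    proof (intro conjI allI impI)
      show "m \<cdot> w \<in> Arr D" "Cod D n = Cod D (m \<cdot> w)" using n by simp_all
      show "is_mono D n" by fact
      show "factors_through D (m \<cdot> w) n"
        unfolding product_map_incl[OF s wp n c] u[OF dh]
        using incl_refl[of "m' \<cdot> q0'" "m' \<cdot> q1'" d] by simp
      fix n' assume "is_mono D n' \<and> Cod D n' = Cod D (m \<cdot> w) \<and> factors_through D (m \<cdot> w) n'"
      then have n': "is_mono D n'" "Cod D n' = Dom D s0" and f: "factors_through D (m \<cdot> w) n'"
        by simp_all
      \<comment> \<open>Every competing mono has a classifying arrow, so leastness among monos
        follows from leastness among arrows.\<close>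
      obtain T where c': "classifies D q0' q1' m' s0 s1 n' T"
        using po' s(1,2) n' unfolding is_power_object_def by metis
      have T: "in_hom D T (Cod D q1) (Cod D q1')"
        using c' s unfolding classifies_def is_product_map_def by auto
      show "factors_through D n n'"
        using f unfolding product_map_incl[OF s wp n' c'] factors_incl[OF s n c n' c'] u[OF T] .
    qed
    then show ?thesis
      unfolding direct_image_arrows_def using s wp c by blast
  qed
  show ?thesis
  proof
    assume di: "direct_image_arrows D q0 q1 m q0' q1' m' k d"
    obtain d' where d': "dimg D (m \<cdot> q0) (m \<cdot> q1) (m' \<cdot> q0') (m' \<cdot> q1') k d'"
      using dimg_ex by blast
    note di' = *[OF d']
    note h = direct_image_univ(1)[OF di] direct_image_univ(1)[OF di']
    have r: "incl D (m' \<cdot> q0') (m' \<cdot> q1') (m' \<cdot> q0') (m' \<cdot> q1') (ide D (Cod D q0')) S S" for S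
      using incl_refl[of "m' \<cdot> q0'" "m' \<cdot> q1'" S] by simp
    have "d = d'"
    proof (rule incl_antisym[OF pm.lex pm.pf])
      show "incl D (m' \<cdot> q0') (m' \<cdot> q1') (m' \<cdot> q0') (m' \<cdot> q1') (ide D (Cod D (m' \<cdot> q0'))) d d'"
        using direct_image_univ(2)[OF di h(2)] direct_image_univ(2)[OF di' h(2)] r by simp
      show "incl D (m' \<cdot> q0') (m' \<cdot> q1') (m' \<cdot> q0') (m' \<cdot> q1') (ide D (Cod D (m' \<cdot> q0'))) d' d"
        using direct_image_univ(2)[OF di h(1)] direct_image_univ(2)[OF di' h(1)] r by simp
    qed (use h in simp_all)
    then show "dimg D (m \<cdot> q0) (m \<cdot> q1) (m' \<cdot> q0') (m' \<cdot> q1') k d" using d' by simp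
  qed (rule *)
qed

text \<open>Membership pulled back along k x id is the relation k(x) \<in> T, and to classify this
  relation is the membership condition of \<open>iimg\<close>.\<close>

lemma inverse_image_iff:
  "inverse_image_arrows D q0 q1 m q0' q1' m' k d \<longleftrightarrow>
     iimg D (m \<cdot> q0) (m \<cdot> q1) (m' \<cdot> q0') (m' \<cdot> q1') k d"
proof -
  have *: "classifies D q0 q1 m s0 s1 n d \<longleftrightarrow> iimg D (m \<cdot> q0) (m \<cdot> q1) (m' \<cdot> q0') (m' \<cdot> q1') k d"
    if s: "is_product D s0 s1" "Cod D s0 = Cod D q0" "Cod D s1 = Cod D q1'"
      and w: "is_product_map D s0 s1 q0' q1' k (ide D (Cod D q1')) w"
      and pb: "is_pullback D n t w m'" for s0 s1 w n t
  proof -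
    note [simp] = is_productD[OF s(1)] s(2,3)
    have wh: "in_hom D w (Dom D s0) (Dom D q0')" "w \<cdot> q0' = s0 \<cdot> k" "w \<cdot> q1' = s1"
      using w unfolding is_product_map_def by simp_all
    note [simp] = in_homD[OF wh(1)]
    have n: "is_mono D n" "Cod D n = Dom D s0"
      using pullback_mono[OF pb q'(2)] is_pullbackD(6)[OF pb] by simp_all
    have [simp]: "n \<in> Arr D" "Cod D n = Dom D s0" using n by (simp_all add: is_mono_def)
    have r: "rel D (n \<cdot> s0) (n \<cdot> s1) x T \<longleftrightarrow> rel D (m' \<cdot> q0') (m' \<cdot> q1') (x \<cdot> k) T"
      if x: "in_hom D x V (Cod D q0)" and T: "in_hom D T V (Cod D q1')" for V x T
    proof -
      obtain z where z: "in_hom D z V (Dom D s0)" "z \<cdot> s0 = x" "z \<cdot> s1 = T"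
        by (rule is_product_pair[OF s(1), of x V T]) (simp_all add: x T)
      note [simp] = in_homD[OF z(1)] in_homD[OF x] in_homD[OF T]
      show ?thesis
        using rel_pullback_mono[OF s(1) q' pb wh(1) z(1)]
        by (simp add: z wh cmp_eq_assoc1[OF z(2)])
    qed
    show ?thesis
      unfolding classifies_iff_rel[OF q s(1,2) n]
    proof
      assume c: "classifies_rel D (m \<cdot> q0) (m \<cdot> q1) (n \<cdot> s0) (n \<cdot> s1) d"
      show "iimg D (m \<cdot> q0) (m \<cdot> q1) (m' \<cdot> q0') (m' \<cdot> q1') k d"
        unfolding iimg_def
      proof (intro conjI allI impI)
        show "in_hom D d (Cod D (m' \<cdot> q1')) (Cod D (m \<cdot> q1))" using classifies_relD(2)[OF c] by simp
        fix Z x T assume "in_hom D x Z (Cod D (m \<cdot> q0)) \<and> in_hom D T Z (Cod D (m' \<cdot> q1'))"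
        then show "rel D (m \<cdot> q0) (m \<cdot> q1) x (T \<cdot> d) \<longleftrightarrow> rel D (m' \<cdot> q0') (m' \<cdot> q1') (x \<cdot> k) T"
          using classifies_relD(1)[OF c, of x Z T] r[of x Z T] by simp
      qed
    next
      assume i: "iimg D (m \<cdot> q0) (m \<cdot> q1) (m' \<cdot> q0') (m' \<cdot> q1') k d"
      show "classifies_rel D (m \<cdot> q0) (m \<cdot> q1) (n \<cdot> s0) (n \<cdot> s1) d"
        unfolding classifies_rel_def
      proof (intro conjI allI impI)
        show "in_hom D d (Cod D (n \<cdot> s1)) (Cod D (m \<cdot> q1))" using i unfolding iimg_def by simp
        fix V x t assume "in_hom D x V (Cod D (m \<cdot> q0)) \<and> in_hom D t V (Cod D (n \<cdot> s1))"
        then show "rel D (n \<cdot> s0) (n \<cdot> s1) x t \<longleftrightarrow> rel D (m \<cdot> q0) (m \<cdot> q1) x (t \<cdot> d)"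
          using iimgD[OF i, of x V t] r[of x V t] by simp
      qed
    qed
  qed
  show ?thesis
  proof
    assume "inverse_image_arrows D q0 q1 m q0' q1' m' k d"
    then show "iimg D (m \<cdot> q0) (m \<cdot> q1) (m' \<cdot> q0') (m' \<cdot> q1') k d"
      unfolding inverse_image_arrows_def using * by blast
  next
    assume i: "iimg D (m \<cdot> q0) (m \<cdot> q1) (m' \<cdot> q0') (m' \<cdot> q1') k d"
    have [simp]: "Cod D q1' \<in> Obj D" using Obj_simps(2)[of q1'] by simp
    obtain s0 s1 where s: "is_product D s0 s1" "Cod D s0 = Cod D q0" "Cod D s1 = Cod D q1'"
      and [simp]: "s0 \<in> Arr D" "s1 \<in> Arr D" "Dom D s1 = Dom D s0"
      by (rule obtain_product[of "Cod D q0" "Cod D q1'"]) (simp_all add: Obj_simps(2))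
    obtain w where w: "in_hom D w (Dom D s0) (Dom D q0')" "w \<cdot> q0' = s0 \<cdot> k" "w \<cdot> q1' = s1"
      by (rule is_product_pair[OF q'(1), of "s0 \<cdot> k" "Dom D s0" s1]) (simp_all add: in_hom_def s)
    note [simp] = in_homD[OF w(1)]
    have wp: "is_product_map D s0 s1 q0' q1' k (ide D (Cod D q1')) w"
      unfolding is_product_map_def using w s kh by (simp add: in_hom_def)
    obtain n t where pb: "is_pullback D n t w m'"
      by (rule obtain_pullback[of w m']) simp_all
    show "inverse_image_arrows D q0 q1 m q0' q1' m' k d"
      unfolding inverse_image_arrows_def using s wp pb *[OF s wp pb] i by blast
  qed
qed

end

section \<open>Functors preserving finite limits\<close>

declare One_nat_def [simp del]

text \<open>Objects and arrows are numbers because \<open>has_finite_limits\<close> ranges over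
  shapes of type \<open>(nat, nat) cat\<close>.\<close>

definition pair_shape :: "(nat, nat) cat" where
  "pair_shape = \<lparr>Obj = {0, 1}, Arr = {0, 1}, Dom = id, Cod = id, ide = id, cmp = (\<lambda>f g. f)\<rparr>"

text \<open>The arrows \<open>3\<close> and \<open>4\<close> form the cospan; the others are the identities.\<close>

definition cospan_shape :: "(nat, nat) cat" where
  "cospan_shape = \<lparr>Obj = {0, 1, 2}, Arr = {0, 1, 2, 3, 4},
     Dom = (\<lambda>u. if u = 3 then 0 else if u = 4 then 1 else u),
     Cod = (\<lambda>u. if u = 3 \<or> u = 4 then 2 else u), ide = id, cmp = (\<lambda>f g. if f \<le> 2 then g else f)\<rparr>"

definition pair_diagram :: "('o, 'm) cat \<Rightarrow> 'o \<Rightarrow> 'o \<Rightarrow> (nat, nat, 'o, 'm) ftor" where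
  "pair_diagram D a b = \<lparr>fobj = (\<lambda>j. if j = 0 then a else b),
     farr = (\<lambda>j. if j = 0 then ide D a else ide D b)\<rparr>"

definition cospan_diagram :: "('o, 'm) cat \<Rightarrow> 'm \<Rightarrow> 'm \<Rightarrow> (nat, nat, 'o, 'm) ftor" where
  "cospan_diagram D f g = \<lparr>fobj = (\<lambda>j. if j = 0 then Dom D f else if j = 1 then Dom D g else Cod D f),
     farr = (\<lambda>u. if u = 0 then ide D (Dom D f) else if u = 1 then ide D (Dom D g)
       else if u = 2 then ide D (Cod D f) else if u = 3 then f else g)\<rparr>"

lemma finite_pair_shape: "finite_category pair_shape"
  unfolding finite_category_def by (auto simp: pair_shape_def in_hom_def intro!: category.intro)

lemma finite_cospan_shape: "finite_category cospan_shape"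
  unfolding finite_category_def
  by (auto simp: cospan_shape_def in_hom_def intro!: category.intro split: if_splits)

context category
begin

lemma pair_diagram_functor:
  "a \<in> Obj D \<Longrightarrow> b \<in> Obj D \<Longrightarrow> is_functor pair_shape D (pair_diagram D a b)"
  by (auto simp: is_functor_def pair_shape_def pair_diagram_def in_hom_def)

lemma cospan_diagram_functor:
  assumes [simp]: "f \<in> Arr D" "g \<in> Arr D" "Cod D g = Cod D f"
  shows "is_functor cospan_shape D (cospan_diagram D f g)"
  by (auto simp: is_functor_def cospan_shape_def cospan_diagram_def in_hom_def)

lemma product_cone:
  assumes "a \<in> Obj D" "b \<in> Obj D" "L \<in> Obj D"
  shows "is_cone pair_shape D (pair_diagram D a b) L l \<longleftrightarrow> in_hom D (l 0) L a \<and> in_hom D (l 1) L b"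
  using assms unfolding is_cone_def pair_shape_def pair_diagram_def in_hom_def by auto

text \<open>Mediates between limits of shaped diagrams, for which existence and preservation are
  stated, and the elementary notion that the proofs use; \<open>pullback_limit\<close> does so for
  cospans.\<close>

lemma product_limit:
  assumes ab: "a \<in> Obj D" "b \<in> Obj D"
  shows "is_limit pair_shape D (pair_diagram D a b) L l \<longleftrightarrow>
    is_product D (l 0) (l 1) \<and> Dom D (l 0) = L \<and> Cod D (l 0) = a \<and> Cod D (l 1) = b"
proof
  assume lim: "is_limit pair_shape D (pair_diagram D a b) L l"
  then have L: "L \<in> Obj D" and "is_cone pair_shape D (pair_diagram D a b) L l"
    unfolding is_limit_def is_cone_def by blast+
  then have l: "in_hom D (l 0) L a" "in_hom D (l 1) L b" using product_cone[OF ab] by blast+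
  note [simp] = in_homD[OF l(1)] in_homD[OF l(2)]
  have "is_product D (l 0) (l 1)"
    unfolding is_product_def
  proof (intro conjI ballI impI)
    fix x y assume xy: "x \<in> Arr D" "y \<in> Arr D"
      "Dom D x = Dom D y \<and> Cod D x = Cod D (l 0) \<and> Cod D y = Cod D (l 1)"
    have "is_cone pair_shape D (pair_diagram D a b) (Dom D x) (\<lambda>j. if j = 0 then x else y)"
      using xy product_cone[OF ab] by (simp add: in_hom_def)
    then have "\<exists>!h. in_hom D h (Dom D x) L \<and>
        (\<forall>j \<in> Obj pair_shape. h \<cdot> l j = (if j = 0 then x else y))"
      using lim unfolding is_limit_def by blast
    then show "\<exists>!h. in_hom D h (Dom D x) (Dom D (l 0)) \<and> h \<cdot> l 0 = x \<and> h \<cdot> l 1 = y"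
      by (simp add: pair_shape_def)
  qed simp_all
  then show "is_product D (l 0) (l 1) \<and> Dom D (l 0) = L \<and> Cod D (l 0) = a \<and> Cod D (l 1) = b" by simp
next
  assume p: "is_product D (l 0) (l 1) \<and> Dom D (l 0) = L \<and> Cod D (l 0) = a \<and> Cod D (l 1) = b"
  then have p': "is_product D (l 0) (l 1)" by simp
  note [simp] = is_productD[OF p']
  have [simp]: "L \<in> Obj D" using p Obj_simps(1)[of "l 0"] by simp
  show "is_limit pair_shape D (pair_diagram D a b) L l"
    unfolding is_limit_def
  proof (intro conjI allI impI)
    show "is_cone pair_shape D (pair_diagram D a b) L l"
      using p by (simp add: product_cone[OF ab] in_hom_def)
    fix M n assume c: "is_cone pair_shape D (pair_diagram D a b) M n"
    then have "M \<in> Obj D" unfolding is_cone_def by blast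
    then have n: "in_hom D (n 0) M a" "in_hom D (n 1) M b" using c product_cone[OF ab] by blast+
    then have "\<exists>!h. in_hom D h M (Dom D (l 0)) \<and> h \<cdot> l 0 = n 0 \<and> h \<cdot> l 1 = n 1"
      using p by (intro is_product_ex1[OF p']) simp_all
    then show "\<exists>!h. in_hom D h M L \<and> (\<forall>j \<in> Obj pair_shape. h \<cdot> l j = n j)"
      using p by (simp add: pair_shape_def)
  qed
qed

lemma cospan_cone:
  assumes "f \<in> Arr D" "g \<in> Arr D" "Cod D g = Cod D f" "L \<in> Obj D"
  shows "is_cone cospan_shape D (cospan_diagram D f g) L l \<longleftrightarrow>
    in_hom D (l 0) L (Dom D f) \<and> in_hom D (l 1) L (Dom D g) \<and> l 2 = l 0 \<cdot> f \<and> l 0 \<cdot> f = l 1 \<cdot> g"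
  using assms unfolding is_cone_def cospan_shape_def cospan_diagram_def in_hom_def by auto

lemma pullback_limit:
  assumes fg: "f \<in> Arr D" "g \<in> Arr D" "Cod D g = Cod D f"
  shows "is_limit cospan_shape D (cospan_diagram D f g) L l \<longleftrightarrow>
    is_pullback D (l 0) (l 1) f g \<and> Dom D (l 0) = L \<and> l 2 = l 0 \<cdot> f"
proof
  note [simp] = fg
  assume lim: "is_limit cospan_shape D (cospan_diagram D f g) L l"
  then have L: "L \<in> Obj D" and "is_cone cospan_shape D (cospan_diagram D f g) L l"
    unfolding is_limit_def is_cone_def by blast+
  then have l: "in_hom D (l 0) L (Dom D f)" "in_hom D (l 1) L (Dom D g)" and
    l2: "l 2 = l 0 \<cdot> f" "l 0 \<cdot> f = l 1 \<cdot> g" using cospan_cone[OF fg] by blast+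
  note [simp] = in_homD[OF l(1)] in_homD[OF l(2)]
  have "is_pullback D (l 0) (l 1) f g"
    unfolding is_pullback_def
  proof (intro conjI ballI impI)
    show "l 0 \<cdot> f = l 1 \<cdot> g" by fact
    fix x y assume xy: "x \<in> Arr D" "y \<in> Arr D"
      "Dom D x = Dom D y \<and> Cod D x = Dom D f \<and> Cod D y = Dom D g \<and> x \<cdot> f = y \<cdot> g"
    have "is_cone cospan_shape D (cospan_diagram D f g) (Dom D x)
        (\<lambda>j. if j = 0 then x else if j = 1 then y else x \<cdot> f)"
      using xy cospan_cone[OF fg] by (simp add: in_hom_def)
    then have "\<exists>!h. in_hom D h (Dom D x) L \<and>
        (\<forall>j \<in> Obj cospan_shape. h \<cdot> l j = (if j = 0 then x else if j = 1 then y else x \<cdot> f))"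
      using lim unfolding is_limit_def by blast
    then have 1: "\<exists>!h. in_hom D h (Dom D x) L \<and> h \<cdot> l 0 = x \<and> h \<cdot> l 1 = y \<and> h \<cdot> l 2 = x \<cdot> f"
      by (simp add: cospan_shape_def)
    \<comment> \<open>The leg of a cone at the vertex of the cospan is determined by the first leg,
      so two equations are enough.\<close>
    have "h \<cdot> l 2 = x \<cdot> f" if "in_hom D h (Dom D x) L" "h \<cdot> l 0 = x" for h
      using that cmp_eq_assoc1[OF that(2), of f] by (simp add: l2(1) in_hom_def)
    then show "\<exists>!h. in_hom D h (Dom D x) (Dom D (l 0)) \<and> h \<cdot> l 0 = x \<and> h \<cdot> l 1 = y"
      using 1 in_homD[OF l(1)] by (simp add: conj_commute cong: conj_cong)
  qed simp_all
  then show "is_pullback D (l 0) (l 1) f g \<and> Dom D (l 0) = L \<and> l 2 = l 0 \<cdot> f" using l2 by simp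
next
  assume p: "is_pullback D (l 0) (l 1) f g \<and> Dom D (l 0) = L \<and> l 2 = l 0 \<cdot> f"
  then have p': "is_pullback D (l 0) (l 1) f g" by simp
  note [simp] = is_pullbackD(1-8)[OF p']
  have [simp]: "L \<in> Obj D" using p Obj_simps(1)[of "l 0"] by simp
  show "is_limit cospan_shape D (cospan_diagram D f g) L l"
    unfolding is_limit_def
  proof (intro conjI allI impI)
    show "is_cone cospan_shape D (cospan_diagram D f g) L l"
      using p is_pullbackD(9)[OF p'] by (simp add: cospan_cone[OF fg] in_hom_def)
    fix M n assume c: "is_cone cospan_shape D (cospan_diagram D f g) M n"
    then have "M \<in> Obj D" unfolding is_cone_def by blast
    then have n: "in_hom D (n 0) M (Dom D f)" "in_hom D (n 1) M (Dom D g)"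
      "n 2 = n 0 \<cdot> f" "n 0 \<cdot> f = n 1 \<cdot> g" using c cospan_cone[OF fg] by blast+
    then obtain h where h: "in_hom D h M (Dom D (l 0))" "h \<cdot> l 0 = n 0" "h \<cdot> l 1 = n 1"
      using is_pullback_pair[OF p'] by blast
    show "\<exists>!h. in_hom D h M L \<and> (\<forall>j \<in> Obj cospan_shape. h \<cdot> l j = n j)"
    proof (rule ex1I[of _ h])
      show "in_hom D h M L \<and> (\<forall>j \<in> Obj cospan_shape. h \<cdot> l j = n j)"
        using h p cmp_eq_assoc1[OF h(2), of f] in_homD[OF h(1)] by (simp add: cospan_shape_def n(3))
      fix h' assume "in_hom D h' M L \<and> (\<forall>j \<in> Obj cospan_shape. h' \<cdot> l j = n j)"
      then show "h' = h"
        using h p by (intro jointly_monicD[OF pullback_jointly_monic[OF p'], of h' M h])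
          (simp_all add: cospan_shape_def)
    qed
  qed
qed

lemma lex_category_if_limits:
  assumes "has_finite_limits D"
  shows "lex_category D"
proof unfold_locales
  fix a b assume ab: "a \<in> Obj D" "b \<in> Obj D"
  then obtain L l where "is_limit pair_shape D (pair_diagram D a b) L l"
    using assms finite_pair_shape pair_diagram_functor[OF ab] unfolding has_finite_limits_def by blast
  then show "\<exists>p q. is_product D p q \<and> Cod D p = a \<and> Cod D q = b"
    unfolding product_limit[OF ab] by blast
next
  fix f g assume "f \<in> Arr D" "g \<in> Arr D" "Cod D f = Cod D g"
  then have fg: "f \<in> Arr D" "g \<in> Arr D" "Cod D g = Cod D f" by simp_all
  then obtain L l where "is_limit cospan_shape D (cospan_diagram D f g) L l"
    using assms finite_cospan_shape cospan_diagram_functor[OF fg] unfolding has_finite_limits_def by blast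
  then show "\<exists>p q. is_pullback D p q f g"
    unfolding pullback_limit[OF fg] by blast
qed

text \<open>Makes being monic a limit condition, which is preserved together with pullbacks.\<close>

lemma mono_iff_pullback:
  assumes "n \<in> Arr D"
  shows "is_mono D n \<longleftrightarrow> is_pullback D (ide D (Dom D n)) (ide D (Dom D n)) n n"
proof
  assume m: "is_mono D n"
  show "is_pullback D (ide D (Dom D n)) (ide D (Dom D n)) n n"
  proof (rule is_pullbackI)
    fix V x y assume xy: "in_hom D x V (Dom D n)" "in_hom D y V (Dom D n)" "x \<cdot> n = y \<cdot> n"
    have "x = y" by (rule is_monoD[OF m xy])
    then show "\<exists>h. in_hom D h V (Dom D (ide D (Dom D n))) \<and> h \<cdot> ide D (Dom D n) = x \<and> h \<cdot> ide D (Dom D n) = y"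
      using xy assms in_homD[OF xy(1)] by (intro exI[of _ x]) simp
  next
    show "jointly_monic D (ide D (Dom D n)) (ide D (Dom D n))"
      unfolding jointly_monic_def
    proof (intro conjI allI impI)
      fix V e e' assume a: "in_hom D e V (Dom D (ide D (Dom D n))) \<and> in_hom D e' V (Dom D (ide D (Dom D n)))
        \<and> e \<cdot> ide D (Dom D n) = e' \<cdot> ide D (Dom D n) \<and> e \<cdot> ide D (Dom D n) = e' \<cdot> ide D (Dom D n)"
      then have "e \<in> Arr D" "Cod D e = Dom D n" "e' \<in> Arr D" "Cod D e' = Dom D n"
        using assms by (auto dest: in_homD)
      then have "e \<cdot> ide D (Dom D n) = e" "e' \<cdot> ide D (Dom D n) = e'" by simp_all
      then show "e = e'" using a by metis
    qed (use assms in simp_all)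
  qed (use assms in simp_all)
next
  assume p: "is_pullback D (ide D (Dom D n)) (ide D (Dom D n)) n n"
  show "is_mono D n"
    unfolding is_mono_def
  proof (intro conjI ballI impI assms)
    fix x y assume xy: "x \<in> Arr D" "y \<in> Arr D"
      "Dom D x = Dom D y \<and> Cod D x = Dom D n \<and> Cod D y = Dom D n \<and> x \<cdot> n = y \<cdot> n"
    obtain h where h: "in_hom D h (Dom D x) (Dom D (ide D (Dom D n)))" "h \<cdot> ide D (Dom D n) = x"
        "h \<cdot> ide D (Dom D n) = y"
    proof (rule is_pullback_pair[OF p])
      show "in_hom D x (Dom D x) (Dom D n)" "in_hom D y (Dom D x) (Dom D n)" "x \<cdot> n = y \<cdot> n"
        using xy by (auto simp: in_hom_def)
    qed
    show "x = y" using h(2,3) by (rule trans[OF sym])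
  qed
qed

end

locale lex_functor = D: category D + E: category E
  for D :: "('o, 'm) cat" and E :: "('p, 'n) cat" +
  fixes G :: "('o, 'm, 'p, 'n) ftor"
  assumes G: "is_functor D E G" and G_lex: "preserves_finite_limits D E G"
begin

lemma G_obj [simp]: "a \<in> Obj D \<Longrightarrow> fobj G a \<in> Obj E"
  and G_ide [simp]: "a \<in> Obj D \<Longrightarrow> farr G (ide D a) = ide E (fobj G a)"
  and G_cmp [simp]: "f \<in> Arr D \<Longrightarrow> g \<in> Arr D \<Longrightarrow> Cod D f = Dom D g \<Longrightarrow>
     farr G (f \<cdot>\<^bsub>D\<^esub> g) = farr G f \<cdot>\<^bsub>E\<^esub> farr G g"
  using G unfolding is_functor_def by blast+

lemma G_arr [simp]:
  assumes "f \<in> Arr D"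
  shows "farr G f \<in> Arr E" "Dom E (farr G f) = fobj G (Dom D f)" "Cod E (farr G f) = fobj G (Cod D f)"
  using G assms unfolding is_functor_def in_hom_def by blast+

lemma G_hom: "in_hom D f a b \<Longrightarrow> in_hom E (farr G f) (fobj G a) (fobj G b)"
  by (auto simp: in_hom_def)

lemma G_product:
  assumes "is_product D p q" shows "is_product E (farr G p) (farr G q)"
proof -
  note p = is_productD[OF assms]
  let ?l = "\<lambda>j::nat. if j = 0 then p else q"
  let ?F = "pair_diagram D (Cod D p) (Cod D q)"
  have ob: "Cod D p \<in> Obj D" "Cod D q \<in> Obj D" using p by simp_all
  have "is_limit pair_shape D ?F (Dom D p) ?l"
    using assms by (simp add: D.product_limit[OF ob])
  then have "is_limit pair_shape E (ftor_comp ?F G) (fobj G (Dom D p)) (\<lambda>j. farr G (?l j))"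
    using G_lex finite_pair_shape D.pair_diagram_functor[OF ob] unfolding preserves_finite_limits_def
    by blast
  also have "ftor_comp ?F G = pair_diagram E (fobj G (Cod D p)) (fobj G (Cod D q))"
    using ob by (auto simp: ftor_comp_def pair_diagram_def)
  finally show ?thesis using ob by (simp add: E.product_limit)
qed

lemma G_pullback:
  assumes "is_pullback D p q f g" shows "is_pullback E (farr G p) (farr G q) (farr G f) (farr G g)"
proof -
  note p = is_pullbackD[OF assms]
  let ?l = "\<lambda>j::nat. if j = 0 then p else if j = 1 then q else p \<cdot>\<^bsub>D\<^esub> f"
  have "is_limit cospan_shape D (cospan_diagram D f g) (Dom D p) ?l"
    using assms by (simp add: D.pullback_limit[OF p(3,4,8)])
  then have "is_limit cospan_shape E (ftor_comp (cospan_diagram D f g) G) (fobj G (Dom D p)) (\<lambda>j. farr G (?l j))"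
    using G_lex finite_cospan_shape D.cospan_diagram_functor[OF p(3,4,8)]
    unfolding preserves_finite_limits_def by blast
  also have "ftor_comp (cospan_diagram D f g) G = cospan_diagram E (farr G f) (farr G g)"
    using p by (auto simp: ftor_comp_def cospan_diagram_def)
  finally show ?thesis using p by (simp add: E.pullback_limit)
qed

lemma G_mono:
  assumes "is_mono D n" shows "is_mono E (farr G n)"
proof -
  have n: "n \<in> Arr D" using assms unfolding is_mono_def by blast
  show ?thesis
    using G_pullback[of "ide D (Dom D n)" "ide D (Dom D n)" n n] assms n
    by (simp add: D.mono_iff_pullback E.mono_iff_pullback)
qed

text \<open>A factorisation is carried over, not reflected. This suffices because \<open>rel\<close>
  occurs only positively in \<open>dimg_data\<close>.\<close>

lemma G_rel:
  assumes "rel D n0 n1 x y" "n0 \<in> Arr D" "n1 \<in> Arr D" "Dom D n1 = Dom D n0" "x \<in> Arr D"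
  shows "rel E (farr G n0) (farr G n1) (farr G x) (farr G y)"
proof -
  obtain e where e: "in_hom D e (Dom D x) (Dom D n0)" "e \<cdot>\<^bsub>D\<^esub> n0 = x" "e \<cdot>\<^bsub>D\<^esub> n1 = y"
    using assms(1) unfolding rel_def by blast
  note [simp] = in_homD[OF e(1)] assms(2-5)
  show ?thesis
    by (rule relI[where e = "farr G e"])
      (simp_all add: in_hom_def e(2,3) G_cmp[symmetric] del: G_cmp)
qed

lemma G_iimg_data:
  assumes "iimg_data D e0 e1 f0 f1 k d" and [simp]: "e0 \<in> Arr D" "e1 \<in> Arr D" "Dom D e1 = Dom D e0"
    "f0 \<in> Arr D" "f1 \<in> Arr D" "Dom D f1 = Dom D f0"
  shows "iimg_data E (farr G e0) (farr G e1) (farr G f0) (farr G f1) (farr G k) (farr G d)"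
proof -
  obtain n c c' where d: "in_hom D d (Cod D f1) (Cod D e1)" and 1: "is_pullback D n c k f0"
    and 2: "is_pullback D (c \<cdot>\<^bsub>D\<^esub> f1) c' d e1" and 3: "c' \<cdot>\<^bsub>D\<^esub> e0 = n"
    using assms(1) unfolding iimg_data_def by blast
  have [simp]: "c \<in> Arr D" "Cod D c = Dom D f0" "c' \<in> Arr D" "Cod D c' = Dom D e0"
    using is_pullbackD[OF 1] is_pullbackD[OF 2] by simp_all
  show ?thesis
    unfolding iimg_data_def
  proof (intro conjI exI)
    show "is_pullback E (farr G n) (farr G c) (farr G k) (farr G f0)" by (rule G_pullback[OF 1])
    show "is_pullback E (farr G c \<cdot>\<^bsub>E\<^esub> farr G f1) (farr G c') (farr G d) (farr G e1)"
      using G_pullback[OF 2] by simp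
    show "farr G c' \<cdot>\<^bsub>E\<^esub> farr G e0 = farr G n" by (simp add: 3[symmetric])
    show "in_hom E (farr G d) (Cod E (farr G f1)) (Cod E (farr G e1))"
      using G_hom[OF d] by simp
  qed
qed

lemma G_meet_data:
  assumes "meet_data D e0 e1 f0 f1 k p0 p1 u"
    and [simp]: "e0 \<in> Arr D" "e1 \<in> Arr D" "Dom D e1 = Dom D e0"
    "f0 \<in> Arr D" "f1 \<in> Arr D" "Dom D f1 = Dom D f0" "k \<in> Arr D" "Dom D k = Cod D e0" "Cod D k = Cod D f0"
  shows "meet_data E (farr G e0) (farr G e1) (farr G f0) (farr G f1) (farr G k) (farr G p0) (farr G p1) (farr G u)"
proof -
  obtain p p' n c where 1: "is_product D p0 p1" "Cod D p0 = Cod D e1" "Cod D p1 = Cod D f1"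
    and 2: "is_pullback D p p' (e0 \<cdot>\<^bsub>D\<^esub> k) f0" and n: "in_hom D n (Dom D p) (Dom D p0)"
    and 3: "n \<cdot>\<^bsub>D\<^esub> p0 = p \<cdot>\<^bsub>D\<^esub> e1" "n \<cdot>\<^bsub>D\<^esub> p1 = p' \<cdot>\<^bsub>D\<^esub> f1"
    and 4: "is_pullback D n c u e1" "c \<cdot>\<^bsub>D\<^esub> e0 = p \<cdot>\<^bsub>D\<^esub> e0"
    using assms(1) unfolding meet_data_def by blast
  note [simp] = is_productD[OF 1(1)] 1(2,3) in_homD[OF n]
  have [simp]: "p \<in> Arr D" "p' \<in> Arr D" "Dom D p' = Dom D p" "Cod D p = Dom D e0" "Cod D p' = Dom D f0"
    "c \<in> Arr D" "Cod D c = Dom D e0"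
    using is_pullbackD[OF 2] is_pullbackD[OF 4(1)] by simp_all
  show ?thesis
    unfolding meet_data_def
  proof (intro conjI exI)
    show "is_product E (farr G p0) (farr G p1)" by (rule G_product[OF 1(1)])
    show "is_pullback E (farr G p) (farr G p') (farr G e0 \<cdot>\<^bsub>E\<^esub> farr G k) (farr G f0)"
      using G_pullback[OF 2] by simp
    show "in_hom E (farr G n) (Dom E (farr G p)) (Dom E (farr G p0))" using G_hom[OF n] by simp
    show "is_pullback E (farr G n) (farr G c) (farr G u) (farr G e1)" by (rule G_pullback[OF 4(1)])
    show "farr G n \<cdot>\<^bsub>E\<^esub> farr G p0 = farr G p \<cdot>\<^bsub>E\<^esub> farr G e1"
      "farr G n \<cdot>\<^bsub>E\<^esub> farr G p1 = farr G p' \<cdot>\<^bsub>E\<^esub> farr G f1"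
      "farr G c \<cdot>\<^bsub>E\<^esub> farr G e0 = farr G p \<cdot>\<^bsub>E\<^esub> farr G e0"
      using arg_cong[OF 3(1), of "farr G"] arg_cong[OF 3(2), of "farr G"] arg_cong[OF 4(2), of "farr G"]
      by simp_all
  qed simp_all
qed

text \<open>\<open>dimg\<close> quantifies over the stages of \<open>D\<close> and so says nothing
  about stages of \<open>E\<close>. The data consist of finitely many products, pullbacks, equations
  and factorisations, which the functor carries over one by one.\<close>

lemma G_dimg_data:
  assumes "dimg_data D e0 e1 f0 f1 k d"
    and [simp]: "e0 \<in> Arr D" "e1 \<in> Arr D" "Dom D e1 = Dom D e0"
    "f0 \<in> Arr D" "f1 \<in> Arr D" "Dom D f1 = Dom D f0" "k \<in> Arr D" "Dom D k = Cod D e0" "Cod D k = Cod D f0"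
  shows "dimg_data E (farr G e0) (farr G e1) (farr G f0) (farr G f1) (farr G k) (farr G d)"
proof -
  obtain p0 p1 u l v where d: "in_hom D d (Cod D e1) (Cod D f1)"
    and 1: "rel D f0 f1 (e0 \<cdot>\<^bsub>D\<^esub> k) (e1 \<cdot>\<^bsub>D\<^esub> d)" and 2: "meet_data D e0 e1 f0 f1 k p0 p1 u"
    and 3: "is_pullback D l v (u \<cdot>\<^bsub>D\<^esub> d) f1" and 4: "rel D f0 f1 (v \<cdot>\<^bsub>D\<^esub> f0) (l \<cdot>\<^bsub>D\<^esub> p1)"
    using assms(1) unfolding dimg_data_def by blast
  have p: "is_product D p0 p1" using 2 unfolding meet_data_def by blast
  have "u \<in> Arr D \<and> Cod D u = Cod D e1 \<and> Dom D u = Dom D p0"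
    using 2 unfolding meet_data_def by (metis in_homD(3) is_pullbackD(3,6,8))
  then have [simp]: "u \<in> Arr D" "Cod D u = Cod D e1" "Dom D u = Dom D p0" by blast+
  note [simp] = is_productD[OF p] in_homD[OF d]
  have [simp]: "l \<in> Arr D" "v \<in> Arr D" "Dom D v = Dom D l" "Cod D l = Dom D p0" "Cod D v = Dom D f0"
    using is_pullbackD[OF 3] by simp_all
  show ?thesis
    unfolding dimg_data_def
  proof (intro conjI exI)
    show "in_hom E (farr G d) (Cod E (farr G e1)) (Cod E (farr G f1))" using G_hom[OF d] by simp
    show "rel E (farr G f0) (farr G f1) (farr G e0 \<cdot>\<^bsub>E\<^esub> farr G k) (farr G e1 \<cdot>\<^bsub>E\<^esub> farr G d)"
      using G_rel[OF 1] by simp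
    show "meet_data E (farr G e0) (farr G e1) (farr G f0) (farr G f1) (farr G k) (farr G p0) (farr G p1) (farr G u)"
      by (rule G_meet_data[OF 2]) simp_all
    show "is_pullback E (farr G l) (farr G v) (farr G u \<cdot>\<^bsub>E\<^esub> farr G d) (farr G f1)"
      using G_pullback[OF 3] by simp
    show "rel E (farr G f0) (farr G f1) (farr G v \<cdot>\<^bsub>E\<^esub> farr G f0) (farr G l \<cdot>\<^bsub>E\<^esub> farr G p1)"
      using G_rel[OF 4] by simp
  qed
qed

end

section \<open>Uniqueness, composition and preservation of images\<close>

context power_category
begin

lemma power_arrows:
  assumes "is_power_object D q0 q1 m"
  shows "is_product D q0 q1" "is_mono D m" "Cod D m = Dom D q0" "m \<in> Arr D" "q0 \<in> Arr D"
    "q1 \<in> Arr D" "Dom D q1 = Dom D q0"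
proof -
  show *: "is_product D q0 q1" "is_mono D m" "Cod D m = Dom D q0"
    using assms unfolding is_power_object_def by blast+
  show "m \<in> Arr D" "q0 \<in> Arr D" "q1 \<in> Arr D" "Dom D q1 = Dom D q0"
    using * is_productD[OF *(1)] unfolding is_mono_def by blast+
qed

lemma direct_image_iff_dimg:
  assumes "is_power_object D q0 q1 m" "is_power_object D q0' q1' m'" "in_hom D k (Cod D q0) (Cod D q0')"
  shows "direct_image_arrows D q0 q1 m q0' q1' m' k d \<longleftrightarrow>
    dimg D (m \<cdot> q0) (m \<cdot> q1) (m' \<cdot> q0') (m' \<cdot> q1') k d"
proof -
  interpret pom: power_objects_map D q0 q1 m q0' q1' m' k
    using assms by unfold_locales
  show ?thesis by (rule pom.direct_image_iff)
qed

lemma inverse_image_iff_iimg: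
  assumes "is_power_object D q0 q1 m" "is_power_object D q0' q1' m'" "in_hom D k (Cod D q0) (Cod D q0')"
  shows "inverse_image_arrows D q0 q1 m q0' q1' m' k d \<longleftrightarrow>
    iimg D (m \<cdot> q0) (m \<cdot> q1) (m' \<cdot> q0') (m' \<cdot> q1') k d"
proof -
  interpret pom: power_objects_map D q0 q1 m q0' q1' m' k
    using assms by unfold_locales
  show ?thesis by (rule pom.inverse_image_iff)
qed

lemma direct_image_ex1:
  assumes po: "is_power_object D q0 q1 m" and po': "is_power_object D q0' q1' m'"
    and k: "in_hom D k (Cod D q0) (Cod D q0')"
  shows "\<exists>!d. direct_image_arrows D q0 q1 m q0' q1' m' k d"
    and "direct_image_arrows D q0 q1 m q0' q1' m' k d \<Longrightarrow> in_hom D d (Cod D q1) (Cod D q1')"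
proof -
  interpret pom: power_objects_map D q0 q1 m q0' q1' m' k
    using assms by unfold_locales
  show "\<exists>!d. direct_image_arrows D q0 q1 m q0' q1' m' k d"
    unfolding pom.direct_image_iff using pom.dimg_ex dimg_unique[OF pom.pm.lex pom.pm.pe pom.pm.pf] by blast
  show "direct_image_arrows D q0 q1 m q0' q1' m' k d \<Longrightarrow> in_hom D d (Cod D q1) (Cod D q1')"
    by (rule pom.direct_image_univ(1))
qed

lemma inverse_image_ex1:
  assumes po: "is_power_object D q0 q1 m" and po': "is_power_object D q0' q1' m'"
    and k: "in_hom D k (Cod D q0) (Cod D q0')"
  shows "\<exists>!d. inverse_image_arrows D q0 q1 m q0' q1' m' k d"
    and "inverse_image_arrows D q0 q1 m q0' q1' m' k d \<Longrightarrow> in_hom D d (Cod D q1') (Cod D q1)"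
proof -
  interpret pom: power_objects_map D q0 q1 m q0' q1' m' k
    using assms by unfold_locales
  obtain d0 where "iimg D (m \<cdot> q0) (m \<cdot> q1) (m' \<cdot> q0') (m' \<cdot> q1') k d0" by (rule pom.pm.obtain_iimg)
  then show "\<exists>!d. inverse_image_arrows D q0 q1 m q0' q1' m' k d"
    unfolding pom.inverse_image_iff using iimg_unique[OF pom.pm.lex pom.pm.pe pom.pm.pf] by blast
  show "inverse_image_arrows D q0 q1 m q0' q1' m' k d \<Longrightarrow> in_hom D d (Cod D q1') (Cod D q1)"
    unfolding pom.inverse_image_iff iimg_def by simp
qed

lemma direct_image_ide:
  assumes po: "is_power_object D q0 q1 m"
  shows "direct_image_arrows D q0 q1 m q0 q1 m (ide D (Cod D q0)) (ide D (Cod D q1))"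
proof -
  note [simp] = power_arrows[OF po]
  have h: "in_hom D (ide D (Cod D q0)) (Cod D q0) (Cod D q0)" by (simp add: in_hom_def)
  show ?thesis
    unfolding direct_image_iff_dimg[OF po po h]
    using dimg_ide[OF power_object_power_rel[OF po]] by simp
qed

lemma inverse_image_ide:
  assumes po: "is_power_object D q0 q1 m"
  shows "inverse_image_arrows D q0 q1 m q0 q1 m (ide D (Cod D q0)) (ide D (Cod D q1))"
proof -
  note [simp] = power_arrows[OF po]
  have h: "in_hom D (ide D (Cod D q0)) (Cod D q0) (Cod D q0)" by (simp add: in_hom_def)
  show ?thesis
    unfolding inverse_image_iff_iimg[OF po po h]
    using iimg_ide[OF power_object_power_rel[OF po]] by simp
qed

text \<open>Images compose because left adjoints do; the intermediate term is the inverse image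
  \<open>i\<close> along \<open>l\<close>, which exists in any category of this kind.\<close>

lemma direct_image_comp:
  assumes po: "is_power_object D q0 q1 m" and po': "is_power_object D q0' q1' m'"
    and po'': "is_power_object D q0'' q1'' m''"
    and k: "in_hom D k (Cod D q0) (Cod D q0')" and l: "in_hom D l (Cod D q0') (Cod D q0'')"
    and d: "direct_image_arrows D q0 q1 m q0' q1' m' k d"
    and e: "direct_image_arrows D q0' q1' m' q0'' q1'' m'' l e"
  shows "direct_image_arrows D q0 q1 m q0'' q1'' m'' (k \<cdot> l) (d \<cdot> e)"
proof -
  note [simp] = power_arrows[OF po] power_arrows[OF po'] power_arrows[OF po'']
  have kl: "in_hom D (k \<cdot> l) (Cod D q0) (Cod D q0'')" using k l by (simp add: in_hom_def)
  interpret pom: power_objects_map D q0' q1' m' q0'' q1'' m'' l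
    using po' po'' l by unfold_locales
  obtain i where i: "iimg D (m' \<cdot> q0') (m' \<cdot> q1') (m'' \<cdot> q0'') (m'' \<cdot> q1'') l i"
    by (rule pom.pm.obtain_iimg)
  show ?thesis
    unfolding direct_image_iff_dimg[OF po po'' kl]
    by (rule dimg_comp[OF power_rel_jm[OF power_object_power_rel[OF po]] pom.pm.je pom.pm.jf _ _
        direct_image_iff_dimg[OF po po' k, THEN iffD1, OF d]
        direct_image_iff_dimg[OF po' po'' l, THEN iffD1, OF e] i])
      (use k l in simp_all)
qed

lemma inverse_image_comp:
  assumes po: "is_power_object D q0 q1 m" and po': "is_power_object D q0' q1' m'"
    and po'': "is_power_object D q0'' q1'' m''"
    and k: "in_hom D k (Cod D q0) (Cod D q0')" and l: "in_hom D l (Cod D q0') (Cod D q0'')"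
    and d: "inverse_image_arrows D q0 q1 m q0' q1' m' k d"
    and e: "inverse_image_arrows D q0' q1' m' q0'' q1'' m'' l e"
  shows "inverse_image_arrows D q0 q1 m q0'' q1'' m'' (k \<cdot> l) (e \<cdot> d)"
proof -
  note [simp] = power_arrows[OF po] power_arrows[OF po'] power_arrows[OF po'']
  have kl: "in_hom D (k \<cdot> l) (Cod D q0) (Cod D q0'')" using k l by (simp add: in_hom_def)
  show ?thesis
    unfolding inverse_image_iff_iimg[OF po po'' kl]
    by (rule iimg_comp[OF power_rel_jm[OF power_object_power_rel[OF po]]
        power_rel_jm[OF power_object_power_rel[OF po']] power_rel_jm[OF power_object_power_rel[OF po'']] _ _
        inverse_image_iff_iimg[OF po po' k, THEN iffD1, OF d]
        inverse_image_iff_iimg[OF po' po'' l, THEN iffD1, OF e]])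
      (use k l in simp_all)
qed

end

locale logical_functor = lex_functor + D: power_category D + E: power_category E +
  assumes G_power: "preserves_power_objects D E G"
begin

lemma G_power_object:
  "is_power_object D q0 q1 m \<Longrightarrow> is_power_object E (farr G q0) (farr G q1) (farr G m)"
  using G_power unfolding preserves_power_objects_def by blast

text \<open>Leastness of an image is not a limit condition. The arrow \<open>d\<close> is therefore
  translated into adjoint data, carried over in this form, and recognised as a direct image again in
  \<open>E\<close>.\<close>

lemma G_direct_image:
  assumes po: "is_power_object D q0 q1 m" and po': "is_power_object D q0' q1' m'"
    and k: "in_hom D k (Cod D q0) (Cod D q0')"
    and d: "direct_image_arrows D q0 q1 m q0' q1' m' k d"
  shows "direct_image_arrows E (farr G q0) (farr G q1) (farr G m) (farr G q0') (farr G q1') (farr G m')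
    (farr G k) (farr G d)"
proof -
  interpret D: power_objects_map D q0 q1 m q0' q1' m' k
    using po po' k by unfold_locales
  interpret E: power_objects_map E "farr G q0" "farr G q1" "farr G m" "farr G q0'" "farr G q1'" "farr G m'" "farr G k"
    using G_power_object[OF po] G_power_object[OF po'] G_hom[OF k] D.power_arrows[OF po] D.power_arrows[OF po']
    by unfold_locales simp_all
  note D.power_arrows[OF po, simp] D.power_arrows[OF po', simp]
  have "dimg_data D (m \<cdot>\<^bsub>D\<^esub> q0) (m \<cdot>\<^bsub>D\<^esub> q1) (m' \<cdot>\<^bsub>D\<^esub> q0') (m' \<cdot>\<^bsub>D\<^esub> q1') k d"
    using d unfolding D.direct_image_iff D.pm.dimg_iff_data .
  from G_dimg_data[OF this] show ?thesis
    unfolding E.direct_image_iff E.pm.dimg_iff_data by simp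
qed

lemma G_inverse_image:
  assumes po: "is_power_object D q0 q1 m" and po': "is_power_object D q0' q1' m'"
    and k: "in_hom D k (Cod D q0) (Cod D q0')"
    and d: "inverse_image_arrows D q0 q1 m q0' q1' m' k d"
  shows "inverse_image_arrows E (farr G q0) (farr G q1) (farr G m) (farr G q0') (farr G q1') (farr G m')
    (farr G k) (farr G d)"
proof -
  interpret D: power_objects_map D q0 q1 m q0' q1' m' k
    using po po' k by unfold_locales
  interpret E: power_objects_map E "farr G q0" "farr G q1" "farr G m" "farr G q0'" "farr G q1'" "farr G m'" "farr G k"
    using G_power_object[OF po] G_power_object[OF po'] G_hom[OF k] D.power_arrows[OF po] D.power_arrows[OF po']
    by unfold_locales simp_all
  note D.power_arrows[OF po, simp] D.power_arrows[OF po', simp]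
  have "iimg_data D (m \<cdot>\<^bsub>D\<^esub> q0) (m \<cdot>\<^bsub>D\<^esub> q1) (m' \<cdot>\<^bsub>D\<^esub> q0') (m' \<cdot>\<^bsub>D\<^esub> q1') k d"
    using d unfolding D.inverse_image_iff D.pm.iimg_iff_data .
  from G_iimg_data[OF this] show ?thesis
    unfolding E.inverse_image_iff E.pm.iimg_iff_data by simp
qed

end

section \<open>Whiskering\<close>

lemma und_simps [simp]:
  "Obj (und C) = Ob C" "Arr (und C) = Mor C" "Dom (und C) = Src C" "Cod (und C) = Tgt C"
  "ide (und C) = Id1 C" "cmp (und C) = comp1 C"
  by (simp_all add: und_def)

lemma vert_simps [simp]:
  "Obj (vert C) = Mor C" "Arr (vert C) = Cell C" "Dom (vert C) = Dom2 C" "Cod (vert C) = Cod2 C"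
  "ide (vert C) = Id2 C" "cmp (vert C) = vcomp C"
  by (simp_all add: vert_def)

lemma in_morD: "in_mor C f A B \<Longrightarrow> f \<in> Mor C" "in_mor C f A B \<Longrightarrow> Src C f = A"
    "in_mor C f A B \<Longrightarrow> Tgt C f = B"
  by (simp_all add: in_mor_def)

lemma in_cellD: "in_cell C \<alpha> f g \<Longrightarrow> \<alpha> \<in> Cell C" "in_cell C \<alpha> f g \<Longrightarrow> Dom2 C \<alpha> = f"
    "in_cell C \<alpha> f g \<Longrightarrow> Cod2 C \<alpha> = g"
  by (simp_all add: in_cell_def)

context two_category
begin

sublocale U: category "und C" by (rule category_und)
sublocale V: category "vert C" by (rule category_vert)

lemma Mor_simps [simp]:
  "A \<in> Ob C \<Longrightarrow> Id1 C A \<in> Mor C" "A \<in> Ob C \<Longrightarrow> Src C (Id1 C A) = A" "A \<in> Ob C \<Longrightarrow> Tgt C (Id1 C A) = A"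
  "f \<in> Mor C \<Longrightarrow> Src C f \<in> Ob C" "f \<in> Mor C \<Longrightarrow> Tgt C f \<in> Ob C"
  using U.ide_simps U.Obj_simps by simp_all

lemma comp1_simps [simp]:
  assumes "f \<in> Mor C" "g \<in> Mor C" "Tgt C f = Src C g"
  shows "f \<bullet> g \<in> Mor C" "Src C (f \<bullet> g) = Src C f" "Tgt C (f \<bullet> g) = Tgt C g"
  using U.cmp_simps[of f g] assms by simp_all

lemma comp1_assoc [simp]:
  "f \<in> Mor C \<Longrightarrow> g \<in> Mor C \<Longrightarrow> h \<in> Mor C \<Longrightarrow> Tgt C f = Src C g \<Longrightarrow> Tgt C g = Src C h \<Longrightarrow>
     (f \<bullet> g) \<bullet> h = f \<bullet> (g \<bullet> h)"
  using U.cmp_assoc_simp[of f g h] by simp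

lemma comp1_Id [simp]:
  "f \<in> Mor C \<Longrightarrow> Src C f = A \<Longrightarrow> Id1 C A \<bullet> f = f" "f \<in> Mor C \<Longrightarrow> Tgt C f = A \<Longrightarrow> f \<bullet> Id1 C A = f"
  using U.ide_cmp_simp[of f A] U.cmp_ide_simp[of f A] by simp_all

lemma comp1_eq_assoc:
  assumes "f \<bullet> g = h \<bullet> k" "f \<in> Mor C" "g \<in> Mor C" "h \<in> Mor C" "k \<in> Mor C" "l \<in> Mor C"
    "Tgt C f = Src C g" "Tgt C h = Src C k" "Tgt C g = Src C l" "Tgt C k = Src C l"
  shows "f \<bullet> (g \<bullet> l) = h \<bullet> (k \<bullet> l)"
  using assms comp1_assoc by metis

lemma comp1_eq_assoc1:
  assumes "f \<bullet> g = h" "f \<in> Mor C" "g \<in> Mor C" "l \<in> Mor C" "Tgt C f = Src C g" "Tgt C g = Src C l"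
  shows "f \<bullet> (g \<bullet> l) = h \<bullet> l"
  using assms comp1_assoc by metis

lemma Cell_simps [simp]:
  "f \<in> Mor C \<Longrightarrow> Id2 C f \<in> Cell C" "f \<in> Mor C \<Longrightarrow> Dom2 C (Id2 C f) = f" "f \<in> Mor C \<Longrightarrow> Cod2 C (Id2 C f) = f"
  "\<alpha> \<in> Cell C \<Longrightarrow> Dom2 C \<alpha> \<in> Mor C" "\<alpha> \<in> Cell C \<Longrightarrow> Cod2 C \<alpha> \<in> Mor C"
  using V.ide_simps V.Obj_simps by simp_all

lemma Cod2_parallel [simp]:
  "\<alpha> \<in> Cell C \<Longrightarrow> Src C (Cod2 C \<alpha>) = Src C (Dom2 C \<alpha>)"
  "\<alpha> \<in> Cell C \<Longrightarrow> Tgt C (Cod2 C \<alpha>) = Tgt C (Dom2 C \<alpha>)"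
  using parallel by simp_all

lemma vcomp_simps [simp]:
  assumes "\<alpha> \<in> Cell C" "\<beta> \<in> Cell C" "Cod2 C \<alpha> = Dom2 C \<beta>"
  shows "\<alpha> \<odot> \<beta> \<in> Cell C" "Dom2 C (\<alpha> \<odot> \<beta>) = Dom2 C \<alpha>" "Cod2 C (\<alpha> \<odot> \<beta>) = Cod2 C \<beta>"
  using V.cmp_simps[of \<alpha> \<beta>] assms by simp_all

lemma vcomp_assoc [simp]:
  "\<alpha> \<in> Cell C \<Longrightarrow> \<beta> \<in> Cell C \<Longrightarrow> \<gamma> \<in> Cell C \<Longrightarrow> Cod2 C \<alpha> = Dom2 C \<beta> \<Longrightarrow> Cod2 C \<beta> = Dom2 C \<gamma> \<Longrightarrow>
     (\<alpha> \<odot> \<beta>) \<odot> \<gamma> = \<alpha> \<odot> (\<beta> \<odot> \<gamma>)"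
  using V.cmp_assoc_simp[of \<alpha> \<beta> \<gamma>] by simp

lemma vcomp_Id [simp]:
  "\<alpha> \<in> Cell C \<Longrightarrow> Dom2 C \<alpha> = f \<Longrightarrow> Id2 C f \<odot> \<alpha> = \<alpha>" "\<alpha> \<in> Cell C \<Longrightarrow> Cod2 C \<alpha> = f \<Longrightarrow> \<alpha> \<odot> Id2 C f = \<alpha>"
  using V.ide_cmp_simp[of \<alpha> f] V.cmp_ide_simp[of \<alpha> f] by simp_all

lemma vcomp_eq_assoc1:
  assumes "\<alpha> \<odot> \<beta> = \<gamma>" "\<alpha> \<in> Cell C" "\<beta> \<in> Cell C" "\<delta> \<in> Cell C" "Cod2 C \<alpha> = Dom2 C \<beta>" "Cod2 C \<beta> = Dom2 C \<delta>"
  shows "\<alpha> \<odot> (\<beta> \<odot> \<delta>) = \<gamma> \<odot> \<delta>"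
  using assms vcomp_assoc by metis

lemma lwhisker_simps [simp]:
  assumes "f \<in> Mor C" "\<alpha> \<in> Cell C" "Tgt C f = Src C (Dom2 C \<alpha>)"
  shows "f \<rhd> \<alpha> \<in> Cell C" "Dom2 C (f \<rhd> \<alpha>) = f \<bullet> Dom2 C \<alpha>" "Cod2 C (f \<rhd> \<alpha>) = f \<bullet> Cod2 C \<alpha>"
  using hcomp_cell[of "Id2 C f" \<alpha>] assms by (simp_all add: lwhisker_def hcomposable_def in_cell_def)

lemma rwhisker_simps [simp]:
  assumes "f \<in> Mor C" "\<alpha> \<in> Cell C" "Tgt C (Dom2 C \<alpha>) = Src C f"
  shows "\<alpha> \<lhd> f \<in> Cell C" "Dom2 C (\<alpha> \<lhd> f) = Dom2 C \<alpha> \<bullet> f" "Cod2 C (\<alpha> \<lhd> f) = Cod2 C \<alpha> \<bullet> f"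
  using hcomp_cell[of \<alpha> "Id2 C f"] assms by (simp_all add: rwhisker_def hcomposable_def in_cell_def)

lemma lwhisker_lwhisker [simp]:
  assumes "f \<in> Mor C" "g \<in> Mor C" "\<alpha> \<in> Cell C" "Tgt C f = Src C g" "Tgt C g = Src C (Dom2 C \<alpha>)"
  shows "f \<rhd> (g \<rhd> \<alpha>) = (f \<bullet> g) \<rhd> \<alpha>"
  using hcomp_assoc[of "Id2 C f" "Id2 C g" \<alpha>] hcomp_Id2[of f g] assms
  by (simp add: lwhisker_def hcomposable_def)

lemma rwhisker_rwhisker [simp]:
  assumes "f \<in> Mor C" "g \<in> Mor C" "\<alpha> \<in> Cell C" "Tgt C f = Src C g" "Tgt C (Dom2 C \<alpha>) = Src C f"
  shows "(\<alpha> \<lhd> f) \<lhd> g = \<alpha> \<lhd> (f \<bullet> g)"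
  using hcomp_assoc[of \<alpha> "Id2 C f" "Id2 C g"] hcomp_Id2[of f g] assms
  by (simp add: rwhisker_def hcomposable_def)

lemma lwhisker_rwhisker [simp]:
  assumes "f \<in> Mor C" "g \<in> Mor C" "\<alpha> \<in> Cell C" "Tgt C f = Src C (Dom2 C \<alpha>)" "Tgt C (Dom2 C \<alpha>) = Src C g"
  shows "(f \<rhd> \<alpha>) \<lhd> g = f \<rhd> (\<alpha> \<lhd> g)"
  using hcomp_assoc[of "Id2 C f" \<alpha> "Id2 C g"] assms
  by (simp add: rwhisker_def lwhisker_def hcomposable_def)

lemma lwhisker_Id2 [simp]:
  "f \<in> Mor C \<Longrightarrow> g \<in> Mor C \<Longrightarrow> Tgt C f = Src C g \<Longrightarrow> f \<rhd> Id2 C g = Id2 C (f \<bullet> g)"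
  "f \<in> Mor C \<Longrightarrow> g \<in> Mor C \<Longrightarrow> Tgt C f = Src C g \<Longrightarrow> Id2 C f \<lhd> g = Id2 C (f \<bullet> g)"
  using hcomp_Id2 by (simp_all add: lwhisker_def rwhisker_def)

lemma whisker_Id1 [simp]:
  "\<alpha> \<in> Cell C \<Longrightarrow> A = Src C (Dom2 C \<alpha>) \<Longrightarrow> Id1 C A \<rhd> \<alpha> = \<alpha>"
  "\<alpha> \<in> Cell C \<Longrightarrow> A = Tgt C (Dom2 C \<alpha>) \<Longrightarrow> \<alpha> \<lhd> Id1 C A = \<alpha>"
  using Id_hcomp hcomp_Id by (simp_all add: lwhisker_def rwhisker_def)

lemma lwhisker_vcomp:
  assumes "f \<in> Mor C" "\<alpha> \<in> Cell C" "\<beta> \<in> Cell C" "Cod2 C \<alpha> = Dom2 C \<beta>" "Tgt C f = Src C (Dom2 C \<alpha>)"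
  shows "f \<rhd> (\<alpha> \<odot> \<beta>) = (f \<rhd> \<alpha>) \<odot> (f \<rhd> \<beta>)"
proof -
  have "Src C (Dom2 C \<beta>) = Src C (Dom2 C \<alpha>)" using assms Cod2_parallel(1)[of \<alpha>] by simp
  then show ?thesis
    using interchange[of "Id2 C f" \<alpha> "Id2 C f" \<beta>] assms
    by (simp add: lwhisker_def hcomposable_def)
qed

lemma rwhisker_vcomp:
  assumes "f \<in> Mor C" "\<alpha> \<in> Cell C" "\<beta> \<in> Cell C" "Cod2 C \<alpha> = Dom2 C \<beta>" "Tgt C (Dom2 C \<alpha>) = Src C f"
  shows "(\<alpha> \<odot> \<beta>) \<lhd> f = (\<alpha> \<lhd> f) \<odot> (\<beta> \<lhd> f)"
proof -
  have "Tgt C (Dom2 C \<beta>) = Tgt C (Dom2 C \<alpha>)" using assms Cod2_parallel(2)[of \<alpha>] by simp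
  then show ?thesis
    using interchange[of \<alpha> "Id2 C f" \<beta> "Id2 C f"] assms
    by (simp add: rwhisker_def hcomposable_def)
qed

text \<open>Both composites are the horizontal composite of \<alpha> and \<beta>, by interchange
  with identities. Most naturality squares below are instances.\<close>

lemma whisker_exchange:
  assumes "\<alpha> \<in> Cell C" "\<beta> \<in> Cell C" "Tgt C (Dom2 C \<alpha>) = Src C (Dom2 C \<beta>)"
  shows "(\<alpha> \<lhd> Dom2 C \<beta>) \<odot> (Cod2 C \<alpha> \<rhd> \<beta>) = (Dom2 C \<alpha> \<rhd> \<beta>) \<odot> (\<alpha> \<lhd> Cod2 C \<beta>)"
  using interchange[of \<alpha> "Id2 C (Dom2 C \<beta>)" "Id2 C (Cod2 C \<alpha>)" \<beta>]
    interchange[of "Id2 C (Dom2 C \<alpha>)" \<beta> \<alpha> "Id2 C (Cod2 C \<beta>)"] assms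
  by (simp add: lwhisker_def rwhisker_def hcomposable_def)

end

subsection \<open>Hom categories\<close>

lemma hom_simps [simp]:
  "Obj (hom C A B) = {f \<in> Mor C. Src C f = A \<and> Tgt C f = B}"
  "Dom (hom C A B) = Dom2 C" "Cod (hom C A B) = Cod2 C" "ide (hom C A B) = Id2 C" "cmp (hom C A B) = vcomp C"
  by (auto simp: hom_def full_subcat_def subcat_def vert_def in_mor_def)

context two_category
begin

lemma hom_Arr [simp]:
  "\<alpha> \<in> Arr (hom C A B) \<longleftrightarrow> \<alpha> \<in> Cell C \<and> Src C (Dom2 C \<alpha>) = A \<and> Tgt C (Dom2 C \<alpha>) = B"
  by (auto simp: hom_def full_subcat_def subcat_def in_mor_def)

lemma in_hom_hom:
  "in_hom (hom C A B) \<alpha> f g \<longleftrightarrow> in_cell C \<alpha> f g \<and> Src C f = A \<and> Tgt C f = B"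
  by (auto simp: in_hom_def in_cell_def)

lemma category_hom: "category (hom C A B)"
  by unfold_locales (auto simp: in_hom_def)

lemma is_iso_vert:
  "is_iso (vert C) \<alpha> \<longleftrightarrow> \<alpha> \<in> Cell C \<and> (\<exists>\<beta>. in_cell C \<beta> (Cod2 C \<alpha>) (Dom2 C \<alpha>)
     \<and> \<alpha> \<odot> \<beta> = Id2 C (Dom2 C \<alpha>) \<and> \<beta> \<odot> \<alpha> = Id2 C (Cod2 C \<alpha>))"
  by (auto simp: is_iso_def inverse_arrows_def in_hom_def in_cell_def)

lemma is_iso_hom: "is_iso (hom C A B) \<alpha> \<longleftrightarrow> \<alpha> \<in> Arr (hom C A B) \<and> is_iso (vert C) \<alpha>"
  unfolding is_iso_vert by (auto simp: is_iso_def inverse_arrows_def in_hom_def in_cell_def)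

lemma is_iso_vertI:
  "in_cell C \<alpha> f g \<Longrightarrow> in_cell C \<beta> g f \<Longrightarrow> \<alpha> \<odot> \<beta> = Id2 C f \<Longrightarrow> \<beta> \<odot> \<alpha> = Id2 C g \<Longrightarrow> is_iso (vert C) \<alpha>"
  unfolding is_iso_vert by (auto simp: in_cell_def)

lemma is_iso_vertE:
  assumes "is_iso (vert C) \<alpha>" "in_cell C \<alpha> f g"
  obtains \<beta> where "in_cell C \<beta> g f" "\<alpha> \<odot> \<beta> = Id2 C f" "\<beta> \<odot> \<alpha> = Id2 C g"
  using assms unfolding is_iso_vert by (auto simp: in_cell_def)

lemma iso_rwhisker:
  assumes "is_iso (vert C) \<alpha>" "f \<in> Mor C" "Tgt C (Dom2 C \<alpha>) = Src C f"
  shows "is_iso (vert C) (\<alpha> \<lhd> f)"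
proof -
  have a: "in_cell C \<alpha> (Dom2 C \<alpha>) (Cod2 C \<alpha>)" using assms(1) by (simp add: is_iso_vert in_cell_def)
  obtain \<beta> where b: "in_cell C \<beta> (Cod2 C \<alpha>) (Dom2 C \<alpha>)" "\<alpha> \<odot> \<beta> = Id2 C (Dom2 C \<alpha>)" "\<beta> \<odot> \<alpha> = Id2 C (Cod2 C \<alpha>)"
    by (rule is_iso_vertE[OF assms(1) a])
  note [simp] = in_cellD[OF b(1)] assms(2,3) in_cellD(1)[OF a]
  show ?thesis
  proof (rule is_iso_vertI)
    show "in_cell C (\<alpha> \<lhd> f) (Dom2 C \<alpha> \<bullet> f) (Cod2 C \<alpha> \<bullet> f)" "in_cell C (\<beta> \<lhd> f) (Cod2 C \<alpha> \<bullet> f) (Dom2 C \<alpha> \<bullet> f)"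
      by (simp_all add: in_cell_def)
    show "(\<alpha> \<lhd> f) \<odot> (\<beta> \<lhd> f) = Id2 C (Dom2 C \<alpha> \<bullet> f)" "(\<beta> \<lhd> f) \<odot> (\<alpha> \<lhd> f) = Id2 C (Cod2 C \<alpha> \<bullet> f)"
      using b(2,3) by (simp_all add: rwhisker_vcomp[symmetric])
  qed
qed

lemma iso_cancel_left:
  assumes "is_iso (vert C) \<alpha>" "\<beta> \<in> Cell C" "\<gamma> \<in> Cell C" "Cod2 C \<alpha> = Dom2 C \<beta>" "Cod2 C \<alpha> = Dom2 C \<gamma>"
    "\<alpha> \<odot> \<beta> = \<alpha> \<odot> \<gamma>"
  shows "\<beta> = \<gamma>"
proof -
  have a: "in_cell C \<alpha> (Dom2 C \<alpha>) (Cod2 C \<alpha>)" using assms(1) by (simp add: is_iso_vert in_cell_def)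
  obtain \<delta> where b: "in_cell C \<delta> (Cod2 C \<alpha>) (Dom2 C \<alpha>)" "\<alpha> \<odot> \<delta> = Id2 C (Dom2 C \<alpha>)" "\<delta> \<odot> \<alpha> = Id2 C (Cod2 C \<alpha>)"
    by (rule is_iso_vertE[OF assms(1) a])
  have *: "\<delta> \<odot> (\<alpha> \<odot> \<xi>) = \<xi>" if "\<xi> \<in> Cell C" "Cod2 C \<alpha> = Dom2 C \<xi>" for \<xi>
  proof -
    have "\<delta> \<odot> (\<alpha> \<odot> \<xi>) = Id2 C (Cod2 C \<alpha>) \<odot> \<xi>"
      by (rule vcomp_eq_assoc1[OF b(3)]) (use in_cellD[OF a] in_cellD[OF b(1)] that in simp_all)
    then show ?thesis using that by simp
  qed
  show ?thesis using *[of \<beta>] *[of \<gamma>] assms by simp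
qed

lemma is_functor_pre:
  assumes "in_mor C h A' A"
  shows "is_functor (hom C A X) (hom C A' X) (pre C h)"
  using in_morD[OF assms] unfolding is_functor_def
  by (auto simp: pre_def in_hom_def lwhisker_vcomp)

lemma pre_simps [simp]: "fobj (pre C h) f = h \<bullet> f" "farr (pre C h) \<alpha> = h \<rhd> \<alpha>"
  by (simp_all add: pre_def)

lemma post_simps [simp]: "fobj (post C h) f = f \<bullet> h" "farr (post C h) \<alpha> = \<alpha> \<lhd> h"
  by (simp_all add: post_def)

end

section \<open>Cotensors\<close>

lemma ftor_restrict_simps [simp]:
  "fobj (ftor_restrict J F) = restrict (fobj F) (Obj J)"
  "farr (ftor_restrict J F) = restrict (farr F) (Arr J)"
  by (simp_all add: ftor_restrict_def)

lemma ftor_restrict_idem [simp]: "ftor_restrict J (ftor_restrict J F) = ftor_restrict J F"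
  by (simp add: ftor_restrict_def)

lemma ftor_eqI:
  assumes "ftor_restrict J F = F" "ftor_restrict J G = G"
    and "\<And>j. j \<in> Obj J \<Longrightarrow> fobj F j = fobj G j" "\<And>u. u \<in> Arr J \<Longrightarrow> farr F u = farr G u"
  shows "F = G"
proof -
  have "ftor_restrict J F = ftor_restrict J G"
    unfolding ftor_restrict_def using assms(3,4) by (simp add: restrict_def fun_eq_iff)
  then show ?thesis using assms(1,2) by simp
qed

lemma restrict_functor:
  assumes "category J"
  shows "is_functor J D (ftor_restrict J F) \<longleftrightarrow> is_functor J D F"
proof -
  interpret J: category J by fact
  show ?thesis unfolding is_functor_def by simp
qed

lemma fun_cat_simps [simp]:
  "Obj (fun_cat J D) = {F. is_functor J D F \<and> ftor_restrict J F = F}"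
  "Arr (fun_cat J D) = {(F, G, \<eta>). is_functor J D F \<and> ftor_restrict J F = F
     \<and> is_functor J D G \<and> ftor_restrict J G = G
     \<and> natural_transformation J D F G \<eta> \<and> \<eta> \<in> extensional (Obj J)}"
  "Dom (fun_cat J D) = (\<lambda>(F, G, \<eta>). F)" "Cod (fun_cat J D) = (\<lambda>(F, G, \<eta>). G)"
  "ide (fun_cat J D) = (\<lambda>F. (F, F, \<lambda>j \<in> Obj J. ide D (fobj F j)))"
  "cmp (fun_cat J D) = (\<lambda>(F, G, \<eta>) (G', H, \<theta>). (F, H, \<lambda>j \<in> Obj J. cmp D (\<eta> j) (\<theta> j)))"
  by (simp_all add: fun_cat_def)

lemma full_subcat_simps [simp]:
  "Obj (full_subcat D S) = S" "Arr (full_subcat D S) = {f \<in> Arr D. Dom D f \<in> S \<and> Cod D f \<in> S}"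
  "Dom (full_subcat D S) = Dom D" "Cod (full_subcat D S) = Cod D" "ide (full_subcat D S) = ide D"
  "cmp (full_subcat D S) = cmp D"
  by (simp_all add: full_subcat_def subcat_def)

lemma full_subcat_fun_cat: "full_subcat (fun_cat J D) (Obj (fun_cat J D)) = fun_cat J D"
  unfolding full_subcat_def subcat_def by (auto simp: fun_cat_def)

lemma diagram_of_simps [simp]:
  "fobj (diagram_of C J ev f) = (\<lambda>j \<in> Obj J. f \<bullet>\<^bsub>C\<^esub> fobj ev j)"
  "farr (diagram_of C J ev f) = (\<lambda>u \<in> Arr J. f \<rhd>\<^bsub>C\<^esub> farr ev u)"
  "ftor_restrict J (diagram_of C J ev f) = diagram_of C J ev f"
  by (simp_all add: diagram_of_def ftor_comp_def pre_def ftor_restrict_def)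

context two_category
begin

lemma hom_functorD:
  assumes "is_functor J (hom C A X) F"
  shows "j \<in> Obj J \<Longrightarrow> fobj F j \<in> Mor C" "j \<in> Obj J \<Longrightarrow> Src C (fobj F j) = A" "j \<in> Obj J \<Longrightarrow> Tgt C (fobj F j) = X"
    "u \<in> Arr J \<Longrightarrow> farr F u \<in> Cell C" "u \<in> Arr J \<Longrightarrow> Dom2 C (farr F u) = fobj F (Dom J u)"
    "u \<in> Arr J \<Longrightarrow> Cod2 C (farr F u) = fobj F (Cod J u)"
    "j \<in> Obj J \<Longrightarrow> farr F (ide J j) = Id2 C (fobj F j)"
    "u \<in> Arr J \<Longrightarrow> v \<in> Arr J \<Longrightarrow> Cod J u = Dom J v \<Longrightarrow> farr F (cmp J u v) = farr F u \<odot> farr F v"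
  using assms unfolding is_functor_def in_hom_def by (auto split: if_splits)

lemma diagram_functor:
  assumes J: "category J" and ev: "is_functor J (hom C XJ X) ev" and f: "in_mor C f A XJ"
  shows "is_functor J (hom C A X) (diagram_of C J ev f)"
proof -
  interpret J: category J by fact
  note [simp] = hom_functorD[OF ev] in_morD[OF f]
  show ?thesis
    unfolding is_functor_def by (simp add: in_hom_def lwhisker_vcomp)
qed

text \<open>An isomorphism of categories is reduced to existence and uniqueness, separately for
  morphisms and for 2-cells. The set \<open>S\<close> cuts out a full subcategory, so that the same
  lemma serves all diagrams of shape [2] and the stable relation diagrams.\<close>

lemma cotensor_iso:
  assumes J: "category J" and ev: "is_functor J (hom C XJ X) ev" and A: "A \<in> Ob C"
    and S: "S \<subseteq> Obj (fun_cat J (hom C A X))"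
    and dS: "\<And>f. in_mor C f A XJ \<Longrightarrow> diagram_of C J ev f \<in> S"
    and mor: "\<And>F. F \<in> S \<Longrightarrow> \<exists>f. in_mor C f A XJ \<and> diagram_of C J ev f = F"
    and inj: "\<And>f f'. in_mor C f A XJ \<Longrightarrow> in_mor C f' A XJ \<Longrightarrow> diagram_of C J ev f = diagram_of C J ev f' \<Longrightarrow> f = f'"
    and cell: "\<And>f f' \<eta>. in_mor C f A XJ \<Longrightarrow> in_mor C f' A XJ \<Longrightarrow>
      natural_transformation J (hom C A X) (diagram_of C J ev f) (diagram_of C J ev f') \<eta> \<Longrightarrow>
      \<exists>\<alpha>. in_cell C \<alpha> f f' \<and> (\<forall>j \<in> Obj J. \<alpha> \<lhd> fobj ev j = \<eta> j)"
    and cell_inj: "\<And>f f' \<alpha> \<alpha>'. in_mor C f A XJ \<Longrightarrow> in_mor C f' A XJ \<Longrightarrow> in_cell C \<alpha> f f' \<Longrightarrow>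
      in_cell C \<alpha>' f f' \<Longrightarrow> (\<forall>j \<in> Obj J. \<alpha> \<lhd> fobj ev j = \<alpha>' \<lhd> fobj ev j) \<Longrightarrow> \<alpha> = \<alpha>'"
  shows "cat_isomorphism (hom C A XJ) (full_subcat (fun_cat J (hom C A X)) S) (cotensor_functor C J ev)"
proof -
  interpret J: category J by fact
  note [simp] = hom_functorD[OF ev]
  let ?D = "diagram_of C J ev" and ?T = "cotensor_functor C J ev"
  have T [simp]: "fobj ?T = ?D"
    "farr ?T \<alpha> = (?D (Dom2 C \<alpha>), ?D (Cod2 C \<alpha>), \<lambda>j \<in> Obj J. \<alpha> \<lhd> fobj ev j)" for \<alpha>
    by (simp_all add: cotensor_functor_def)
  \<comment> \<open>Naturality of the components is the exchange law for \<alpha> and the 2-cells of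
    \<open>ev\<close>.\<close>
  have nat: "natural_transformation J (hom C A X) (?D (Dom2 C \<alpha>)) (?D (Cod2 C \<alpha>)) (\<lambda>j \<in> Obj J. \<alpha> \<lhd> fobj ev j)"
    if a: "\<alpha> \<in> Arr (hom C A XJ)" for \<alpha>
    unfolding natural_transformation_def
  proof (intro conjI ballI)
    fix j assume "j \<in> Obj J"
    then show "in_hom (hom C A X) ((\<lambda>j\<in>Obj J. \<alpha> \<lhd> fobj ev j) j) (fobj (?D (Dom2 C \<alpha>)) j) (fobj (?D (Cod2 C \<alpha>)) j)"
      using a by (simp add: in_hom_def)
  next
    fix u assume u: "u \<in> Arr J"
    show "farr (?D (Dom2 C \<alpha>)) u \<cdot>\<^bsub>hom C A X\<^esub> (\<lambda>j\<in>Obj J. \<alpha> \<lhd> fobj ev j) (Cod J u) =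
       (\<lambda>j\<in>Obj J. \<alpha> \<lhd> fobj ev j) (Dom J u) \<cdot>\<^bsub>hom C A X\<^esub> farr (?D (Cod2 C \<alpha>)) u"
      using whisker_exchange[of \<alpha> "farr ev u"] a u by simp
  qed
  have mS: "?D f \<in> S \<and> is_functor J (hom C A X) (?D f)" if "f \<in> Mor C" "Src C f = A" "Tgt C f = XJ" for f
    using dS[of f] diagram_functor[OF J ev, of f A] that by (simp add: in_mor_def)
  show ?thesis
    unfolding cat_isomorphism_def
  proof (intro conjI)
    show "is_functor (hom C A XJ) (full_subcat (fun_cat J (hom C A X)) S) ?T"
      unfolding is_functor_def
    proof (intro conjI ballI impI)
      fix f assume f: "f \<in> Obj (hom C A XJ)"
      then show "fobj ?T f \<in> Obj (full_subcat (fun_cat J (hom C A X)) S)" using mS by simp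
      show "farr ?T (ide (hom C A XJ) f) = ide (full_subcat (fun_cat J (hom C A X)) S) (fobj ?T f)"
        using f by (auto simp: fun_eq_iff restrict_def)
    next
      fix \<alpha> assume a: "\<alpha> \<in> Arr (hom C A XJ)"
      show "in_hom (full_subcat (fun_cat J (hom C A X)) S) (farr ?T \<alpha>) (fobj ?T (Dom (hom C A XJ) \<alpha>)) (fobj ?T (Cod (hom C A XJ) \<alpha>))"
        using a nat[OF a] mS by (simp add: in_hom_def)
    next
      fix \<alpha> \<beta> assume "\<alpha> \<in> Arr (hom C A XJ)" "\<beta> \<in> Arr (hom C A XJ)" "Cod (hom C A XJ) \<alpha> = Dom (hom C A XJ) \<beta>"
      then show "farr ?T (\<alpha> \<cdot>\<^bsub>hom C A XJ\<^esub> \<beta>) = farr ?T \<alpha> \<cdot>\<^bsub>full_subcat (fun_cat J (hom C A X)) S\<^esub> farr ?T \<beta>"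
        by (auto simp: fun_eq_iff restrict_def rwhisker_vcomp)
    qed
    show "bij_betw (fobj ?T) (Obj (hom C A XJ)) (Obj (full_subcat (fun_cat J (hom C A X)) S))"
      unfolding bij_betw_def
    proof
      show "inj_on (fobj ?T) (Obj (hom C A XJ))"
        using inj by (auto simp: inj_on_def in_mor_def)
      show "fobj ?T ` Obj (hom C A XJ) = Obj (full_subcat (fun_cat J (hom C A X)) S)"
      proof (intro equalityI subsetI)
        fix F assume "F \<in> fobj ?T ` Obj (hom C A XJ)"
        then show "F \<in> Obj (full_subcat (fun_cat J (hom C A X)) S)" using mS by auto
      next
        fix F assume "F \<in> Obj (full_subcat (fun_cat J (hom C A X)) S)"
        then obtain f where "in_mor C f A XJ" "?D f = F" using mor[of F] by auto
        then show "F \<in> fobj ?T ` Obj (hom C A XJ)" by (intro image_eqI[of _ _ f]) (simp_all add: in_mor_def)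
      qed
    qed
    show "bij_betw (farr ?T) (Arr (hom C A XJ)) (Arr (full_subcat (fun_cat J (hom C A X)) S))"
      unfolding bij_betw_def
    proof
      show "inj_on (farr ?T) (Arr (hom C A XJ))"
      proof (rule inj_onI)
        fix \<alpha> \<beta> assume ab: "\<alpha> \<in> Arr (hom C A XJ)" "\<beta> \<in> Arr (hom C A XJ)" "farr ?T \<alpha> = farr ?T \<beta>"
        \<comment> \<open>The ends are identified first, because \<open>cell_inj\<close> compares
          parallel 2-cells only.\<close>
        have 1: "Dom2 C \<alpha> = Dom2 C \<beta>" "Cod2 C \<alpha> = Cod2 C \<beta>"
          using inj[of "Dom2 C \<alpha>" "Dom2 C \<beta>"] inj[of "Cod2 C \<alpha>" "Cod2 C \<beta>"] ab by (simp_all add: in_mor_def)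
        have "(\<lambda>j\<in>Obj J. \<alpha> \<lhd> fobj ev j) = (\<lambda>j\<in>Obj J. \<beta> \<lhd> fobj ev j)" using ab(3) by simp
        then have 2: "\<alpha> \<lhd> fobj ev j = \<beta> \<lhd> fobj ev j" if "j \<in> Obj J" for j
          using that by (auto dest: fun_cong[of _ _ j])
        show "\<alpha> = \<beta>"
        proof (rule cell_inj[of "Dom2 C \<alpha>" "Cod2 C \<alpha>"])
          show "in_mor C (Dom2 C \<alpha>) A XJ" "in_mor C (Cod2 C \<alpha>) A XJ" "in_cell C \<alpha> (Dom2 C \<alpha>) (Cod2 C \<alpha>)"
            using ab(1) by (simp_all add: in_mor_def in_cell_def)
          show "in_cell C \<beta> (Dom2 C \<alpha>) (Cod2 C \<alpha>)" using ab(2) 1 by (simp add: in_cell_def)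
        qed (use 2 in blast)
      qed
      show "farr ?T ` Arr (hom C A XJ) = Arr (full_subcat (fun_cat J (hom C A X)) S)"
      proof (intro equalityI subsetI)
        fix x assume "x \<in> farr ?T ` Arr (hom C A XJ)"
        then show "x \<in> Arr (full_subcat (fun_cat J (hom C A X)) S)"
          using nat mS by auto
      next
        fix x assume x: "x \<in> Arr (full_subcat (fun_cat J (hom C A X)) S)"
        obtain F G \<eta> where x_eq: "x = (F, G, \<eta>)" by (cases x) auto
        with x have FG: "F \<in> S" "G \<in> S" and n: "natural_transformation J (hom C A X) F G \<eta>" "\<eta> \<in> extensional (Obj J)"
          by auto
        obtain f g where f: "in_mor C f A XJ" "?D f = F" and g: "in_mor C g A XJ" "?D g = G"
          using mor[OF FG(1)] mor[OF FG(2)] by blast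
        obtain \<alpha> where a: "in_cell C \<alpha> f g" "\<forall>j \<in> Obj J. \<alpha> \<lhd> fobj ev j = \<eta> j"
          using cell[OF f(1) g(1)] n f(2) g(2) by blast
        have "(\<lambda>j\<in>Obj J. \<alpha> \<lhd> fobj ev j) = \<eta>"
          using a(2) n(2) by (auto simp: fun_eq_iff restrict_def extensional_def)
        then have "x = farr ?T \<alpha>" using a(1) f g by (simp add: x_eq in_cell_def)
        then show "x \<in> farr ?T ` Arr (hom C A XJ)"
          using a(1) f g by (auto simp: in_cell_def in_mor_def)
      qed
    qed
  qed
qed

lemma cotensor_mor:
  assumes c: "is_cotensor C J X XJ ev" and A: "A \<in> Ob C"
    and F: "is_functor J (hom C A X) F" "ftor_restrict J F = F"
  shows "\<exists>!f. in_mor C f A XJ \<and> diagram_of C J ev f = F"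
proof -
  have b: "bij_betw (diagram_of C J ev) (Obj (hom C A XJ)) (Obj (fun_cat J (hom C A X)))"
    using c A unfolding is_cotensor_def cat_isomorphism_def cotensor_functor_def by simp
  have "F \<in> Obj (fun_cat J (hom C A X))" using F by simp
  then obtain f where "f \<in> Obj (hom C A XJ)" "diagram_of C J ev f = F"
  proof -
    have "F \<in> diagram_of C J ev ` Obj (hom C A XJ)" using b \<open>F \<in> Obj (fun_cat J (hom C A X))\<close> by (metis bij_betw_def)
    then show thesis using that by blast
  qed
  then have f: "in_mor C f A XJ" "diagram_of C J ev f = F" by (simp_all add: in_mor_def)
  have "inj_on (diagram_of C J ev) (Obj (hom C A XJ))" using b by (rule bij_betw_imp_inj_on)
  then have "g = f" if "in_mor C g A XJ" "diagram_of C J ev g = F" for g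
    using f that by (auto dest!: inj_onD simp: in_mor_def)
  then show ?thesis using f by blast
qed

lemma cotensor_cell:
  assumes J: "category J" and c: "is_cotensor C J X XJ ev"
    and f: "in_mor C f A XJ" and g: "in_mor C g A XJ"
    and n: "natural_transformation J (hom C A X) (diagram_of C J ev f) (diagram_of C J ev g) \<eta>"
  shows "\<exists>!\<alpha>. in_cell C \<alpha> f g \<and> (\<forall>j \<in> Obj J. \<alpha> \<lhd> fobj ev j = \<eta> j)"
proof -
  interpret J: category J by fact
  let ?T = "cotensor_functor C J ev"
  have A: "A \<in> Ob C" using Mor_simps(4)[of f] in_morD[OF f] by simp
  have ev: "is_functor J (hom C XJ X) ev" using c unfolding is_cotensor_def by blast
  have bo: "bij_betw (diagram_of C J ev) (Obj (hom C A XJ)) (Obj (fun_cat J (hom C A X)))"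
    and b: "bij_betw (farr ?T) (Arr (hom C A XJ)) (Arr (fun_cat J (hom C A X)))"
    using c A unfolding is_cotensor_def cat_isomorphism_def by (simp_all add: cotensor_functor_def)
  have T: "farr ?T \<alpha> = (diagram_of C J ev (Dom2 C \<alpha>), diagram_of C J ev (Cod2 C \<alpha>), \<lambda>j \<in> Obj J. \<alpha> \<lhd> fobj ev j)" for \<alpha>
    by (simp add: cotensor_functor_def)
  let ?x = "(diagram_of C J ev f, diagram_of C J ev g, restrict \<eta> (Obj J))"
  have "natural_transformation J (hom C A X) (diagram_of C J ev f) (diagram_of C J ev g) (restrict \<eta> (Obj J))"
    using n unfolding natural_transformation_def by simp
  then have "?x \<in> Arr (fun_cat J (hom C A X))"
    using diagram_functor[OF J ev f] diagram_functor[OF J ev g] by simp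
  then have "?x \<in> farr ?T ` Arr (hom C A XJ)" by (simp only: bij_betw_imp_surj_on[OF b])
  then obtain \<alpha> where a: "\<alpha> \<in> Arr (hom C A XJ)" "farr ?T \<alpha> = ?x" by (elim imageE) (rule that, assumption, erule sym)
  have inj: "x = y" if "in_mor C x A XJ" "in_mor C y A XJ" "diagram_of C J ev x = diagram_of C J ev y" for x y
    by (rule inj_onD[OF bij_betw_imp_inj_on[OF bo]]) (use that in \<open>simp_all add: in_mor_def\<close>)
  have ac: "in_cell C \<alpha> f g"
    using a inj[of "Dom2 C \<alpha>" f] inj[of "Cod2 C \<alpha>" g] f g by (simp add: T in_cell_def in_mor_def)
  have "(\<lambda>j \<in> Obj J. \<alpha> \<lhd> fobj ev j) = restrict \<eta> (Obj J)" using a by (simp add: T)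
  then have ae: "\<forall>j \<in> Obj J. \<alpha> \<lhd> fobj ev j = \<eta> j" by (metis restrict_apply')
  show ?thesis
  proof (rule ex1I[of _ \<alpha>])
    show "in_cell C \<alpha> f g \<and> (\<forall>j \<in> Obj J. \<alpha> \<lhd> fobj ev j = \<eta> j)" using ac ae by blast
    fix \<beta> assume be: "in_cell C \<beta> f g \<and> (\<forall>j \<in> Obj J. \<beta> \<lhd> fobj ev j = \<eta> j)"
    have "(\<lambda>j \<in> Obj J. \<beta> \<lhd> fobj ev j) = (\<lambda>j \<in> Obj J. \<alpha> \<lhd> fobj ev j)"
      using be ae by (auto simp: restrict_def fun_eq_iff)
    then have "farr ?T \<beta> = farr ?T \<alpha>" using be ac by (simp add: T in_cell_def)
    moreover have "\<beta> \<in> Arr (hom C A XJ)" using be f g by (auto simp: in_cell_def in_mor_def)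
    ultimately show "\<beta> = \<alpha>" using inj_onD[OF bij_betw_imp_inj_on[OF b]] a(1) by blast
  qed
qed

end

subsection \<open>Arrow objects\<close>

lemma preorder_cat_simps [simp]:
  "Obj (preorder_cat S R) = S" "Arr (preorder_cat S R) = {(i, j). i \<in> S \<and> j \<in> S \<and> (i, j) \<in> R}"
  "Dom (preorder_cat S R) = fst" "Cod (preorder_cat S R) = snd" "ide (preorder_cat S R) = (\<lambda>i. (i, i))"
  "cmp (preorder_cat S R) = (\<lambda>(i, j) (j', k). (i, k))"
  by (simp_all add: preorder_cat_def)

lemma category_preorder_cat:
  assumes "\<And>i. i \<in> S \<Longrightarrow> (i, i) \<in> R" "trans R"
  shows "category (preorder_cat S R)"
  by unfold_locales (use assms in \<open>auto simp: in_hom_def dest: transD\<close>)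

lemma category_ord_cat: "category (ord_cat k)"
  unfolding ord_cat_def by (rule category_preorder_cat) (auto simp: trans_def)

lemma ord_cat_simps [simp]:
  "Obj (ord_cat k) = {0..k}" "Arr (ord_cat k) = {(i, j). j \<le> k \<and> i \<le> j}"
  "Dom (ord_cat k) = fst" "Cod (ord_cat k) = snd" "ide (ord_cat k) = (\<lambda>i. (i, i))"
  "cmp (ord_cat k) = (\<lambda>(i, j) (j', k). (i, k))"
  by (auto simp: ord_cat_def)

text \<open>The cotensor with [1] unfolded: a functor on [1] is a single 2-cell, and a natural
  transformation is a commuting square. Inserters and the cotensor with [2] are built from this
  form.\<close>

definition arrow_object :: "('o, 'm, 'c) twocat \<Rightarrow> 'o \<Rightarrow> 'o \<Rightarrow> 'c \<Rightarrow> bool" where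
  "arrow_object C X XA d \<longleftrightarrow> d \<in> Cell C \<and> Src C (Dom2 C d) = XA \<and> Tgt C (Dom2 C d) = X
   \<and> (\<forall>\<alpha> \<in> Cell C. Tgt C (Dom2 C \<alpha>) = X \<longrightarrow>
        (\<exists>!h. in_mor C h (Src C (Dom2 C \<alpha>)) XA \<and> h \<rhd>\<^bsub>C\<^esub> d = \<alpha>))
   \<and> (\<forall>A h h' \<beta>0 \<beta>1. in_mor C h A XA \<and> in_mor C h' A XA
        \<and> in_cell C \<beta>0 (h \<bullet>\<^bsub>C\<^esub> Dom2 C d) (h' \<bullet>\<^bsub>C\<^esub> Dom2 C d)
        \<and> in_cell C \<beta>1 (h \<bullet>\<^bsub>C\<^esub> Cod2 C d) (h' \<bullet>\<^bsub>C\<^esub> Cod2 C d)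
        \<and> \<beta>0 \<odot>\<^bsub>C\<^esub> (h' \<rhd>\<^bsub>C\<^esub> d) = (h \<rhd>\<^bsub>C\<^esub> d) \<odot>\<^bsub>C\<^esub> \<beta>1 \<longrightarrow>
        (\<exists>!\<beta>. in_cell C \<beta> h h' \<and> \<beta> \<lhd>\<^bsub>C\<^esub> Dom2 C d = \<beta>0 \<and> \<beta> \<lhd>\<^bsub>C\<^esub> Cod2 C d = \<beta>1))"

lemma ord1_cases: "(i, j) \<in> Arr (ord_cat 1) \<Longrightarrow> (i, j) = (0, 0) \<or> (i, j) = (0, 1) \<or> (i, j) = (1, 1)"
  by auto

context two_category
begin

text \<open>The arrow (0, 1) has both objects as its ends, and the two other arrows are identities,
  so its value determines the functor.\<close>

lemma ord1_functor_eq: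
  assumes ev: "is_functor (ord_cat 1) (hom C XA X) ev" and h: "in_mor C h A XA"
    and F: "is_functor (ord_cat 1) (hom C A X) F" "ftor_restrict (ord_cat 1) F = F"
  shows "diagram_of C (ord_cat 1) ev h = F \<longleftrightarrow> h \<rhd> farr ev (0, 1) = farr F (0, 1)"
proof
  assume e: "h \<rhd> farr ev (0, 1) = farr F (0, 1)"
  note [simp] = hom_functorD(1-6)[OF ev] in_morD[OF h]
  have [simp]: "fobj F 0 = h \<bullet> fobj ev 0" "fobj F 1 = h \<bullet> fobj ev 1"
    using arg_cong[OF e, of "Dom2 C"] arg_cong[OF e, of "Cod2 C"] hom_functorD(5,6)[OF F(1), of "(0,1)"] by simp_all
  show "diagram_of C (ord_cat 1) ev h = F"
  proof (rule ftor_eqI[OF _ F(2)])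
    fix j assume "j \<in> Obj (ord_cat 1)"
    then have "j = 0 \<or> j = 1" by auto
    then show "fobj (diagram_of C (ord_cat 1) ev h) j = fobj F j" by auto
  next
    fix u assume u: "u \<in> Arr (ord_cat 1)"
    then have "u = (0, 0) \<or> u = (0, 1) \<or> u = (1, 1)" using ord1_cases by (cases u) auto
    then show "farr (diagram_of C (ord_cat 1) ev h) u = farr F u"
      using e hom_functorD(7)[OF F(1), of 0] hom_functorD(7)[OF F(1), of 1]
        hom_functorD(7)[OF ev, of 0] hom_functorD(7)[OF ev, of 1]
      by auto
  qed simp
qed auto

lemma cotensor_arrow_object:
  assumes c: "is_cotensor C (ord_cat 1) X XA ev"
  shows "arrow_object C X XA (farr ev (0, 1))"
    and "Dom2 C (farr ev (0, 1)) = fobj ev 0" "Cod2 C (farr ev (0, 1)) = fobj ev 1"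
proof -
  let ?d = "farr ev (0, 1)"
  have ev: "is_functor (ord_cat 1) (hom C XA X) ev" and ob: "X \<in> Ob C" "XA \<in> Ob C"
    using c unfolding is_cotensor_def by blast+
  note [simp] = hom_functorD(1-6)[OF ev]
  show d: "Dom2 C ?d = fobj ev 0" "Cod2 C ?d = fobj ev 1" by simp_all
  show "arrow_object C X XA ?d"
    unfolding arrow_object_def
  proof (intro conjI ballI allI impI)
    fix \<alpha> assume [simp]: "\<alpha> \<in> Cell C" "Tgt C (Dom2 C \<alpha>) = X"
    define F where "F = ftor_restrict (ord_cat 1)
      \<lparr>fobj = (\<lambda>j. if j = 0 then Dom2 C \<alpha> else Cod2 C \<alpha>),
       farr = (\<lambda>u. if u = (0, 0) then Id2 C (Dom2 C \<alpha>) else if u = (1, 1) then Id2 C (Cod2 C \<alpha>) else \<alpha>)\<rparr>"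
    let ?A = "Src C (Dom2 C \<alpha>)"
    have F: "is_functor (ord_cat 1) (hom C ?A X) F"
      unfolding F_def restrict_functor[OF category_ord_cat] is_functor_def
      by (auto simp: in_hom_def)
    have Fr: "ftor_restrict (ord_cat 1) F = F" by (simp add: F_def)
    have "\<exists>!h. in_mor C h ?A XA \<and> diagram_of C (ord_cat 1) ev h = F"
      by (rule cotensor_mor[OF c _ F Fr]) simp
    moreover have "farr F (0, 1) = \<alpha>" by (simp add: F_def)
    ultimately show "\<exists>!h. in_mor C h ?A XA \<and> h \<rhd> ?d = \<alpha>"
      using ord1_functor_eq[OF ev _ F Fr] by (simp cong: conj_cong)
  next
    fix A h h' \<beta>0 \<beta>1
    assume "in_mor C h A XA \<and> in_mor C h' A XA
        \<and> in_cell C \<beta>0 (h \<bullet> Dom2 C ?d) (h' \<bullet> Dom2 C ?d) \<and> in_cell C \<beta>1 (h \<bullet> Cod2 C ?d) (h' \<bullet> Cod2 C ?d)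
        \<and> \<beta>0 \<odot> (h' \<rhd> ?d) = (h \<rhd> ?d) \<odot> \<beta>1"
    then have h: "in_mor C h A XA" "in_mor C h' A XA" and b0: "in_cell C \<beta>0 (h \<bullet> fobj ev 0) (h' \<bullet> fobj ev 0)"
      and b1: "in_cell C \<beta>1 (h \<bullet> fobj ev 1) (h' \<bullet> fobj ev 1)" and e: "\<beta>0 \<odot> (h' \<rhd> ?d) = (h \<rhd> ?d) \<odot> \<beta>1"
      by simp_all
    note [simp] = in_morD[OF h(1)] in_morD[OF h(2)] in_cellD[OF b0] in_cellD[OF b1]
    have "natural_transformation (ord_cat 1) (hom C A X) (diagram_of C (ord_cat 1) ev h) (diagram_of C (ord_cat 1) ev h')
       (\<lambda>j. if j = 0 then \<beta>0 else \<beta>1)"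
      unfolding natural_transformation_def
    proof (intro conjI ballI)
      fix j assume "j \<in> Obj (ord_cat 1)"
      then have "j = 0 \<or> j = 1" by auto
      then show "in_hom (hom C A X) (if j = 0 then \<beta>0 else \<beta>1) (fobj (diagram_of C (ord_cat 1) ev h) j) (fobj (diagram_of C (ord_cat 1) ev h') j)"
        by (auto simp: in_hom_def)
    next
      fix u assume u: "u \<in> Arr (ord_cat 1)"
      then have "u = (0, 0) \<or> u = (0, 1) \<or> u = (1, 1)" using ord1_cases by (cases u) auto
      then show "farr (diagram_of C (ord_cat 1) ev h) u \<cdot>\<^bsub>hom C A X\<^esub> (if Cod (ord_cat 1) u = 0 then \<beta>0 else \<beta>1) =
        (if Dom (ord_cat 1) u = 0 then \<beta>0 else \<beta>1) \<cdot>\<^bsub>hom C A X\<^esub> farr (diagram_of C (ord_cat 1) ev h') u"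
        using e hom_functorD(7)[OF ev, of 0] hom_functorD(7)[OF ev, of 1] by auto
    qed
    from cotensor_cell[OF category_ord_cat c h this]
    have *: "\<exists>!\<alpha>. in_cell C \<alpha> h h' \<and> (\<forall>j \<in> Obj (ord_cat 1). \<alpha> \<lhd> fobj ev j = (if j = 0 then \<beta>0 else \<beta>1))" .
    have **: "(\<forall>j \<in> Obj (ord_cat 1). P j) \<longleftrightarrow> P 0 \<and> P 1" for P
    proof -
      have "Obj (ord_cat 1) = {0, 1}" by auto
      then show ?thesis by simp
    qed
    show "\<exists>!\<beta>. in_cell C \<beta> h h' \<and> \<beta> \<lhd> Dom2 C ?d = \<beta>0 \<and> \<beta> \<lhd> Cod2 C ?d = \<beta>1"
      using *[unfolded **] by simp
  qed simp_all
qed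

end

section \<open>Inserters and equifiers\<close>

text \<open>A strict product with its isomorphism of hom-categories spelt out as unique existence of
  morphisms and of 2-cells; inserters and equifiers are put in the same form.\<close>

definition prod2 :: "('o, 'm, 'c) twocat \<Rightarrow> 'm \<Rightarrow> 'm \<Rightarrow> bool" where
  "prod2 C p q \<longleftrightarrow> p \<in> Mor C \<and> q \<in> Mor C \<and> Src C q = Src C p
   \<and> (\<forall>A f g. in_mor C f A (Tgt C p) \<and> in_mor C g A (Tgt C q) \<longrightarrow>
        (\<exists>!h. in_mor C h A (Src C p) \<and> h \<bullet>\<^bsub>C\<^esub> p = f \<and> h \<bullet>\<^bsub>C\<^esub> q = g))
   \<and> (\<forall>A h h' \<alpha> \<beta>. in_mor C h A (Src C p) \<and> in_mor C h' A (Src C p)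
        \<and> in_cell C \<alpha> (h \<bullet>\<^bsub>C\<^esub> p) (h' \<bullet>\<^bsub>C\<^esub> p) \<and> in_cell C \<beta> (h \<bullet>\<^bsub>C\<^esub> q) (h' \<bullet>\<^bsub>C\<^esub> q) \<longrightarrow>
        (\<exists>!\<gamma>. in_cell C \<gamma> h h' \<and> \<gamma> \<lhd>\<^bsub>C\<^esub> p = \<alpha> \<and> \<gamma> \<lhd>\<^bsub>C\<^esub> q = \<beta>))"

definition inserter :: "('o, 'm, 'c) twocat \<Rightarrow> 'm \<Rightarrow> 'm \<Rightarrow> 'm \<Rightarrow> 'c \<Rightarrow> bool" where
  "inserter C f g j l \<longleftrightarrow> j \<in> Mor C \<and> Tgt C j = Src C f \<and> in_cell C l (j \<bullet>\<^bsub>C\<^esub> f) (j \<bullet>\<^bsub>C\<^esub> g)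
   \<and> (\<forall>A h \<sigma>. in_mor C h A (Src C f) \<and> in_cell C \<sigma> (h \<bullet>\<^bsub>C\<^esub> f) (h \<bullet>\<^bsub>C\<^esub> g) \<longrightarrow>
        (\<exists>!k. in_mor C k A (Src C j) \<and> k \<bullet>\<^bsub>C\<^esub> j = h \<and> k \<rhd>\<^bsub>C\<^esub> l = \<sigma>))
   \<and> (\<forall>A k k' \<tau>. in_mor C k A (Src C j) \<and> in_mor C k' A (Src C j)
        \<and> in_cell C \<tau> (k \<bullet>\<^bsub>C\<^esub> j) (k' \<bullet>\<^bsub>C\<^esub> j)
        \<and> (\<tau> \<lhd>\<^bsub>C\<^esub> f) \<odot>\<^bsub>C\<^esub> (k' \<rhd>\<^bsub>C\<^esub> l) = (k \<rhd>\<^bsub>C\<^esub> l) \<odot>\<^bsub>C\<^esub> (\<tau> \<lhd>\<^bsub>C\<^esub> g) \<longrightarrow>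
        (\<exists>!\<gamma>. in_cell C \<gamma> k k' \<and> \<gamma> \<lhd>\<^bsub>C\<^esub> j = \<tau>))"

text \<open>A whole set of parallel pairs is equified at once. The inclusion of an equifier is fully
  faithful on 2-cells, so unlike for an inserter no equation is asked of \<tau>.\<close>

definition equifier :: "('o, 'm, 'c) twocat \<Rightarrow> 'o \<Rightarrow> ('c \<times> 'c) set \<Rightarrow> 'm \<Rightarrow> bool" where
  "equifier C B S j \<longleftrightarrow> j \<in> Mor C \<and> Tgt C j = B \<and> (\<forall>(\<alpha>, \<beta>) \<in> S. j \<rhd>\<^bsub>C\<^esub> \<alpha> = j \<rhd>\<^bsub>C\<^esub> \<beta>)
   \<and> (\<forall>A h. in_mor C h A B \<and> (\<forall>(\<alpha>, \<beta>) \<in> S. h \<rhd>\<^bsub>C\<^esub> \<alpha> = h \<rhd>\<^bsub>C\<^esub> \<beta>) \<longrightarrow>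
        (\<exists>!k. in_mor C k A (Src C j) \<and> k \<bullet>\<^bsub>C\<^esub> j = h))
   \<and> (\<forall>A k k' \<tau>. in_mor C k A (Src C j) \<and> in_mor C k' A (Src C j)
        \<and> in_cell C \<tau> (k \<bullet>\<^bsub>C\<^esub> j) (k' \<bullet>\<^bsub>C\<^esub> j) \<longrightarrow>
        (\<exists>!\<gamma>. in_cell C \<gamma> k k' \<and> \<gamma> \<lhd>\<^bsub>C\<^esub> j = \<tau>))"

context two_category
begin

lemma is_functor_post:
  assumes "in_mor C f X Y"
  shows "is_functor (hom C A X) (hom C A Y) (post C f)"
  using in_morD[OF assms] unfolding is_functor_def
  by (auto simp: in_hom_def rwhisker_vcomp)

lemma isofibrationI:
  assumes f: "f \<in> Mor C"
    and "\<And>x v. x \<in> Mor C \<Longrightarrow> Tgt C x = Src C f \<Longrightarrow> v \<in> Cell C \<Longrightarrow> is_iso (vert C) v \<Longrightarrow> Dom2 C v = x \<bullet> f \<Longrightarrow>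
      \<exists>u. is_iso (vert C) u \<and> Dom2 C u = x \<and> u \<lhd> f = v"
  shows "isofibration C f"
  unfolding isofibration_def isofibration_functor_def
proof (intro conjI ballI allI impI f)
  fix A assume "A \<in> Ob C"
  show "is_functor (hom C A (Src C f)) (hom C A (Tgt C f)) (post C f)"
    by (rule is_functor_post) (simp add: in_mor_def f)
  fix x v assume x: "x \<in> Obj (hom C A (Src C f))"
    and v: "is_iso (hom C A (Tgt C f)) v \<and> Dom (hom C A (Tgt C f)) v = fobj (post C f) x"
  then have "v \<in> Cell C" "is_iso (vert C) v" "Dom2 C v = x \<bullet> f" by (simp_all add: is_iso_hom)
  then obtain u where u: "is_iso (vert C) u" "Dom2 C u = x" "u \<lhd> f = v"
    using assms(2)[of x v] x by auto
  then show "\<exists>u. is_iso (hom C A (Src C f)) u \<and> Dom (hom C A (Src C f)) u = x \<and> farr (post C f) u = v"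
    using x by (intro exI[of _ u]) (auto simp: is_iso_hom is_iso_vert)
qed

lemma pullback_functor_simps:
  "fobj (pair_functor (post C p) (post C q)) h = (h \<bullet> p, h \<bullet> q)"
  "farr (pair_functor (post C p) (post C q)) \<gamma> = (\<gamma> \<lhd> p, \<gamma> \<lhd> q)"
  by (simp_all add: pair_functor_def)

lemma strict_pullbackD:
  assumes "strict_pullback C p q f g"
  shows "p \<in> Mor C" "q \<in> Mor C" "f \<in> Mor C" "g \<in> Mor C" "Src C q = Src C p" "Tgt C p = Src C f"
    "Tgt C q = Src C g" "Tgt C g = Tgt C f" "p \<bullet> f = q \<bullet> g"
  using assms unfolding strict_pullback_def by simp_all

lemma strict_pullback_mor:
  assumes pb: "strict_pullback C p q f g"
    and x: "in_mor C x A (Src C f)" and y: "in_mor C y A (Src C g)" and xy: "x \<bullet> f = y \<bullet> g"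
  shows "\<exists>!h. in_mor C h A (Src C p) \<and> h \<bullet> p = x \<and> h \<bullet> q = y"
proof -
  let ?F = "pair_functor (post C p) (post C q)"
  have A: "A \<in> Ob C" using Mor_simps(4)[of x] in_morD[OF x] by simp
  have "bij_betw (fobj ?F) (Obj (hom C A (Src C p)))
     (Obj (fibre_product_cat (hom C A (Src C f)) (hom C A (Src C g)) (post C f) (post C g)))"
    using pb A unfolding strict_pullback_def cat_isomorphism_def by blast
  then have b: "bij_betw (fobj ?F) (Obj (hom C A (Src C p)))
     {(x, y). x \<in> Obj (hom C A (Src C f)) \<and> y \<in> Obj (hom C A (Src C g)) \<and> x \<bullet> f = y \<bullet> g}"
    by (simp add: fibre_product_cat_def subcat_def)
  have "(x, y) \<in> {(x, y). x \<in> Obj (hom C A (Src C f)) \<and> y \<in> Obj (hom C A (Src C g)) \<and> x \<bullet> f = y \<bullet> g}"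
    using in_morD[OF x] in_morD[OF y] xy by simp
  then have "(x, y) \<in> fobj ?F ` Obj (hom C A (Src C p))" by (simp only: bij_betw_imp_surj_on[OF b])
  then obtain h where h: "h \<in> Obj (hom C A (Src C p))" "(x, y) = fobj ?F h" by (rule imageE)
  show ?thesis
  proof (rule ex1I[of _ h])
    show "in_mor C h A (Src C p) \<and> h \<bullet> p = x \<and> h \<bullet> q = y"
      using h by (simp add: pullback_functor_simps in_mor_def)
    fix k assume "in_mor C k A (Src C p) \<and> k \<bullet> p = x \<and> k \<bullet> q = y"
    then show "k = h"
      using h by (intro inj_onD[OF bij_betw_imp_inj_on[OF b]]) (simp_all add: pullback_functor_simps in_mor_def)
  qed
qed

lemma strict_pullback_cell:
  assumes pb: "strict_pullback C p q f g"
    and h: "in_mor C h A (Src C p)" and h': "in_mor C h' A (Src C p)"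
    and \<alpha>: "in_cell C \<alpha> (h \<bullet> p) (h' \<bullet> p)" and \<beta>: "in_cell C \<beta> (h \<bullet> q) (h' \<bullet> q)"
    and e: "\<alpha> \<lhd> f = \<beta> \<lhd> g"
  shows "\<exists>!\<gamma>. in_cell C \<gamma> h h' \<and> \<gamma> \<lhd> p = \<alpha> \<and> \<gamma> \<lhd> q = \<beta>"
proof -
  note [simp] = strict_pullbackD(1-8)[OF pb] in_morD[OF h] in_morD[OF h']
  let ?F = "pair_functor (post C p) (post C q)"
  have A: "A \<in> Ob C" using Mor_simps(4)[of h] by simp
  have "bij_betw (farr ?F) (Arr (hom C A (Src C p)))
     (Arr (fibre_product_cat (hom C A (Src C f)) (hom C A (Src C g)) (post C f) (post C g)))"
    using pb A unfolding strict_pullback_def cat_isomorphism_def by blast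
  then have b: "bij_betw (farr ?F) (Arr (hom C A (Src C p)))
     {(x, y). x \<in> Arr (hom C A (Src C f)) \<and> y \<in> Arr (hom C A (Src C g)) \<and> x \<lhd> f = y \<lhd> g}"
    by (simp add: fibre_product_cat_def subcat_def)
  have "(\<alpha>, \<beta>) \<in> {(x, y). x \<in> Arr (hom C A (Src C f)) \<and> y \<in> Arr (hom C A (Src C g)) \<and> x \<lhd> f = y \<lhd> g}"
    using in_cellD[OF \<alpha>] in_cellD[OF \<beta>] e by simp
  then have "(\<alpha>, \<beta>) \<in> farr ?F ` Arr (hom C A (Src C p))" by (simp only: bij_betw_imp_surj_on[OF b])
  then obtain \<gamma> where g: "\<gamma> \<in> Arr (hom C A (Src C p))" "(\<alpha>, \<beta>) = farr ?F \<gamma>" by (rule imageE)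
  have g': "\<gamma> \<in> Cell C" "Src C (Dom2 C \<gamma>) = A" "Tgt C (Dom2 C \<gamma>) = Src C p" "\<gamma> \<lhd> p = \<alpha>" "\<gamma> \<lhd> q = \<beta>"
    using g by (simp_all add: pullback_functor_simps)
  note [simp] = g'(1-3)
  have uniq: "k = k'" if "in_mor C k A (Src C p)" "in_mor C k' A (Src C p)" "k \<bullet> p = k' \<bullet> p" "k \<bullet> q = k' \<bullet> q" for k k'
  proof -
    note [simp] = in_morD[OF that(1)] in_morD[OF that(2)]
    have "(k \<bullet> p) \<bullet> f = (k \<bullet> q) \<bullet> g" using strict_pullbackD(9)[OF pb] by simp
    then have "\<exists>!m. in_mor C m A (Src C p) \<and> m \<bullet> p = k \<bullet> p \<and> m \<bullet> q = k \<bullet> q"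
      by (intro strict_pullback_mor[OF pb]) (simp_all add: in_mor_def)
    then show ?thesis using that by metis
  qed
  have "Dom2 C \<gamma> = h"
    by (rule uniq)
      (use arg_cong[OF g'(4), of "Dom2 C"] arg_cong[OF g'(5), of "Dom2 C"] in_cellD[OF \<alpha>] in_cellD[OF \<beta>] in \<open>simp_all add: in_mor_def\<close>)
  moreover have "Cod2 C \<gamma> = h'"
    by (rule uniq)
      (use arg_cong[OF g'(4), of "Cod2 C"] arg_cong[OF g'(5), of "Cod2 C"] in_cellD[OF \<alpha>] in_cellD[OF \<beta>] in \<open>simp_all add: in_mor_def\<close>)
  ultimately have gc: "in_cell C \<gamma> h h'" by (simp add: in_cell_def)
  show ?thesis
  proof (rule ex1I[of _ \<gamma>])
    show "in_cell C \<gamma> h h' \<and> \<gamma> \<lhd> p = \<alpha> \<and> \<gamma> \<lhd> q = \<beta>" using gc g' by blast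
    fix \<delta> assume "in_cell C \<delta> h h' \<and> \<delta> \<lhd> p = \<alpha> \<and> \<delta> \<lhd> q = \<beta>"
    then show "\<delta> = \<gamma>"
      using g(1) g'(4,5)
      by (intro inj_onD[OF bij_betw_imp_inj_on[OF b]]) (simp_all add: pullback_functor_simps in_cell_def)
  qed
qed

lemma prod2D:
  assumes "prod2 C p q"
  shows "p \<in> Mor C" "q \<in> Mor C" "Src C q = Src C p"
  using assms unfolding prod2_def by blast+

lemma prod2_mor:
  assumes "prod2 C p q" "in_mor C f A (Tgt C p)" "in_mor C g A (Tgt C q)"
  obtains h where "in_mor C h A (Src C p)" "h \<bullet> p = f" "h \<bullet> q = g"
  using assms unfolding prod2_def by blast

lemma prod2_mor_eq:
  assumes "prod2 C p q" "in_mor C h A (Src C p)" "in_mor C h' A (Src C p)" "h \<bullet> p = h' \<bullet> p" "h \<bullet> q = h' \<bullet> q"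
  shows "h = h'"
proof -
  have "in_mor C (h \<bullet> p) A (Tgt C p)" "in_mor C (h \<bullet> q) A (Tgt C q)"
    using in_morD[OF assms(2)] prod2D[OF assms(1)] by (simp_all add: in_mor_def)
  then have "\<exists>!m. in_mor C m A (Src C p) \<and> m \<bullet> p = h \<bullet> p \<and> m \<bullet> q = h \<bullet> q"
    using assms(1) unfolding prod2_def by blast
  then show ?thesis using assms(2-5) by metis
qed

lemma prod2_cell:
  assumes "prod2 C p q" "in_mor C h A (Src C p)" "in_mor C h' A (Src C p)"
    "in_cell C \<alpha> (h \<bullet> p) (h' \<bullet> p)" "in_cell C \<beta> (h \<bullet> q) (h' \<bullet> q)"
  shows "\<exists>!\<gamma>. in_cell C \<gamma> h h' \<and> \<gamma> \<lhd> p = \<alpha> \<and> \<gamma> \<lhd> q = \<beta>"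
  using assms unfolding prod2_def by blast

lemma prod2_cell_eq:
  assumes p: "prod2 C p q" and \<gamma>: "in_cell C \<gamma> h h'" and \<delta>: "in_cell C \<delta> h h'" and h: "in_mor C h A (Src C p)"
    and e: "\<gamma> \<lhd> p = \<delta> \<lhd> p" "\<gamma> \<lhd> q = \<delta> \<lhd> q"
  shows "\<gamma> = \<delta>"
proof -
  note [simp] = prod2D[OF p] in_cellD[OF \<gamma>] in_morD[OF h]
  have h': "in_mor C h' A (Src C p)"
    using Cod2_parallel[of \<gamma>] Cell_simps(5)[of \<gamma>] by (simp add: in_mor_def)
  note [simp] = in_morD[OF h']
  have "\<exists>!\<xi>. in_cell C \<xi> h h' \<and> \<xi> \<lhd> p = \<gamma> \<lhd> p \<and> \<xi> \<lhd> q = \<gamma> \<lhd> q"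
    by (rule prod2_cell[OF p h h']) (simp_all add: in_cell_def)
  then show ?thesis using \<gamma> \<delta> e by metis
qed

lemma arrow_objectD:
  assumes "arrow_object C X XA d"
  shows "d \<in> Cell C" "Src C (Dom2 C d) = XA" "Tgt C (Dom2 C d) = X"
  using assms unfolding arrow_object_def by blast+

lemma arrow_object_mor:
  assumes "arrow_object C X XA d" "\<alpha> \<in> Cell C" "Tgt C (Dom2 C \<alpha>) = X"
  obtains h where "in_mor C h (Src C (Dom2 C \<alpha>)) XA" "h \<rhd> d = \<alpha>"
  using assms unfolding arrow_object_def by blast

lemma arrow_object_mor_eq:
  assumes a: "arrow_object C X XA d" and h: "in_mor C h A XA" "in_mor C h' A XA" and e: "h \<rhd> d = h' \<rhd> d"
  shows "h = h'"
proof -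
  note [simp] = arrow_objectD[OF a] in_morD[OF h(1)]
  have "\<exists>!k. in_mor C k (Src C (Dom2 C (h \<rhd> d))) XA \<and> k \<rhd> d = h \<rhd> d"
  proof -
    have "h \<rhd> d \<in> Cell C" "Tgt C (Dom2 C (h \<rhd> d)) = X" by simp_all
    then show ?thesis using a unfolding arrow_object_def by blast
  qed
  moreover have "Src C (Dom2 C (h \<rhd> d)) = A" by simp
  ultimately show ?thesis using h e by metis
qed

lemma arrow_object_cell:
  assumes "arrow_object C X XA d" "in_mor C h A XA" "in_mor C h' A XA"
    "in_cell C \<beta>0 (h \<bullet> Dom2 C d) (h' \<bullet> Dom2 C d)" "in_cell C \<beta>1 (h \<bullet> Cod2 C d) (h' \<bullet> Cod2 C d)"
    "\<beta>0 \<odot> (h' \<rhd> d) = (h \<rhd> d) \<odot> \<beta>1"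
  shows "\<exists>!\<beta>. in_cell C \<beta> h h' \<and> \<beta> \<lhd> Dom2 C d = \<beta>0 \<and> \<beta> \<lhd> Cod2 C d = \<beta>1"
  using assms unfolding arrow_object_def by blast

lemma arrow_object_cell_eq:
  assumes a: "arrow_object C X XA d" and \<gamma>: "in_cell C \<gamma> h h'" and \<delta>: "in_cell C \<delta> h h'" and h: "in_mor C h A XA"
    and e: "\<gamma> \<lhd> Dom2 C d = \<delta> \<lhd> Dom2 C d" "\<gamma> \<lhd> Cod2 C d = \<delta> \<lhd> Cod2 C d"
  shows "\<gamma> = \<delta>"
proof -
  note [simp] = arrow_objectD[OF a] in_cellD[OF \<gamma>] in_morD[OF h]
  have h': "in_mor C h' A XA"
    using Cod2_parallel[of \<gamma>] Cell_simps(5)[of \<gamma>] by (simp add: in_mor_def)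
  note [simp] = in_morD[OF h']
  have "\<exists>!\<xi>. in_cell C \<xi> h h' \<and> \<xi> \<lhd> Dom2 C d = \<gamma> \<lhd> Dom2 C d \<and> \<xi> \<lhd> Cod2 C d = \<gamma> \<lhd> Cod2 C d"
    by (rule arrow_object_cell[OF a h h'])
      (use whisker_exchange[of \<gamma> d] in \<open>simp_all add: in_cell_def\<close>)
  then show ?thesis using \<gamma> \<delta> e by metis
qed

end

locale pita_category = two_category +
  assumes pita: "pita C"
begin

lemma obtain_arrow_object:
  assumes "X \<in> Ob C"
  obtains XA d where "arrow_object C X XA d"
proof -
  obtain XA ev where "is_cotensor C (ord_cat 1) X XA ev" using pita assms unfolding pita_def by blast
  then show thesis using cotensor_arrow_object(1) that by blast
qed

lemma obtain_strict_pullback: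
  assumes "isofibration C f" "g \<in> Mor C" "Tgt C g = Tgt C f"
  obtains p q where "strict_pullback C p q f g"
proof -
  have "f \<in> Mor C" using assms(1) unfolding isofibration_def by blast
  then show thesis using pita assms that unfolding pita_def by metis
qed

text \<open>The product is the pullback over the terminal object. It is available because a morphism
  to a terminal object has only identity 2-cells to lift and hence is an isofibration.\<close>

lemma obtain_prod2:
  assumes X: "X \<in> Ob C" and Y: "Y \<in> Ob C"
  obtains p q where "prod2 C p q" "Tgt C p = X" "Tgt C q = Y"
proof -
  obtain T where T: "strict_terminal C T" using pita unfolding pita_def by blast
  have tc: "\<alpha> = \<beta>" if "A \<in> Ob C" "\<alpha> \<in> Arr (hom C A T)" "\<beta> \<in> Arr (hom C A T)" for A \<alpha> \<beta>
    using T that unfolding strict_terminal_def by (auto simp: in_mor_def)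
  have tm: "\<exists>!f. in_mor C f A T" if "A \<in> Ob C" for A
    using T that unfolding strict_terminal_def by (simp add: in_mor_def)
  obtain s t where s: "in_mor C s X T" and t: "in_mor C t Y T" using tm[OF X] tm[OF Y] by blast
  note [simp] = in_morD[OF s] in_morD[OF t]
  have "isofibration C s"
  proof (rule isofibrationI)
    fix x v assume x: "x \<in> Mor C" "Tgt C x = Src C s" and v: "v \<in> Cell C" "is_iso (vert C) v" "Dom2 C v = x \<bullet> s"
    have "v = Id2 C (x \<bullet> s)"
      by (rule tc[of "Src C x"]) (use x v in simp_all)
    moreover have "is_iso (vert C) (Id2 C x)"
      by (rule is_iso_vertI[of _ x x "Id2 C x"]) (use x in \<open>simp_all add: in_cell_def\<close>)
    ultimately show "\<exists>u. is_iso (vert C) u \<and> Dom2 C u = x \<and> u \<lhd> s = v"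
      using x by (intro exI[of _ "Id2 C x"]) simp
  qed simp
  then obtain p q where pb: "strict_pullback C p q s t"
    by (rule obtain_strict_pullback[of s t]) simp_all
  note [simp] = strict_pullbackD(1-8)[OF pb]
  have "prod2 C p q"
    unfolding prod2_def
  proof (intro conjI allI impI)
    fix A f g assume fg: "in_mor C f A (Tgt C p) \<and> in_mor C g A (Tgt C q)"
    then have [simp]: "f \<in> Mor C" "Src C f = A" "Tgt C f = X" "g \<in> Mor C" "Src C g = A" "Tgt C g = Y"
      by (simp_all add: in_mor_def)
    have "A \<in> Ob C" using Mor_simps(4)[of f] by simp
    from tm[OF this] have "f \<bullet> s = g \<bullet> t" by (auto simp: in_mor_def)
    then show "\<exists>!h. in_mor C h A (Src C p) \<and> h \<bullet> p = f \<and> h \<bullet> q = g"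
      by (intro strict_pullback_mor[OF pb]) (simp_all add: in_mor_def)
  next
    fix A h h' \<alpha> \<beta> assume as: "in_mor C h A (Src C p) \<and> in_mor C h' A (Src C p)
        \<and> in_cell C \<alpha> (h \<bullet> p) (h' \<bullet> p) \<and> in_cell C \<beta> (h \<bullet> q) (h' \<bullet> q)"
    then have [simp]: "h \<in> Mor C" "Src C h = A" "Tgt C h = Src C p" "h' \<in> Mor C" "Src C h' = A" "Tgt C h' = Src C p"
      "\<alpha> \<in> Cell C" "Dom2 C \<alpha> = h \<bullet> p" "\<beta> \<in> Cell C" "Dom2 C \<beta> = h \<bullet> q"
      by (simp_all add: in_mor_def in_cell_def)
    have "A \<in> Ob C" using Mor_simps(4)[of h] by simp
    from tc[OF this, of "\<alpha> \<lhd> s" "\<beta> \<lhd> t"] have "\<alpha> \<lhd> s = \<beta> \<lhd> t" by simp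
    then show "\<exists>!\<gamma>. in_cell C \<gamma> h h' \<and> \<gamma> \<lhd> p = \<alpha> \<and> \<gamma> \<lhd> q = \<beta>"
      using as by (intro strict_pullback_cell[OF pb]) blast+
  qed simp_all
  then show thesis using that by simp
qed

end

context two_category
begin

text \<open>The inverses of the two sides of a commuting square form a commuting square again, and
  this square is the inverse.\<close>

lemma arrow_object_reflects_iso:
  assumes a: "arrow_object C X XA d" and h: "in_mor C h A XA" and \<beta>: "in_cell C \<beta> h h'"
    and i0: "is_iso (vert C) (\<beta> \<lhd> Dom2 C d)" and i1: "is_iso (vert C) (\<beta> \<lhd> Cod2 C d)"
  shows "is_iso (vert C) \<beta>"
proof -
  note [simp] = arrow_objectD[OF a] in_morD[OF h] in_cellD[OF \<beta>]
  have h': "in_mor C h' A XA"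
    using Cod2_parallel[of \<beta>] Cell_simps(5)[of \<beta>] by (simp add: in_mor_def)
  note [simp] = in_morD[OF h']
  obtain \<gamma>0 where g0: "in_cell C \<gamma>0 (h' \<bullet> Dom2 C d) (h \<bullet> Dom2 C d)"
      "(\<beta> \<lhd> Dom2 C d) \<odot> \<gamma>0 = Id2 C (h \<bullet> Dom2 C d)" "\<gamma>0 \<odot> (\<beta> \<lhd> Dom2 C d) = Id2 C (h' \<bullet> Dom2 C d)"
    by (rule is_iso_vertE[OF i0, of "h \<bullet> Dom2 C d" "h' \<bullet> Dom2 C d"]) (simp_all add: in_cell_def)
  obtain \<gamma>1 where g1: "in_cell C \<gamma>1 (h' \<bullet> Cod2 C d) (h \<bullet> Cod2 C d)"
      "(\<beta> \<lhd> Cod2 C d) \<odot> \<gamma>1 = Id2 C (h \<bullet> Cod2 C d)" "\<gamma>1 \<odot> (\<beta> \<lhd> Cod2 C d) = Id2 C (h' \<bullet> Cod2 C d)"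
    by (rule is_iso_vertE[OF i1, of "h \<bullet> Cod2 C d" "h' \<bullet> Cod2 C d"]) (simp_all add: in_cell_def)
  note [simp] = in_cellD[OF g0(1)] in_cellD[OF g1(1)]
  have x: "(\<beta> \<lhd> Dom2 C d) \<odot> (h' \<rhd> d) = (h \<rhd> d) \<odot> (\<beta> \<lhd> Cod2 C d)"
    using whisker_exchange[of \<beta> d] by simp
  have "\<gamma>0 \<odot> (h \<rhd> d) = \<gamma>0 \<odot> ((h \<rhd> d) \<odot> ((\<beta> \<lhd> Cod2 C d) \<odot> \<gamma>1))"
    by (simp add: g1(2))
  also have "\<dots> = \<gamma>0 \<odot> (((h \<rhd> d) \<odot> (\<beta> \<lhd> Cod2 C d)) \<odot> \<gamma>1)" by simp
  also have "\<dots> = (\<gamma>0 \<odot> (\<beta> \<lhd> Dom2 C d)) \<odot> ((h' \<rhd> d) \<odot> \<gamma>1)"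
    unfolding x[symmetric] by simp
  also have "\<dots> = (h' \<rhd> d) \<odot> \<gamma>1" unfolding g0(3) by simp
  finally have "\<exists>!\<gamma>. in_cell C \<gamma> h' h \<and> \<gamma> \<lhd> Dom2 C d = \<gamma>0 \<and> \<gamma> \<lhd> Cod2 C d = \<gamma>1"
    by (rule arrow_object_cell[OF a h' h g0(1) g1(1)])
  then obtain \<gamma> where g: "in_cell C \<gamma> h' h" "\<gamma> \<lhd> Dom2 C d = \<gamma>0" "\<gamma> \<lhd> Cod2 C d = \<gamma>1" by blast
  note [simp] = in_cellD[OF g(1)]
  show ?thesis
  proof (rule is_iso_vertI[OF \<beta> g(1)])
    show "\<beta> \<odot> \<gamma> = Id2 C h"
      by (rule arrow_object_cell_eq[OF a _ _ h])
        (simp_all add: in_cell_def rwhisker_vcomp g(2,3) g0 g1)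
    show "\<gamma> \<odot> \<beta> = Id2 C h'"
      by (rule arrow_object_cell_eq[OF a _ _ h'])
        (simp_all add: in_cell_def rwhisker_vcomp g(2,3) g0 g1)
  qed
qed

text \<open>An arrow of X is moved along isomorphisms at its two ends by conjugation. So the
  morphism from X^[1] to X x X is an isofibration, and its pullbacks along arbitrary morphisms
  exist; inserters rest on this.\<close>

lemma arrow_object_isofibration:
  assumes a: "arrow_object C X XA d" and p: "prod2 C p q" "Tgt C p = X" "Tgt C q = X"
    and e: "in_mor C e XA (Src C p)" "e \<bullet> p = Dom2 C d" "e \<bullet> q = Cod2 C d"
  shows "isofibration C e"
proof (rule isofibrationI)
  note [simp] = arrow_objectD[OF a] prod2D[OF p(1)] p(2,3) in_morD[OF e(1)]
  show "e \<in> Mor C" by simp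
  fix x v assume x0: "x \<in> Mor C" "Tgt C x = Src C e" and v: "v \<in> Cell C" "is_iso (vert C) v" "Dom2 C v = x \<bullet> e"
  have [simp]: "x \<in> Mor C" "Tgt C x = XA" "v \<in> Cell C" "Dom2 C v = x \<bullet> e" using x0 v by simp_all
  let ?y = "Cod2 C v"
  have [simp]: "?y \<in> Mor C" "Src C ?y = Src C x" "Tgt C ?y = Src C p" by simp_all
  have vi: "is_iso (vert C) (v \<lhd> p)" "is_iso (vert C) (v \<lhd> q)"
    by (rule iso_rwhisker[OF v(2)]; simp)+
  obtain w where w: "in_cell C w (?y \<bullet> p) (x \<bullet> Dom2 C d)" "(v \<lhd> p) \<odot> w = Id2 C (x \<bullet> Dom2 C d)"
      "w \<odot> (v \<lhd> p) = Id2 C (?y \<bullet> p)"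
    by (rule is_iso_vertE[OF vi(1), of "x \<bullet> Dom2 C d" "?y \<bullet> p"]) (simp_all add: in_cell_def e(2,3))
  note [simp] = in_cellD[OF w(1)]
  \<comment> \<open>The conjugate: back along \<open>v\<close> at the source, then the arrow
    \<open>x\<close>, then forward along \<open>v\<close> at the target.\<close>
  let ?\<alpha> = "w \<odot> ((x \<rhd> d) \<odot> (v \<lhd> q))"
  have ac: "?\<alpha> \<in> Cell C" "Dom2 C ?\<alpha> = ?y \<bullet> p" "Cod2 C ?\<alpha> = ?y \<bullet> q" by (simp_all add: e(2,3))
  obtain x' where x': "in_mor C x' (Src C (Dom2 C ?\<alpha>)) XA" "x' \<rhd> d = ?\<alpha>"
    by (rule arrow_object_mor[OF a, of ?\<alpha>]) (simp_all add: ac)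
  have [simp]: "x' \<in> Mor C" "Src C x' = Src C x" "Tgt C x' = XA" using in_morD[OF x'(1)] ac(2) by simp_all
  have xy: "x' \<bullet> Dom2 C d = ?y \<bullet> p" "x' \<bullet> Cod2 C d = ?y \<bullet> q"
    using arg_cong[OF x'(2), of "Dom2 C"] arg_cong[OF x'(2), of "Cod2 C"] ac by simp_all
  have h: "in_mor C x (Src C x) XA" "in_mor C x' (Src C x) XA" by (simp_all add: in_mor_def)
  have vp: "in_cell C (v \<lhd> p) (x \<bullet> Dom2 C d) (x' \<bullet> Dom2 C d)" "in_cell C (v \<lhd> q) (x \<bullet> Cod2 C d) (x' \<bullet> Cod2 C d)"
    by (simp_all add: in_cell_def e(2,3) xy)
  have "(v \<lhd> p) \<odot> ?\<alpha> = ((v \<lhd> p) \<odot> w) \<odot> ((x \<rhd> d) \<odot> (v \<lhd> q))" by (simp add: e(2,3))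
  also have "\<dots> = (x \<rhd> d) \<odot> (v \<lhd> q)" unfolding w(2) by (simp add: e(2,3))
  finally have "(v \<lhd> p) \<odot> (x' \<rhd> d) = (x \<rhd> d) \<odot> (v \<lhd> q)" by (simp only: x'(2))
  from arrow_object_cell[OF a h vp this] obtain u where u: "in_cell C u x x'" "u \<lhd> Dom2 C d = v \<lhd> p" "u \<lhd> Cod2 C d = v \<lhd> q"
    by blast
  note [simp] = in_cellD[OF u(1)]
  have "is_iso (vert C) u"
    by (rule arrow_object_reflects_iso[OF a h(1) u(1)]) (simp_all only: u(2,3) vi)
  moreover have xe: "x' \<bullet> e = ?y"
    by (rule prod2_mor_eq[OF p(1), of _ "Src C x"]) (simp_all add: in_mor_def e(2,3) xy)
  have "u \<lhd> e = v"
    by (rule prod2_cell_eq[OF p(1), of _ "x \<bullet> e" "?y" _ "Src C x"])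
      (simp_all add: in_cell_def in_mor_def e(2,3) u(2,3) xe)
  ultimately show "\<exists>u. is_iso (vert C) u \<and> Dom2 C u = x \<and> u \<lhd> e = v" by (intro exI[of _ u]) simp
qed

lemma inserterD:
  assumes "inserter C f g j l"
  shows "j \<in> Mor C" "Tgt C j = Src C f" "in_cell C l (j \<bullet> f) (j \<bullet> g)"
  using assms unfolding inserter_def by blast+

lemma inserter_mor:
  assumes "inserter C f g j l" "in_mor C h A (Src C f)" "in_cell C \<sigma> (h \<bullet> f) (h \<bullet> g)"
  shows "\<exists>!k. in_mor C k A (Src C j) \<and> k \<bullet> j = h \<and> k \<rhd> l = \<sigma>"
  using assms unfolding inserter_def by blast

lemma inserter_cell:
  assumes "inserter C f g j l" "in_mor C k A (Src C j)" "in_mor C k' A (Src C j)"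
    "in_cell C \<tau> (k \<bullet> j) (k' \<bullet> j)" "(\<tau> \<lhd> f) \<odot> (k' \<rhd> l) = (k \<rhd> l) \<odot> (\<tau> \<lhd> g)"
  shows "\<exists>!\<gamma>. in_cell C \<gamma> k k' \<and> \<gamma> \<lhd> j = \<tau>"
  using assms unfolding inserter_def by blast

lemma inserter_mor_eq:
  assumes i: "inserter C f g j l" and f: "f \<in> Mor C" "g \<in> Mor C" "Src C g = Src C f" "Tgt C g = Tgt C f"
    and k: "in_mor C k A (Src C j)" and k': "in_mor C k' A (Src C j)" and e: "k \<bullet> j = k' \<bullet> j" "k \<rhd> l = k' \<rhd> l"
  shows "k = k'"
proof -
  note [simp] = inserterD(1,2)[OF i] in_cellD[OF inserterD(3)[OF i]] in_morD[OF k] in_morD[OF k'] f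
  have "\<exists>!m. in_mor C m A (Src C j) \<and> m \<bullet> j = k \<bullet> j \<and> m \<rhd> l = k \<rhd> l"
    by (rule inserter_mor[OF i]) (simp_all add: in_mor_def in_cell_def)
  then show ?thesis using k k' e by metis
qed

lemma inserter_cell_eq:
  assumes i: "inserter C f g j l" and f: "f \<in> Mor C" "g \<in> Mor C" "Src C g = Src C f" "Tgt C g = Tgt C f"
    and k: "in_mor C k A (Src C j)" and \<gamma>: "in_cell C \<gamma> k k'" and \<delta>: "in_cell C \<delta> k k'" and e: "\<gamma> \<lhd> j = \<delta> \<lhd> j"
  shows "\<gamma> = \<delta>"
proof -
  note [simp] = inserterD(1,2)[OF i] in_cellD[OF inserterD(3)[OF i]] in_morD[OF k] in_cellD[OF \<gamma>] f
  have k': "in_mor C k' A (Src C j)"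
    using Cod2_parallel[of \<gamma>] Cell_simps(5)[of \<gamma>] by (simp add: in_mor_def)
  note [simp] = in_morD[OF k']
  have "\<exists>!\<xi>. in_cell C \<xi> k k' \<and> \<xi> \<lhd> j = \<gamma> \<lhd> j"
    by (rule inserter_cell[OF i k k'])
      (use whisker_exchange[of \<gamma> l] in \<open>simp_all add: in_cell_def\<close>)
  then show ?thesis using \<gamma> \<delta> e by metis
qed

lemma equifierD:
  assumes "equifier C B S j"
  shows "j \<in> Mor C" "Tgt C j = B" "(\<alpha>, \<beta>) \<in> S \<Longrightarrow> j \<rhd> \<alpha> = j \<rhd> \<beta>"
  using assms unfolding equifier_def by blast+

lemma equifier_mor:
  assumes "equifier C B S j" "in_mor C h A B" "\<And>\<alpha> \<beta>. (\<alpha>, \<beta>) \<in> S \<Longrightarrow> h \<rhd> \<alpha> = h \<rhd> \<beta>"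
  shows "\<exists>!k. in_mor C k A (Src C j) \<and> k \<bullet> j = h"
  using assms unfolding equifier_def by blast

lemma equifier_cell:
  assumes "equifier C B S j" "in_mor C k A (Src C j)" "in_mor C k' A (Src C j)" "in_cell C \<tau> (k \<bullet> j) (k' \<bullet> j)"
  shows "\<exists>!\<gamma>. in_cell C \<gamma> k k' \<and> \<gamma> \<lhd> j = \<tau>"
  using assms unfolding equifier_def by blast

end

context pita_category
begin

text \<open>A 2-cell from h f to h g is a morphism into X^[1] over the pair (h f, h g). The inserter
  is thus the pullback of X^[1] along the pairing of \<open>f\<close> and \<open>g\<close>.\<close>

lemma obtain_inserter:
  assumes f: "in_mor C f B X" and g: "in_mor C g B X"
  obtains j l where "inserter C f g j l"
proof -
  note [simp] = in_morD[OF f] in_morD[OF g]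
  have X: "X \<in> Ob C" using Mor_simps(5)[of f] by simp
  obtain XA d where a: "arrow_object C X XA d" by (rule obtain_arrow_object[OF X])
  obtain p q where p: "prod2 C p q" "Tgt C p = X" "Tgt C q = X" by (rule obtain_prod2[OF X X])
  note [simp] = arrow_objectD[OF a] prod2D[OF p(1)] p(2,3)
  obtain e where e: "in_mor C e XA (Src C p)" "e \<bullet> p = Dom2 C d" "e \<bullet> q = Cod2 C d"
    by (rule prod2_mor[OF p(1), of "Dom2 C d" XA "Cod2 C d"]) (simp_all add: in_mor_def)
  obtain t where t: "in_mor C t B (Src C p)" "t \<bullet> p = f" "t \<bullet> q = g"
    by (rule prod2_mor[OF p(1), of f B g]) (simp_all add: in_mor_def)
  note [simp] = in_morD[OF e(1)] in_morD[OF t(1)]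
  obtain b j where pb: "strict_pullback C b j e t"
    by (rule obtain_strict_pullback[OF arrow_object_isofibration[OF a p e], of t]) simp_all
  have [simp]: "b \<in> Mor C" "j \<in> Mor C" "Src C j = Src C b" "Tgt C b = XA" "Tgt C j = B"
    using strict_pullbackD[OF pb] by simp_all
  have be: "b \<bullet> e = j \<bullet> t" by (rule strict_pullbackD(9)[OF pb])
  have b01: "b \<bullet> Dom2 C d = j \<bullet> f" "b \<bullet> Cod2 C d = j \<bullet> g"
    using comp1_eq_assoc[OF be, of p] comp1_eq_assoc[OF be, of q] e t by simp_all
  have kb: "k \<bullet> (b \<bullet> Dom2 C d) = k \<bullet> (j \<bullet> f)" "k \<bullet> (b \<bullet> Cod2 C d) = k \<bullet> (j \<bullet> g)" for k
    by (simp_all only: b01)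
  have "inserter C f g j (b \<rhd> d)"
    unfolding inserter_def
  proof (intro conjI allI impI)
    show "in_cell C (b \<rhd> d) (j \<bullet> f) (j \<bullet> g)" by (simp add: in_cell_def b01)
    fix A h \<sigma> assume "in_mor C h A (Src C f) \<and> in_cell C \<sigma> (h \<bullet> f) (h \<bullet> g)"
    then have [simp]: "h \<in> Mor C" "Src C h = A" "Tgt C h = B" "\<sigma> \<in> Cell C" "Dom2 C \<sigma> = h \<bullet> f" "Cod2 C \<sigma> = h \<bullet> g"
      by (simp_all add: in_mor_def in_cell_def)
    obtain k1 where k1: "in_mor C k1 (Src C (Dom2 C \<sigma>)) XA" "k1 \<rhd> d = \<sigma>"
      by (rule arrow_object_mor[OF a, of \<sigma>]) simp_all
    have k1m: "k1 \<in> Mor C" "Src C k1 = A" "Tgt C k1 = XA" using in_morD[OF k1(1)] by simp_all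
    note [simp] = k1m
    have k1d: "k1 \<bullet> Dom2 C d = h \<bullet> f" "k1 \<bullet> Cod2 C d = h \<bullet> g"
      using arg_cong[OF k1(2), of "Dom2 C"] arg_cong[OF k1(2), of "Cod2 C"] by simp_all
    have "k1 \<bullet> e = h \<bullet> t"
      by (rule prod2_mor_eq[OF p(1), of _ A]) (simp_all add: in_mor_def e t k1d)
    then have ex: "\<exists>!k. in_mor C k A (Src C b) \<and> k \<bullet> b = k1 \<and> k \<bullet> j = h"
      by (intro strict_pullback_mor[OF pb]) (simp_all add: in_mor_def)
    then obtain k where k: "in_mor C k A (Src C b)" "k \<bullet> b = k1" "k \<bullet> j = h" by blast
    show "\<exists>!k. in_mor C k A (Src C j) \<and> k \<bullet> j = h \<and> k \<rhd> (b \<rhd> d) = \<sigma>"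
    proof (rule ex1I[of _ k])
      show "in_mor C k A (Src C j) \<and> k \<bullet> j = h \<and> k \<rhd> (b \<rhd> d) = \<sigma>"
        using k k1(2) in_morD[OF k(1)] by simp
      fix m assume m: "in_mor C m A (Src C j) \<and> m \<bullet> j = h \<and> m \<rhd> (b \<rhd> d) = \<sigma>"
      then have [simp]: "m \<in> Mor C" "Src C m = A" "Tgt C m = Src C b" by (simp_all add: in_mor_def)
      have "m \<bullet> b = k1"
        by (rule arrow_object_mor_eq[OF a, of _ A]) (use m k1(2) in \<open>simp_all add: in_mor_def\<close>)
      then show "m = k" using ex k m by (metis \<open>Src C j = Src C b\<close>)
    qed
  next
    fix A k k' \<tau> assume as: "in_mor C k A (Src C j) \<and> in_mor C k' A (Src C j) \<and> in_cell C \<tau> (k \<bullet> j) (k' \<bullet> j)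
        \<and> (\<tau> \<lhd> f) \<odot> (k' \<rhd> (b \<rhd> d)) = (k \<rhd> (b \<rhd> d)) \<odot> (\<tau> \<lhd> g)"
    then have [simp]: "k \<in> Mor C" "Src C k = A" "Tgt C k = Src C b" "k' \<in> Mor C" "Src C k' = A" "Tgt C k' = Src C b"
      "\<tau> \<in> Cell C" "Dom2 C \<tau> = k \<bullet> j" "Cod2 C \<tau> = k' \<bullet> j"
      by (simp_all add: in_mor_def in_cell_def)
    have ke: "(\<tau> \<lhd> f) \<odot> ((k' \<bullet> b) \<rhd> d) = ((k \<bullet> b) \<rhd> d) \<odot> (\<tau> \<lhd> g)" using as by simp
    have kk: "in_mor C k A (Src C b)" "in_mor C k' A (Src C b)" by (simp_all add: in_mor_def)
    have kbm: "in_mor C (k \<bullet> b) A XA" "in_mor C (k' \<bullet> b) A XA" by (simp_all add: in_mor_def)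
    have "\<exists>!\<rho>. in_cell C \<rho> (k \<bullet> b) (k' \<bullet> b) \<and> \<rho> \<lhd> Dom2 C d = \<tau> \<lhd> f \<and> \<rho> \<lhd> Cod2 C d = \<tau> \<lhd> g"
      by (rule arrow_object_cell[OF a kbm _ _ ke]) (simp_all add: in_cell_def kb)
    then obtain \<rho> where r: "in_cell C \<rho> (k \<bullet> b) (k' \<bullet> b)" "\<rho> \<lhd> Dom2 C d = \<tau> \<lhd> f" "\<rho> \<lhd> Cod2 C d = \<tau> \<lhd> g" by blast
    note [simp] = in_cellD[OF r(1)]
    have kbe: "k \<bullet> (b \<bullet> e) = k \<bullet> (j \<bullet> t)" "k' \<bullet> (b \<bullet> e) = k' \<bullet> (j \<bullet> t)" by (simp_all only: be)
    have "\<rho> \<lhd> e = \<tau> \<lhd> t"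
      by (rule prod2_cell_eq[OF p(1), of _ "k \<bullet> (b \<bullet> e)" "k' \<bullet> (b \<bullet> e)" _ A])
        (simp_all add: in_cell_def in_mor_def kbe e t r)
    then have ex: "\<exists>!\<gamma>. in_cell C \<gamma> k k' \<and> \<gamma> \<lhd> b = \<rho> \<and> \<gamma> \<lhd> j = \<tau>"
      by (intro strict_pullback_cell[OF pb kk r(1)]) (simp_all add: in_cell_def)
    then obtain \<gamma> where g: "in_cell C \<gamma> k k'" "\<gamma> \<lhd> b = \<rho>" "\<gamma> \<lhd> j = \<tau>" by blast
    show "\<exists>!\<gamma>. in_cell C \<gamma> k k' \<and> \<gamma> \<lhd> j = \<tau>"
    proof (rule ex1I[of _ \<gamma>])
      fix \<delta> assume d: "in_cell C \<delta> k k' \<and> \<delta> \<lhd> j = \<tau>"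
      then have [simp]: "\<delta> \<in> Cell C" "Dom2 C \<delta> = k" "Cod2 C \<delta> = k'" by (simp_all add: in_cell_def)
      have dj: "\<delta> \<lhd> (j \<bullet> f) = \<tau> \<lhd> f" "\<delta> \<lhd> (j \<bullet> g) = \<tau> \<lhd> g"
        using d rwhisker_rwhisker[of j f \<delta>] rwhisker_rwhisker[of j g \<delta>] by simp_all
      have "\<delta> \<lhd> b = \<rho>"
        by (rule arrow_object_cell_eq[OF a _ r(1) kbm(1)]) (simp_all add: in_cell_def b01 dj r)
      then show "\<delta> = \<gamma>" using ex g d by metis
    qed (use g in blast)
  qed simp_all
  then show thesis by (rule that)
qed

text \<open>The inserter of the two ends on X^[1] is the object of parallel pairs of arrows of X:
  \<open>p\<close> gives the first arrow and \<open>l\<close> the second. The pair (\<alpha>,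
  \<beta>) is a morphism \<open>t\<close> into it, and the equifier is the pullback of
  \<open>t\<close> along the diagonal \<delta>.\<close>

lemma obtain_equifier1:
  assumes f: "in_mor C f B X" and \<alpha>: "in_cell C \<alpha> f g" and \<beta>: "in_cell C \<beta> f g"
  obtains j where "equifier C B {(\<alpha>, \<beta>)} j"
proof -
  note [simp] = in_morD[OF f] in_cellD[OF \<alpha>] in_cellD[OF \<beta>]
  have [simp]: "g \<in> Mor C" "Src C g = B" "Tgt C g = X"
    using Cod2_parallel[of \<alpha>] Cell_simps(5)[of \<alpha>] by simp_all
  have X: "X \<in> Ob C" using Mor_simps(5)[of f] by simp
  obtain XA d where a: "arrow_object C X XA d" by (rule obtain_arrow_object[OF X])
  note [simp] = arrow_objectD[OF a]
  have XA: "XA \<in> Ob C" using Mor_simps(4)[of "Dom2 C d"] by simp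
  obtain p l where i: "inserter C (Dom2 C d) (Cod2 C d) p l"
    by (rule obtain_inserter[of "Dom2 C d" XA X "Cod2 C d"]) (simp_all add: in_mor_def)
  note ieq = inserter_mor_eq[OF i] and iceq = inserter_cell_eq[OF i]
  have [simp]: "p \<in> Mor C" "Tgt C p = XA" using inserterD[OF i] by simp_all
  have lc: "in_cell C l (p \<bullet> Dom2 C d) (p \<bullet> Cod2 C d)" by (rule inserterD(3)[OF i])
  note [simp] = in_cellD[OF lc]
  have "\<exists>!k. in_mor C k XA (Src C p) \<and> k \<bullet> p = Id1 C XA \<and> k \<rhd> l = d"
    by (rule inserter_mor[OF i]) (simp_all add: in_mor_def in_cell_def XA)
  then obtain \<delta> where \<delta>: "in_mor C \<delta> XA (Src C p)" "\<delta> \<bullet> p = Id1 C XA" "\<delta> \<rhd> l = d" by blast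
  note [simp] = in_morD[OF \<delta>(1)]
  \<comment> \<open>An isomorphism from a diagonal pair to another pair exhibits both members of the
    latter as the same conjugate of one arrow. So the target is diagonal as well, and the first
    component of the isomorphism is the lift.\<close>
  have iso: "isofibration C \<delta>"
  proof (rule isofibrationI)
    fix x v assume x: "x \<in> Mor C" "Tgt C x = Src C \<delta>" and v: "v \<in> Cell C" "is_iso (vert C) v" "Dom2 C v = x \<bullet> \<delta>"
    have [simp]: "x \<in> Mor C" "Tgt C x = XA" "v \<in> Cell C" "Dom2 C v = x \<bullet> \<delta>" using x v by simp_all
    let ?y = "Cod2 C v"
    have [simp]: "?y \<in> Mor C" "Src C ?y = Src C x" "Tgt C ?y = Src C p" by simp_all
    have vi: "is_iso (vert C) (v \<lhd> p)" by (rule iso_rwhisker[OF v(2)]) simp_all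
    have vpi: "is_iso (vert C) (v \<lhd> (p \<bullet> Dom2 C d))" by (rule iso_rwhisker[OF v(2)]) simp_all
    have ypd: "(v \<lhd> (p \<bullet> Dom2 C d)) \<odot> (?y \<rhd> l) = (x \<rhd> d) \<odot> (v \<lhd> (p \<bullet> Cod2 C d))"
      using whisker_exchange[of v l] lwhisker_lwhisker[of x \<delta> l] by (simp add: \<delta>(3))
    have ypd': "(v \<lhd> (p \<bullet> Dom2 C d)) \<odot> ((?y \<bullet> p) \<rhd> d) = (x \<rhd> d) \<odot> (v \<lhd> (p \<bullet> Cod2 C d))"
      using whisker_exchange[of "v \<lhd> p" d] by (simp add: \<delta>(2))
    have yl: "?y \<rhd> l = (?y \<bullet> p) \<rhd> d"
      by (rule iso_cancel_left[OF vpi]) (simp_all add: ypd ypd')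
    have "?y = (?y \<bullet> p) \<bullet> \<delta>"
      by (rule ieq[of _ "Src C x"])
        (simp_all add: in_mor_def \<delta>(2) yl lwhisker_lwhisker[symmetric] \<delta>(3) del: lwhisker_lwhisker)
    then have yp: "?y \<bullet> (p \<bullet> \<delta>) = ?y" by simp
    have "(v \<lhd> p) \<lhd> \<delta> = v"
      by (rule iceq[of "x \<bullet> \<delta>" "Src C x" _ ?y])
        (simp_all add: in_mor_def in_cell_def \<delta>(2) yp comp1_eq_assoc1[OF \<delta>(2)])
    then show "\<exists>u. is_iso (vert C) u \<and> Dom2 C u = x \<and> u \<lhd> \<delta> = v"
      using vi by (intro exI[of _ "v \<lhd> p"]) (simp add: \<delta>(2))
  qed simp
  obtain t0 where t0: "in_mor C t0 B XA" "t0 \<rhd> d = \<alpha>"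
    by (rule arrow_object_mor[OF a, of \<alpha>]) simp_all
  note [simp] = in_morD[OF t0(1)]
  have t0d: "t0 \<bullet> Dom2 C d = f" "t0 \<bullet> Cod2 C d = g"
    using arg_cong[OF t0(2), of "Dom2 C"] arg_cong[OF t0(2), of "Cod2 C"] by simp_all
  have "\<exists>!k. in_mor C k B (Src C p) \<and> k \<bullet> p = t0 \<and> k \<rhd> l = \<beta>"
    by (rule inserter_mor[OF i]) (simp_all add: in_mor_def in_cell_def t0d)
  then obtain t where t: "in_mor C t B (Src C p)" "t \<bullet> p = t0" "t \<rhd> l = \<beta>" by blast
  note [simp] = in_morD[OF t(1)]
  obtain b j where pb: "strict_pullback C b j \<delta> t"
    by (rule obtain_strict_pullback[OF iso, of t]) simp_all
  have [simp]: "b \<in> Mor C" "j \<in> Mor C" "Src C j = Src C b" "Tgt C b = XA" "Tgt C j = B"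
    using strict_pullbackD[OF pb] by simp_all
  have bd: "b \<bullet> \<delta> = j \<bullet> t" by (rule strict_pullbackD(9)[OF pb])
  \<comment> \<open>Comparison of first components shows that \<open>b\<close> is determined by
    \<open>j\<close>; hence the universal property can be stated for \<open>j\<close> alone.\<close>
  have bjt: "b = j \<bullet> t0" using comp1_eq_assoc[OF bd, of p] by (simp add: \<delta>(2) t(2))
  have "equifier C B {(\<alpha>, \<beta>)} j"
    unfolding equifier_def
  proof (intro conjI allI impI)
    have "j \<rhd> \<alpha> = b \<rhd> d" unfolding bjt t0(2)[symmetric] by simp
    also have "\<dots> = (b \<bullet> \<delta>) \<rhd> l" by (simp add: lwhisker_lwhisker[symmetric] \<delta>(3) del: lwhisker_lwhisker)
    also have "\<dots> = j \<rhd> \<beta>" by (simp add: bd lwhisker_lwhisker[symmetric] t(3) del: lwhisker_lwhisker)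
    finally show "\<forall>(\<alpha>, \<beta>)\<in>{(\<alpha>, \<beta>)}. j \<rhd> \<alpha> = j \<rhd> \<beta>" by simp
  next
    fix A h assume "in_mor C h A B \<and> (\<forall>(\<alpha>, \<beta>)\<in>{(\<alpha>, \<beta>)}. h \<rhd> \<alpha> = h \<rhd> \<beta>)"
    then have h: "in_mor C h A B" and hab: "h \<rhd> \<alpha> = h \<rhd> \<beta>" by simp_all
    note [simp] = in_morD[OF h]
    have "(h \<bullet> t0) \<bullet> \<delta> = h \<bullet> t"
    proof (rule ieq[of _ A])
      show "((h \<bullet> t0) \<bullet> \<delta>) \<rhd> l = (h \<bullet> t) \<rhd> l"
        using hab by (simp add: lwhisker_lwhisker[symmetric] t0(2) \<delta>(3) t(3) del: lwhisker_lwhisker)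
    qed (simp_all add: in_mor_def \<delta>(2) t(2))
    then have ex: "\<exists>!k. in_mor C k A (Src C b) \<and> k \<bullet> b = h \<bullet> t0 \<and> k \<bullet> j = h"
      by (intro strict_pullback_mor[OF pb]) (simp_all add: in_mor_def)
    have "k \<bullet> b = h \<bullet> t0" if "in_mor C k A (Src C b)" "k \<bullet> j = h" for k
      unfolding bjt by (rule comp1_eq_assoc1[OF that(2)]) (use in_morD[OF that(1)] in simp_all)
    then show "\<exists>!k. in_mor C k A (Src C j) \<and> k \<bullet> j = h" using ex by (metis \<open>Src C j = Src C b\<close>)
  next
    fix A k k' \<tau> assume "in_mor C k A (Src C j) \<and> in_mor C k' A (Src C j) \<and> in_cell C \<tau> (k \<bullet> j) (k' \<bullet> j)"
    then have k: "in_mor C k A (Src C b)" "in_mor C k' A (Src C b)" and \<tau>: "in_cell C \<tau> (k \<bullet> j) (k' \<bullet> j)" by simp_all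
    note [simp] = in_morD[OF k(1)] in_morD[OF k(2)] in_cellD[OF \<tau>]
    have kb: "k \<bullet> b = k \<bullet> (j \<bullet> t0)" "k' \<bullet> b = k' \<bullet> (j \<bullet> t0)" by (simp_all only: bjt)
    have kd: "k \<bullet> (j \<bullet> (t0 \<bullet> \<delta>)) = k \<bullet> (j \<bullet> t)" "k' \<bullet> (j \<bullet> (t0 \<bullet> \<delta>)) = k' \<bullet> (j \<bullet> t)"
    proof -
      have "j \<bullet> (t0 \<bullet> \<delta>) = j \<bullet> t" unfolding bd[symmetric] unfolding bjt by simp
      then show "k \<bullet> (j \<bullet> (t0 \<bullet> \<delta>)) = k \<bullet> (j \<bullet> t)" "k' \<bullet> (j \<bullet> (t0 \<bullet> \<delta>)) = k' \<bullet> (j \<bullet> t)" by simp_all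
    qed
    have "(\<tau> \<lhd> t0) \<lhd> \<delta> = \<tau> \<lhd> t"
      by (rule iceq[of "k \<bullet> (j \<bullet> t)" A _ "k' \<bullet> (j \<bullet> t)"])
        (simp_all add: in_mor_def in_cell_def kd \<delta>(2) t(2))
    then have ex: "\<exists>!\<gamma>. in_cell C \<gamma> k k' \<and> \<gamma> \<lhd> b = \<tau> \<lhd> t0 \<and> \<gamma> \<lhd> j = \<tau>"
      by (intro strict_pullback_cell[OF pb k]) (simp_all add: in_cell_def kb)
    have "\<gamma> \<lhd> b = \<tau> \<lhd> t0" if "in_cell C \<gamma> k k'" "\<gamma> \<lhd> j = \<tau>" for \<gamma>
      unfolding bjt by (subst rwhisker_rwhisker[symmetric]) (use in_cellD[OF that(1)] that(2) in simp_all)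
    then show "\<exists>!\<gamma>. in_cell C \<gamma> k k' \<and> \<gamma> \<lhd> j = \<tau>" using ex by metis
  qed simp_all
  then show thesis by (rule that)
qed

text \<open>One pair at a time: the next pair is restricted along the equifier of the earlier ones,
  and inclusions that are fully faithful on 2-cells compose.\<close>

lemma obtain_equifier:
  assumes "finite S" "B \<in> Ob C" "\<And>\<alpha> \<beta>. (\<alpha>, \<beta>) \<in> S \<Longrightarrow> \<alpha> \<in> Cell C \<and> \<beta> \<in> Cell C
    \<and> Src C (Dom2 C \<alpha>) = B \<and> Dom2 C \<beta> = Dom2 C \<alpha> \<and> Cod2 C \<beta> = Cod2 C \<alpha>"
  shows "\<exists>j. equifier C B S j"
  using assms(1,3)
proof (induction S rule: finite_induct)
  case empty
  have "equifier C B {} (Id1 C B)"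
    unfolding equifier_def
  proof (intro conjI allI impI)
    fix A h assume "in_mor C h A B \<and> (\<forall>(\<alpha>, \<beta>)\<in>{}. h \<rhd> \<alpha> = h \<rhd> \<beta>)"
    then show "\<exists>!k. in_mor C k A (Src C (Id1 C B)) \<and> k \<bullet> Id1 C B = h"
      using assms(2) by (intro ex1I[of _ h]) (auto simp: in_mor_def)
  next
    fix A k k' \<tau>
    assume "in_mor C k A (Src C (Id1 C B)) \<and> in_mor C k' A (Src C (Id1 C B)) \<and> in_cell C \<tau> (k \<bullet> Id1 C B) (k' \<bullet> Id1 C B)"
    then show "\<exists>!\<gamma>. in_cell C \<gamma> k k' \<and> \<gamma> \<lhd> Id1 C B = \<tau>"
      using assms(2) by (intro ex1I[of _ \<tau>]) (auto simp: in_mor_def in_cell_def)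
  qed (use assms(2) in simp_all)
  then show ?case by blast
next
  case (insert x S)
  obtain \<alpha> \<beta> where x: "x = (\<alpha>, \<beta>)" by (cases x)
  have c [simp]: "\<alpha> \<in> Cell C" "\<beta> \<in> Cell C" "Src C (Dom2 C \<alpha>) = B" "Dom2 C \<beta> = Dom2 C \<alpha>" "Cod2 C \<beta> = Cod2 C \<alpha>"
    using insert.prems[of \<alpha> \<beta>] x by simp_all
  have cS: "\<gamma> \<in> Cell C \<and> \<delta> \<in> Cell C \<and> Src C (Dom2 C \<gamma>) = B \<and> Dom2 C \<delta> = Dom2 C \<gamma>" if "(\<gamma>, \<delta>) \<in> S" for \<gamma> \<delta>
    using insert.prems[of \<gamma> \<delta>] that by simp
  obtain j where j: "equifier C B S j" using insert.IH insert.prems by blast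
  note [simp] = equifierD(1,2)[OF j]
  obtain i where i: "equifier C (Src C j) {(j \<rhd> \<alpha>, j \<rhd> \<beta>)} i"
    by (rule obtain_equifier1[of "j \<bullet> Dom2 C \<alpha>" "Src C j" "Tgt C (Dom2 C \<alpha>)" "j \<rhd> \<alpha>" "j \<bullet> Cod2 C \<alpha>" "j \<rhd> \<beta>"])
      (simp_all add: in_mor_def in_cell_def)
  note [simp] = equifierD(1,2)[OF i]
  have "equifier C B (insert (\<alpha>, \<beta>) S) (i \<bullet> j)"
    unfolding equifier_def
  proof (intro conjI allI impI)
    have "(i \<bullet> j) \<rhd> \<gamma> = (i \<bullet> j) \<rhd> \<delta>" if "(\<gamma>, \<delta>) \<in> S" for \<gamma> \<delta>
      using equifierD(3)[OF j that] cS[OF that] by (simp add: lwhisker_lwhisker[symmetric] del: lwhisker_lwhisker)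
    moreover have "(i \<bullet> j) \<rhd> \<alpha> = (i \<bullet> j) \<rhd> \<beta>"
      using equifierD(3)[OF i, of "j \<rhd> \<alpha>" "j \<rhd> \<beta>"] by simp
    ultimately show "\<forall>(\<gamma>, \<delta>)\<in>insert (\<alpha>, \<beta>) S. (i \<bullet> j) \<rhd> \<gamma> = (i \<bullet> j) \<rhd> \<delta>" by auto
  next
    fix A h assume h0: "in_mor C h A B \<and> (\<forall>(\<gamma>, \<delta>)\<in>insert (\<alpha>, \<beta>) S. h \<rhd> \<gamma> = h \<rhd> \<delta>)"
    then have h: "in_mor C h A B" and hab: "h \<rhd> \<alpha> = h \<rhd> \<beta>" and hS: "\<And>\<gamma> \<delta>. (\<gamma>, \<delta>) \<in> S \<Longrightarrow> h \<rhd> \<gamma> = h \<rhd> \<delta>"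
      by auto
    have e1: "\<exists>!k. in_mor C k A (Src C j) \<and> k \<bullet> j = h" by (rule equifier_mor[OF j h hS])
    then obtain k where k: "in_mor C k A (Src C j)" "k \<bullet> j = h" by blast
    note [simp] = in_morD[OF k(1)]
    have e2: "\<exists>!m. in_mor C m A (Src C i) \<and> m \<bullet> i = k"
      by (rule equifier_mor[OF i k(1)]) (use hab in \<open>simp add: k(2)\<close>)
    then obtain m where m: "in_mor C m A (Src C i)" "m \<bullet> i = k" by blast
    show "\<exists>!m. in_mor C m A (Src C (i \<bullet> j)) \<and> m \<bullet> (i \<bullet> j) = h"
    proof (rule ex1I[of _ m])
      show "in_mor C m A (Src C (i \<bullet> j)) \<and> m \<bullet> (i \<bullet> j) = h"
        using m in_morD[OF m(1)] comp1_eq_assoc1[OF m(2), of j] k(2) by simp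
      fix n assume n: "in_mor C n A (Src C (i \<bullet> j)) \<and> n \<bullet> (i \<bullet> j) = h"
      then have n': "in_mor C n A (Src C i)" by simp
      note [simp] = in_morD[OF n']
      have "in_mor C (n \<bullet> i) A (Src C j)" "(n \<bullet> i) \<bullet> j = h" using n by (simp_all add: in_mor_def)
      then have "n \<bullet> i = k" using e1 k by blast
      then show "n = m" using e2 m n' by blast
    qed
  next
    fix A k k' \<tau> assume "in_mor C k A (Src C (i \<bullet> j)) \<and> in_mor C k' A (Src C (i \<bullet> j))
       \<and> in_cell C \<tau> (k \<bullet> (i \<bullet> j)) (k' \<bullet> (i \<bullet> j))"
    then have k: "in_mor C k A (Src C i)" "in_mor C k' A (Src C i)"
      and \<tau>: "in_cell C \<tau> (k \<bullet> (i \<bullet> j)) (k' \<bullet> (i \<bullet> j))" by simp_all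
    note [simp] = in_morD[OF k(1)] in_morD[OF k(2)] in_cellD[OF \<tau>]
    have e1: "\<exists>!\<gamma>. in_cell C \<gamma> (k \<bullet> i) (k' \<bullet> i) \<and> \<gamma> \<lhd> j = \<tau>"
      by (rule equifier_cell[OF j, of _ A]) (simp_all add: in_mor_def in_cell_def)
    then obtain \<gamma> where g: "in_cell C \<gamma> (k \<bullet> i) (k' \<bullet> i)" "\<gamma> \<lhd> j = \<tau>" by blast
    have e2: "\<exists>!\<delta>. in_cell C \<delta> k k' \<and> \<delta> \<lhd> i = \<gamma>" by (rule equifier_cell[OF i k g(1)])
    then obtain \<delta> where d: "in_cell C \<delta> k k'" "\<delta> \<lhd> i = \<gamma>" by blast
    show "\<exists>!\<delta>. in_cell C \<delta> k k' \<and> \<delta> \<lhd> (i \<bullet> j) = \<tau>"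
    proof (rule ex1I[of _ \<delta>])
      show "in_cell C \<delta> k k' \<and> \<delta> \<lhd> (i \<bullet> j) = \<tau>"
        using d in_cellD[OF d(1)] rwhisker_rwhisker[of i j \<delta>] g by simp
      fix \<xi> assume x: "in_cell C \<xi> k k' \<and> \<xi> \<lhd> (i \<bullet> j) = \<tau>"
      then have [simp]: "\<xi> \<in> Cell C" "Dom2 C \<xi> = k" "Cod2 C \<xi> = k'" by (simp_all add: in_cell_def)
      have "in_cell C (\<xi> \<lhd> i) (k \<bullet> i) (k' \<bullet> i)" "(\<xi> \<lhd> i) \<lhd> j = \<tau>" using x by (simp_all add: in_cell_def)
      then have "\<xi> \<lhd> i = \<gamma>" using e1 g by blast
      then show "\<xi> = \<delta>" using e2 d x by blast
    qed
  qed simp_all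
  then show ?case unfolding x by blast
qed

end

section \<open>Nerves\<close>

lemma ord2_cases:
  "u \<in> Arr (ord_cat 2) \<Longrightarrow> u \<in> {(0, 0), (1, 1), (2, 2), (0, 1), (1, 2), (0, 2)}"
proof (cases u)
  fix i j assume "u \<in> Arr (ord_cat 2)" "u = (i, j)"
  then have "j \<le> 2" "i \<le> j" "u = (i, j)" by auto
  then have "(j = 0 \<and> i = 0) \<or> (j = 1 \<and> (i = 0 \<or> i = 1)) \<or> (j = 2 \<and> (i = 0 \<or> i = 1 \<or> i = 2))" by arith
  then show ?thesis using \<open>u = (i, j)\<close> by auto
qed

lemma ord2_Obj: "Obj (ord_cat 2) = {0, 1, 2}" by auto

definition composable_pair :: "('o, 'm, 'c) twocat \<Rightarrow> 'c \<Rightarrow> 'c \<Rightarrow> (nat, nat \<times> nat, 'm, 'c) ftor" where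
  "composable_pair C a b = ftor_restrict (ord_cat 2)
     \<lparr>fobj = (\<lambda>j. if j = 0 then Dom2 C a else if j = 1 then Cod2 C a else Cod2 C b),
      farr = (\<lambda>u. if u = (0, 1) then a else if u = (1, 2) then b else if u = (0, 2) then a \<odot>\<^bsub>C\<^esub> b
        else if u = (0, 0) then Id2 C (Dom2 C a) else if u = (1, 1) then Id2 C (Cod2 C a) else Id2 C (Cod2 C b))\<rparr>"

lemma composable_pair_simps [simp]:
  "fobj (composable_pair C a b) 0 = Dom2 C a" "fobj (composable_pair C a b) 1 = Cod2 C a"
  "fobj (composable_pair C a b) 2 = Cod2 C b"
  "farr (composable_pair C a b) (0, 1) = a" "farr (composable_pair C a b) (1, 2) = b"
  "farr (composable_pair C a b) (0, 2) = a \<odot>\<^bsub>C\<^esub> b"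
  "farr (composable_pair C a b) (0, 0) = Id2 C (Dom2 C a)"
  "farr (composable_pair C a b) (1, 1) = Id2 C (Cod2 C a)"
  "farr (composable_pair C a b) (2, 2) = Id2 C (Cod2 C b)"
  "ftor_restrict (ord_cat 2) (composable_pair C a b) = composable_pair C a b"
  by (simp_all add: composable_pair_def)

context two_category
begin

lemma composable_pair_functor:
  assumes [simp]: "a \<in> Cell C" "b \<in> Cell C" "Dom2 C b = Cod2 C a" "Src C (Dom2 C a) = A" "Tgt C (Dom2 C a) = X"
  shows "is_functor (ord_cat 2) (hom C A X) (composable_pair C a b)"
proof -
  have [simp]: "Src C (Cod2 C b) = A" "Tgt C (Cod2 C b) = X"
    using Cod2_parallel[of b] by (simp_all del: Cod2_parallel add: Cod2_parallel[of a])
  show ?thesis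
    unfolding is_functor_def
  proof (intro conjI ballI impI)
    fix j assume "j \<in> Obj (ord_cat 2)"
    then have j: "j = 0 \<or> j = 1 \<or> j = 2" by (auto simp: ord2_Obj)
    then show "fobj (composable_pair C a b) j \<in> Obj (hom C A X)" by auto
    show "farr (composable_pair C a b) (ide (ord_cat 2) j) = ide (hom C A X) (fobj (composable_pair C a b) j)"
      using j by auto
  next
    fix u assume "u \<in> Arr (ord_cat 2)"
    from ord2_cases[OF this]
    show "in_hom (hom C A X) (farr (composable_pair C a b) u) (fobj (composable_pair C a b) (Dom (ord_cat 2) u))
         (fobj (composable_pair C a b) (Cod (ord_cat 2) u))"
      by (auto simp: in_hom_def)
  next
    fix u v assume "u \<in> Arr (ord_cat 2)" "v \<in> Arr (ord_cat 2)" "Cod (ord_cat 2) u = Dom (ord_cat 2) v"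
    then show "farr (composable_pair C a b) (u \<cdot>\<^bsub>ord_cat 2\<^esub> v) =
        farr (composable_pair C a b) u \<cdot>\<^bsub>hom C A X\<^esub> farr (composable_pair C a b) v"
      using ord2_cases[of u] ord2_cases[of v] by auto
  qed
qed

lemma ord2_functor_eqI:
  assumes F: "is_functor (ord_cat 2) (hom C A X) F" "ftor_restrict (ord_cat 2) F = F"
    and G: "is_functor (ord_cat 2) (hom C A X) G" "ftor_restrict (ord_cat 2) G = G"
    and e: "farr F (0, 1) = farr G (0, 1)" "farr F (1, 2) = farr G (1, 2)"
  shows "F = G"
proof (rule ftor_eqI[OF F(2) G(2)])
  note f = hom_functorD[OF F(1)] and g = hom_functorD[OF G(1)]
  have o: "fobj F 0 = fobj G 0" "fobj F 1 = fobj G 1" "fobj F 2 = fobj G 2"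
    using f(5,6)[of "(0, 1)"] g(5,6)[of "(0, 1)"] f(6)[of "(1, 2)"] g(6)[of "(1, 2)"] e by simp_all
  show "fobj F j = fobj G j" if "j \<in> Obj (ord_cat 2)" for j
    using that o unfolding ord2_Obj by auto
  show "farr F u = farr G u" if "u \<in> Arr (ord_cat 2)" for u
    using ord2_cases[OF that] f(7)[of 0] f(7)[of 1] f(7)[of 2] g(7)[of 0] g(7)[of 1] g(7)[of 2] o e
      f(8)[of "(0, 1)" "(1, 2)"] g(8)[of "(0, 1)" "(1, 2)"]
    by auto
qed

end

context pita_category
begin

text \<open>Only X^[1] is given. A composable pair is an arrow of X, an object of X, and a second
  arrow from the target of the first to that object; this is an inserter over X^[1] x X.\<close>

lemma cotensor2_ex:
  assumes X: "X \<in> Ob C"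
  shows "\<exists>X2 ev2. is_cotensor C (ord_cat 2) X X2 ev2"
proof -
  obtain XA d where a: "arrow_object C X XA d" by (rule obtain_arrow_object[OF X])
  note [simp] = arrow_objectD[OF a]
  have XA: "XA \<in> Ob C" using Mor_simps(4)[of "Dom2 C d"] by simp
  obtain p q where p: "prod2 C p q" "Tgt C p = XA" "Tgt C q = X" by (rule obtain_prod2[OF XA X])
  note [simp] = prod2D[OF p(1)] p(2,3)
  have pq: "p \<bullet> Cod2 C d \<in> Mor C" "q \<in> Mor C" "Src C q = Src C (p \<bullet> Cod2 C d)" "Tgt C q = Tgt C (p \<bullet> Cod2 C d)"
    by simp_all
  obtain j l where i: "inserter C (p \<bullet> Cod2 C d) q j l"
    by (rule obtain_inserter[of "p \<bullet> Cod2 C d" "Src C p" X q]) (simp_all add: in_mor_def)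
  note ieq = inserter_mor_eq[OF i pq] and iceq = inserter_cell_eq[OF i pq]
  have [simp]: "j \<in> Mor C" "Tgt C j = Src C p" using inserterD[OF i] by simp_all
  have lc: "in_cell C l (j \<bullet> (p \<bullet> Cod2 C d)) (j \<bullet> q)" by (rule inserterD(3)[OF i])
  note [simp] = in_cellD[OF lc]
  let ?X2 = "Src C j"
  \<comment> \<open>The first arrow comes from the projection to X^[1], the second is the inserted
    2-cell \<open>l\<close>; their composite is the value at (0, 2).\<close>
  let ?ev = "composable_pair C ((j \<bullet> p) \<rhd> d) l"
  have ev: "is_functor (ord_cat 2) (hom C ?X2 X) ?ev"
    by (rule composable_pair_functor) simp_all
  have dg: "is_functor (ord_cat 2) (hom C A X) (diagram_of C (ord_cat 2) ?ev k)" if "in_mor C k A ?X2" for k A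
    by (rule diagram_functor[OF category_ord_cat ev that])
  have dv: "farr (diagram_of C (ord_cat 2) ?ev k) (0, 1) = (k \<bullet> (j \<bullet> p)) \<rhd> d"
    "farr (diagram_of C (ord_cat 2) ?ev k) (1, 2) = k \<rhd> l"
    "fobj (diagram_of C (ord_cat 2) ?ev k) 0 = k \<bullet> (j \<bullet> (p \<bullet> Dom2 C d))"
    "fobj (diagram_of C (ord_cat 2) ?ev k) 1 = k \<bullet> (j \<bullet> (p \<bullet> Cod2 C d))"
    "fobj (diagram_of C (ord_cat 2) ?ev k) 2 = k \<bullet> (j \<bullet> q)" if "in_mor C k A ?X2" for k A
    using in_morD[OF that] by simp_all
  have "cat_isomorphism (hom C A ?X2) (full_subcat (fun_cat (ord_cat 2) (hom C A X)) (Obj (fun_cat (ord_cat 2) (hom C A X))))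
      (cotensor_functor C (ord_cat 2) ?ev)" if A: "A \<in> Ob C" for A
  proof (rule cotensor_iso[OF category_ord_cat ev A subset_refl])
    fix k assume "in_mor C k A ?X2"
    then show "diagram_of C (ord_cat 2) ?ev k \<in> Obj (fun_cat (ord_cat 2) (hom C A X))" using dg by simp
  next
    fix F assume "F \<in> Obj (fun_cat (ord_cat 2) (hom C A X))"
    then have F: "is_functor (ord_cat 2) (hom C A X) F" "ftor_restrict (ord_cat 2) F = F" by simp_all
    note f = hom_functorD(1-6)[OF F(1)]
    have [simp]: "farr F (0, 1) \<in> Cell C" "Dom2 C (farr F (0, 1)) = fobj F 0" "Cod2 C (farr F (0, 1)) = fobj F 1"
      "farr F (1, 2) \<in> Cell C" "Dom2 C (farr F (1, 2)) = fobj F 1" "Cod2 C (farr F (1, 2)) = fobj F 2"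
      "fobj F 0 \<in> Mor C" "Src C (fobj F 0) = A" "Tgt C (fobj F 0) = X"
      "fobj F 2 \<in> Mor C" "Src C (fobj F 2) = A" "Tgt C (fobj F 2) = X"
      using f by simp_all
    obtain k1 where k1: "in_mor C k1 A XA" "k1 \<rhd> d = farr F (0, 1)"
      by (rule arrow_object_mor[OF a, of "farr F (0, 1)"]) simp_all
    note [simp] = in_morD[OF k1(1)]
    have k1d: "k1 \<bullet> Cod2 C d = fobj F 1" using arg_cong[OF k1(2), of "Cod2 C"] by simp
    obtain h where h: "in_mor C h A (Src C p)" "h \<bullet> p = k1" "h \<bullet> q = fobj F 2"
      by (rule prod2_mor[OF p(1), of k1 A "fobj F 2"]) (simp_all add: in_mor_def)
    note [simp] = in_morD[OF h(1)]
    have "h \<bullet> (p \<bullet> Cod2 C d) = fobj F 1" using comp1_eq_assoc1[OF h(2), of "Cod2 C d"] k1d by simp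
    then have "\<exists>!k. in_mor C k A ?X2 \<and> k \<bullet> j = h \<and> k \<rhd> l = farr F (1, 2)"
      by (intro inserter_mor[OF i]) (simp_all add: in_mor_def in_cell_def h(3))
    then obtain k where k: "in_mor C k A ?X2" "k \<bullet> j = h" "k \<rhd> l = farr F (1, 2)" by blast
    note [simp] = in_morD[OF k(1)]
    have "diagram_of C (ord_cat 2) ?ev k = F"
      by (rule ord2_functor_eqI[OF dg[OF k(1)] _ F])
        (simp_all only: diagram_of_simps(3) dv[OF k(1)] k(3) comp1_eq_assoc1[OF k(2), of p] h(2) k1(2) comp1_simps(2,3)
          \<open>j \<in> Mor C\<close> \<open>p \<in> Mor C\<close> \<open>k \<in> Mor C\<close> \<open>Tgt C k = Src C j\<close> \<open>Tgt C j = Src C p\<close>)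
    then show "\<exists>f. in_mor C f A ?X2 \<and> diagram_of C (ord_cat 2) ?ev f = F" using k(1) by blast
  next
    fix k k' assume k: "in_mor C k A ?X2" and k': "in_mor C k' A ?X2"
      and e: "diagram_of C (ord_cat 2) ?ev k = diagram_of C (ord_cat 2) ?ev k'"
    note [simp] = in_morD[OF k] in_morD[OF k']
    have e1: "(k \<bullet> (j \<bullet> p)) \<rhd> d = (k' \<bullet> (j \<bullet> p)) \<rhd> d" and e2: "k \<rhd> l = k' \<rhd> l" and e3: "k \<bullet> (j \<bullet> q) = k' \<bullet> (j \<bullet> q)"
      using dv[OF k] dv[OF k'] e by metis+
    have "k \<bullet> (j \<bullet> p) = k' \<bullet> (j \<bullet> p)"
      by (rule arrow_object_mor_eq[OF a _ _ e1, of A]) (simp_all add: in_mor_def)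
    then have "k \<bullet> j = k' \<bullet> j"
      by (intro prod2_mor_eq[OF p(1), of "k \<bullet> j" A "k' \<bullet> j"]) (simp_all add: in_mor_def e3)
    then show "k = k'" by (rule ieq[OF k k' _ e2])
  next
    fix k k' \<eta> assume k: "in_mor C k A ?X2" and k': "in_mor C k' A ?X2"
      and n: "natural_transformation (ord_cat 2) (hom C A X) (diagram_of C (ord_cat 2) ?ev k) (diagram_of C (ord_cat 2) ?ev k') \<eta>"
    note [simp] = in_morD[OF k] in_morD[OF k']
    note n1 = n[unfolded natural_transformation_def, THEN conjunct1, rule_format]
      and n2 = n[unfolded natural_transformation_def, THEN conjunct2, rule_format]
    have "in_cell C (\<eta> 0) (k \<bullet> (j \<bullet> (p \<bullet> Dom2 C d))) (k' \<bullet> (j \<bullet> (p \<bullet> Dom2 C d)))"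
      "in_cell C (\<eta> 1) (k \<bullet> (j \<bullet> (p \<bullet> Cod2 C d))) (k' \<bullet> (j \<bullet> (p \<bullet> Cod2 C d)))"
      "in_cell C (\<eta> 2) (k \<bullet> (j \<bullet> q)) (k' \<bullet> (j \<bullet> q))"
      using n1[of 0] n1[of 1] n1[of 2] by (simp_all add: in_hom_hom)
    note e = this
    note [simp] = in_cellD[OF e(1)] in_cellD[OF e(2)] in_cellD[OF e(3)]
    have kjp: "in_mor C (k \<bullet> (j \<bullet> p)) A XA" "in_mor C (k' \<bullet> (j \<bullet> p)) A XA" by (simp_all add: in_mor_def)
    have "\<exists>!\<rho>. in_cell C \<rho> (k \<bullet> (j \<bullet> p)) (k' \<bullet> (j \<bullet> p)) \<and> \<rho> \<lhd> Dom2 C d = \<eta> 0 \<and> \<rho> \<lhd> Cod2 C d = \<eta> 1"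
      by (rule arrow_object_cell[OF a kjp]) (use n2[of "(0, 1)"] in \<open>simp_all add: in_cell_def\<close>)
    then obtain \<rho> where r: "in_cell C \<rho> (k \<bullet> (j \<bullet> p)) (k' \<bullet> (j \<bullet> p))" "\<rho> \<lhd> Dom2 C d = \<eta> 0" "\<rho> \<lhd> Cod2 C d = \<eta> 1" by blast
    note [simp] = in_cellD[OF r(1)]
    have "\<exists>!\<tau>. in_cell C \<tau> (k \<bullet> j) (k' \<bullet> j) \<and> \<tau> \<lhd> p = \<rho> \<and> \<tau> \<lhd> q = \<eta> 2"
      by (rule prod2_cell[OF p(1), of _ A]) (simp_all add: in_mor_def in_cell_def)
    then obtain \<tau> where t: "in_cell C \<tau> (k \<bullet> j) (k' \<bullet> j)" "\<tau> \<lhd> p = \<rho>" "\<tau> \<lhd> q = \<eta> 2" by blast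
    note [simp] = in_cellD[OF t(1)]
    have tp: "\<tau> \<lhd> (p \<bullet> Cod2 C d) = \<eta> 1" "\<tau> \<lhd> (p \<bullet> Dom2 C d) = \<eta> 0"
      using r(2,3) by (simp_all add: t(2)[symmetric])
    have "\<exists>!\<gamma>. in_cell C \<gamma> k k' \<and> \<gamma> \<lhd> j = \<tau>"
      by (rule inserter_cell[OF i k k' t(1)]) (use n2[of "(1, 2)"] in \<open>simp add: tp t(3)\<close>)
    then obtain \<gamma> where g: "in_cell C \<gamma> k k'" "\<gamma> \<lhd> j = \<tau>" by blast
    note [simp] = in_cellD[OF g(1)]
    have "\<gamma> \<lhd> (j \<bullet> (p \<bullet> Dom2 C d)) = \<eta> 0" "\<gamma> \<lhd> (j \<bullet> (p \<bullet> Cod2 C d)) = \<eta> 1" "\<gamma> \<lhd> (j \<bullet> q) = \<eta> 2"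
      using tp t(3) by (simp_all add: g(2)[symmetric])
    then show "\<exists>\<gamma>. in_cell C \<gamma> k k' \<and> (\<forall>m \<in> Obj (ord_cat 2). \<gamma> \<lhd> fobj ?ev m = \<eta> m)"
      using g(1) unfolding ord2_Obj by (intro exI[of _ \<gamma>]) simp
  next
    fix k k' \<gamma> \<delta> assume k: "in_mor C k A ?X2" and k': "in_mor C k' A ?X2" and g: "in_cell C \<gamma> k k'" and h: "in_cell C \<delta> k k'"
      and e: "\<forall>m \<in> Obj (ord_cat 2). \<gamma> \<lhd> fobj ?ev m = \<delta> \<lhd> fobj ?ev m"
    note [simp] = in_morD[OF k] in_morD[OF k'] in_cellD[OF g] in_cellD[OF h]
    have e0: "\<gamma> \<lhd> (j \<bullet> (p \<bullet> Dom2 C d)) = \<delta> \<lhd> (j \<bullet> (p \<bullet> Dom2 C d))"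
      "\<gamma> \<lhd> (j \<bullet> (p \<bullet> Cod2 C d)) = \<delta> \<lhd> (j \<bullet> (p \<bullet> Cod2 C d))" "\<gamma> \<lhd> (j \<bullet> q) = \<delta> \<lhd> (j \<bullet> q)"
      using e unfolding ord2_Obj by simp_all
    have 1: "\<gamma> \<lhd> (j \<bullet> p) = \<delta> \<lhd> (j \<bullet> p)"
      by (rule arrow_object_cell_eq[OF a, of _ "k \<bullet> (j \<bullet> p)" "k' \<bullet> (j \<bullet> p)" _ A])
        (use e0 in \<open>simp_all add: in_mor_def in_cell_def\<close>)
    have "\<gamma> \<lhd> j = \<delta> \<lhd> j"
      by (rule prod2_cell_eq[OF p(1), of _ "k \<bullet> j" "k' \<bullet> j" _ A])
        (use 1 e0 in \<open>simp_all add: in_mor_def in_cell_def\<close>)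
    then show "\<gamma> = \<delta>" by (rule iceq[OF k g h])
  qed
  then have "is_cotensor C (ord_cat 2) X ?X2 ?ev"
    unfolding is_cotensor_def full_subcat_fun_cat using X ev by simp
  then show ?thesis by blast
qed

end

section \<open>Cores and morphisms out of groupoids\<close>

context two_category
begin

lemma core_mor:
  assumes c: "is_core C X K i" and f: "in_mor C f A X" and aw: "arrowwise_iso C f"
  shows "\<exists>!h. in_mor C h A K \<and> h \<bullet> i = f"
proof -
  have A: "A \<in> Ob C" using Mor_simps(4)[of f] in_morD[OF f] by simp
  have b: "bij_betw (fobj (post C i)) (Obj (hom C A K)) (Obj (arrowwise_iso_cat C A X))"
    using c A unfolding is_core_def cat_isomorphism_def by blast
  have "f \<in> Obj (arrowwise_iso_cat C A X)"
    using aw in_morD[OF f] by (simp add: arrowwise_iso_cat_def subcat_def)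
  then have "f \<in> fobj (post C i) ` Obj (hom C A K)" by (simp only: bij_betw_imp_surj_on[OF b])
  then obtain h where h: "h \<in> Obj (hom C A K)" "f = fobj (post C i) h" by (rule imageE)
  show ?thesis
  proof (rule ex1I[of _ h])
    show "in_mor C h A K \<and> h \<bullet> i = f" using h by (simp add: in_mor_def)
    fix k assume k: "in_mor C k A K \<and> k \<bullet> i = f"
    show "k = h"
    proof (rule inj_onD[OF bij_betw_imp_inj_on[OF b]])
      show "fobj (post C i) k = fobj (post C i) h" using k h(2) by simp
    qed (use k h(1) in \<open>simp_all add: in_mor_def\<close>)
  qed
qed

lemma groupoid_cell_iso:
  assumes "groupoid_ob C K" "\<alpha> \<in> Cell C" "Tgt C (Dom2 C \<alpha>) = K"
  shows "is_iso (vert C) \<alpha>"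
proof -
  have "Src C (Dom2 C \<alpha>) \<in> Ob C" using assms(2) by simp
  then have "is_iso (hom C (Src C (Dom2 C \<alpha>)) K) \<alpha>"
    using assms unfolding groupoid_ob_def groupoid_cat_def by simp
  then show ?thesis unfolding is_iso_hom by blast
qed

lemma groupoid_arrowwise_iso:
  assumes "groupoid_ob C A" "in_mor C f A X"
  shows "arrowwise_iso C f"
  unfolding arrowwise_iso_def
  using assms(2) iso_rwhisker groupoid_cell_iso[OF assms(1)] by (simp add: in_mor_def)

text \<open>A 2-cell into the core becomes invertible in X, as \<open>i\<close> is an arrow-wise
  iso. The inverse has arrow-wise isos as its ends, so it belongs to the subcategory that the core
  represents and lifts back; injectivity on 2-cells transfers the inverse laws.\<close>

lemma core_groupoid:
  assumes c: "is_core C X K i"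
  shows "groupoid_ob C K"
  unfolding groupoid_ob_def groupoid_cat_def
proof (intro conjI ballI)
  have i: "in_mor C i K X" and aw: "arrowwise_iso C i" using c unfolding is_core_def by blast+
  note [simp] = in_morD[OF i]
  show "K \<in> Ob C" using Mor_simps(4)[of i] by simp
  fix A \<alpha> assume A: "A \<in> Ob C" and a: "\<alpha> \<in> Arr (hom C A K)"
  then have [simp]: "\<alpha> \<in> Cell C" "Src C (Dom2 C \<alpha>) = A" "Tgt C (Dom2 C \<alpha>) = K" by simp_all
  have cf: "is_functor (hom C A K) (arrowwise_iso_cat C A X) (post C i)"
    and b: "bij_betw (farr (post C i)) (Arr (hom C A K)) (Arr (arrowwise_iso_cat C A X))"
    and bo: "bij_betw (fobj (post C i)) (Obj (hom C A K)) (Obj (arrowwise_iso_cat C A X))"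
    using c A unfolding is_core_def cat_isomorphism_def by blast+
  have "is_iso (vert C) (\<alpha> \<lhd> i)" using aw unfolding arrowwise_iso_def by simp
  then obtain \<beta> where be: "in_cell C \<beta> (Cod2 C \<alpha> \<bullet> i) (Dom2 C \<alpha> \<bullet> i)" "(\<alpha> \<lhd> i) \<odot> \<beta> = Id2 C (Dom2 C \<alpha> \<bullet> i)"
      "\<beta> \<odot> (\<alpha> \<lhd> i) = Id2 C (Cod2 C \<alpha> \<bullet> i)"
    by (rule is_iso_vertE[of _ "Dom2 C \<alpha> \<bullet> i" "Cod2 C \<alpha> \<bullet> i"]) (simp_all add: in_cell_def)
  note [simp] = in_cellD[OF be(1)]
  have aws: "arrowwise_iso C (k \<bullet> i)" if "in_mor C k A K" for k
  proof -
    have "k \<bullet> i \<in> Obj (arrowwise_iso_cat C A X)"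
      using cf that unfolding is_functor_def by (simp add: in_mor_def)
    then show ?thesis by (simp add: arrowwise_iso_cat_def subcat_def)
  qed
  have "is_iso (vert C) \<beta>"
    by (rule is_iso_vertI[OF be(1) _ be(3,2)]) (simp add: in_cell_def)
  then have "\<beta> \<in> Arr (arrowwise_iso_cat C A X)"
    using aws[of "Dom2 C \<alpha>"] aws[of "Cod2 C \<alpha>"]
    by (simp add: arrowwise_iso_cat_def subcat_def is_iso_hom in_mor_def)
  then have "\<beta> \<in> farr (post C i) ` Arr (hom C A K)" by (simp only: bij_betw_imp_surj_on[OF b])
  then obtain \<gamma> where g: "\<gamma> \<in> Arr (hom C A K)" "\<beta> = farr (post C i) \<gamma>" by (rule imageE)
  have [simp]: "\<gamma> \<in> Cell C" "Src C (Dom2 C \<gamma>) = A" "Tgt C (Dom2 C \<gamma>) = K" and gi: "\<gamma> \<lhd> i = \<beta>" using g by simp_all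
  have "Dom2 C \<gamma> = Cod2 C \<alpha>"
    by (rule inj_onD[OF bij_betw_imp_inj_on[OF bo]]) (use arg_cong[OF gi, of "Dom2 C"] in simp_all)
  moreover have "Cod2 C \<gamma> = Dom2 C \<alpha>"
    by (rule inj_onD[OF bij_betw_imp_inj_on[OF bo]]) (use arg_cong[OF gi, of "Cod2 C"] in simp_all)
  ultimately have [simp]: "Dom2 C \<gamma> = Cod2 C \<alpha>" "Cod2 C \<gamma> = Dom2 C \<alpha>" by simp_all
  have "\<alpha> \<odot> \<gamma> = Id2 C (Dom2 C \<alpha>)"
    by (rule inj_onD[OF bij_betw_imp_inj_on[OF b]]) (simp_all add: rwhisker_vcomp gi be)
  moreover have "\<gamma> \<odot> \<alpha> = Id2 C (Cod2 C \<alpha>)"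
    by (rule inj_onD[OF bij_betw_imp_inj_on[OF b]]) (simp_all add: rwhisker_vcomp gi be)
  ultimately have "is_iso (vert C) \<alpha>"
    by (intro is_iso_vertI[of \<alpha> "Dom2 C \<alpha>" "Cod2 C \<alpha>" \<gamma>]) (simp_all add: in_cell_def)
  then show "is_iso (hom C A K) \<alpha>" using a by (simp add: is_iso_hom)
qed

lemma lift_along_eq:
  assumes "\<exists>!h. in_mor C h (Src C f) (Src C i) \<and> h \<bullet> i = f"
  shows "in_mor C (lift_along C i f) (Src C f) (Src C i)" "lift_along C i f \<bullet> i = f"
    "in_mor C h (Src C f) (Src C i) \<Longrightarrow> h \<bullet> i = f \<Longrightarrow> lift_along C i f = h"
proof -
  show *: "in_mor C (lift_along C i f) (Src C f) (Src C i)" "lift_along C i f \<bullet> i = f"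
    using theI'[OF assms] unfolding lift_along_def by blast+
  show "in_mor C h (Src C f) (Src C i) \<Longrightarrow> h \<bullet> i = f \<Longrightarrow> lift_along C i f = h"
    using * assms by blast
qed

end

text \<open>What is used of a nerve; unlike \<open>is_nerve\<close>, this is visibly invariant under replacing \<open>X\<close> by
  an isomorphic object.\<close>

definition nerve_like :: "('o, 'm, 'c) twocat \<Rightarrow> ('o, 'm) icat \<Rightarrow> 'o \<Rightarrow> 'm \<Rightarrow> 'c \<Rightarrow> bool" where
  "nerve_like C N X g g01 \<longleftrightarrow>
     groupoid_ob C (ic0 N) \<and> groupoid_ob C (ic1 N) \<and> groupoid_ob C (ic2 N)
   \<and> in_mor C (pi0 N) (ic1 N) (ic0 N) \<and> in_mor C (pi1 N) (ic1 N) (ic0 N) \<and> in_mor C (ie N) (ic0 N) (ic1 N)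
   \<and> in_mor C (pi01 N) (ic2 N) (ic1 N) \<and> in_mor C (pi12 N) (ic2 N) (ic1 N) \<and> in_mor C (pi02 N) (ic2 N) (ic1 N)
   \<and> in_mor C g (ic0 N) X \<and> in_cell C g01 (pi0 N \<bullet>\<^bsub>C\<^esub> g) (pi1 N \<bullet>\<^bsub>C\<^esub> g)
   \<and> ie N \<rhd>\<^bsub>C\<^esub> g01 = Id2 C g
   \<and> pi01 N \<bullet>\<^bsub>C\<^esub> pi1 N = pi12 N \<bullet>\<^bsub>C\<^esub> pi0 N
   \<and> pi02 N \<rhd>\<^bsub>C\<^esub> g01 = (pi01 N \<rhd>\<^bsub>C\<^esub> g01) \<odot>\<^bsub>C\<^esub> (pi12 N \<rhd>\<^bsub>C\<^esub> g01)
   \<and> (\<forall>A f. groupoid_ob C A \<and> in_mor C f A X \<longrightarrow> (\<exists>!h. in_mor C h A (ic0 N) \<and> h \<bullet>\<^bsub>C\<^esub> g = f))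
   \<and> (\<forall>A \<alpha>. groupoid_ob C A \<and> \<alpha> \<in> Cell C \<and> Src C (Dom2 C \<alpha>) = A \<and> Tgt C (Dom2 C \<alpha>) = X \<longrightarrow>
        (\<exists>!a. in_mor C a A (ic1 N) \<and> a \<rhd>\<^bsub>C\<^esub> g01 = \<alpha>))"

lemma nerve_likeD:
  assumes "nerve_like C N X g g01"
  shows "groupoid_ob C (ic0 N)" "groupoid_ob C (ic1 N)" "groupoid_ob C (ic2 N)"
    "in_mor C (pi0 N) (ic1 N) (ic0 N)" "in_mor C (pi1 N) (ic1 N) (ic0 N)" "in_mor C (ie N) (ic0 N) (ic1 N)"
    "in_mor C (pi01 N) (ic2 N) (ic1 N)" "in_mor C (pi12 N) (ic2 N) (ic1 N)" "in_mor C (pi02 N) (ic2 N) (ic1 N)"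
    "in_mor C g (ic0 N) X" "in_cell C g01 (pi0 N \<bullet>\<^bsub>C\<^esub> g) (pi1 N \<bullet>\<^bsub>C\<^esub> g)" "ie N \<rhd>\<^bsub>C\<^esub> g01 = Id2 C g"
    "pi01 N \<bullet>\<^bsub>C\<^esub> pi1 N = pi12 N \<bullet>\<^bsub>C\<^esub> pi0 N"
    "pi02 N \<rhd>\<^bsub>C\<^esub> g01 = (pi01 N \<rhd>\<^bsub>C\<^esub> g01) \<odot>\<^bsub>C\<^esub> (pi12 N \<rhd>\<^bsub>C\<^esub> g01)"
    "groupoid_ob C A \<Longrightarrow> in_mor C f A X \<Longrightarrow> \<exists>!h. in_mor C h A (ic0 N) \<and> h \<bullet>\<^bsub>C\<^esub> g = f"
    "groupoid_ob C A \<Longrightarrow> \<alpha> \<in> Cell C \<Longrightarrow> Src C (Dom2 C \<alpha>) = A \<Longrightarrow> Tgt C (Dom2 C \<alpha>) = X \<Longrightarrow>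
       \<exists>!a. in_mor C a A (ic1 N) \<and> a \<rhd>\<^bsub>C\<^esub> g01 = \<alpha>"
  using assms unfolding nerve_like_def by blast+

context two_category
begin

lemma groupoid_lift:
  assumes "is_core C X K i" "groupoid_ob C A" "in_mor C f A X"
  shows "\<exists>!h. in_mor C h A K \<and> h \<bullet> i = f"
  by (rule core_mor[OF assms(1,3) groupoid_arrowwise_iso[OF assms(2,3)]])

lemma is_coreD: "is_core C X K i \<Longrightarrow> in_mor C i K X"
  unfolding is_core_def by blast

lemma core_map_eq:
  assumes c: "is_core C X K i" and c': "is_core C X' K' i'" and f: "in_mor C f X X'"
  shows "in_mor C (core_map C i i' f) K K'" "core_map C i i' f \<bullet> i' = i \<bullet> f"
proof -
  note [simp] = in_morD[OF is_coreD[OF c]] in_morD[OF is_coreD[OF c']] in_morD[OF f]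
  have "\<exists>!h. in_mor C h (Src C (i \<bullet> f)) (Src C i') \<and> h \<bullet> i' = i \<bullet> f"
    using groupoid_lift[OF c' core_groupoid[OF c], of "i \<bullet> f"] by (simp add: in_mor_def)
  from lift_along_eq(1,2)[OF this]
  show "in_mor C (core_map C i i' f) K K'" "core_map C i i' f \<bullet> i' = i \<bullet> f"
    by (simp_all add: core_map_def)
qed

text \<open>\<open>trivial_ev\<close> is constant at the identity of X, so a morphism into X is its
  own diagram of shape [0], and the structure map is evaluation at \<open>j\<close>.\<close>

lemma cotensor_map_to_ord0:
  assumes ev: "is_functor (ord_cat k) (hom C XJ X) ev" and X: "X \<in> Ob C" and j: "j \<le> k"
  shows "cotensor_map C XJ ev (ord_cat 0) X (trivial_ev C X) (delta [j]) = fobj ev j"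
  unfolding cotensor_map_def
proof (rule the_equality)
  note [simp] = hom_functorD(1-6)[OF ev] X j
  show "in_mor C (fobj ev j) XJ X \<and> diagram_of C (ord_cat 0) (trivial_ev C X) (fobj ev j) =
     ftor_restrict (ord_cat 0) (ftor_comp (delta [j]) ev)"
  proof
    show "diagram_of C (ord_cat 0) (trivial_ev C X) (fobj ev j) = ftor_restrict (ord_cat 0) (ftor_comp (delta [j]) ev)"
    proof (rule ftor_eqI)
      show "farr (diagram_of C (ord_cat 0) (trivial_ev C X) (fobj ev j)) u = farr (ftor_restrict (ord_cat 0) (ftor_comp (delta [j]) ev)) u"
        if "u \<in> Arr (ord_cat 0)" for u
        using that hom_functorD(7)[OF ev, of j] by (auto simp: trivial_ev_def ftor_comp_def delta_def)
    qed (auto simp: trivial_ev_def ftor_comp_def delta_def)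
  qed (simp add: in_mor_def)
  fix h assume h: "in_mor C h XJ X \<and> diagram_of C (ord_cat 0) (trivial_ev C X) h =
     ftor_restrict (ord_cat 0) (ftor_comp (delta [j]) ev)"
  then have "fobj (diagram_of C (ord_cat 0) (trivial_ev C X) h) 0 = fobj (ftor_restrict (ord_cat 0) (ftor_comp (delta [j]) ev)) 0"
    by simp
  then show "h = fobj ev j"
    using h by (simp add: trivial_ev_def ftor_comp_def delta_def in_mor_def)
qed

text \<open>A morphism into X^[1] is known through its 2-cell, so only the value of \<open>F\<close>
  at (0, 1) matters for a structure map.\<close>

lemma cotensor_map_to_ord1:
  assumes c: "is_cotensor C (ord_cat 1) X X1 ev1" and G: "is_functor (ord_cat 1) (hom C A X) (ftor_comp F ev)"
    and A: "A \<in> Ob C"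
  shows "in_mor C (cotensor_map C A ev (ord_cat 1) X1 ev1 F) A X1"
    "cotensor_map C A ev (ord_cat 1) X1 ev1 F \<rhd> farr ev1 (0, 1) = farr ev (farr F (0, 1))"
proof -
  have ev1: "is_functor (ord_cat 1) (hom C X1 X) ev1" using c unfolding is_cotensor_def by blast
  let ?G = "ftor_restrict (ord_cat 1) (ftor_comp F ev)"
  have G': "is_functor (ord_cat 1) (hom C A X) ?G"
    using G restrict_functor[OF category_ord_cat] by blast
  have "\<exists>!h. in_mor C h A X1 \<and> diagram_of C (ord_cat 1) ev1 h = ?G"
    by (rule cotensor_mor[OF c A G']) simp
  from theI'[OF this]
  have h: "in_mor C (cotensor_map C A ev (ord_cat 1) X1 ev1 F) A X1"
    "diagram_of C (ord_cat 1) ev1 (cotensor_map C A ev (ord_cat 1) X1 ev1 F) = ?G"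
    unfolding cotensor_map_def by blast+
  show "in_mor C (cotensor_map C A ev (ord_cat 1) X1 ev1 F) A X1" by (rule h)
  show "cotensor_map C A ev (ord_cat 1) X1 ev1 F \<rhd> farr ev1 (0, 1) = farr ev (farr F (0, 1))"
    using ord1_functor_eq[OF ev1 h(1) G'] h(2) by (simp add: ftor_comp_def)
qed

lemma delta_functor:
  assumes ev: "is_functor (ord_cat k) (hom C A X) ev" and ij: "i \<le> j" "j \<le> k"
  shows "is_functor (ord_cat 1) (hom C A X) (ftor_comp (delta [i, j]) ev)"
proof -
  note e = hom_functorD[OF ev]
  have [simp]: "i \<le> k" using ij by simp
  note [simp] = e(1-6) ij
  have [simp]: "farr ev (i, i) = Id2 C (fobj ev i)" "farr ev (j, j) = Id2 C (fobj ev j)"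
    using e(7)[of i] e(7)[of j] by simp_all
  have 1: "u \<in> {(0, 0), (0, 1), (1, 1)}" if "u \<in> Arr (ord_cat 1)" for u
    using ord1_cases that by (cases u) blast
  show ?thesis
    unfolding is_functor_def
  proof (intro conjI ballI impI)
    fix m assume "m \<in> Obj (ord_cat 1)"
    then have m: "m = 0 \<or> m = 1" by auto
    then show "fobj (ftor_comp (delta [i, j]) ev) m \<in> Obj (hom C A X)"
      "farr (ftor_comp (delta [i, j]) ev) (ide (ord_cat 1) m) = ide (hom C A X) (fobj (ftor_comp (delta [i, j]) ev) m)"
      by (auto simp: ftor_comp_def delta_def)
  next
    fix u assume "u \<in> Arr (ord_cat 1)"
    from 1[OF this] show "in_hom (hom C A X) (farr (ftor_comp (delta [i, j]) ev) u) (fobj (ftor_comp (delta [i, j]) ev) (Dom (ord_cat 1) u))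
         (fobj (ftor_comp (delta [i, j]) ev) (Cod (ord_cat 1) u))"
      by (auto simp: ftor_comp_def delta_def in_hom_def)
  next
    fix u v assume "u \<in> Arr (ord_cat 1)" "v \<in> Arr (ord_cat 1)" "Cod (ord_cat 1) u = Dom (ord_cat 1) v"
    then show "farr (ftor_comp (delta [i, j]) ev) (u \<cdot>\<^bsub>ord_cat 1\<^esub> v) =
        farr (ftor_comp (delta [i, j]) ev) u \<cdot>\<^bsub>hom C A X\<^esub> farr (ftor_comp (delta [i, j]) ev) v"
      using 1[of u] 1[of v] by (auto simp: ftor_comp_def delta_def)
  qed
qed

lemma trivial_functor: "X \<in> Ob C \<Longrightarrow> is_functor (ord_cat 0) (hom C X X) (trivial_ev C X)"
  unfolding is_functor_def by (auto simp: trivial_ev_def in_hom_def)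

text \<open>A 2-cell between morphisms from a groupoid A to X is a morphism from A to X^[1], and
  this lifts uniquely to the core; so \<open>ic1 N\<close> represents such 2-cells. The laws for
  \<open>g01\<close> come from the functor laws of the evaluations, read through \<open>i1\<close>
  and \<open>i2\<close>.\<close>

lemma nerve_is_nerve_like:
  assumes X: "X \<in> Ob C" and N: "is_nerve C X N g g01"
  shows "nerve_like C N X g g01"
proof -
  obtain X1 ev1 X2 ev2 i1 i2 where c1: "is_cotensor C (ord_cat 1) X X1 ev1" and c2: "is_cotensor C (ord_cat 2) X X2 ev2"
    and k0: "is_core C X (ic0 N) g" and k1: "is_core C X1 (ic1 N) i1" and k2: "is_core C X2 (ic2 N) i2"
    and p0: "pi0 N = core_map C i1 g (cotensor_map C X1 ev1 (ord_cat 0) X (trivial_ev C X) (delta [0]))"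
    and p1: "pi1 N = core_map C i1 g (cotensor_map C X1 ev1 (ord_cat 0) X (trivial_ev C X) (delta [1]))"
    and e: "ie N = core_map C g i1 (cotensor_map C X (trivial_ev C X) (ord_cat 1) X1 ev1 (delta [0, 0]))"
    and p01: "pi01 N = core_map C i2 i1 (cotensor_map C X2 ev2 (ord_cat 1) X1 ev1 (delta [0, 1]))"
    and p12: "pi12 N = core_map C i2 i1 (cotensor_map C X2 ev2 (ord_cat 1) X1 ev1 (delta [1, 2]))"
    and p02: "pi02 N = core_map C i2 i1 (cotensor_map C X2 ev2 (ord_cat 1) X1 ev1 (delta [0, 2]))"
    and g01: "g01 = i1 \<rhd> farr ev1 (0, 1)"
    using N unfolding is_nerve_def by blast
  have ev1: "is_functor (ord_cat 1) (hom C X1 X) ev1" and ev2: "is_functor (ord_cat 2) (hom C X2 X) ev2"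
    and X1: "X1 \<in> Ob C" and X2: "X2 \<in> Ob C"
    using c1 c2 unfolding is_cotensor_def by blast+
  let ?d = "farr ev1 (0, 1)"
  note ao = cotensor_arrow_object[OF c1]
  note [simp] = arrow_objectD[OF ao(1)] ao(2,3)
  note e1 = hom_functorD[OF ev1] and e2 = hom_functorD[OF ev2]
  have [simp]: "fobj ev1 0 \<in> Mor C" "Src C (fobj ev1 0) = X1" "Tgt C (fobj ev1 0) = X"
    "fobj ev1 1 \<in> Mor C" "Src C (fobj ev1 1) = X1" "Tgt C (fobj ev1 1) = X"
    using e1(1-3)[of 0] e1(1-3)[of 1] by simp_all
  note ci = is_coreD[OF k0] is_coreD[OF k1] is_coreD[OF k2]
  note [simp] = in_morD[OF ci(1)] in_morD[OF ci(2)] in_morD[OF ci(3)] X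
  have m0: "in_mor C (pi0 N) (ic1 N) (ic0 N)" "pi0 N \<bullet> g = i1 \<bullet> fobj ev1 0"
    unfolding p0 cotensor_map_to_ord0[OF ev1 X, of 0, simplified]
    by (rule core_map_eq[OF k1 k0]; simp add: in_mor_def)+
  have m1: "in_mor C (pi1 N) (ic1 N) (ic0 N)" "pi1 N \<bullet> g = i1 \<bullet> fobj ev1 1"
    unfolding p1 cotensor_map_to_ord0[OF ev1 X, of 1, simplified]
    by (rule core_map_eq[OF k1 k0]; simp add: in_mor_def)+
  have cm: "in_mor C (core_map C i2 i1 (cotensor_map C X2 ev2 (ord_cat 1) X1 ev1 (delta [i, j]))) (ic2 N) (ic1 N)"
    "core_map C i2 i1 (cotensor_map C X2 ev2 (ord_cat 1) X1 ev1 (delta [i, j])) \<rhd> g01 = i2 \<rhd> farr ev2 (i, j)"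
    if ij: "i \<le> j" "j \<le> 2" for i j
  proof -
    let ?x = "cotensor_map C X2 ev2 (ord_cat 1) X1 ev1 (delta [i, j])"
    note x = cotensor_map_to_ord1[OF c1 delta_functor[OF ev2 ij] X2]
    have xd: "?x \<rhd> ?d = farr ev2 (i, j)" using x(2) by (simp add: delta_def)
    note h = core_map_eq[OF k2 k1 x(1)]
    note [simp] = in_morD[OF x(1)] in_morD[OF h(1)]
    show "in_mor C (core_map C i2 i1 ?x) (ic2 N) (ic1 N)" by (rule h)
    have "core_map C i2 i1 ?x \<rhd> g01 = (i2 \<bullet> ?x) \<rhd> ?d" by (simp add: g01 h(2))
    also have "\<dots> = i2 \<rhd> (?x \<rhd> ?d)" by simp
    finally show "core_map C i2 i1 ?x \<rhd> g01 = i2 \<rhd> farr ev2 (i, j)" by (simp only: xd)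
  qed
  have m01: "in_mor C (pi01 N) (ic2 N) (ic1 N)" "pi01 N \<rhd> g01 = i2 \<rhd> farr ev2 (0, 1)"
    and m12: "in_mor C (pi12 N) (ic2 N) (ic1 N)" "pi12 N \<rhd> g01 = i2 \<rhd> farr ev2 (1, 2)"
    and m02: "in_mor C (pi02 N) (ic2 N) (ic1 N)" "pi02 N \<rhd> g01 = i2 \<rhd> farr ev2 (0, 2)"
    unfolding p01 p12 p02 by (rule cm; simp)+
  let ?s = "cotensor_map C X (trivial_ev C X) (ord_cat 1) X1 ev1 (delta [0, 0])"
  note s = cotensor_map_to_ord1[OF c1 delta_functor[OF trivial_functor[OF X], of 0 0, simplified] X]
  have sd: "?s \<rhd> ?d = Id2 C (Id1 C X)" using s(2) by (simp add: delta_def trivial_ev_def)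
  note me = core_map_eq[OF k0 k1 s(1), folded e]
  note [simp] = in_morD[OF s(1)] in_morD[OF me(1)] in_morD[OF m0(1)] in_morD[OF m1(1)]
    in_morD[OF m01(1)] in_morD[OF m12(1)] in_morD[OF m02(1)]
  have gc: "in_cell C g01 (pi0 N \<bullet> g) (pi1 N \<bullet> g)" by (simp add: g01 in_cell_def m0(2) m1(2))
  note [simp] = in_cellD[OF gc]
  have "ie N \<rhd> g01 = (g \<bullet> ?s) \<rhd> ?d" by (simp add: g01 me(2))
  also have "\<dots> = g \<rhd> (?s \<rhd> ?d)" by simp
  finally have eg: "ie N \<rhd> g01 = Id2 C g" by (simp add: sd)
  have ev2_simps [simp]: "farr ev2 (0, 1) \<in> Cell C" "farr ev2 (1, 2) \<in> Cell C" "Dom2 C (farr ev2 (0, 1)) = fobj ev2 0"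
    "Cod2 C (farr ev2 (0, 1)) = fobj ev2 1" "Dom2 C (farr ev2 (1, 2)) = fobj ev2 1" "Src C (fobj ev2 0) = X2"
    "Src C (fobj ev2 1) = X2"
    using e2 by simp_all
  have "farr ev2 (0, 2) = farr ev2 (0, 1) \<odot> farr ev2 (1, 2)" using e2(8)[of "(0, 1)" "(1, 2)"] by simp
  then have comp: "pi02 N \<rhd> g01 = (pi01 N \<rhd> g01) \<odot> (pi12 N \<rhd> g01)"
    unfolding m01(2) m12(2) m02(2) by (simp add: lwhisker_vcomp)
  \<comment> \<open>Morphisms from a groupoid to the core are compared after composition with
    \<open>g\<close>, where both are the middle object of the universal composable pair.\<close>
  have "(pi01 N \<bullet> pi1 N) \<bullet> g = (pi12 N \<bullet> pi0 N) \<bullet> g"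
    using arg_cong[OF m01(2), of "Cod2 C"] arg_cong[OF m12(2), of "Dom2 C"] by simp
  moreover have "in_mor C (pi01 N \<bullet> pi1 N) (ic2 N) (ic0 N)" "in_mor C (pi12 N \<bullet> pi0 N) (ic2 N) (ic0 N)"
    by (simp_all add: in_mor_def)
  moreover have "\<exists>!h. in_mor C h (ic2 N) (ic0 N) \<and> h \<bullet> g = (pi01 N \<bullet> pi1 N) \<bullet> g"
    by (rule groupoid_lift[OF k0 core_groupoid[OF k2]]) (simp add: in_mor_def)
  ultimately have comm: "pi01 N \<bullet> pi1 N = pi12 N \<bullet> pi0 N" by metis
  have cells: "\<exists>!a. in_mor C a A (ic1 N) \<and> a \<rhd> g01 = \<alpha>"
    if A: "groupoid_ob C A" and \<alpha>: "\<alpha> \<in> Cell C" "Src C (Dom2 C \<alpha>) = A" "Tgt C (Dom2 C \<alpha>) = X" for A \<alpha>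
  proof -
    obtain k where k: "in_mor C k A X1" "k \<rhd> ?d = \<alpha>"
      by (rule arrow_object_mor[OF ao(1) \<alpha>(1,3)]) (simp add: \<alpha>)
    have ex: "\<exists>!a. in_mor C a A (ic1 N) \<and> a \<bullet> i1 = k" by (rule groupoid_lift[OF k1 A k(1)])
    \<comment> \<open>Morphisms into X^[1] are compared through the universal 2-cell
      \<open>?d\<close>.\<close>
    have iff: "a \<rhd> g01 = \<alpha> \<longleftrightarrow> a \<bullet> i1 = k" if a: "in_mor C a A (ic1 N)" for a
    proof -
      note [simp] = in_morD[OF a]
      have "a \<rhd> g01 = (a \<bullet> i1) \<rhd> ?d" by (simp add: g01)
      moreover have "(a \<bullet> i1) \<rhd> ?d = k \<rhd> ?d \<Longrightarrow> a \<bullet> i1 = k"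
        by (rule arrow_object_mor_eq[OF ao(1) _ k(1)]) (simp add: in_mor_def)
      ultimately show ?thesis using k(2) by metis
    qed
    show ?thesis using ex iff by metis
  qed
  show ?thesis
    unfolding nerve_like_def
  proof (intro conjI allI impI)
    fix A f assume "groupoid_ob C A \<and> in_mor C f A X"
    then show "\<exists>!h. in_mor C h A (ic0 N) \<and> h \<bullet> g = f" by (elim conjE) (rule groupoid_lift[OF k0])
  next
    fix A \<alpha> assume "groupoid_ob C A \<and> \<alpha> \<in> Cell C \<and> Src C (Dom2 C \<alpha>) = A \<and> Tgt C (Dom2 C \<alpha>) = X"
    then show "\<exists>!a. in_mor C a A (ic1 N) \<and> a \<rhd> g01 = \<alpha>" by (elim conjE) (rule cells)
  qed (fact core_groupoid[OF k0] core_groupoid[OF k1] core_groupoid[OF k2] m0(1) m1(1) me(1)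
      m01(1) m12(1) m02(1) ci(1) gc eg comm comp)+
qed

end

locale groupoidant_category = pita_category +
  assumes groupoidant: "groupoidant C"
begin

lemma obtain_core:
  assumes "X \<in> Ob C"
  obtains K i where "is_core C X K i"
  using groupoidant assms unfolding groupoidant_def by blast

lemma nerve_ex:
  assumes X: "X \<in> Ob C"
  shows "\<exists>N g g01. is_nerve C X N g g01"
proof -
  obtain X1 ev1 where c1: "is_cotensor C (ord_cat 1) X X1 ev1" using pita X unfolding pita_def by blast
  obtain X2 ev2 where c2: "is_cotensor C (ord_cat 2) X X2 ev2" using cotensor2_ex[OF X] by blast
  have X1: "X1 \<in> Ob C" and X2: "X2 \<in> Ob C" using c1 c2 unfolding is_cotensor_def by blast+
  obtain K0 g where k0: "is_core C X K0 g" by (rule obtain_core[OF X])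
  obtain K1 i1 where k1: "is_core C X1 K1 i1" by (rule obtain_core[OF X1])
  obtain K2 i2 where k2: "is_core C X2 K2 i2" by (rule obtain_core[OF X2])
  let ?N = "\<lparr>ic0 = K0, ic1 = K1, ic2 = K2,
    pi0 = core_map C i1 g (cotensor_map C X1 ev1 (ord_cat 0) X (trivial_ev C X) (delta [0])),
    pi1 = core_map C i1 g (cotensor_map C X1 ev1 (ord_cat 0) X (trivial_ev C X) (delta [1])),
    ie = core_map C g i1 (cotensor_map C X (trivial_ev C X) (ord_cat 1) X1 ev1 (delta [0, 0])),
    pi01 = core_map C i2 i1 (cotensor_map C X2 ev2 (ord_cat 1) X1 ev1 (delta [0, 1])),
    pi12 = core_map C i2 i1 (cotensor_map C X2 ev2 (ord_cat 1) X1 ev1 (delta [1, 2])),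
    pi02 = core_map C i2 i1 (cotensor_map C X2 ev2 (ord_cat 1) X1 ev1 (delta [0, 2]))\<rparr>"
  have "is_nerve C X ?N g (i1 \<rhd> farr ev1 (0, 1))"
    unfolding is_nerve_def
    by (intro exI[of _ X1] exI[of _ ev1] exI[of _ X2] exI[of _ ev2] exI[of _ i1] exI[of _ i2])
      (simp add: c1 c2 k0 k1 k2)
  then show ?thesis by blast
qed

lemma nerve_quotient: "X \<in> Ob C \<Longrightarrow> is_nerve C X N g g01 \<Longrightarrow> strict_quotient C N X g g01"
  using groupoidant unfolding groupoidant_def by blast

end

section \<open>Strict quotients\<close>

context two_category
begin

lemma cocone_simps [simp]:
  "Obj (cocone_cat C D Y) = {(g, g01). is_cocone C D Y g g01}"
  "Arr (cocone_cat C D Y) = {((g, g01), (k, k01), \<alpha>). is_cocone C D Y g g01 \<and> is_cocone C D Y k k01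
     \<and> in_cell C \<alpha> g k \<and> (pi0 D \<rhd> \<alpha>) \<odot> k01 = g01 \<odot> (pi1 D \<rhd> \<alpha>)}"
  by (simp_all add: cocone_cat_def)

lemma quotient_mor:
  assumes q: "strict_quotient C D X g g01" and k: "is_cocone C D Y k k01" and Y: "Y \<in> Ob C"
  shows "\<exists>!h. in_mor C h X Y \<and> g \<bullet> h = k \<and> g01 \<lhd> h = k01"
proof -
  have b: "bij_betw (\<lambda>h. (g \<bullet> h, g01 \<lhd> h)) (Obj (hom C X Y)) (Obj (cocone_cat C D Y))"
    using q Y unfolding strict_quotient_def cat_isomorphism_def quotient_functor_def by simp
  have "(k, k01) \<in> Obj (cocone_cat C D Y)" using k by simp
  then have "(k, k01) \<in> (\<lambda>h. (g \<bullet> h, g01 \<lhd> h)) ` Obj (hom C X Y)" by (simp only: bij_betw_imp_surj_on[OF b])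
  then obtain h where h: "h \<in> Obj (hom C X Y)" "(k, k01) = (g \<bullet> h, g01 \<lhd> h)" by (rule imageE)
  show ?thesis
  proof (rule ex1I[of _ h])
    show "in_mor C h X Y \<and> g \<bullet> h = k \<and> g01 \<lhd> h = k01" using h by (simp add: in_mor_def)
    fix h' assume h': "in_mor C h' X Y \<and> g \<bullet> h' = k \<and> g01 \<lhd> h' = k01"
    show "h' = h"
      by (rule inj_onD[OF bij_betw_imp_inj_on[OF b]]) (use h h' in \<open>simp_all add: in_mor_def\<close>)
  qed
qed

lemma quotient_cocone:
  assumes q: "strict_quotient C D X g g01" and h: "in_mor C h X Y"
  shows "is_cocone C D Y (g \<bullet> h) (g01 \<lhd> h)"
proof -
  have Y: "Y \<in> Ob C" using Mor_simps(5)[of h] in_morD[OF h] by simp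
  have "is_functor (hom C X Y) (cocone_cat C D Y) (quotient_functor C g g01)"
    using q Y unfolding strict_quotient_def cat_isomorphism_def by blast
  then show ?thesis using h unfolding is_functor_def by (simp add: quotient_functor_def in_mor_def)
qed

lemma quotient_cell:
  assumes q: "strict_quotient C D X g g01" and h: "in_mor C h X Y" and h': "in_mor C h' X Y"
    and \<alpha>: "in_cell C \<alpha> (g \<bullet> h) (g \<bullet> h')" and e: "(pi0 D \<rhd> \<alpha>) \<odot> (g01 \<lhd> h') = (g01 \<lhd> h) \<odot> (pi1 D \<rhd> \<alpha>)"
  shows "\<exists>!\<beta>. in_cell C \<beta> h h' \<and> g \<rhd> \<beta> = \<alpha>"
proof -
  have Y: "Y \<in> Ob C" using Mor_simps(5)[of h] in_morD[OF h] by simp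
  let ?F = "quotient_functor C g g01"
  have b: "bij_betw (farr ?F) (Arr (hom C X Y)) (Arr (cocone_cat C D Y))"
    using q Y unfolding strict_quotient_def cat_isomorphism_def by blast
  have F: "farr ?F \<beta> = ((g \<bullet> Dom2 C \<beta>, g01 \<lhd> Dom2 C \<beta>), (g \<bullet> Cod2 C \<beta>, g01 \<lhd> Cod2 C \<beta>), g \<rhd> \<beta>)" for \<beta>
    by (simp add: quotient_functor_def)
  have "((g \<bullet> h, g01 \<lhd> h), (g \<bullet> h', g01 \<lhd> h'), \<alpha>) \<in> Arr (cocone_cat C D Y)"
    using quotient_cocone[OF q h] quotient_cocone[OF q h'] \<alpha> e by simp
  then have "((g \<bullet> h, g01 \<lhd> h), (g \<bullet> h', g01 \<lhd> h'), \<alpha>) \<in> farr ?F ` Arr (hom C X Y)"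
    by (simp only: bij_betw_imp_surj_on[OF b])
  then obtain \<beta> where be: "\<beta> \<in> Arr (hom C X Y)" "((g \<bullet> h, g01 \<lhd> h), (g \<bullet> h', g01 \<lhd> h'), \<alpha>) = farr ?F \<beta>"
    by (rule imageE)
  have beq: "g \<bullet> h = g \<bullet> Dom2 C \<beta>" "g01 \<lhd> h = g01 \<lhd> Dom2 C \<beta>" "g \<bullet> h' = g \<bullet> Cod2 C \<beta>" "g01 \<lhd> h' = g01 \<lhd> Cod2 C \<beta>"
    "\<alpha> = g \<rhd> \<beta>" using be(2) by (simp_all add: F)
  have dm: "in_mor C (Dom2 C \<beta>) X Y" "in_mor C (Cod2 C \<beta>) X Y" using be(1) by (simp_all add: in_mor_def)
  have "Dom2 C \<beta> = h" using quotient_mor[OF q quotient_cocone[OF q h] Y] h dm(1) beq(1,2) by metis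
  moreover have "Cod2 C \<beta> = h'" using quotient_mor[OF q quotient_cocone[OF q h'] Y] h' dm(2) beq(3,4) by metis
  ultimately have bc: "in_cell C \<beta> h h'" using be(1) by (simp add: in_cell_def)
  show ?thesis
  proof (rule ex1I[of _ \<beta>])
    show "in_cell C \<beta> h h' \<and> g \<rhd> \<beta> = \<alpha>" using bc beq(5) by simp
    fix \<gamma> assume g: "in_cell C \<gamma> h h' \<and> g \<rhd> \<gamma> = \<alpha>"
    show "\<gamma> = \<beta>"
    proof (rule inj_onD[OF bij_betw_imp_inj_on[OF b]])
      show "farr ?F \<gamma> = farr ?F \<beta>" using g bc beq(5) by (simp add: F in_cell_def)
      show "\<gamma> \<in> Arr (hom C X Y)" using g in_morD[OF h] by (auto simp: in_cell_def)
    qed (rule be(1))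
  qed
qed

text \<open>Two strict quotients of the same congruence are isomorphic, compatibly with their
  cocones, and lifts of morphisms and 2-cells are carried along this isomorphism. It serves
  oppositions, whose congruence is a nerve of some object while \<open>X\<close> is given as a
  quotient.\<close>

lemma nerve_like_transport:
  assumes n: "nerve_like C N Y k k01" and qY: "strict_quotient C N Y k k01" and qX: "strict_quotient C N X g g01"
  shows "nerve_like C N X g g01"
proof -
  have Y: "Y \<in> Ob C" and X: "X \<in> Ob C" using qY qX unfolding strict_quotient_def by blast+
  have cY: "is_cocone C N Y k k01" and cX: "is_cocone C N X g g01" using qY qX unfolding strict_quotient_def by blast+
  obtain p where p: "in_mor C p Y X" "k \<bullet> p = g" "k01 \<lhd> p = g01" using quotient_mor[OF qY cX X] by blast
  obtain s where s: "in_mor C s X Y" "g \<bullet> s = k" "g01 \<lhd> s = k01" using quotient_mor[OF qX cY Y] by blast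
  have kt: "in_mor C k (ic0 N) Y" "in_mor C g (ic0 N) X" and ct: "in_cell C k01 (pi0 N \<bullet> k) (pi1 N \<bullet> k)"
     "in_cell C g01 (pi0 N \<bullet> g) (pi1 N \<bullet> g)" and cx: "ie N \<rhd> g01 = Id2 C g" "pi02 N \<rhd> g01 = (pi01 N \<rhd> g01) \<odot> (pi12 N \<rhd> g01)"
    using cX cY unfolding is_cocone_def by blast+
  have ms: "in_mor C (pi0 N) (ic1 N) (ic0 N)" "in_mor C (pi1 N) (ic1 N) (ic0 N)"
    and lift: "\<And>A f. groupoid_ob C A \<Longrightarrow> in_mor C f A Y \<Longrightarrow> \<exists>!h. in_mor C h A (ic0 N) \<and> h \<bullet> k = f"
    and clift: "\<And>A \<alpha>. groupoid_ob C A \<Longrightarrow> \<alpha> \<in> Cell C \<Longrightarrow> Src C (Dom2 C \<alpha>) = A \<Longrightarrow> Tgt C (Dom2 C \<alpha>) = Y \<Longrightarrow>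
        \<exists>!a. in_mor C a A (ic1 N) \<and> a \<rhd> k01 = \<alpha>"
    using n unfolding nerve_like_def by blast+
  note [simp] = in_morD[OF p(1)] in_morD[OF s(1)] in_morD[OF kt(1)] in_morD[OF kt(2)] in_cellD[OF ct(1)] in_cellD[OF ct(2)]
    in_morD[OF ms(1)] in_morD[OF ms(2)] X Y
  have ps: "p \<bullet> s = Id1 C Y"
  proof -
    have "in_mor C (p \<bullet> s) Y Y" "k \<bullet> (p \<bullet> s) = k" "k01 \<lhd> (p \<bullet> s) = k01"
      using comp1_eq_assoc1[OF p(2), of s] rwhisker_rwhisker[of p s k01] by (simp_all add: in_mor_def s p(3))
    moreover have "in_mor C (Id1 C Y) Y Y" "k \<bullet> Id1 C Y = k" "k01 \<lhd> Id1 C Y = k01" by (simp_all add: in_mor_def)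
    ultimately show ?thesis using quotient_mor[OF qY cY Y] by blast
  qed
  have sp: "s \<bullet> p = Id1 C X"
  proof -
    have "in_mor C (s \<bullet> p) X X" "g \<bullet> (s \<bullet> p) = g" "g01 \<lhd> (s \<bullet> p) = g01"
      using comp1_eq_assoc1[OF s(2), of p] rwhisker_rwhisker[of s p g01] by (simp_all add: in_mor_def p s(3))
    moreover have "in_mor C (Id1 C X) X X" "g \<bullet> Id1 C X = g" "g01 \<lhd> Id1 C X = g01" by (simp_all add: in_mor_def)
    ultimately show ?thesis using quotient_mor[OF qX cX X] by blast
  qed
  have lift': "\<exists>!h. in_mor C h A (ic0 N) \<and> h \<bullet> g = f" if A: "groupoid_ob C A" and f: "in_mor C f A X" for A f
  proof -
    note [simp] = in_morD[OF f]
    have "\<exists>!h. in_mor C h A (ic0 N) \<and> h \<bullet> k = f \<bullet> s" by (rule lift[OF A]) (simp add: in_mor_def)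
    moreover have "h \<bullet> k = f \<bullet> s \<longleftrightarrow> h \<bullet> g = f" if h: "in_mor C h A (ic0 N)" for h
    proof
      note [simp] = in_morD[OF h]
      assume e: "h \<bullet> k = f \<bullet> s"
      show "h \<bullet> g = f" using comp1_eq_assoc[OF e, of p] by (simp add: p(2) sp)
    next
      note [simp] = in_morD[OF h]
      assume e: "h \<bullet> g = f"
      show "h \<bullet> k = f \<bullet> s" using comp1_eq_assoc1[OF e, of s] by (simp add: s(2))
    qed
    ultimately show ?thesis by metis
  qed
  have clift': "\<exists>!a. in_mor C a A (ic1 N) \<and> a \<rhd> g01 = \<alpha>"
    if A: "groupoid_ob C A" and \<alpha>: "\<alpha> \<in> Cell C" "Src C (Dom2 C \<alpha>) = A" "Tgt C (Dom2 C \<alpha>) = X" for A \<alpha>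
  proof -
    note [simp] = \<alpha>
    have "\<exists>!a. in_mor C a A (ic1 N) \<and> a \<rhd> k01 = \<alpha> \<lhd> s" by (rule clift[OF A]) simp_all
    moreover have "a \<rhd> k01 = \<alpha> \<lhd> s \<longleftrightarrow> a \<rhd> g01 = \<alpha>" if a: "in_mor C a A (ic1 N)" for a
    proof
      note [simp] = in_morD[OF a]
      assume e: "a \<rhd> k01 = \<alpha> \<lhd> s"
      have "a \<rhd> (k01 \<lhd> p) = \<alpha> \<lhd> (s \<bullet> p)"
        using arg_cong[OF e, of "\<lambda>x. x \<lhd> p"] by simp
      then show "a \<rhd> g01 = \<alpha>" by (simp add: p(3) sp)
    next
      note [simp] = in_morD[OF a]
      assume e: "a \<rhd> g01 = \<alpha>"
      have "a \<rhd> (g01 \<lhd> s) = \<alpha> \<lhd> s" by (simp add: e[symmetric])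
      then show "a \<rhd> k01 = \<alpha> \<lhd> s" by (simp only: s(3))
    qed
    ultimately show ?thesis by metis
  qed
  show ?thesis
    unfolding nerve_like_def
  proof (intro conjI allI impI)
    fix A f assume "groupoid_ob C A \<and> in_mor C f A X"
    then show "\<exists>!h. in_mor C h A (ic0 N) \<and> h \<bullet> g = f" by (elim conjE) (rule lift')
  next
    fix A \<alpha> assume "groupoid_ob C A \<and> \<alpha> \<in> Cell C \<and> Src C (Dom2 C \<alpha>) = A \<and> Tgt C (Dom2 C \<alpha>) = X"
    then show "\<exists>!a. in_mor C a A (ic1 N) \<and> a \<rhd> g01 = \<alpha>" by (elim conjE) (rule clift')
  qed (fact kt(2) ct(2) cx nerve_likeD[OF n])+
qed

end

section \<open>The object of stable relations\<close>

lemma ex1_unique: "\<exists>!x. P x \<Longrightarrow> P a \<Longrightarrow> P b \<Longrightarrow> a = b"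
  by blast

context category
begin

lemma mono_iff_kernel_pair:
  assumes pb: "is_pullback D k0 k1 m m"
  shows "is_mono D m \<longleftrightarrow> k0 = k1"
proof
  note [simp] = is_pullbackD(1-8)[OF pb]
  assume "is_mono D m"
  then show "k0 = k1"
    by (rule is_monoD[of D m k0 "Dom D k0" k1]) (simp_all add: in_hom_def is_pullbackD(9)[OF pb])
next
  assume eq: "k0 = k1"
  show "is_mono D m"
    unfolding is_mono_def
  proof (intro conjI ballI impI)
    show "m \<in> Arr D" by (rule is_pullbackD(3)[OF pb])
    fix x y assume xy: "x \<in> Arr D" "y \<in> Arr D"
      "Dom D x = Dom D y \<and> Cod D x = Dom D m \<and> Cod D y = Dom D m \<and> x \<cdot> m = y \<cdot> m"
    have "in_hom D x (Dom D x) (Dom D m)" "in_hom D y (Dom D x) (Dom D m)" "x \<cdot> m = y \<cdot> m"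
      using xy by (auto simp: in_hom_def)
    from is_pullback_pair[OF pb this] obtain h where "h \<cdot> k0 = x" "h \<cdot> k1 = y" by blast
    then show "x = y" unfolding eq by (rule trans[OF sym])
  qed
qed

lemma product_iso:
  assumes w: "is_product D w0 w1" and u: "is_iso D u" "Cod D u = Dom D w0"
  shows "is_product D (u \<cdot> w0) (u \<cdot> w1)"
proof -
  obtain v where v: "u \<in> Arr D" "in_hom D v (Cod D u) (Dom D u)" "u \<cdot> v = ide D (Dom D u)" "v \<cdot> u = ide D (Cod D u)"
    using u(1) unfolding is_iso_def inverse_arrows_def by blast
  note [simp] = is_productD[OF w] u(2) v(1) in_homD[OF v(2)]
  show ?thesis
    unfolding is_product_def
  proof (intro conjI ballI impI)
    fix x y assume "x \<in> Arr D" "y \<in> Arr D"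
      "Dom D x = Dom D y \<and> Cod D x = Cod D (u \<cdot> w0) \<and> Cod D y = Cod D (u \<cdot> w1)"
    then have x: "in_hom D x (Dom D x) (Cod D w0)" and y: "in_hom D y (Dom D x) (Cod D w1)"
      by (simp_all add: in_hom_def)
    obtain h where h: "in_hom D h (Dom D x) (Dom D w0)" "h \<cdot> w0 = x" "h \<cdot> w1 = y"
      by (rule is_product_pair[OF w x y])
    note [simp] = in_homD[OF h(1)]
    show "\<exists>!h. in_hom D h (Dom D x) (Dom D (u \<cdot> w0)) \<and> h \<cdot> (u \<cdot> w0) = x \<and> h \<cdot> (u \<cdot> w1) = y"
    proof (rule ex1I[of _ "h \<cdot> v"])
      show "in_hom D (h \<cdot> v) (Dom D x) (Dom D (u \<cdot> w0)) \<and> (h \<cdot> v) \<cdot> (u \<cdot> w0) = x \<and> (h \<cdot> v) \<cdot> (u \<cdot> w1) = y"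
        using cmp_eq_assoc1[OF v(4), of w0] cmp_eq_assoc1[OF v(4), of w1] h by (simp add: in_hom_def)
      fix k assume k: "in_hom D k (Dom D x) (Dom D (u \<cdot> w0)) \<and> k \<cdot> (u \<cdot> w0) = x \<and> k \<cdot> (u \<cdot> w1) = y"
      then have [simp]: "k \<in> Arr D" "Dom D k = Dom D x" "Cod D k = Dom D u" by (simp_all add: in_hom_def)
      have ku: "k \<cdot> u = h"
        by (rule jointly_monicD[OF product_jointly_monic[OF w], of _ "Dom D x"])
          (use k h in \<open>simp_all add: in_hom_def\<close>)
      have "k \<cdot> (u \<cdot> v) = h \<cdot> v" by (rule cmp_eq_assoc1[OF ku]) simp_all
      then show "k = h \<cdot> v" by (simp add: v(3))
    qed
  qed simp_all
qed

lemma product_comparison: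
  assumes p: "is_product D p q" and w: "is_product D w0 w1" and c: "Cod D p = Cod D w0" "Cod D q = Cod D w1"
  obtains u where "in_hom D u (Dom D p) (Dom D w0)" "u \<cdot> w0 = p" "u \<cdot> w1 = q" "is_iso D u"
proof -
  note [simp] = is_productD[OF p] is_productD[OF w] c
  obtain u where u: "in_hom D u (Dom D p) (Dom D w0)" "u \<cdot> w0 = p" "u \<cdot> w1 = q"
    by (rule is_product_pair[OF w, of p "Dom D p" q]) (simp_all add: in_hom_def)
  obtain v where v: "in_hom D v (Dom D w0) (Dom D p)" "v \<cdot> p = w0" "v \<cdot> q = w1"
    by (rule is_product_pair[OF p, of w0 "Dom D w0" w1]) (simp_all add: in_hom_def)
  note [simp] = in_homD[OF u(1)] in_homD[OF v(1)]
  have "u \<cdot> v = ide D (Dom D p)"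
    by (rule jointly_monicD[OF product_jointly_monic[OF p], of _ "Dom D p"]) (simp_all add: in_hom_def u v)
  moreover have "v \<cdot> u = ide D (Dom D w0)"
    by (rule jointly_monicD[OF product_jointly_monic[OF w], of _ "Dom D w0"]) (simp_all add: in_hom_def u v)
  ultimately have "is_iso D u"
    unfolding is_iso_def inverse_arrows_def by (intro exI[of _ v]) (simp add: in_hom_def)
  then show thesis using that u by blast
qed

end

lemma K_check_Obj: "Obj K_check = {0, 1, 2, 3}"
  by (simp add: K_check_def)

lemma K_check_rtrancl:
  "(i, j) \<in> {(3::nat, 2::nat), (2, 0), (2, 1)}\<^sup>* \<longleftrightarrow>
     i = j \<or> (i, j) \<in> {(3, 2), (2, 0), (2, 1), (3, 0), (3, 1)}" (is "?L \<longleftrightarrow> ?R")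
proof
  assume ?L
  then show ?R by (induction rule: rtrancl_induct) auto
next
  let ?r = "{(3::nat, 2::nat), (2, 0), (2, 1)}"
  have 1: "(3, 2) \<in> ?r\<^sup>*" "(2, 0) \<in> ?r\<^sup>*" "(2, 1) \<in> ?r\<^sup>*" by (rule r_into_rtrancl; simp)+
  have 2: "(3, 0) \<in> ?r\<^sup>*" "(3, 1) \<in> ?r\<^sup>*" using 1 by (blast intro: rtrancl_trans)+
  assume ?R
  then show ?L using 1 2 by auto
qed

lemma K_check_Arr: "Arr K_check = {(0, 0), (1, 1), (2, 2), (3, 3), (3, 2), (2, 0), (2, 1), (3, 0), (3, 1)}"
  unfolding K_check_def preorder_cat_simps K_check_rtrancl by auto

lemma K_check_simps [simp]:
  "Dom K_check = fst" "Cod K_check = snd" "ide K_check = (\<lambda>i. (i, i))" "cmp K_check = (\<lambda>(i, j) (j', k). (i, k))"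
  by (simp_all add: K_check_def)

lemma category_K_check: "category K_check"
  unfolding K_check_def by (rule category_preorder_cat) (auto simp: trans_def)

definition relation_diagram :: "('o, 'm, 'c) twocat \<Rightarrow> 'c \<Rightarrow> 'c \<Rightarrow> 'c \<Rightarrow> (nat, nat \<times> nat, 'm, 'c) ftor" where
  "relation_diagram C m u v = ftor_restrict K_check
     \<lparr>fobj = (\<lambda>j. if j = 0 then Cod2 C u else if j = 1 then Cod2 C v else if j = 2 then Cod2 C m else Dom2 C m),
      farr = (\<lambda>x. if x = (3, 2) then m else if x = (2, 0) then u else if x = (2, 1) then v
        else if x = (3, 0) then m \<odot>\<^bsub>C\<^esub> u else if x = (3, 1) then m \<odot>\<^bsub>C\<^esub> v
        else if x = (0, 0) then Id2 C (Cod2 C u) else if x = (1, 1) then Id2 C (Cod2 C v)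
        else if x = (2, 2) then Id2 C (Cod2 C m) else Id2 C (Dom2 C m))\<rparr>"

lemma relation_diagram_simps [simp]:
  "fobj (relation_diagram C m u v) 0 = Cod2 C u" "fobj (relation_diagram C m u v) 1 = Cod2 C v"
  "fobj (relation_diagram C m u v) 2 = Cod2 C m" "fobj (relation_diagram C m u v) 3 = Dom2 C m"
  "farr (relation_diagram C m u v) (3, 2) = m" "farr (relation_diagram C m u v) (2, 0) = u"
  "farr (relation_diagram C m u v) (2, 1) = v" "farr (relation_diagram C m u v) (3, 0) = m \<odot>\<^bsub>C\<^esub> u"
  "farr (relation_diagram C m u v) (3, 1) = m \<odot>\<^bsub>C\<^esub> v" "farr (relation_diagram C m u v) (0, 0) = Id2 C (Cod2 C u)"
  "farr (relation_diagram C m u v) (1, 1) = Id2 C (Cod2 C v)" "farr (relation_diagram C m u v) (2, 2) = Id2 C (Cod2 C m)"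
  "farr (relation_diagram C m u v) (3, 3) = Id2 C (Dom2 C m)"
  "ftor_restrict K_check (relation_diagram C m u v) = relation_diagram C m u v"
  by (simp_all add: relation_diagram_def K_check_Obj K_check_Arr)

context two_category
begin

lemma relation_diagram_functor:
  assumes [simp]: "m \<in> Cell C" "u \<in> Cell C" "v \<in> Cell C" "Dom2 C u = Cod2 C m" "Dom2 C v = Cod2 C m"
    "Src C (Dom2 C m) = A" "Tgt C (Dom2 C m) = X"
  shows "is_functor K_check (hom C A X) (relation_diagram C m u v)"
proof -
  have [simp]: "Src C (Cod2 C u) = A" "Tgt C (Cod2 C u) = X" "Src C (Cod2 C v) = A" "Tgt C (Cod2 C v) = X"
    using Cod2_parallel[of u] Cod2_parallel[of v] by (simp_all del: Cod2_parallel add: Cod2_parallel[of m])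
  show ?thesis
    unfolding is_functor_def
  proof (intro conjI ballI impI)
    fix j assume "j \<in> Obj K_check"
    then have j: "j = 0 \<or> j = 1 \<or> j = 2 \<or> j = 3" by (auto simp: K_check_Obj)
    then show "fobj (relation_diagram C m u v) j \<in> Obj (hom C A X)" by auto
    show "farr (relation_diagram C m u v) (ide K_check j) = ide (hom C A X) (fobj (relation_diagram C m u v) j)"
      using j by auto
  next
    fix x assume "x \<in> Arr K_check"
    then show "in_hom (hom C A X) (farr (relation_diagram C m u v) x) (fobj (relation_diagram C m u v) (Dom K_check x))
         (fobj (relation_diagram C m u v) (Cod K_check x))"
      unfolding K_check_Arr by (auto simp: in_hom_def)
  next
    fix x y assume "x \<in> Arr K_check" "y \<in> Arr K_check" "Cod K_check x = Dom K_check y"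
    then show "farr (relation_diagram C m u v) (x \<cdot>\<^bsub>K_check\<^esub> y) =
        farr (relation_diagram C m u v) x \<cdot>\<^bsub>hom C A X\<^esub> farr (relation_diagram C m u v) y"
      unfolding K_check_Arr by auto
  qed
qed

text \<open>The arrows 3 \<rightarrow> 2, 2 \<rightarrow> 0 and 2 \<rightarrow> 1 generate the shape
  and meet all its objects.\<close>

lemma K_check_functor_eqI:
  assumes F: "is_functor K_check (hom C A X) F" "ftor_restrict K_check F = F"
    and G: "is_functor K_check (hom C A X) G" "ftor_restrict K_check G = G"
    and e: "farr F (3, 2) = farr G (3, 2)" "farr F (2, 0) = farr G (2, 0)" "farr F (2, 1) = farr G (2, 1)"
  shows "F = G"
proof (rule ftor_eqI[OF F(2) G(2)])
  note f = hom_functorD[OF F(1)] and g = hom_functorD[OF G(1)]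
  have o: "fobj F 0 = fobj G 0" "fobj F 1 = fobj G 1" "fobj F 2 = fobj G 2" "fobj F 3 = fobj G 3"
    using f(5,6)[of "(3, 2)"] g(5,6)[of "(3, 2)"] f(6)[of "(2, 0)"] g(6)[of "(2, 0)"] f(6)[of "(2, 1)"] g(6)[of "(2, 1)"] e
    by (simp_all add: K_check_Arr)
  show "fobj F j = fobj G j" if "j \<in> Obj K_check" for j
    using that o unfolding K_check_Obj by auto
  have i: "farr F (j, j) = farr G (j, j)" if "j \<in> Obj K_check" for j
    using f(7)[OF that] g(7)[OF that] \<open>j \<in> Obj K_check \<Longrightarrow> fobj F j = fobj G j\<close>[OF that] by simp
  have c: "farr F (3, 0) = farr G (3, 0)" "farr F (3, 1) = farr G (3, 1)"
    using f(8)[of "(3, 2)" "(2, 0)"] g(8)[of "(3, 2)" "(2, 0)"] f(8)[of "(3, 2)" "(2, 1)"] g(8)[of "(3, 2)" "(2, 1)"] e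
    by (simp_all add: K_check_Arr)
  show "farr F u = farr G u" if "u \<in> Arr K_check" for u
    using that i[of 0] i[of 1] i[of 2] i[of 3] c e unfolding K_check_Arr K_check_Obj by auto
qed

end

context pita_category
begin

text \<open>An invertible 2-cell is a pair of opposite 2-cells, inserted one after the other,
  subject to the two inverse laws; these laws and the pairs of \<open>S\<close> are equified
  together. For the lifting of 2-cells, compatibility with the inverse follows from compatibility
  with \<open>U\<close>.\<close>

lemma obtain_iso_inserter:
  assumes f: "in_mor C f B X" and g: "in_mor C g B X" and S: "finite S"
    and par: "\<And>\<alpha> \<beta>. (\<alpha>, \<beta>) \<in> S \<Longrightarrow> \<alpha> \<in> Cell C \<and> \<beta> \<in> Cell C
      \<and> Src C (Dom2 C \<alpha>) = B \<and> Dom2 C \<beta> = Dom2 C \<alpha> \<and> Cod2 C \<beta> = Cod2 C \<alpha>"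
  obtains t U where "in_mor C t (Src C t) B" "in_cell C U (t \<bullet> f) (t \<bullet> g)" "is_iso (vert C) U"
    "\<And>\<alpha> \<beta>. (\<alpha>, \<beta>) \<in> S \<Longrightarrow> t \<rhd> \<alpha> = t \<rhd> \<beta>"
    "\<And>A s x. in_mor C s A B \<Longrightarrow> in_cell C x (s \<bullet> f) (s \<bullet> g) \<Longrightarrow> is_iso (vert C) x \<Longrightarrow>
      (\<And>\<alpha> \<beta>. (\<alpha>, \<beta>) \<in> S \<Longrightarrow> s \<rhd> \<alpha> = s \<rhd> \<beta>) \<Longrightarrow>
      \<exists>!k. in_mor C k A (Src C t) \<and> k \<bullet> t = s \<and> k \<rhd> U = x"
    "\<And>A k k' \<tau>. in_mor C k A (Src C t) \<Longrightarrow> in_mor C k' A (Src C t) \<Longrightarrow> in_cell C \<tau> (k \<bullet> t) (k' \<bullet> t) \<Longrightarrow>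
      (\<tau> \<lhd> f) \<odot> (k' \<rhd> U) = (k \<rhd> U) \<odot> (\<tau> \<lhd> g) \<Longrightarrow> \<exists>!\<gamma>. in_cell C \<gamma> k k' \<and> \<gamma> \<lhd> t = \<tau>"
proof -
  note [simp] = in_morD[OF f] in_morD[OF g]
  obtain j1 l1 where i1: "inserter C f g j1 l1" by (rule obtain_inserter[OF f g])
  note [simp] = inserterD(1,2)[OF i1] in_cellD[OF inserterD(3)[OF i1]]
  obtain j2 l2 where i2: "inserter C (j1 \<bullet> g) (j1 \<bullet> f) j2 l2"
    by (rule obtain_inserter[of "j1 \<bullet> g" "Src C j1" X "j1 \<bullet> f"]) (simp_all add: in_mor_def)
  have [simp]: "j2 \<in> Mor C" "Tgt C j2 = Src C j1" "l2 \<in> Cell C" "Dom2 C l2 = j2 \<bullet> (j1 \<bullet> g)" "Cod2 C l2 = j2 \<bullet> (j1 \<bullet> f)"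
    using inserterD[OF i2] by (simp_all add: in_cell_def)
  note pq1 = in_morD(1)[OF f] in_morD(1)[OF g]
  let ?J = "j2 \<bullet> j1" and ?u = "j2 \<rhd> l1"
  let ?S = "{(?u \<odot> l2, Id2 C (?J \<bullet> f)), (l2 \<odot> ?u, Id2 C (?J \<bullet> g))} \<union> (\<lambda>(\<alpha>, \<beta>). (?J \<rhd> \<alpha>, ?J \<rhd> \<beta>)) ` S"
  have "\<exists>e. equifier C (Src C j2) ?S e"
    by (rule obtain_equifier) (use S par in auto)
  then obtain e where e: "equifier C (Src C j2) ?S e" by blast
  note [simp] = equifierD(1,2)[OF e]
  have e1: "e \<rhd> (?u \<odot> l2) = e \<rhd> Id2 C (?J \<bullet> f)" and e2: "e \<rhd> (l2 \<odot> ?u) = e \<rhd> Id2 C (?J \<bullet> g)"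
    by (rule equifierD(3)[OF e]; simp)+
  have e3: "(e \<bullet> ?J) \<rhd> \<alpha> = (e \<bullet> ?J) \<rhd> \<beta>" if "(\<alpha>, \<beta>) \<in> S" for \<alpha> \<beta>
  proof -
    have "e \<rhd> (?J \<rhd> \<alpha>) = e \<rhd> (?J \<rhd> \<beta>)"
      by (rule equifierD(3)[OF e]) (use that in force)
    then show ?thesis using par[OF that] by simp
  qed
  let ?t = "e \<bullet> ?J" and ?U = "(e \<bullet> j2) \<rhd> l1" and ?V = "e \<rhd> l2"
  have U: "in_cell C ?U (?t \<bullet> f) (?t \<bullet> g)" and V: "in_cell C ?V (?t \<bullet> g) (?t \<bullet> f)"
    by (simp_all add: in_cell_def)
  have UV: "?U \<odot> ?V = Id2 C (?t \<bullet> f)" using e1 by (simp add: lwhisker_vcomp)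
  have VU: "?V \<odot> ?U = Id2 C (?t \<bullet> g)" using e2 by (simp add: lwhisker_vcomp)
  show thesis
  proof (rule that[of ?t ?U])
    show "in_mor C ?t (Src C ?t) B" by (simp add: in_mor_def)
    show "in_cell C ?U (?t \<bullet> f) (?t \<bullet> g)" by (rule U)
    show "is_iso (vert C) ?U" by (rule is_iso_vertI[OF U V UV VU])
    show "(\<alpha>, \<beta>) \<in> S \<Longrightarrow> ?t \<rhd> \<alpha> = ?t \<rhd> \<beta>" for \<alpha> \<beta> by (rule e3)
  next
    fix A s x assume s: "in_mor C s A B" and x: "in_cell C x (s \<bullet> f) (s \<bullet> g)" and xi: "is_iso (vert C) x"
      and sS: "\<And>\<alpha> \<beta>. (\<alpha>, \<beta>) \<in> S \<Longrightarrow> s \<rhd> \<alpha> = s \<rhd> \<beta>"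
    note [simp] = in_morD[OF s] in_cellD[OF x]
    obtain y where y: "in_cell C y (s \<bullet> g) (s \<bullet> f)" "x \<odot> y = Id2 C (s \<bullet> f)" "y \<odot> x = Id2 C (s \<bullet> g)"
      by (rule is_iso_vertE[OF xi x])
    note [simp] = in_cellD[OF y(1)]
    have ex1: "\<exists>!k. in_mor C k A (Src C j1) \<and> k \<bullet> j1 = s \<and> k \<rhd> l1 = x"
      by (rule inserter_mor[OF i1]) (simp_all add: in_mor_def in_cell_def)
    then obtain k1 where k1: "in_mor C k1 A (Src C j1)" "k1 \<bullet> j1 = s" "k1 \<rhd> l1 = x" by blast
    note [simp] = in_morD[OF k1(1)]
    have kfg: "k1 \<bullet> (j1 \<bullet> f) = s \<bullet> f" "k1 \<bullet> (j1 \<bullet> g) = s \<bullet> g"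
      using comp1_eq_assoc1[OF k1(2), of f] comp1_eq_assoc1[OF k1(2), of g] by simp_all
    have ex2: "\<exists>!k. in_mor C k A (Src C j2) \<and> k \<bullet> j2 = k1 \<and> k \<rhd> l2 = y"
      by (rule inserter_mor[OF i2]) (simp_all add: in_mor_def in_cell_def kfg)
    then obtain k2 where k2: "in_mor C k2 A (Src C j2)" "k2 \<bullet> j2 = k1" "k2 \<rhd> l2 = y" by blast
    note [simp] = in_morD[OF k2(1)]
    have k2J: "k2 \<bullet> (j2 \<bullet> j1) = s" using comp1_eq_assoc1[OF k2(2), of j1] k1(2) by simp
    have k2Jf: "k2 \<bullet> (j2 \<bullet> (j1 \<bullet> f)) = s \<bullet> f" "k2 \<bullet> (j2 \<bullet> (j1 \<bullet> g)) = s \<bullet> g"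
      using comp1_eq_assoc1[OF k2(2), of "j1 \<bullet> f"] comp1_eq_assoc1[OF k2(2), of "j1 \<bullet> g"] kfg by simp_all
    have ex3: "\<exists>!k. in_mor C k A (Src C e) \<and> k \<bullet> e = k2"
    proof (rule equifier_mor[OF e k2(1)])
      fix \<alpha> \<beta> assume "(\<alpha>, \<beta>) \<in> ?S"
      then consider "\<alpha> = ?u \<odot> l2" "\<beta> = Id2 C (?J \<bullet> f)" | "\<alpha> = l2 \<odot> ?u" "\<beta> = Id2 C (?J \<bullet> g)"
        | \<gamma> \<delta> where "(\<gamma>, \<delta>) \<in> S" "\<alpha> = ?J \<rhd> \<gamma>" "\<beta> = ?J \<rhd> \<delta>" by auto
      then show "k2 \<rhd> \<alpha> = k2 \<rhd> \<beta>"
      proof cases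
        case 1
        then show ?thesis by (simp add: lwhisker_vcomp k2 k1(3) y(2) k2Jf)
      next
        case 2
        then show ?thesis by (simp add: lwhisker_vcomp k2 k1(3) y(3) k2Jf)
      next
        case 3
        then show ?thesis using sS[OF 3(1)] par[OF 3(1)] by (simp add: k2J)
      qed
    qed
    then obtain k where k: "in_mor C k A (Src C e)" "k \<bullet> e = k2" by blast
    note [simp] = in_morD[OF k(1)]
    show "\<exists>!k. in_mor C k A (Src C ?t) \<and> k \<bullet> ?t = s \<and> k \<rhd> ?U = x"
    proof (rule ex1I[of _ k])
      have "k \<bullet> (e \<bullet> j2) = k1" using comp1_eq_assoc1[OF k(2), of j2] k2(2) by simp
      then show "in_mor C k A (Src C ?t) \<and> k \<bullet> ?t = s \<and> k \<rhd> ?U = x"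
        using comp1_eq_assoc1[OF k(2), of ?J] k2J k1(3) by (simp add: in_mor_def)
      fix m assume m: "in_mor C m A (Src C ?t) \<and> m \<bullet> ?t = s \<and> m \<rhd> ?U = x"
      then have [simp]: "m \<in> Mor C" "Src C m = A" "Tgt C m = Src C e" by (simp_all add: in_mor_def)
      have mt: "m \<bullet> (e \<bullet> (j2 \<bullet> j1)) = s" and mU: "m \<rhd> ?U = x" using m by blast+
      have m1: "(m \<bullet> (e \<bullet> j2)) = k1"
        by (rule ex1_unique[OF ex1]) (use m k1 in \<open>simp_all add: in_mor_def\<close>)
      have mtg: "m \<bullet> (e \<bullet> (j2 \<bullet> (j1 \<bullet> f))) = s \<bullet> f" "m \<bullet> (e \<bullet> (j2 \<bullet> (j1 \<bullet> g))) = s \<bullet> g"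
        using comp1_eq_assoc1[OF mt, of f] comp1_eq_assoc1[OF mt, of g] by simp_all
      \<comment> \<open>Inverses are unique, so the second inserted 2-cell of \<open>m\<close> must
        be the inverse \<open>y\<close> of \<open>x\<close>.\<close>
      have "x \<odot> (m \<rhd> ?V) = m \<rhd> (?U \<odot> ?V)" using mU by (simp add: lwhisker_vcomp)
      also have "\<dots> = x \<odot> y" unfolding UV y(2) by (simp add: mtg)
      finally have "m \<rhd> ?V = y"
        by (rule iso_cancel_left[OF xi, rotated -1]) (simp_all add: mtg)
      then have "m \<bullet> e = k2"
        by (intro ex1_unique[OF ex2]) (use m1 k2 in \<open>simp_all add: in_mor_def\<close>)
      then show "m = k" using ex3 k \<open>m \<in> Mor C\<close> \<open>Src C m = A\<close> \<open>Tgt C m = Src C e\<close> unfolding in_mor_def by blast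
    qed
  next
    fix A k k' \<tau> assume k0: "in_mor C k A (Src C ?t)" and k0': "in_mor C k' A (Src C ?t)" and \<tau>: "in_cell C \<tau> (k \<bullet> ?t) (k' \<bullet> ?t)"
      and c: "(\<tau> \<lhd> f) \<odot> (k' \<rhd> ?U) = (k \<rhd> ?U) \<odot> (\<tau> \<lhd> g)"
    have k: "in_mor C k A (Src C e)" and k': "in_mor C k' A (Src C e)" using k0 k0' by simp_all
    note [simp] = in_morD[OF k] in_morD[OF k'] in_cellD[OF \<tau>]
    have ex1: "\<exists>!\<gamma>. in_cell C \<gamma> (k \<bullet> (e \<bullet> j2)) (k' \<bullet> (e \<bullet> j2)) \<and> \<gamma> \<lhd> j1 = \<tau>"
      by (rule inserter_cell[OF i1, of _ A]) (use c in \<open>simp_all add: in_mor_def in_cell_def\<close>)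
    then obtain \<gamma>1 where g1: "in_cell C \<gamma>1 (k \<bullet> (e \<bullet> j2)) (k' \<bullet> (e \<bullet> j2))" "\<gamma>1 \<lhd> j1 = \<tau>" by blast
    note [simp] = in_cellD[OF g1(1)]
    have g1f: "\<gamma>1 \<lhd> (j1 \<bullet> f) = \<tau> \<lhd> f" "\<gamma>1 \<lhd> (j1 \<bullet> g) = \<tau> \<lhd> g"
      by (simp_all add: g1(2)[symmetric])
    have kUV: "(k \<rhd> ?U) \<odot> (k \<rhd> ?V) = Id2 C (k \<bullet> (?t \<bullet> f))" "(k \<rhd> ?V) \<odot> (k \<rhd> ?U) = Id2 C (k \<bullet> (?t \<bullet> g))"
      "(k' \<rhd> ?U) \<odot> (k' \<rhd> ?V) = Id2 C (k' \<bullet> (?t \<bullet> f))"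
      using arg_cong[OF UV, of "\<lambda>x. k \<rhd> x"] arg_cong[OF VU, of "\<lambda>x. k \<rhd> x"] arg_cong[OF UV, of "\<lambda>x. k' \<rhd> x"]
      by (simp_all add: lwhisker_vcomp)
    \<comment> \<open>The square for \<open>?U\<close> is conjugated by the inverses into the square
      for \<open>?V\<close>.\<close>
    have "(\<tau> \<lhd> g) \<odot> (k' \<rhd> ?V) = ((k \<rhd> ?V) \<odot> (k \<rhd> ?U)) \<odot> ((\<tau> \<lhd> g) \<odot> (k' \<rhd> ?V))"
      unfolding kUV(2) by simp
    also have "\<dots> = (k \<rhd> ?V) \<odot> (((k \<rhd> ?U) \<odot> (\<tau> \<lhd> g)) \<odot> (k' \<rhd> ?V))" by simp
    also have "\<dots> = (k \<rhd> ?V) \<odot> ((\<tau> \<lhd> f) \<odot> ((k' \<rhd> ?U) \<odot> (k' \<rhd> ?V)))" unfolding c[symmetric] by simp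
    also have "\<dots> = (k \<rhd> ?V) \<odot> (\<tau> \<lhd> f)" unfolding kUV(3) by simp
    finally have c': "(\<tau> \<lhd> g) \<odot> (k' \<rhd> ?V) = (k \<rhd> ?V) \<odot> (\<tau> \<lhd> f)" .
    have ex2: "\<exists>!\<gamma>. in_cell C \<gamma> (k \<bullet> e) (k' \<bullet> e) \<and> \<gamma> \<lhd> j2 = \<gamma>1"
      by (rule inserter_cell[OF i2, of _ A]) (use c' in \<open>simp_all add: in_mor_def in_cell_def g1f\<close>)
    then obtain \<gamma>2 where g2: "in_cell C \<gamma>2 (k \<bullet> e) (k' \<bullet> e)" "\<gamma>2 \<lhd> j2 = \<gamma>1" by blast
    note [simp] = in_cellD[OF g2(1)]
    have ex3: "\<exists>!\<gamma>. in_cell C \<gamma> k k' \<and> \<gamma> \<lhd> e = \<gamma>2" by (rule equifier_cell[OF e k k' g2(1)])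
    then obtain \<gamma> where g3: "in_cell C \<gamma> k k'" "\<gamma> \<lhd> e = \<gamma>2" by blast
    show "\<exists>!\<gamma>. in_cell C \<gamma> k k' \<and> \<gamma> \<lhd> ?t = \<tau>"
    proof (rule ex1I[of _ \<gamma>])
      have "\<gamma> \<lhd> ?t = (\<gamma> \<lhd> e) \<lhd> ?J" using in_cellD[OF g3(1)] by simp
      also have "\<dots> = (\<gamma>2 \<lhd> j2) \<lhd> j1" unfolding g3(2) by simp
      finally show "in_cell C \<gamma> k k' \<and> \<gamma> \<lhd> ?t = \<tau>" using g3(1) g2(2) g1(2) by simp
      fix \<delta> assume d: "in_cell C \<delta> k k' \<and> \<delta> \<lhd> ?t = \<tau>"
      then have [simp]: "\<delta> \<in> Cell C" "Dom2 C \<delta> = k" "Cod2 C \<delta> = k'" by (simp_all add: in_cell_def)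
      have "\<delta> \<lhd> (e \<bullet> j2) = \<gamma>1"
        by (rule ex1_unique[OF ex1]) (use d g1 in \<open>simp_all add: in_cell_def\<close>)
      then have "\<delta> \<lhd> e = \<gamma>2"
        by (intro ex1_unique[OF ex2]) (use g2 in \<open>simp_all add: in_cell_def\<close>)
      then show "\<delta> = \<gamma>" using ex3 d g3 by blast
    qed
  qed
qed

end

context pita_category
begin

text \<open>The base is X^[1] x X x X: an arrow 3 \<rightarrow> 2 and two objects 0 and 1 that are
  so far unrelated to it.\<close>

lemma obtain_relation_base:
  assumes X: "X \<in> Ob C"
  obtains B \<mu> a b where "\<mu> \<in> Cell C" "Src C (Dom2 C \<mu>) = B" "Tgt C (Dom2 C \<mu>) = X"
    "in_mor C a B X" "in_mor C b B X"
    "\<And>A m x y. m \<in> Cell C \<Longrightarrow> Src C (Dom2 C m) = A \<Longrightarrow> Tgt C (Dom2 C m) = X \<Longrightarrow> in_mor C x A X \<Longrightarrow> in_mor C y A X \<Longrightarrow>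
      \<exists>!s. in_mor C s A B \<and> s \<rhd> \<mu> = m \<and> s \<bullet> a = x \<and> s \<bullet> b = y"
    "\<And>A s s' \<eta>3 \<eta>2 \<eta>0 \<eta>1. in_mor C s A B \<Longrightarrow> in_mor C s' A B \<Longrightarrow>
      in_cell C \<eta>3 (s \<bullet> Dom2 C \<mu>) (s' \<bullet> Dom2 C \<mu>) \<Longrightarrow> in_cell C \<eta>2 (s \<bullet> Cod2 C \<mu>) (s' \<bullet> Cod2 C \<mu>) \<Longrightarrow>
      in_cell C \<eta>0 (s \<bullet> a) (s' \<bullet> a) \<Longrightarrow> in_cell C \<eta>1 (s \<bullet> b) (s' \<bullet> b) \<Longrightarrow> \<eta>3 \<odot> (s' \<rhd> \<mu>) = (s \<rhd> \<mu>) \<odot> \<eta>2 \<Longrightarrow>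
      \<exists>!\<tau>. in_cell C \<tau> s s' \<and> \<tau> \<lhd> Dom2 C \<mu> = \<eta>3 \<and> \<tau> \<lhd> Cod2 C \<mu> = \<eta>2 \<and> \<tau> \<lhd> a = \<eta>0 \<and> \<tau> \<lhd> b = \<eta>1"
proof -
  obtain XA d where ao: "arrow_object C X XA d" by (rule obtain_arrow_object[OF X])
  note [simp] = arrow_objectD[OF ao]
  have XA: "XA \<in> Ob C" using Mor_simps(4)[of "Dom2 C d"] by simp
  obtain p q where p: "prod2 C p q" "Tgt C p = XA" "Tgt C q = X" by (rule obtain_prod2[OF XA X])
  note [simp] = prod2D[OF p(1)] p(2,3)
  have P: "Src C p \<in> Ob C" by simp
  obtain p' q' where p': "prod2 C p' q'" "Tgt C p' = Src C p" "Tgt C q' = X" by (rule obtain_prod2[OF P X])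
  note [simp] = prod2D[OF p'(1)] p'(2,3)
  let ?\<mu> = "(p' \<bullet> p) \<rhd> d" and ?a = "p' \<bullet> q" and ?B = "Src C p'"
  show thesis
  proof (rule that[of ?\<mu> ?B ?a q'])
    show "?\<mu> \<in> Cell C" "Src C (Dom2 C ?\<mu>) = ?B" "Tgt C (Dom2 C ?\<mu>) = X" "in_mor C ?a ?B X" "in_mor C q' ?B X"
      by (simp_all add: in_mor_def)
  next
    fix A m x y assume m: "m \<in> Cell C" "Src C (Dom2 C m) = A" "Tgt C (Dom2 C m) = X"
      and x: "in_mor C x A X" and y: "in_mor C y A X"
    obtain k where k: "in_mor C k (Src C (Dom2 C m)) XA" "k \<rhd> d = m" by (rule arrow_object_mor[OF ao m(1,3)])
    have [simp]: "k \<in> Mor C" "Src C k = A" "Tgt C k = XA" using in_morD[OF k(1)] m(2) by simp_all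
    obtain h where h: "in_mor C h A (Src C p)" "h \<bullet> p = k" "h \<bullet> q = x"
      by (rule prod2_mor[OF p(1), of k A x]) (use x in \<open>simp_all add: in_mor_def\<close>)
    obtain s where s: "in_mor C s A ?B" "s \<bullet> p' = h" "s \<bullet> q' = y"
      by (rule prod2_mor[OF p'(1), of h A y]) (use h y in \<open>simp_all add: in_mor_def\<close>)
    note [simp] = in_morD[OF h(1)] in_morD[OF s(1)]
    have sp: "s \<bullet> (p' \<bullet> p) = k" "s \<bullet> (p' \<bullet> q) = x"
      using comp1_eq_assoc1[OF s(2), of p] comp1_eq_assoc1[OF s(2), of q] h by simp_all
    show "\<exists>!s. in_mor C s A ?B \<and> s \<rhd> ?\<mu> = m \<and> s \<bullet> ?a = x \<and> s \<bullet> q' = y"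
    proof (rule ex1I[of _ s])
      show "in_mor C s A ?B \<and> s \<rhd> ?\<mu> = m \<and> s \<bullet> ?a = x \<and> s \<bullet> q' = y"
        using s(1,3) k(2) by (simp add: sp)
      fix t assume t: "in_mor C t A ?B \<and> t \<rhd> ?\<mu> = m \<and> t \<bullet> ?a = x \<and> t \<bullet> q' = y"
      then have [simp]: "t \<in> Mor C" "Src C t = A" "Tgt C t = ?B" by (simp_all add: in_mor_def)
      have tk: "t \<bullet> (p' \<bullet> p) = k"
        by (rule arrow_object_mor_eq[OF ao, of _ A]) (use t k(2) in \<open>simp_all add: in_mor_def\<close>)
      have th: "t \<bullet> p' = h"
        by (rule prod2_mor_eq[OF p(1), of _ A]) (use t tk h in \<open>simp_all add: in_mor_def\<close>)
      show "t = s"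
        by (rule prod2_mor_eq[OF p'(1), of _ A]) (use t th s in \<open>simp_all add: in_mor_def\<close>)
    qed
  next
    fix A s s' \<eta>3 \<eta>2 \<eta>0 \<eta>1
    assume s: "in_mor C s A ?B" and s': "in_mor C s' A ?B"
      and e3: "in_cell C \<eta>3 (s \<bullet> Dom2 C ?\<mu>) (s' \<bullet> Dom2 C ?\<mu>)" and e2: "in_cell C \<eta>2 (s \<bullet> Cod2 C ?\<mu>) (s' \<bullet> Cod2 C ?\<mu>)"
      and e0: "in_cell C \<eta>0 (s \<bullet> ?a) (s' \<bullet> ?a)" and e1: "in_cell C \<eta>1 (s \<bullet> q') (s' \<bullet> q')"
      and c: "\<eta>3 \<odot> (s' \<rhd> ?\<mu>) = (s \<rhd> ?\<mu>) \<odot> \<eta>2"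
    note [simp] = in_morD[OF s] in_morD[OF s'] in_cellD[OF e3] in_cellD[OF e2] in_cellD[OF e0] in_cellD[OF e1]
    have "\<exists>!\<rho>. in_cell C \<rho> (s \<bullet> (p' \<bullet> p)) (s' \<bullet> (p' \<bullet> p)) \<and> \<rho> \<lhd> Dom2 C d = \<eta>3 \<and> \<rho> \<lhd> Cod2 C d = \<eta>2"
      by (rule arrow_object_cell[OF ao, of _ A]) (use c in \<open>simp_all add: in_mor_def in_cell_def\<close>)
    then obtain \<rho> where r: "in_cell C \<rho> (s \<bullet> (p' \<bullet> p)) (s' \<bullet> (p' \<bullet> p))" "\<rho> \<lhd> Dom2 C d = \<eta>3" "\<rho> \<lhd> Cod2 C d = \<eta>2" by blast
    note [simp] = in_cellD[OF r(1)]
    have "\<exists>!\<sigma>. in_cell C \<sigma> (s \<bullet> p') (s' \<bullet> p') \<and> \<sigma> \<lhd> p = \<rho> \<and> \<sigma> \<lhd> q = \<eta>0"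
      by (rule prod2_cell[OF p(1), of _ A]) (simp_all add: in_mor_def in_cell_def)
    then obtain \<sigma> where g: "in_cell C \<sigma> (s \<bullet> p') (s' \<bullet> p')" "\<sigma> \<lhd> p = \<rho>" "\<sigma> \<lhd> q = \<eta>0" by blast
    note [simp] = in_cellD[OF g(1)]
    have "\<exists>!\<tau>. in_cell C \<tau> s s' \<and> \<tau> \<lhd> p' = \<sigma> \<and> \<tau> \<lhd> q' = \<eta>1"
      by (rule prod2_cell[OF p'(1), of _ A]) (simp_all add: in_mor_def in_cell_def)
    then obtain \<tau> where t: "in_cell C \<tau> s s'" "\<tau> \<lhd> p' = \<sigma>" "\<tau> \<lhd> q' = \<eta>1" by blast
    note [simp] = in_cellD[OF t(1)]
    have tt: "\<tau> \<lhd> (p' \<bullet> p) = \<rho>" "\<tau> \<lhd> (p' \<bullet> q) = \<eta>0"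
      using rwhisker_rwhisker[of p' p \<tau>] rwhisker_rwhisker[of p' q \<tau>] by (simp_all add: t(2) g)
    have tt': "\<tau> \<lhd> (p' \<bullet> (p \<bullet> Dom2 C d)) = \<eta>3" "\<tau> \<lhd> (p' \<bullet> (p \<bullet> Cod2 C d)) = \<eta>2"
      using rwhisker_rwhisker[of "p' \<bullet> p" "Dom2 C d" \<tau>] rwhisker_rwhisker[of "p' \<bullet> p" "Cod2 C d" \<tau>]
      by (simp_all add: tt(1) r)
    show "\<exists>!\<tau>. in_cell C \<tau> s s' \<and> \<tau> \<lhd> Dom2 C ?\<mu> = \<eta>3 \<and> \<tau> \<lhd> Cod2 C ?\<mu> = \<eta>2 \<and> \<tau> \<lhd> ?a = \<eta>0 \<and> \<tau> \<lhd> q' = \<eta>1"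
    proof (rule ex1I[of _ \<tau>])
      show "in_cell C \<tau> s s' \<and> \<tau> \<lhd> Dom2 C ?\<mu> = \<eta>3 \<and> \<tau> \<lhd> Cod2 C ?\<mu> = \<eta>2 \<and> \<tau> \<lhd> ?a = \<eta>0 \<and> \<tau> \<lhd> q' = \<eta>1"
        using t(1,3) tt tt' by simp
      fix \<xi> assume x: "in_cell C \<xi> s s' \<and> \<xi> \<lhd> Dom2 C ?\<mu> = \<eta>3 \<and> \<xi> \<lhd> Cod2 C ?\<mu> = \<eta>2 \<and> \<xi> \<lhd> ?a = \<eta>0 \<and> \<xi> \<lhd> q' = \<eta>1"
      then have [simp]: "\<xi> \<in> Cell C" "Dom2 C \<xi> = s" "Cod2 C \<xi> = s'" by (simp_all add: in_cell_def)
      have 1: "\<xi> \<lhd> (p' \<bullet> p) = \<rho>"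
        by (rule arrow_object_cell_eq[OF ao _ r(1), of _ A]) (use x r in \<open>simp_all add: in_mor_def in_cell_def\<close>)
      have 2: "\<xi> \<lhd> p' = \<sigma>"
        by (rule prod2_cell_eq[OF p(1) _ g(1), of _ A]) (use x 1 g in \<open>simp_all add: in_mor_def in_cell_def\<close>)
      show "\<xi> = \<tau>"
        by (rule prod2_cell_eq[OF p'(1) _ t(1) s]) (use x 2 t in \<open>simp_all add: in_cell_def\<close>)
    qed
  qed
qed

end

context two_category
begin

lemma hom_lex: "ob_has_finite_limits C X \<Longrightarrow> A \<in> Ob C \<Longrightarrow> lex_category (hom C A X)"
  unfolding ob_has_finite_limits_def by (blast intro: category.lex_category_if_limits category_hom)

lemma pre_lex_functor:
  assumes "ob_has_finite_limits C X" "in_mor C h A' A"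
  shows "lex_functor (hom C A X) (hom C A' X) (pre C h)"
proof -
  interpret D: category "hom C A X" by (rule category_hom)
  interpret E: category "hom C A' X" by (rule category_hom)
  have "A \<in> Ob C" "A' \<in> Ob C" using Mor_simps(4,5)[of h] in_morD[OF assms(2)] by simp_all
  then have "preserves_finite_limits (hom C A X) (hom C A' X) (pre C h)"
    using assms unfolding ob_has_finite_limits_def by blast
  then show ?thesis using is_functor_pre[OF assms(2)] by unfold_locales
qed

end

context pita_category
begin

text \<open>Over the base, a product of the objects 0 and 1 and a kernel pair of the arrow are
  chosen once. Restriction preserves finite limits, so these choices serve at every stage, and what
  remains to be represented is an isomorphism of 2 with the chosen product and one equation of
  2-cells. The same preservation gives stability of the diagrams.\<close>

lemma K_check_power_ex:
  assumes fl: "ob_has_finite_limits C X"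
  shows "\<exists>XK ev. is_K_check_power C X XK ev"
proof -
  have X: "X \<in> Ob C" using fl unfolding ob_has_finite_limits_def by blast
  obtain B \<mu> a b where mu: "\<mu> \<in> Cell C" "Src C (Dom2 C \<mu>) = B" "Tgt C (Dom2 C \<mu>) = X"
    and a: "in_mor C a B X" and b: "in_mor C b B X"
    and Q1: "\<And>A m x y. m \<in> Cell C \<Longrightarrow> Src C (Dom2 C m) = A \<Longrightarrow> Tgt C (Dom2 C m) = X \<Longrightarrow> in_mor C x A X \<Longrightarrow> in_mor C y A X \<Longrightarrow>
      \<exists>!s. in_mor C s A B \<and> s \<rhd> \<mu> = m \<and> s \<bullet> a = x \<and> s \<bullet> b = y"
    and Q2: "\<And>A s s' \<eta>3 \<eta>2 \<eta>0 \<eta>1. in_mor C s A B \<Longrightarrow> in_mor C s' A B \<Longrightarrow>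
      in_cell C \<eta>3 (s \<bullet> Dom2 C \<mu>) (s' \<bullet> Dom2 C \<mu>) \<Longrightarrow> in_cell C \<eta>2 (s \<bullet> Cod2 C \<mu>) (s' \<bullet> Cod2 C \<mu>) \<Longrightarrow>
      in_cell C \<eta>0 (s \<bullet> a) (s' \<bullet> a) \<Longrightarrow> in_cell C \<eta>1 (s \<bullet> b) (s' \<bullet> b) \<Longrightarrow> \<eta>3 \<odot> (s' \<rhd> \<mu>) = (s \<rhd> \<mu>) \<odot> \<eta>2 \<Longrightarrow>
      \<exists>!\<tau>. in_cell C \<tau> s s' \<and> \<tau> \<lhd> Dom2 C \<mu> = \<eta>3 \<and> \<tau> \<lhd> Cod2 C \<mu> = \<eta>2 \<and> \<tau> \<lhd> a = \<eta>0 \<and> \<tau> \<lhd> b = \<eta>1"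
    by (rule obtain_relation_base[OF X]) blast
  note [simp] = mu in_morD[OF a] in_morD[OF b]
  have Bo: "B \<in> Ob C" using Mor_simps(4)[of a] by simp
  interpret H: lex_category "hom C B X" by (rule hom_lex[OF fl Bo])
  \<comment> \<open>The chosen product of the generic objects 0 and 1.\<close>
  obtain w0 w1 where w: "is_product (hom C B X) w0 w1" "Cod2 C w0 = a" "Cod2 C w1 = b"
    using H.has_products[of a b] by auto
  have wc [simp]: "w0 \<in> Cell C" "w1 \<in> Cell C" "Dom2 C w1 = Dom2 C w0" "Src C (Dom2 C w0) = B" "Tgt C (Dom2 C w0) = X"
    using is_productD[OF w(1)] by simp_all
  note [simp] = w(2,3)
  \<comment> \<open>The kernel pair of the generic arrow 3 \<rightarrow> 2.\<close>
  obtain k0 k1 where k: "is_pullback (hom C B X) k0 k1 \<mu> \<mu>"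
    using H.has_pullbacks[of \<mu> \<mu>] by auto
  have kc [simp]: "k0 \<in> Cell C" "k1 \<in> Cell C" "Dom2 C k1 = Dom2 C k0" "Src C (Dom2 C k0) = B" "Tgt C (Dom2 C k0) = X"
    "Cod2 C k0 = Dom2 C \<mu>" "Cod2 C k1 = Dom2 C \<mu>"
    using is_pullbackD[OF k] by simp_all
  let ?W = "Dom2 C w0" and ?K = "Cod2 C \<mu>"
  obtain t U where t: "in_mor C t (Src C t) B" and U: "in_cell C U (t \<bullet> ?K) (t \<bullet> ?W)" and Ui: "is_iso (vert C) U"
    and tk: "\<And>\<alpha> \<beta>. (\<alpha>, \<beta>) \<in> {(k0, k1)} \<Longrightarrow> t \<rhd> \<alpha> = t \<rhd> \<beta>"
    and R1: "\<And>A s x. in_mor C s A B \<Longrightarrow> in_cell C x (s \<bullet> ?K) (s \<bullet> ?W) \<Longrightarrow> is_iso (vert C) x \<Longrightarrow>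
      (\<And>\<alpha> \<beta>. (\<alpha>, \<beta>) \<in> {(k0, k1)} \<Longrightarrow> s \<rhd> \<alpha> = s \<rhd> \<beta>) \<Longrightarrow>
      \<exists>!k. in_mor C k A (Src C t) \<and> k \<bullet> t = s \<and> k \<rhd> U = x"
    and R2: "\<And>A k k' \<tau>. in_mor C k A (Src C t) \<Longrightarrow> in_mor C k' A (Src C t) \<Longrightarrow> in_cell C \<tau> (k \<bullet> t) (k' \<bullet> t) \<Longrightarrow>
      (\<tau> \<lhd> ?K) \<odot> (k' \<rhd> U) = (k \<rhd> U) \<odot> (\<tau> \<lhd> ?W) \<Longrightarrow> \<exists>!\<gamma>. in_cell C \<gamma> k k' \<and> \<gamma> \<lhd> t = \<tau>"
  proof (rule obtain_iso_inserter[of ?K B X ?W "{(k0, k1)}"], goal_cases)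
    case 5
    show ?case by (rule 5(1)) (fact 5(2-))+
  qed (auto simp: in_mor_def)
  note [simp] = in_morD(1,3)[OF t] in_cellD[OF U]
  let ?E = "Src C t"
  \<comment> \<open>The projections out of 2 are the inserted isomorphism followed by the
    projections of the chosen product.\<close>
  let ?ev = "relation_diagram C (t \<rhd> \<mu>) (U \<odot> (t \<rhd> w0)) (U \<odot> (t \<rhd> w1))"
  have ev: "is_functor K_check (hom C ?E X) ?ev" by (rule relation_diagram_functor) simp_all
  let ?D = "diagram_of C K_check ?ev"
  have dg: "is_functor K_check (hom C A X) (?D h)" if "in_mor C h A ?E" for h A
    by (rule diagram_functor[OF category_K_check ev that])
  have dv: "farr (?D h) (3, 2) = (h \<bullet> t) \<rhd> \<mu>"
    "farr (?D h) (2, 0) = (h \<rhd> U) \<odot> ((h \<bullet> t) \<rhd> w0)" "farr (?D h) (2, 1) = (h \<rhd> U) \<odot> ((h \<bullet> t) \<rhd> w1)"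
    "fobj (?D h) 0 = h \<bullet> (t \<bullet> a)" "fobj (?D h) 1 = h \<bullet> (t \<bullet> b)" "fobj (?D h) 2 = h \<bullet> (t \<bullet> ?K)"
    "fobj (?D h) 3 = h \<bullet> (t \<bullet> Dom2 C \<mu>)"
    if "in_mor C h A ?E" for h A
    using in_morD[OF that] by (simp_all add: K_check_Obj K_check_Arr lwhisker_vcomp)
  have prod: "is_product (hom C A X) (s \<rhd> w0) (s \<rhd> w1)" and pull: "is_pullback (hom C A X) (s \<rhd> k0) (s \<rhd> k1) (s \<rhd> \<mu>) (s \<rhd> \<mu>)"
    if "in_mor C s A B" for s A
    using lex_functor.G_product[OF pre_lex_functor[OF fl that] w(1)] lex_functor.G_pullback[OF pre_lex_functor[OF fl that] k]
    by simp_all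
  have rel: "is_product (hom C A X) (farr (?D h) (2, 0)) (farr (?D h) (2, 1))" "is_mono (hom C A X) (farr (?D h) (3, 2))"
    if h: "in_mor C h A ?E" for h A
  proof -
    interpret HA: category "hom C A X" by (rule category_hom)
    note [simp] = in_morD[OF h]
    have ht: "in_mor C (h \<bullet> t) A B" by (simp add: in_mor_def)
    have "is_iso (vert C) (h \<rhd> U)"
    proof -
      obtain V where V: "in_cell C V (t \<bullet> ?W) (t \<bullet> ?K)" "U \<odot> V = Id2 C (t \<bullet> ?K)" "V \<odot> U = Id2 C (t \<bullet> ?W)"
        by (rule is_iso_vertE[OF Ui U])
      note [simp] = in_cellD[OF V(1)]
      show ?thesis
        by (rule is_iso_vertI[of _ "h \<bullet> (t \<bullet> ?K)" "h \<bullet> (t \<bullet> ?W)" "h \<rhd> V"])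
          (simp_all add: in_cell_def lwhisker_vcomp[symmetric] V(2,3))
    qed
    then have "is_iso (hom C A X) (h \<rhd> U)" by (simp add: is_iso_hom)
    then show "is_product (hom C A X) (farr (?D h) (2, 0)) (farr (?D h) (2, 1))"
      unfolding dv[OF h] using HA.product_iso[OF prod[OF ht], of "h \<rhd> U"] by simp
    have "(h \<bullet> t) \<rhd> k0 = (h \<bullet> t) \<rhd> k1"
      using tk[of k0 k1] by (simp add: lwhisker_lwhisker[symmetric] del: lwhisker_lwhisker)
    then show "is_mono (hom C A X) (farr (?D h) (3, 2))"
      unfolding dv[OF h] using HA.mono_iff_kernel_pair[OF pull[OF ht]] by simp
  qed
  have "cat_isomorphism (hom C A ?E) (full_subcat (fun_cat K_check (hom C A X)) (stable_relation_diagrams C A X))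
      (cotensor_functor C K_check ?ev)" if A: "A \<in> Ob C" for A
  proof (rule cotensor_iso[OF category_K_check ev A])
    interpret HA: category "hom C A X" by (rule category_hom)
    show "stable_relation_diagrams C A X \<subseteq> Obj (fun_cat K_check (hom C A X))"
      unfolding stable_relation_diagrams_def by blast
    show "?D h \<in> stable_relation_diagrams C A X" if h: "in_mor C h A ?E" for h
      unfolding stable_relation_diagrams_def
    proof (intro CollectI conjI ballI allI impI)
      show "?D h \<in> Obj (fun_cat K_check (hom C A X))" using dg[OF h] by simp
      show "is_product (hom C A X) (farr (?D h) (2, 0)) (farr (?D h) (2, 1))" "is_mono (hom C A X) (farr (?D h) (3, 2))"
        by (rule rel[OF h])+
      fix A' h' assume h': "in_mor C h' A' A"
      note [simp] = in_morD[OF h] in_morD[OF h']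
      have hh: "in_mor C (h' \<bullet> h) A' ?E" by (simp add: in_mor_def)
      have "farr (?D (h' \<bullet> h)) (2, 0) = h' \<rhd> farr (?D h) (2, 0)" "farr (?D (h' \<bullet> h)) (2, 1) = h' \<rhd> farr (?D h) (2, 1)"
        "farr (?D (h' \<bullet> h)) (3, 2) = h' \<rhd> farr (?D h) (3, 2)"
        unfolding dv[OF h] dv[OF hh] by (simp_all add: lwhisker_vcomp)
      then show "is_product (hom C A' X) (h' \<rhd> farr (?D h) (2, 0)) (h' \<rhd> farr (?D h) (2, 1))" "is_mono (hom C A' X) (h' \<rhd> farr (?D h) (3, 2))"
        using rel[OF hh] by simp_all
    qed
  next
    interpret HA: category "hom C A X" by (rule category_hom)
    fix F assume "F \<in> stable_relation_diagrams C A X"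
    then have F: "is_functor K_check (hom C A X) F" "ftor_restrict K_check F = F"
      and Fp: "is_product (hom C A X) (farr F (2, 0)) (farr F (2, 1))" and Fm: "is_mono (hom C A X) (farr F (3, 2))"
      unfolding stable_relation_diagrams_def by simp_all
    note f = hom_functorD(1-6)[OF F(1)]
    have fc [simp]: "farr F (3, 2) \<in> Cell C" "farr F (2, 0) \<in> Cell C" "farr F (2, 1) \<in> Cell C"
      "Dom2 C (farr F (3, 2)) = fobj F 3" "Cod2 C (farr F (3, 2)) = fobj F 2" "Dom2 C (farr F (2, 0)) = fobj F 2"
      "Cod2 C (farr F (2, 0)) = fobj F 0" "Dom2 C (farr F (2, 1)) = fobj F 2" "Cod2 C (farr F (2, 1)) = fobj F 1"
      using f(4-6) by (simp_all add: K_check_Arr)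
    have fo [simp]: "fobj F j \<in> Mor C" "Src C (fobj F j) = A" "Tgt C (fobj F j) = X" if "j \<in> {0, 1, 2, 3}" for j
      using f(1-3)[of j] that by (simp_all add: K_check_Obj)
    obtain s where s: "in_mor C s A B" "s \<rhd> \<mu> = farr F (3, 2)" "s \<bullet> a = fobj F 0" "s \<bullet> b = fobj F 1"
      using Q1[of "farr F (3, 2)" A "fobj F 0" "fobj F 1"] by (auto simp: in_mor_def)
    note [simp] = in_morD[OF s(1)]
    have sK: "s \<bullet> ?K = fobj F 2" using arg_cong[OF s(2), of "Cod2 C"] by simp
    obtain x where x: "in_hom (hom C A X) x (fobj F 2) (s \<bullet> ?W)" "x \<odot> (s \<rhd> w0) = farr F (2, 0)"
        "x \<odot> (s \<rhd> w1) = farr F (2, 1)" "is_iso (hom C A X) x"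
      using HA.product_comparison[OF Fp prod[OF s(1)]] s(3,4) by auto
    have xi: "is_iso (vert C) x" and xc: "in_cell C x (s \<bullet> ?K) (s \<bullet> ?W)"
      using x(1,4) by (simp_all add: is_iso_hom in_hom_hom sK)
    have sk: "s \<rhd> k0 = s \<rhd> k1"
      using HA.mono_iff_kernel_pair[OF pull[OF s(1)]] Fm by (simp add: s(2))
    have "\<exists>!h. in_mor C h A ?E \<and> h \<bullet> t = s \<and> h \<rhd> U = x"
      by (rule R1[OF s(1) xc xi]) (use sk in simp)
    then obtain h where h: "in_mor C h A ?E" "h \<bullet> t = s" "h \<rhd> U = x" by blast
    have "?D h = F"
      by (rule K_check_functor_eqI[OF dg[OF h(1)] _ F]) (simp_all only: diagram_of_simps(3) dv[OF h(1)] h(2,3) s(2) x(2,3))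
    then show "\<exists>h. in_mor C h A ?E \<and> ?D h = F" using h(1) by blast
  next
    interpret HA: category "hom C A X" by (rule category_hom)
    fix h h' assume h: "in_mor C h A ?E" and h': "in_mor C h' A ?E" and e: "?D h = ?D h'"
    note [simp] = in_morD[OF h] in_morD[OF h']
    have e1: "(h \<bullet> t) \<rhd> \<mu> = (h' \<bullet> t) \<rhd> \<mu>" "h \<bullet> (t \<bullet> a) = h' \<bullet> (t \<bullet> a)" "h \<bullet> (t \<bullet> b) = h' \<bullet> (t \<bullet> b)"
      "(h \<rhd> U) \<odot> ((h \<bullet> t) \<rhd> w0) = (h' \<rhd> U) \<odot> ((h' \<bullet> t) \<rhd> w0)" "(h \<rhd> U) \<odot> ((h \<bullet> t) \<rhd> w1) = (h' \<rhd> U) \<odot> ((h' \<bullet> t) \<rhd> w1)"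
      unfolding dv[OF h, symmetric] dv[OF h', symmetric] e by (rule refl)+
    have ht: "in_mor C (h \<bullet> t) A B" "in_mor C (h' \<bullet> t) A B" by (simp_all add: in_mor_def)
    have "\<exists>!s. in_mor C s A B \<and> s \<rhd> \<mu> = (h \<bullet> t) \<rhd> \<mu> \<and> s \<bullet> a = h \<bullet> (t \<bullet> a) \<and> s \<bullet> b = h \<bullet> (t \<bullet> b)"
      by (rule Q1) (simp_all add: in_mor_def)
    then have tt: "h \<bullet> t = h' \<bullet> t"
      by (rule ex1_unique) (use ht e1(1-3) in simp_all)
    have tK: "h \<bullet> (t \<bullet> ?K) = h' \<bullet> (t \<bullet> ?K)" "h \<bullet> (t \<bullet> ?W) = h' \<bullet> (t \<bullet> ?W)"
      using comp1_eq_assoc[OF tt, of ?K] comp1_eq_assoc[OF tt, of ?W] by simp_all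
    \<comment> \<open>The inserted isomorphism is recovered from the two projections, since those of
      the chosen product are jointly monic.\<close>
    have hU: "h \<rhd> U = h' \<rhd> U"
      by (rule jointly_monicD[OF HA.product_jointly_monic[OF prod[OF ht(2)]], of _ "h \<bullet> (t \<bullet> ?K)"])
        (use e1(4,5) in \<open>simp_all add: in_hom_def tt tK\<close>)
    have "\<exists>!m. in_mor C m A ?E \<and> m \<bullet> t = h \<bullet> t \<and> m \<rhd> U = h \<rhd> U"
    proof (rule R1[OF ht(1)])
      show "is_iso (vert C) (h \<rhd> U)"
      proof -
        obtain V where V: "in_cell C V (t \<bullet> ?W) (t \<bullet> ?K)" "U \<odot> V = Id2 C (t \<bullet> ?K)" "V \<odot> U = Id2 C (t \<bullet> ?W)"
          by (rule is_iso_vertE[OF Ui U])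
        note [simp] = in_cellD[OF V(1)]
        show ?thesis
          by (rule is_iso_vertI[of _ "h \<bullet> (t \<bullet> ?K)" "h \<bullet> (t \<bullet> ?W)" "h \<rhd> V"])
            (simp_all add: in_cell_def lwhisker_vcomp[symmetric] V(2,3))
      qed
      show "(h \<bullet> t) \<rhd> \<alpha> = (h \<bullet> t) \<rhd> \<beta>" if "(\<alpha>, \<beta>) \<in> {(k0, k1)}" for \<alpha> \<beta>
        using that tk[of k0 k1] by (simp add: lwhisker_lwhisker[symmetric] del: lwhisker_lwhisker)
    qed (simp add: in_cell_def)
    then show "h = h'" by (rule ex1_unique) (use h h' tt hU in simp_all)
  next
    interpret HA: category "hom C A X" by (rule category_hom)
    fix h h' \<eta> assume h: "in_mor C h A ?E" and h': "in_mor C h' A ?E"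
      and n: "natural_transformation K_check (hom C A X) (?D h) (?D h') \<eta>"
    note [simp] = in_morD[OF h] in_morD[OF h']
    note n1 = n[unfolded natural_transformation_def, THEN conjunct1, rule_format]
      and n2 = n[unfolded natural_transformation_def, THEN conjunct2, rule_format]
    have e: "in_cell C (\<eta> 3) (h \<bullet> (t \<bullet> Dom2 C \<mu>)) (h' \<bullet> (t \<bullet> Dom2 C \<mu>))" "in_cell C (\<eta> 2) (h \<bullet> (t \<bullet> ?K)) (h' \<bullet> (t \<bullet> ?K))"
      "in_cell C (\<eta> 0) (h \<bullet> (t \<bullet> a)) (h' \<bullet> (t \<bullet> a))" "in_cell C (\<eta> 1) (h \<bullet> (t \<bullet> b)) (h' \<bullet> (t \<bullet> b))"
      using n1[of 3, unfolded dv[OF h] dv[OF h']] n1[of 2, unfolded dv[OF h] dv[OF h']]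
        n1[of 0, unfolded dv[OF h] dv[OF h']] n1[of 1, unfolded dv[OF h] dv[OF h']]
      by (simp_all add: in_hom_hom K_check_Obj)
    have nn: "\<eta> 3 \<odot> ((h' \<bullet> t) \<rhd> \<mu>) = ((h \<bullet> t) \<rhd> \<mu>) \<odot> \<eta> 2"
      "((h \<rhd> U) \<odot> ((h \<bullet> t) \<rhd> w0)) \<odot> \<eta> 0 = \<eta> 2 \<odot> ((h' \<rhd> U) \<odot> ((h' \<bullet> t) \<rhd> w0))"
      "((h \<rhd> U) \<odot> ((h \<bullet> t) \<rhd> w1)) \<odot> \<eta> 1 = \<eta> 2 \<odot> ((h' \<rhd> U) \<odot> ((h' \<bullet> t) \<rhd> w1))"
      using n2[of "(3, 2)", unfolded dv[OF h] dv[OF h']] n2[of "(2, 0)", unfolded dv[OF h] dv[OF h']]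
        n2[of "(2, 1)", unfolded dv[OF h] dv[OF h']]
      by (simp_all only: K_check_Arr insert_iff simp_thms K_check_simps fst_conv snd_conv hom_simps)
    note [simp] = in_cellD[OF e(1)] in_cellD[OF e(2)] in_cellD[OF e(3)] in_cellD[OF e(4)]
    have ht: "in_mor C (h \<bullet> t) A B" "in_mor C (h' \<bullet> t) A B" by (simp_all add: in_mor_def)
    have "\<exists>!\<tau>. in_cell C \<tau> (h \<bullet> t) (h' \<bullet> t) \<and> \<tau> \<lhd> Dom2 C \<mu> = \<eta> 3 \<and> \<tau> \<lhd> ?K = \<eta> 2 \<and> \<tau> \<lhd> a = \<eta> 0 \<and> \<tau> \<lhd> b = \<eta> 1"
      by (rule Q2[OF ht _ _ _ _ nn(1)]) (simp_all add: in_cell_def)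
    then obtain \<tau> where T: "in_cell C \<tau> (h \<bullet> t) (h' \<bullet> t)" "\<tau> \<lhd> Dom2 C \<mu> = \<eta> 3" "\<tau> \<lhd> ?K = \<eta> 2" "\<tau> \<lhd> a = \<eta> 0" "\<tau> \<lhd> b = \<eta> 1"
      by blast
    note [simp] = in_cellD[OF T(1)]
    have tw: "(\<tau> \<lhd> ?W) \<odot> ((h' \<bullet> t) \<rhd> w0) = ((h \<bullet> t) \<rhd> w0) \<odot> \<eta> 0" "(\<tau> \<lhd> ?W) \<odot> ((h' \<bullet> t) \<rhd> w1) = ((h \<bullet> t) \<rhd> w1) \<odot> \<eta> 1"
      using whisker_exchange[of \<tau> w0] whisker_exchange[of \<tau> w1] by (simp_all add: T)
    \<comment> \<open>Compatibility with \<open>U\<close> is tested on the two projections of the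
      chosen product, where it is naturality of \<eta> at 2 \<rightarrow> 0 and 2 \<rightarrow>
      1.\<close>
    have "\<eta> 2 \<odot> (h' \<rhd> U) = (h \<rhd> U) \<odot> (\<tau> \<lhd> ?W)"
    proof (rule jointly_monicD[OF HA.product_jointly_monic[OF prod[OF ht(2)]], of _ "h \<bullet> (t \<bullet> ?K)"])
      show "(\<eta> 2 \<odot> (h' \<rhd> U)) \<cdot>\<^bsub>hom C A X\<^esub> ((h' \<bullet> t) \<rhd> w0) = ((h \<rhd> U) \<odot> (\<tau> \<lhd> ?W)) \<cdot>\<^bsub>hom C A X\<^esub> ((h' \<bullet> t) \<rhd> w0)"
        using nn(2) by (simp add: tw)
      show "(\<eta> 2 \<odot> (h' \<rhd> U)) \<cdot>\<^bsub>hom C A X\<^esub> ((h' \<bullet> t) \<rhd> w1) = ((h \<rhd> U) \<odot> (\<tau> \<lhd> ?W)) \<cdot>\<^bsub>hom C A X\<^esub> ((h' \<bullet> t) \<rhd> w1)"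
        using nn(3) by (simp add: tw)
    qed (simp_all add: in_hom_def)
    then have "\<exists>!\<gamma>. in_cell C \<gamma> h h' \<and> \<gamma> \<lhd> t = \<tau>"
      by (intro R2[OF h h' T(1)]) (simp add: T(3))
    then obtain \<gamma> where g: "in_cell C \<gamma> h h'" "\<gamma> \<lhd> t = \<tau>" by blast
    note [simp] = in_cellD[OF g(1)]
    have gt: "\<gamma> \<lhd> (t \<bullet> y) = \<tau> \<lhd> y" if "y \<in> Mor C" "Src C y = B" for y
      using rwhisker_rwhisker[of t y \<gamma>] that by (simp add: g(2))
    show "\<exists>\<gamma>. in_cell C \<gamma> h h' \<and> (\<forall>j \<in> Obj K_check. \<gamma> \<lhd> fobj ?ev j = \<eta> j)"
      using g(1) unfolding K_check_Obj by (intro exI[of _ \<gamma>]) (simp add: gt T)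
  next
    fix h h' \<gamma> \<delta> assume h: "in_mor C h A ?E" and h': "in_mor C h' A ?E" and g: "in_cell C \<gamma> h h'" and d: "in_cell C \<delta> h h'"
      and e: "\<forall>j \<in> Obj K_check. \<gamma> \<lhd> fobj ?ev j = \<delta> \<lhd> fobj ?ev j"
    note [simp] = in_morD[OF h] in_morD[OF h'] in_cellD[OF g] in_cellD[OF d]
    have e0: "\<delta> \<lhd> (t \<bullet> a) = \<gamma> \<lhd> (t \<bullet> a)" "\<delta> \<lhd> (t \<bullet> b) = \<gamma> \<lhd> (t \<bullet> b)" "\<delta> \<lhd> (t \<bullet> ?K) = \<gamma> \<lhd> (t \<bullet> ?K)"
      "\<delta> \<lhd> (t \<bullet> Dom2 C \<mu>) = \<gamma> \<lhd> (t \<bullet> Dom2 C \<mu>)"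
      using e unfolding K_check_Obj by simp_all
    have ht: "in_mor C (h \<bullet> t) A B" "in_mor C (h' \<bullet> t) A B" by (simp_all add: in_mor_def)
    have x: "(\<gamma> \<lhd> (t \<bullet> y)) \<odot> (h' \<rhd> (t \<rhd> z)) = (h \<rhd> (t \<rhd> z)) \<odot> (\<gamma> \<lhd> (t \<bullet> y'))"
      if "in_cell C z y y'" "Src C y = B" for y y' z
      using whisker_exchange[of \<gamma> "t \<rhd> z"] in_cellD[OF that(1)] that(2) Cell_simps(4)[of z] by simp
    have "\<exists>!\<tau>. in_cell C \<tau> (h \<bullet> t) (h' \<bullet> t) \<and> \<tau> \<lhd> Dom2 C \<mu> = \<gamma> \<lhd> (t \<bullet> Dom2 C \<mu>) \<and> \<tau> \<lhd> ?K = \<gamma> \<lhd> (t \<bullet> ?K)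
        \<and> \<tau> \<lhd> a = \<gamma> \<lhd> (t \<bullet> a) \<and> \<tau> \<lhd> b = \<gamma> \<lhd> (t \<bullet> b)"
      by (rule Q2[OF ht]) (use x[of \<mu> "Dom2 C \<mu>" ?K] in \<open>simp_all add: in_cell_def\<close>)
    then have tt: "\<gamma> \<lhd> t = \<delta> \<lhd> t"
      by (rule ex1_unique) (use e0 in \<open>simp_all add: in_cell_def\<close>)
    have "((\<gamma> \<lhd> t) \<lhd> ?K) \<odot> (h' \<rhd> U) = (h \<rhd> U) \<odot> ((\<gamma> \<lhd> t) \<lhd> ?W)"
      using whisker_exchange[of \<gamma> U] by simp
    then have "\<exists>!\<xi>. in_cell C \<xi> h h' \<and> \<xi> \<lhd> t = \<gamma> \<lhd> t"
      by (intro R2[OF h h']) (simp_all add: in_cell_def)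
    then show "\<gamma> = \<delta>" by (rule ex1_unique) (use g d tt in simp_all)
  qed
  then have "is_K_check_power C X ?E ?ev"
    unfolding is_K_check_power_def using X ev by simp
  then show ?thesis by blast
qed

end

section \<open>Power morphisms\<close>

text \<open>The covariant and the contravariant case are treated together: in the latter (\<open>fl\<close>), the
  2-cells of \<open>X\<close> are reversed, so that images always go from \<open>P(q)\<close> to \<open>P(q')\<close>.
  A power object is given by the triple of its two projections and its membership relation.\<close>

definition cell_fl :: "('o, 'm, 'c) twocat \<Rightarrow> bool \<Rightarrow> 'c \<Rightarrow> 'm \<Rightarrow> 'm \<Rightarrow> bool" where
  "cell_fl C fl \<alpha> f f' \<longleftrightarrow> (if fl then in_cell C \<alpha> f' f else in_cell C \<alpha> f f')"

definition vcomp_fl :: "('o, 'm, 'c) twocat \<Rightarrow> bool \<Rightarrow> 'c \<Rightarrow> 'c \<Rightarrow> 'c" where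
  "vcomp_fl C fl \<alpha> \<beta> = (if fl then \<beta> \<odot>\<^bsub>C\<^esub> \<alpha> else \<alpha> \<odot>\<^bsub>C\<^esub> \<beta>)"

definition power_triple :: "('o, 'm, 'c) twocat \<Rightarrow> 'o \<Rightarrow> 'o \<Rightarrow> 'c \<times> 'c \<times> 'c \<Rightarrow> bool" where
  "power_triple C X A = (\<lambda>(q0, q1, m). is_power_object (hom C A X) q0 q1 m)"

definition base :: "('o, 'm, 'c) twocat \<Rightarrow> 'c \<times> 'c \<times> 'c \<Rightarrow> 'm" where
  "base C = (\<lambda>(q0, q1, m). Cod2 C q0)"

definition power :: "('o, 'm, 'c) twocat \<Rightarrow> 'c \<times> 'c \<times> 'c \<Rightarrow> 'm" where
  "power C = (\<lambda>(q0, q1, m). Cod2 C q1)"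

definition pull :: "('o, 'm, 'c) twocat \<Rightarrow> 'm \<Rightarrow> 'c \<times> 'c \<times> 'c \<Rightarrow> 'c \<times> 'c \<times> 'c" where
  "pull C h = (\<lambda>(q0, q1, m). (h \<rhd>\<^bsub>C\<^esub> q0, h \<rhd>\<^bsub>C\<^esub> q1, h \<rhd>\<^bsub>C\<^esub> m))"

definition image_fl :: "('o, 'm, 'c) twocat \<Rightarrow> 'o \<Rightarrow> bool \<Rightarrow> 'o \<Rightarrow> 'c \<times> 'c \<times> 'c \<Rightarrow> 'c \<times> 'c \<times> 'c \<Rightarrow> 'c \<Rightarrow> 'c \<Rightarrow> bool" where
  "image_fl C X fl A = (\<lambda>(q0, q1, m) (q0', q1', m') \<alpha> d.
     if fl then inverse_image_arrows (hom C A X) q0' q1' m' q0 q1 m \<alpha> d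
     else direct_image_arrows (hom C A X) q0 q1 m q0' q1' m' \<alpha> d)"

text \<open>Restriction is respected on the nose, not up to isomorphism. As every morphism from a
  groupoid is a restriction of the core inclusion, such a family is determined by its value
  there.\<close>

definition power_family :: "('o, 'm, 'c) twocat \<Rightarrow> 'o \<Rightarrow> ('m \<Rightarrow> 'c \<times> 'c \<times> 'c) \<Rightarrow> bool" where
  "power_family C X q \<longleftrightarrow> (\<forall>A f. groupoid_ob C A \<and> in_mor C f A X \<longrightarrow>
     power_triple C X A (q f) \<and> base C (q f) = f
   \<and> (\<forall>A' h. groupoid_ob C A' \<and> in_mor C h A' A \<longrightarrow> q (h \<bullet>\<^bsub>C\<^esub> f) = pull C h (q f)))"

locale internal_topos = groupoidant_category +
  fixes X
  assumes topos: "internal_elementary_topos C X"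
begin

lemma finite_limits: "ob_has_finite_limits C X"
  using topos unfolding internal_elementary_topos_def by blast

lemma X_Ob: "X \<in> Ob C"
  using finite_limits unfolding ob_has_finite_limits_def by blast

lemma groupoid_Ob: "groupoid_ob C A \<Longrightarrow> A \<in> Ob C"
  unfolding groupoid_ob_def by blast

lemma power_category_hom:
  assumes "groupoid_ob C A"
  shows "power_category (hom C A X)"
proof -
  interpret lex_category "hom C A X" by (rule hom_lex[OF finite_limits groupoid_Ob[OF assms]])
  show ?thesis
    using topos assms unfolding internal_elementary_topos_def by unfold_locales blast
qed

lemma logical_functor_pre:
  assumes A: "groupoid_ob C A" and A': "groupoid_ob C A'" and h: "in_mor C h A' A"
  shows "logical_functor (hom C A X) (hom C A' X) (pre C h)"
proof -
  interpret D: power_category "hom C A X" by (rule power_category_hom[OF A])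
  interpret E: power_category "hom C A' X" by (rule power_category_hom[OF A'])
  interpret lex_functor "hom C A X" "hom C A' X" "pre C h" by (rule pre_lex_functor[OF finite_limits h])
  have "preserves_power_objects (hom C A X) (hom C A' X) (pre C h)"
    using topos A A' h unfolding internal_elementary_topos_def by blast
  then show ?thesis by unfold_locales
qed

lemma power_triple_cells:
  assumes "groupoid_ob C A" "power_triple C X A (q0, q1, m)"
  shows "q0 \<in> Cell C" "q1 \<in> Cell C" "m \<in> Cell C" "Dom2 C q1 = Dom2 C q0" "Cod2 C m = Dom2 C q0"
    "Src C (Dom2 C q0) = A" "Tgt C (Dom2 C q0) = X" "Src C (Dom2 C m) = A" "Tgt C (Dom2 C m) = X"
    "is_product (hom C A X) q0 q1" "is_mono (hom C A X) m"
  using power_category.power_arrows[OF power_category_hom[OF assms(1)], of q0 q1 m] assms(2)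
  by (simp_all add: power_triple_def)

lemma base_mor:
  assumes "groupoid_ob C A" "power_triple C X A q"
  shows "in_mor C (base C q) A X" "in_mor C (power C q) A X"
proof -
  obtain q0 q1 m where q: "q = (q0, q1, m)" by (cases q)
  note [simp] = power_triple_cells[OF assms(1) assms(2)[unfolded q]]
  show "in_mor C (base C q) A X" "in_mor C (power C q) A X"
    by (simp_all add: in_mor_def base_def power_def q)
qed

lemma pull_power_triple:
  assumes A: "groupoid_ob C A" and A': "groupoid_ob C A'" and h: "in_mor C h A' A" and q: "power_triple C X A q"
  shows "power_triple C X A' (pull C h q)" "base C (pull C h q) = h \<bullet> base C q" "power C (pull C h q) = h \<bullet> power C q"
proof -
  obtain q0 q1 m where qq: "q = (q0, q1, m)" by (cases q)
  note [simp] = power_triple_cells[OF A q[unfolded qq]] in_morD[OF h]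
  show "base C (pull C h q) = h \<bullet> base C q" "power C (pull C h q) = h \<bullet> power C q"
    by (simp_all add: base_def power_def pull_def qq)
  show "power_triple C X A' (pull C h q)"
    using logical_functor.G_power_object[OF logical_functor_pre[OF A A' h], of q0 q1 m] q
    by (simp add: power_triple_def pull_def qq)
qed

lemma pull_pull:
  assumes A: "groupoid_ob C A" and h: "in_mor C h A' A" and h': "in_mor C h' A'' A'" and q: "power_triple C X A q"
  shows "pull C h' (pull C h q) = pull C (h' \<bullet> h) q"
proof -
  obtain q0 q1 m where qq: "q = (q0, q1, m)" by (cases q)
  note [simp] = power_triple_cells[OF A q[unfolded qq]] in_morD[OF h] in_morD[OF h']
  show ?thesis by (simp add: pull_def qq)
qed

lemma pull_Id:
  assumes A: "groupoid_ob C A" and q: "power_triple C X A q"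
  shows "pull C (Id1 C A) q = q"
proof -
  obtain q0 q1 m where qq: "q = (q0, q1, m)" by (cases q)
  note [simp] = power_triple_cells[OF A q[unfolded qq]]
  show ?thesis by (simp add: pull_def qq)
qed

lemma image_ex1:
  assumes A: "groupoid_ob C A" and q: "power_triple C X A q" and q': "power_triple C X A q'"
    and \<alpha>: "cell_fl C fl \<alpha> (base C q) (base C q')"
  shows "\<exists>!d. image_fl C X fl A q q' \<alpha> d"
    and "image_fl C X fl A q q' \<alpha> d \<Longrightarrow> in_cell C d (power C q) (power C q')"
proof -
  obtain q0 q1 m where qq: "q = (q0, q1, m)" by (cases q)
  obtain q0' q1' m' where qq': "q' = (q0', q1', m')" by (cases q')
  note [simp] = power_triple_cells[OF A q[unfolded qq]] power_triple_cells[OF A q'[unfolded qq']]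
  interpret D: power_category "hom C A X" by (rule power_category_hom[OF A])
  have po: "is_power_object (hom C A X) q0 q1 m" "is_power_object (hom C A X) q0' q1' m'"
    using q q' by (simp_all add: power_triple_def qq qq')
  have *: "(\<exists>!d. image_fl C X fl A q q' \<alpha> d) \<and> (image_fl C X fl A q q' \<alpha> d \<longrightarrow> in_cell C d (power C q) (power C q'))"
  proof (cases fl)
    case True
    then have k: "in_hom (hom C A X) \<alpha> (Cod (hom C A X) q0') (Cod (hom C A X) q0)"
      using \<alpha> by (simp add: cell_fl_def base_def qq qq' in_hom_hom)
    show ?thesis
      using D.inverse_image_ex1[OF po(2,1) k] True
      by (simp add: image_fl_def qq qq' power_def in_hom_hom)
  next
    case False
    then have k: "in_hom (hom C A X) \<alpha> (Cod (hom C A X) q0) (Cod (hom C A X) q0')"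
      using \<alpha> by (simp add: cell_fl_def base_def qq qq' in_hom_hom)
    show ?thesis
      using D.direct_image_ex1[OF po k] False
      by (simp add: image_fl_def qq qq' power_def in_hom_hom)
  qed
  then show "\<exists>!d. image_fl C X fl A q q' \<alpha> d"
    "image_fl C X fl A q q' \<alpha> d \<Longrightarrow> in_cell C d (power C q) (power C q')" by blast+
qed

lemma image_ide:
  assumes A: "groupoid_ob C A" and q: "power_triple C X A q"
  shows "image_fl C X fl A q q (Id2 C (base C q)) (Id2 C (power C q))"
proof -
  obtain q0 q1 m where qq: "q = (q0, q1, m)" by (cases q)
  interpret D: power_category "hom C A X" by (rule power_category_hom[OF A])
  have po: "is_power_object (hom C A X) q0 q1 m"
    using q by (simp add: power_triple_def qq)
  show ?thesis
    using D.direct_image_ide[OF po] D.inverse_image_ide[OF po]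
    by (simp add: image_fl_def qq power_def base_def)
qed

text \<open>With \<open>fl\<close> the composition of the 2-cells of X is reversed while that of the
  images is not; this is why one statement covers both variances.\<close>

lemma image_comp:
  assumes A: "groupoid_ob C A" and q: "power_triple C X A q" and q': "power_triple C X A q'"
    and q'': "power_triple C X A q''"
    and \<alpha>: "cell_fl C fl \<alpha> (base C q) (base C q')" and \<beta>: "cell_fl C fl \<beta> (base C q') (base C q'')"
    and d: "image_fl C X fl A q q' \<alpha> d" and e: "image_fl C X fl A q' q'' \<beta> e"
  shows "image_fl C X fl A q q'' (vcomp_fl C fl \<alpha> \<beta>) (d \<odot> e)"
proof -
  obtain q0 q1 m where qq: "q = (q0, q1, m)" by (cases q)
  obtain q0' q1' m' where qq': "q' = (q0', q1', m')" by (cases q')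
  obtain q0'' q1'' m'' where qq'': "q'' = (q0'', q1'', m'')" by (cases q'')
  note [simp] = power_triple_cells[OF A q[unfolded qq]] power_triple_cells[OF A q'[unfolded qq']]
    power_triple_cells[OF A q''[unfolded qq'']]
  interpret D: power_category "hom C A X" by (rule power_category_hom[OF A])
  have po: "is_power_object (hom C A X) q0 q1 m" "is_power_object (hom C A X) q0' q1' m'"
    "is_power_object (hom C A X) q0'' q1'' m''"
    using q q' q'' by (simp_all add: power_triple_def qq qq' qq'')
  show ?thesis
  proof (cases fl)
    case True
    then have k: "in_hom (hom C A X) \<alpha> (Cod (hom C A X) q0') (Cod (hom C A X) q0)"
      "in_hom (hom C A X) \<beta> (Cod (hom C A X) q0'') (Cod (hom C A X) q0')"
      using \<alpha> \<beta> by (simp_all add: cell_fl_def base_def qq qq' qq'' in_hom_hom)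
    show ?thesis
      using D.inverse_image_comp[OF po(3,2,1) k(2,1), of e d] True d e
      by (simp add: image_fl_def qq qq' qq'' vcomp_fl_def)
  next
    case False
    then have k: "in_hom (hom C A X) \<alpha> (Cod (hom C A X) q0) (Cod (hom C A X) q0')"
      "in_hom (hom C A X) \<beta> (Cod (hom C A X) q0') (Cod (hom C A X) q0'')"
      using \<alpha> \<beta> by (simp_all add: cell_fl_def base_def qq qq' qq'' in_hom_hom)
    show ?thesis
      using D.direct_image_comp[OF po k, of d e] False d e
      by (simp add: image_fl_def qq qq' qq'' vcomp_fl_def)
  qed
qed

lemma image_pull:
  assumes A: "groupoid_ob C A" and A': "groupoid_ob C A'" and h: "in_mor C h A' A"
    and q: "power_triple C X A q" and q': "power_triple C X A q'"
    and \<alpha>: "cell_fl C fl \<alpha> (base C q) (base C q')" and d: "image_fl C X fl A q q' \<alpha> d"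
  shows "image_fl C X fl A' (pull C h q) (pull C h q') (h \<rhd> \<alpha>) (h \<rhd> d)"
proof -
  obtain q0 q1 m where qq: "q = (q0, q1, m)" by (cases q)
  obtain q0' q1' m' where qq': "q' = (q0', q1', m')" by (cases q')
  note [simp] = power_triple_cells[OF A q[unfolded qq]] power_triple_cells[OF A q'[unfolded qq']]
  interpret G: logical_functor "hom C A X" "hom C A' X" "pre C h" by (rule logical_functor_pre[OF A A' h])
  have po: "is_power_object (hom C A X) q0 q1 m" "is_power_object (hom C A X) q0' q1' m'"
    using q q' by (simp_all add: power_triple_def qq qq')
  show ?thesis
  proof (cases fl)
    case True
    then have k: "in_hom (hom C A X) \<alpha> (Cod (hom C A X) q0') (Cod (hom C A X) q0)"
      using \<alpha> by (simp add: cell_fl_def base_def qq qq' in_hom_hom)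
    show ?thesis
      using G.G_inverse_image[OF po(2,1) k, of d] True d
      by (simp add: image_fl_def qq qq' pull_def)
  next
    case False
    then have k: "in_hom (hom C A X) \<alpha> (Cod (hom C A X) q0) (Cod (hom C A X) q0')"
      using \<alpha> by (simp add: cell_fl_def base_def qq qq' in_hom_hom)
    show ?thesis
      using G.G_direct_image[OF po k, of d] False d
      by (simp add: image_fl_def qq qq' pull_def)
  qed
qed

lemma power_familyD:
  assumes "power_family C X q" "groupoid_ob C A" "in_mor C f A X"
  shows "power_triple C X A (q f)" "base C (q f) = f"
    "groupoid_ob C A' \<Longrightarrow> in_mor C h A' A \<Longrightarrow> q (h \<bullet> f) = pull C h (q f)"
  using assms unfolding power_family_def by blast+

lemma cell_fl_lwhisker:
  assumes "cell_fl C fl \<alpha> f f'" "in_mor C h A' (Src C f)" "Src C f' = Src C f"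
  shows "cell_fl C fl (h \<rhd> \<alpha>) (h \<bullet> f) (h \<bullet> f')"
  using assms in_morD[OF assms(2)] by (auto simp: cell_fl_def in_cell_def split: if_splits)

subsection \<open>Choices of power objects\<close>

text \<open>A single choice is made, for \<open>i\<close> in the hom-category of the core. Every
  morphism from a groupoid to X is a restriction of \<open>i\<close> along its lift, and restriction
  between groupoids preserves power objects.\<close>

lemma power_choice_ex: "\<exists>i XK ev j P. power_choice C X i XK ev j P"
proof -
  obtain XK ev where K: "is_K_check_power C X XK ev" using K_check_power_ex[OF finite_limits] by blast
  have XK: "XK \<in> Ob C" and ev: "is_functor K_check (hom C XK X) ev"
    using K unfolding is_K_check_power_def by blast+
  obtain A i where i: "is_core C X A i" by (rule obtain_core[OF X_Ob])
  obtain B j where j: "is_core C XK B j" by (rule obtain_core[OF XK])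
  note [simp] = in_morD[OF is_coreD[OF i]] in_morD[OF is_coreD[OF j]]
  have A: "groupoid_ob C A" by (rule core_groupoid[OF i])
  have Ao: "A \<in> Ob C" by (rule groupoid_Ob[OF A])
  interpret D: power_category "hom C A X" by (rule power_category_hom[OF A])
  obtain q0 q1 m where po: "is_power_object (hom C A X) q0 q1 m" and q0: "Cod2 C q0 = i"
  proof -
    have "i \<in> Obj (hom C A X)" by simp
    then obtain q0 q1 m where "is_power_object (hom C A X) q0 q1 m" "Cod (hom C A X) q0 = i"
      using D.has_power unfolding has_power_objects_def by blast
    then show thesis using that by simp
  qed
  then have pt: "power_triple C X A (q0, q1, m)" by (simp add: power_triple_def)
  note c = power_triple_cells[OF A pt]
  note [simp] = c(1-9)
  let ?F = "relation_diagram C m q0 q1"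
  have F: "is_functor K_check (hom C A X) ?F" by (rule relation_diagram_functor) simp_all
  \<comment> \<open>Stability is asked along all morphisms, not only between groupoids; it holds
    because products and monos are finite-limit notions.\<close>
  have "?F \<in> stable_relation_diagrams C A X"
    unfolding stable_relation_diagrams_def
    using F c(10,11) lex_functor.G_product[OF pre_lex_functor[OF finite_limits] c(10)] lex_functor.G_mono[OF pre_lex_functor[OF finite_limits] c(11)]
    by simp
  moreover have "bij_betw (diagram_of C K_check ev) (Obj (hom C A XK)) (stable_relation_diagrams C A X)"
    using K Ao unfolding is_K_check_power_def cat_isomorphism_def by (simp add: cotensor_functor_def)
  ultimately have "?F \<in> diagram_of C K_check ev ` Obj (hom C A XK)" by (simp only: bij_betw_imp_surj_on)
  then obtain p where p: "p \<in> Obj (hom C A XK)" "?F = diagram_of C K_check ev p" by (rule imageE)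
  have pm: "in_mor C p A XK" using p(1) by (simp add: in_mor_def)
  note [simp] = in_morD[OF pm]
  obtain P where P: "in_mor C P A B" "P \<bullet> j = p" using groupoid_lift[OF j A pm] by blast
  note [simp] = in_morD[OF P(1)]
  have ev0: "fobj ev 0 \<in> Mor C" "Src C (fobj ev 0) = XK" "Tgt C (fobj ev 0) = X"
    using hom_functorD(1-3)[OF ev, of 0] by (simp_all add: K_check_Obj)
  note [simp] = ev0
  have pe: "p \<bullet> fobj ev 0 = i"
    using arg_cong[OF p(2), of "\<lambda>F. fobj F 0"] q0 by (simp add: K_check_Obj)
  note cm = core_map_eq[OF j i, of "fobj ev 0", unfolded in_mor_def, simplified]
  \<comment> \<open>Endomorphisms of the core are compared after \<open>i\<close>, and there the
    value at the object 0 is \<open>i\<close> by the choice of \<open>q0\<close>.\<close>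
  have PI: "P \<bullet> core_map C j i (fobj ev 0) = Id1 C A"
  proof -
    have "\<exists>!h. in_mor C h A A \<and> h \<bullet> i = i" by (rule groupoid_lift[OF i A is_coreD[OF i]])
    moreover have "in_mor C (P \<bullet> core_map C j i (fobj ev 0)) A A" using cm by (simp add: in_mor_def)
    moreover have "(P \<bullet> core_map C j i (fobj ev 0)) \<bullet> i = i"
      using cm comp1_eq_assoc1[OF P(2), of "fobj ev 0"] pe by simp
    moreover have "in_mor C (Id1 C A) A A" "Id1 C A \<bullet> i = i" using Ao by (simp_all add: in_mor_def)
    ultimately show ?thesis by blast
  qed
  have PO: "power_object_diagram C X XK ev (lift_along C i f \<bullet> P \<bullet> j)" if A': "groupoid_ob C A'" and f: "in_mor C f A' X" for A' f
  proof -
    note [simp] = in_morD[OF f]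
    have "\<exists>!h. in_mor C h (Src C f) (Src C i) \<and> h \<bullet> i = f" using groupoid_lift[OF i A' f] by simp
    note l = lift_along_eq(1,2)[OF this]
    let ?l = "lift_along C i f"
    have lm: "in_mor C ?l A' A" using l(1) by simp
    note [simp] = in_morD[OF lm]
    have e: "?l \<bullet> P \<bullet> j = ?l \<bullet> p" by (simp add: P(2))
    have lp: "in_mor C (?l \<bullet> p) A' XK" by (simp add: in_mor_def)
    have x: "farr (diagram_of C K_check ev (?l \<bullet> p)) u = ?l \<rhd> farr ?F u" if "u \<in> Arr K_check" for u
    proof -
      have "farr ev u \<in> Cell C" "Src C (Dom2 C (farr ev u)) = XK"
        using hom_functorD(1-6)[OF ev] that category.Dom_Obj[OF category_K_check that] by auto
      then show ?thesis using that by (simp add: p(2))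
    qed
    have "is_power_object (hom C A' X) (?l \<rhd> q0) (?l \<rhd> q1) (?l \<rhd> m)"
      using logical_functor.G_power_object[OF logical_functor_pre[OF A A' lm] po] by simp
    then show ?thesis
      unfolding power_object_diagram_def power_object_functor_def e
      using diagram_functor[OF category_K_check ev lp] x[of "(2, 0)"] x[of "(2, 1)"] x[of "(3, 2)"]
      by (simp del: diagram_of_simps add: K_check_Arr)
  qed
  have "power_choice C X i XK ev j P"
    unfolding power_choice_def
  proof (intro conjI allI impI; (elim conjE)?)
    fix A' f assume "groupoid_ob C A'" "in_mor C f A' X"
    then show "power_object_diagram C X XK ev (lift_along C i f \<bullet> P \<bullet> j)" by (rule PO)
  qed (use K i j P PI in simp_all)
  then show ?thesis by blast
qed

definition chosen_triple :: "(nat, nat \<times> nat, 'b, 'c) ftor \<Rightarrow> 'c \<times> 'c \<times> 'c" where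
  "chosen_triple F = (farr F (2, 0), farr F (2, 1), farr F (3, 2))"

text \<open>The lift of h f to the core is h followed by the lift of f. The chosen diagrams are
  obtained by precomposition with these lifts, so they commute strictly with restriction.\<close>

lemma chosen_diagram_facts:
  assumes pc: "power_choice C X i XK ev j P" and A: "groupoid_ob C A" and f: "in_mor C f A X"
  shows "is_functor K_check (hom C A X) (chosen_diagram C i ev j P f)"
    "fobj (chosen_diagram C i ev j P f) 0 = f"
    "power_triple C X A (chosen_triple (chosen_diagram C i ev j P f))"
    "groupoid_ob C A' \<Longrightarrow> in_mor C h A' A \<Longrightarrow>
      chosen_triple (chosen_diagram C i ev j P (h \<bullet> f)) = pull C h (chosen_triple (chosen_diagram C i ev j P f))"
proof -
  have K: "is_K_check_power C X XK ev" and i: "is_core C X (Src C i) i" and j: "is_core C XK (Src C j) j"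
    and P: "in_mor C P (Src C i) (Src C j)" and Pi: "P \<bullet> core_map C j i (fobj ev 0) = Id1 C (Src C i)"
    and po: "power_object_diagram C X XK ev (lift_along C i f \<bullet> P \<bullet> j)"
    using pc A f unfolding power_choice_def by blast+
  have ev: "is_functor K_check (hom C XK X) ev" using K unfolding is_K_check_power_def by blast
  note [simp] = in_morD(1,3)[OF is_coreD[OF i]] in_morD(1,3)[OF is_coreD[OF j]] in_morD[OF P] in_morD[OF f]
  have "\<exists>!k. in_mor C k (Src C f) (Src C i) \<and> k \<bullet> i = f" using groupoid_lift[OF i A f] by simp
  note l = lift_along_eq(1,2)[OF this]
  let ?l = "lift_along C i f"
  have lm: "in_mor C ?l A (Src C i)" using l(1) by simp
  note [simp] = in_morD[OF lm]
  have lm': "in_mor C (?l \<bullet> P \<bullet> j) A XK" by (simp add: in_mor_def)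
  have ch: "chosen_diagram C i ev j P f = diagram_of C K_check ev (?l \<bullet> P \<bullet> j)"
    by (simp add: chosen_diagram_def)
  show fu: "is_functor K_check (hom C A X) (chosen_diagram C i ev j P f)"
    unfolding ch by (rule diagram_functor[OF category_K_check ev lm'])
  have ev0: "fobj ev 0 \<in> Mor C" "Src C (fobj ev 0) = XK" "Tgt C (fobj ev 0) = X"
    using hom_functorD(1-3)[OF ev, of 0] by (simp_all add: K_check_Obj)
  note [simp] = ev0
  have cm: "core_map C j i (fobj ev 0) \<in> Mor C" "Src C (core_map C j i (fobj ev 0)) = Src C j"
    "Tgt C (core_map C j i (fobj ev 0)) = Src C i" "core_map C j i (fobj ev 0) \<bullet> i = j \<bullet> fobj ev 0"
    using core_map_eq[OF j i, of "fobj ev 0"] by (simp_all add: in_mor_def)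
  have "P \<bullet> (j \<bullet> fobj ev 0) = i"
    using comp1_eq_assoc1[OF Pi, of i] cm by simp
  then have "?l \<bullet> (P \<bullet> (j \<bullet> fobj ev 0)) = f" using l(2) by simp
  then show "fobj (chosen_diagram C i ev j P f) 0 = f" by (simp add: ch K_check_Obj)
  show "power_triple C X A (chosen_triple (chosen_diagram C i ev j P f))"
    using po unfolding power_object_diagram_def power_object_functor_def power_triple_def chosen_triple_def ch
    by (simp del: diagram_of_simps)
  assume A': "groupoid_ob C A'" and h: "in_mor C h A' A"
  note [simp] = in_morD[OF h]
  have hf: "in_mor C (h \<bullet> f) A' X" by (simp add: in_mor_def)
  have "\<exists>!k. in_mor C k (Src C (h \<bullet> f)) (Src C i) \<and> k \<bullet> i = h \<bullet> f" using groupoid_lift[OF i A' hf] by simp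
  then have lh: "lift_along C i (h \<bullet> f) = h \<bullet> ?l"
    by (rule lift_along_eq(3)) (simp_all add: in_mor_def l(2))
  have x: "farr (chosen_diagram C i ev j P (h \<bullet> f)) u = h \<rhd> farr (chosen_diagram C i ev j P f) u" if "u \<in> Arr K_check" for u
  proof -
    have "farr ev u \<in> Cell C" "Src C (Dom2 C (farr ev u)) = XK"
      using hom_functorD(1-6)[OF ev] that category.Dom_Obj[OF category_K_check that] by auto
    then show ?thesis using that by (simp add: chosen_diagram_def lh)
  qed
  show "chosen_triple (chosen_diagram C i ev j P (h \<bullet> f)) = pull C h (chosen_triple (chosen_diagram C i ev j P f))"
    using x[of "(2, 0)"] x[of "(2, 1)"] x[of "(3, 2)"] by (simp add: chosen_triple_def pull_def K_check_Arr)
qed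

lemma chosen_objects:
  assumes F: "is_functor K_check (hom C A X) F"
  shows "base C (chosen_triple F) = fobj F 0" "power C (chosen_triple F) = fobj F 1"
  using hom_functorD(6)[OF F, of "(2, 0)"] hom_functorD(6)[OF F, of "(2, 1)"]
  by (simp_all add: base_def power_def chosen_triple_def K_check_Arr)

lemma chosen_power_family:
  assumes pc: "power_choice C X i XK ev j P"
  shows "power_family C X (\<lambda>f. chosen_triple (chosen_diagram C i ev j P f))"
  unfolding power_family_def
proof (intro allI impI conjI; elim conjE)
  fix A f assume A: "groupoid_ob C A" and f: "in_mor C f A X"
  note * = chosen_diagram_facts[OF pc A f]
  show "power_triple C X A (chosen_triple (chosen_diagram C i ev j P f))" by (rule *(3))
  show "base C (chosen_triple (chosen_diagram C i ev j P f)) = f"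
    using chosen_objects(1)[OF *(1)] *(2) by simp
  fix A' h assume "groupoid_ob C A'" "in_mor C h A' A"
  then show "chosen_triple (chosen_diagram C i ev j P (h \<bullet> f)) = pull C h (chosen_triple (chosen_diagram C i ev j P f))"
    by (rule *(4))
qed

lemma is_direct_image_iff:
  assumes F: "is_functor K_check (hom C A X) F" and G: "is_functor K_check (hom C A X) G"
  shows "is_direct_image (hom C A X) F G \<alpha> d \<longleftrightarrow>
    in_hom (hom C A X) \<alpha> (fobj F 0) (fobj G 0) \<and> image_fl C X False A (chosen_triple F) (chosen_triple G) \<alpha> d"
  using chosen_objects[OF F] chosen_objects[OF G]
  by (simp add: is_direct_image_def image_fl_def chosen_triple_def direct_image_arrows_def base_def power_def)

text \<open>The diagrams change places: with \<open>fl\<close> an image runs from the power object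
  over the target of \<alpha> to the one over its source.\<close>

lemma is_inverse_image_iff:
  assumes F: "is_functor K_check (hom C A X) F" and G: "is_functor K_check (hom C A X) G"
  shows "is_inverse_image (hom C A X) F G \<alpha> d \<longleftrightarrow>
    in_hom (hom C A X) \<alpha> (fobj F 0) (fobj G 0) \<and> image_fl C X True A (chosen_triple G) (chosen_triple F) \<alpha> d"
  using chosen_objects[OF F] chosen_objects[OF G]
  by (simp add: is_inverse_image_def image_fl_def chosen_triple_def inverse_image_arrows_def base_def power_def)

end

section \<open>Power morphisms as cocones under a nerve\<close>

definition icat_fl :: "bool \<Rightarrow> ('o, 'm) icat \<Rightarrow> ('o, 'm) icat" where
  "icat_fl fl N = (if fl then icat_op N else N)"

text \<open>The conditions on a power morphism, with f and \<alpha> replaced by their lifts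
  \<open>h\<close> and \<open>a\<close> to the nerve. The cocone (\<open>k\<close>,
  \<open>k01\<close>) exhibits the source of \<open>Q\<close>: in the covariant case it is
  (\<open>g\<close>, \<open>g01\<close>) again, in the contravariant case the quotient cocone of the
  opposite.\<close>

definition power_like :: "('o, 'm, 'c) twocat \<Rightarrow> 'o \<Rightarrow> bool \<Rightarrow> ('o, 'm) icat \<Rightarrow> 'm \<Rightarrow> 'c \<Rightarrow> 'm \<Rightarrow> 'c \<Rightarrow>
    ('m \<Rightarrow> 'c \<times> 'c \<times> 'c) \<Rightarrow> 'm \<Rightarrow> bool" where
  "power_like C X fl N g g01 k k01 q Q \<longleftrightarrow>
     (\<forall>A h. groupoid_ob C A \<and> in_mor C h A (ic0 N) \<longrightarrow> (h \<bullet>\<^bsub>C\<^esub> k) \<bullet>\<^bsub>C\<^esub> Q = power C (q (h \<bullet>\<^bsub>C\<^esub> g)))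
   \<and> (\<forall>A a. groupoid_ob C A \<and> in_mor C a A (ic1 N) \<longrightarrow>
        image_fl C X fl A (q (a \<bullet>\<^bsub>C\<^esub> (pi0 (icat_fl fl N) \<bullet>\<^bsub>C\<^esub> g))) (q (a \<bullet>\<^bsub>C\<^esub> (pi1 (icat_fl fl N) \<bullet>\<^bsub>C\<^esub> g)))
          (a \<rhd>\<^bsub>C\<^esub> g01) ((a \<rhd>\<^bsub>C\<^esub> k01) \<lhd>\<^bsub>C\<^esub> Q))"

lemma icat_fl_simps [simp]:
  "ic0 (icat_fl fl N) = ic0 N" "ic1 (icat_fl fl N) = ic1 N" "ic2 (icat_fl fl N) = ic2 N"
  "ie (icat_fl fl N) = ie N" "pi02 (icat_fl fl N) = pi02 N"
  by (simp_all add: icat_fl_def icat_op_def)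

context two_category
begin

text \<open>The internal-category identities are recovered by comparing the ends of 2-cells: they
  hold after composition with \<open>g\<close>, and morphisms from a groupoid to
  \<open>ic0 N\<close> are determined by that composite.\<close>

lemma nerve_like_fl:
  assumes n: "nerve_like C N X g g01"
  shows "in_mor C (pi0 (icat_fl fl N)) (ic1 N) (ic0 N)" "in_mor C (pi1 (icat_fl fl N)) (ic1 N) (ic0 N)"
    "in_mor C (pi01 (icat_fl fl N)) (ic2 N) (ic1 N)" "in_mor C (pi12 (icat_fl fl N)) (ic2 N) (ic1 N)"
    "ie N \<bullet> pi0 (icat_fl fl N) = Id1 C (ic0 N)" "ie N \<bullet> pi1 (icat_fl fl N) = Id1 C (ic0 N)"
    "pi02 N \<bullet> pi0 (icat_fl fl N) = pi01 (icat_fl fl N) \<bullet> pi0 (icat_fl fl N)"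
    "pi02 N \<bullet> pi1 (icat_fl fl N) = pi12 (icat_fl fl N) \<bullet> pi1 (icat_fl fl N)"
    "pi01 (icat_fl fl N) \<bullet> pi1 (icat_fl fl N) = pi12 (icat_fl fl N) \<bullet> pi0 (icat_fl fl N)"
    "cell_fl C fl g01 (pi0 (icat_fl fl N) \<bullet> g) (pi1 (icat_fl fl N) \<bullet> g)"
    "pi02 N \<rhd> g01 = vcomp_fl C fl (pi01 (icat_fl fl N) \<rhd> g01) (pi12 (icat_fl fl N) \<rhd> g01)"
proof -
  note d = nerve_likeD[OF n]
  note [simp] = in_morD[OF d(4)] in_morD[OF d(5)] in_morD[OF d(6)] in_morD[OF d(7)] in_morD[OF d(8)] in_morD[OF d(9)]
    in_morD[OF d(10)] in_cellD[OF d(11)]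
  have K: "ic0 N \<in> Ob C" using d(1) unfolding groupoid_ob_def by blast
  have uniq: "h = h'" if "groupoid_ob C A" "in_mor C h A (ic0 N)" "in_mor C h' A (ic0 N)" "h \<bullet> g = h' \<bullet> g" for A h h'
  proof (rule ex1_unique[OF d(15)[OF that(1)]])
    show "in_mor C (h' \<bullet> g) A X" using in_morD[OF that(3)] by (simp add: in_mor_def)
  qed (use that in simp_all)
  have e0: "ie N \<bullet> pi0 N = Id1 C (ic0 N)"
    by (rule uniq[OF d(1)]) (use arg_cong[OF d(12), of "Dom2 C"] K in \<open>simp_all add: in_mor_def\<close>)
  have e1: "ie N \<bullet> pi1 N = Id1 C (ic0 N)"
    by (rule uniq[OF d(1)]) (use arg_cong[OF d(12), of "Cod2 C"] K in \<open>simp_all add: in_mor_def\<close>)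
  have pg: "pi01 N \<bullet> (pi1 N \<bullet> g) = pi12 N \<bullet> (pi0 N \<bullet> g)"
    using comp1_eq_assoc[OF d(13), of g] by simp
  have p0: "pi02 N \<bullet> pi0 N = pi01 N \<bullet> pi0 N"
    by (rule uniq[OF d(3)]) (use arg_cong[OF d(14), of "Dom2 C"] pg in \<open>simp_all add: in_mor_def\<close>)
  have p1: "pi02 N \<bullet> pi1 N = pi12 N \<bullet> pi1 N"
    by (rule uniq[OF d(3)]) (use arg_cong[OF d(14), of "Cod2 C"] pg in \<open>simp_all add: in_mor_def\<close>)
  show "in_mor C (pi0 (icat_fl fl N)) (ic1 N) (ic0 N)" "in_mor C (pi1 (icat_fl fl N)) (ic1 N) (ic0 N)"
    "in_mor C (pi01 (icat_fl fl N)) (ic2 N) (ic1 N)" "in_mor C (pi12 (icat_fl fl N)) (ic2 N) (ic1 N)"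
    "ie N \<bullet> pi0 (icat_fl fl N) = Id1 C (ic0 N)" "ie N \<bullet> pi1 (icat_fl fl N) = Id1 C (ic0 N)"
    "pi02 N \<bullet> pi0 (icat_fl fl N) = pi01 (icat_fl fl N) \<bullet> pi0 (icat_fl fl N)"
    "pi02 N \<bullet> pi1 (icat_fl fl N) = pi12 (icat_fl fl N) \<bullet> pi1 (icat_fl fl N)"
    "pi01 (icat_fl fl N) \<bullet> pi1 (icat_fl fl N) = pi12 (icat_fl fl N) \<bullet> pi0 (icat_fl fl N)"
    "cell_fl C fl g01 (pi0 (icat_fl fl N) \<bullet> g) (pi1 (icat_fl fl N) \<bullet> g)"
    "pi02 N \<rhd> g01 = vcomp_fl C fl (pi01 (icat_fl fl N) \<rhd> g01) (pi12 (icat_fl fl N) \<rhd> g01)"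
    using d(4,5,7,8,11,13,14) e0 e1 p0 p1
    by (simp_all add: icat_fl_def icat_op_def cell_fl_def vcomp_fl_def)
qed

end

context internal_topos
begin

text \<open>The power object over the core and the image of the universal 2-cell, taken between the
  restrictions of that power object along source and target, form a cocone. In each law the two
  sides are images of the same 2-cell between the same power objects, hence equal.\<close>

lemma power_like_ex:
  assumes n: "nerve_like C N X g g01" and Y: "strict_quotient C (icat_fl fl N) Y k k01"
    and q: "power_family C X q"
  shows "\<exists>Q. in_mor C Q Y X \<and> power_like C X fl N g g01 k k01 q Q"
proof -
  note d = nerve_likeD[OF n] and f = nerve_like_fl[OF n, of fl]
  let ?S = "pi0 (icat_fl fl N)" and ?T = "pi1 (icat_fl fl N)" and ?L = "pi01 (icat_fl fl N)" and ?R = "pi12 (icat_fl fl N)"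
  note [simp] = in_morD[OF d(6)] in_morD[OF d(9)] in_morD[OF d(10)]
    in_morD[OF f(1)] in_morD[OF f(2)] in_morD[OF f(3)] in_morD[OF f(4)]
  let ?G = "q g" and ?p = "power C (q g)"
  note G = power_familyD[OF q d(1,10)]
  have p: "in_mor C ?p (ic0 N) X" by (rule base_mor(2)[OF d(1) G(1)])
  note [simp] = in_morD[OF p]
  note P0 = pull_power_triple[OF d(1,2) f(1) G(1)] and P1 = pull_power_triple[OF d(1,2) f(2) G(1)]
  have cg: "cell_fl C fl g01 (base C (pull C ?S ?G)) (base C (pull C ?T ?G))"
    using f(10) by (simp add: P0(2) P1(2) G(2))
  obtain d01 where im: "image_fl C X fl (ic1 N) (pull C ?S ?G) (pull C ?T ?G) g01 d01"
    using image_ex1(1)[OF d(2) P0(1) P1(1) cg] by blast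
  have dc: "in_cell C d01 (?S \<bullet> ?p) (?T \<bullet> ?p)"
    using image_ex1(2)[OF d(2) P0(1) P1(1) cg im] by (simp add: P0(3) P1(3))
  note [simp] = in_cellD[OF dc]
  have pc: "cell_fl C fl (h \<rhd> g01) (base C (pull C (h \<bullet> ?S) ?G)) (base C (pull C (h \<bullet> ?T) ?G))"
    and pim: "image_fl C X fl A (pull C (h \<bullet> ?S) ?G) (pull C (h \<bullet> ?T) ?G) (h \<rhd> g01) (h \<rhd> d01)"
    and ptr: "power_triple C X A (pull C (h \<bullet> ?S) ?G)" "power_triple C X A (pull C (h \<bullet> ?T) ?G)"
    if A: "groupoid_ob C A" and h: "in_mor C h A (ic1 N)" for A h
  proof -
    note [simp] = in_morD[OF h]
    have h0: "in_mor C (h \<bullet> ?S) A (ic0 N)" "in_mor C (h \<bullet> ?T) A (ic0 N)" by (simp_all add: in_mor_def)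
    note pp0 = pull_power_triple[OF d(1) A h0(1) G(1)] and pp1 = pull_power_triple[OF d(1) A h0(2) G(1)]
    show "power_triple C X A (pull C (h \<bullet> ?S) ?G)" "power_triple C X A (pull C (h \<bullet> ?T) ?G)" by (rule pp0 pp1)+
    show "cell_fl C fl (h \<rhd> g01) (base C (pull C (h \<bullet> ?S) ?G)) (base C (pull C (h \<bullet> ?T) ?G))"
      using cell_fl_lwhisker[OF f(10), of h A] h by (simp add: pp0(2) pp1(2) G(2))
    show "image_fl C X fl A (pull C (h \<bullet> ?S) ?G) (pull C (h \<bullet> ?T) ?G) (h \<rhd> g01) (h \<rhd> d01)"
      using image_pull[OF d(2) A h P0(1) P1(1) cg im] by (simp add: pull_pull[OF d(1) f(1) h G(1)] pull_pull[OF d(1) f(2) h G(1)])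
  qed
  have "is_cocone C (icat_fl fl N) X ?p d01"
    unfolding is_cocone_def
  proof (intro conjI)
    show "in_mor C ?p (ic0 (icat_fl fl N)) X" using p by simp
    show "in_cell C d01 (?S \<bullet> ?p) (?T \<bullet> ?p)" by (rule dc)
    \<comment> \<open>Restricted along \<open>ie N\<close>, the universal 2-cell is an identity and
      both of its power objects are \<open>?G\<close>.\<close>
    have "image_fl C X fl (ic0 N) ?G ?G (Id2 C (base C ?G)) (ie N \<rhd> d01)"
      using pim[OF d(1,6)] by (simp add: f(5,6) pull_Id[OF d(1) G(1)] d(12) G(2))
    moreover have "image_fl C X fl (ic0 N) ?G ?G (Id2 C (base C ?G)) (Id2 C ?p)"
      by (rule image_ide[OF d(1) G(1)])
    moreover have "cell_fl C fl (Id2 C (base C ?G)) (base C ?G) (base C ?G)"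
      by (simp add: cell_fl_def in_cell_def G(2))
    ultimately have "ie N \<rhd> d01 = Id2 C ?p" using ex1_unique[OF image_ex1(1)[OF d(1) G(1) G(1)]] by blast
    then show "ie (icat_fl fl N) \<rhd> d01 = Id2 C ?p" by simp
    \<comment> \<open>\<open>a\<close> and \<open>b\<close> are the restrictions along
      \<open>?L\<close> and \<open>?R\<close>, which composes them in the order of the possibly
      reversed nerve; \<open>c\<close> is the restriction along the composite. Folding makes the
      middle power objects literally equal.\<close>
    note a = pc[OF d(3) f(3)] pim[OF d(3) f(3)] ptr[OF d(3) f(3)]
    note b = pc[OF d(3) f(4), folded f(9)] pim[OF d(3) f(4), folded f(9)] ptr[OF d(3) f(4), folded f(9)]
    note c = pc[OF d(3,9), unfolded f(7,8)] pim[OF d(3,9), unfolded f(7,8)]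
    have "image_fl C X fl (ic2 N) (pull C (?L \<bullet> ?S) ?G) (pull C (?R \<bullet> ?T) ?G) (pi02 N \<rhd> g01) ((?L \<rhd> d01) \<odot> (?R \<rhd> d01))"
      unfolding f(11) by (rule image_comp[OF d(3) a(3) a(4) b(4) a(1) b(1) a(2) b(2)])
    then have "pi02 N \<rhd> d01 = (?L \<rhd> d01) \<odot> (?R \<rhd> d01)"
      by (rule ex1_unique[OF image_ex1(1)[OF d(3) a(3) b(4) c(1)] c(2)])
    then show "pi02 (icat_fl fl N) \<rhd> d01 = (?L \<rhd> d01) \<odot> (?R \<rhd> d01)" by simp
  qed
  from quotient_mor[OF Y this X_Ob] obtain Q where Q: "in_mor C Q Y X" "k \<bullet> Q = ?p" "k01 \<lhd> Q = d01" by blast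
  have cY: "is_cocone C (icat_fl fl N) Y k k01" using Y unfolding strict_quotient_def by blast
  have km: "in_mor C k (ic0 N) Y" and kc: "in_cell C k01 (?S \<bullet> k) (?T \<bullet> k)"
    using cY unfolding is_cocone_def by simp_all
  note [simp] = in_morD[OF Q(1)] in_morD[OF km] in_cellD[OF kc]
  have "power_like C X fl N g g01 k k01 q Q"
    unfolding power_like_def
  proof (intro conjI allI impI; elim conjE)
    fix A h assume A: "groupoid_ob C A" and h: "in_mor C h A (ic0 N)"
    note [simp] = in_morD[OF h]
    show "(h \<bullet> k) \<bullet> Q = power C (q (h \<bullet> g))"
      using pull_power_triple(3)[OF d(1) A h G(1)] by (simp add: Q(2) G(3)[OF A h])
  next
    fix A a assume A: "groupoid_ob C A" and a: "in_mor C a A (ic1 N)"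
    note [simp] = in_morD[OF a]
    have a0: "in_mor C (a \<bullet> ?S) A (ic0 N)" "in_mor C (a \<bullet> ?T) A (ic0 N)" by (simp_all add: in_mor_def)
    have "q (a \<bullet> (?S \<bullet> g)) = pull C (a \<bullet> ?S) ?G" "q (a \<bullet> (?T \<bullet> g)) = pull C (a \<bullet> ?T) ?G"
      using G(3)[OF A a0(1)] G(3)[OF A a0(2)] by simp_all
    then show "image_fl C X fl A (q (a \<bullet> (?S \<bullet> g))) (q (a \<bullet> (?T \<bullet> g))) (a \<rhd> g01) ((a \<rhd> k01) \<lhd> Q)"
      using pim[OF A a] by (simp add: Q(3))
  qed
  then show ?thesis using Q(1) by blast
qed

text \<open>The comparison of two power morphisms is the image of an identity for two choices of power
  objects.\<close>

lemma power_like_comparison: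
  assumes n: "nerve_like C N X g g01" and Y: "strict_quotient C (icat_fl fl N) Y k k01"
    and q: "power_family C X q" and Q: "in_mor C Q Y X" and pl: "power_like C X fl N g g01 k k01 q Q"
    and q': "power_family C X q'" and Q': "in_mor C Q' Y X" and pl': "power_like C X fl N g g01 k k01 q' Q'"
  shows "\<exists>\<beta>. in_cell C \<beta> Q Q' \<and> image_fl C X fl (ic0 N) (q g) (q' g) (Id2 C g) (k \<rhd> \<beta>)"
proof -
  note d = nerve_likeD[OF n] and f = nerve_like_fl[OF n, of fl]
  let ?S = "pi0 (icat_fl fl N)" and ?T = "pi1 (icat_fl fl N)"
  note G = power_familyD[OF q d(1,10)] and G' = power_familyD[OF q' d(1,10)]
  have cY: "is_cocone C (icat_fl fl N) Y k k01" using Y unfolding strict_quotient_def by blast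
  have km: "in_mor C k (ic0 N) Y" and kc: "in_cell C k01 (?S \<bullet> k) (?T \<bullet> k)"
    using cY unfolding is_cocone_def by simp_all
  note [simp] = in_morD[OF d(10)] in_morD[OF f(1)] in_morD[OF f(2)] in_morD[OF Q] in_morD[OF Q'] in_morD[OF km] in_cellD[OF kc]
  have K: "ic0 N \<in> Ob C" "ic1 N \<in> Ob C" using d(1,2) by (simp_all add: groupoid_Ob)
  note [simp] = K
  \<comment> \<open>The first condition at the identity of the core evaluates the power morphism on
    the universal object; the second, at the identity of \<open>ic1 N\<close>, evaluates it on the
    universal 2-cell.\<close>
  have kQ: "k \<bullet> R = power C (p g)" if "power_like C X fl N g g01 k k01 p R" "in_mor C R Y X" for p R
  proof -
    have "in_mor C (Id1 C (ic0 N)) (ic0 N) (ic0 N)" by (simp add: in_mor_def)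
    then have "(Id1 C (ic0 N) \<bullet> k) \<bullet> R = power C (p (Id1 C (ic0 N) \<bullet> g))"
      using that(1) d(1) unfolding power_like_def by blast
    then show ?thesis by simp
  qed
  have kim: "image_fl C X fl (ic1 N) (pull C ?S (p g)) (pull C ?T (p g)) g01 (k01 \<lhd> R)"
    if pf: "power_family C X p" and "power_like C X fl N g g01 k k01 p R" for p R
  proof -
    have "in_mor C (Id1 C (ic1 N)) (ic1 N) (ic1 N)" by (simp add: in_mor_def)
    then have "image_fl C X fl (ic1 N) (p (Id1 C (ic1 N) \<bullet> (?S \<bullet> g))) (p (Id1 C (ic1 N) \<bullet> (?T \<bullet> g))) (Id1 C (ic1 N) \<rhd> g01) ((Id1 C (ic1 N) \<rhd> k01) \<lhd> R)"
      using that(2) d(2) unfolding power_like_def by blast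
    moreover have "Id1 C (ic1 N) \<rhd> g01 = g01" using in_cellD[OF d(11)] in_morD[OF d(4)] by simp
    ultimately show ?thesis
      using power_familyD(3)[OF pf d(1,10) d(2) f(1)] power_familyD(3)[OF pf d(1,10) d(2) f(2)] by simp
  qed
  have cid: "cell_fl C fl (Id2 C g) (base C (q g)) (base C (q' g))"
    by (simp add: cell_fl_def in_cell_def G(2) G'(2))
  obtain \<theta> where t: "image_fl C X fl (ic0 N) (q g) (q' g) (Id2 C g) \<theta>"
    using image_ex1(1)[OF d(1) G(1) G'(1) cid] by blast
  have tc: "in_cell C \<theta> (k \<bullet> Q) (k \<bullet> Q')"
    using image_ex1(2)[OF d(1) G(1) G'(1) cid t] by (simp add: kQ[OF pl Q] kQ[OF pl' Q'])
  note P0 = pull_power_triple[OF d(1,2) f(1) G(1)] and P1 = pull_power_triple[OF d(1,2) f(2) G(1)]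
    and P0' = pull_power_triple[OF d(1,2) f(1) G'(1)] and P1' = pull_power_triple[OF d(1,2) f(2) G'(1)]
  have ci: "cell_fl C fl (Id2 C (?S \<bullet> g)) (base C (pull C ?S (q g))) (base C (pull C ?S (q' g)))"
    "cell_fl C fl (Id2 C (?T \<bullet> g)) (base C (pull C ?T (q g))) (base C (pull C ?T (q' g)))"
    "cell_fl C fl g01 (base C (pull C ?S (q g))) (base C (pull C ?T (q g)))"
    "cell_fl C fl g01 (base C (pull C ?S (q' g))) (base C (pull C ?T (q' g)))"
    "cell_fl C fl g01 (base C (pull C ?S (q g))) (base C (pull C ?T (q' g)))"
    using f(10) by (simp_all add: cell_fl_def in_cell_def P0(2) P1(2) P0'(2) P1'(2) G(2) G'(2))
  have t0: "image_fl C X fl (ic1 N) (pull C ?S (q g)) (pull C ?S (q' g)) (Id2 C (?S \<bullet> g)) (?S \<rhd> \<theta>)"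
    using image_pull[OF d(1,2) f(1) G(1) G'(1) cid t] by simp
  have t1: "image_fl C X fl (ic1 N) (pull C ?T (q g)) (pull C ?T (q' g)) (Id2 C (?T \<bullet> g)) (?T \<rhd> \<theta>)"
    using image_pull[OF d(1,2) f(2) G(1) G'(1) cid t] by simp
  have v: "vcomp_fl C fl (Id2 C (?S \<bullet> g)) g01 = g01" "vcomp_fl C fl g01 (Id2 C (?T \<bullet> g)) = g01"
    using f(10) by (auto simp: vcomp_fl_def cell_fl_def in_cell_def split: if_splits)
  \<comment> \<open>Both ways around the naturality square are images of \<open>g01\<close> from the
    choice \<open>q\<close> at the source to the choice \<open>q'\<close> at the target, so they
    agree by uniqueness of images.\<close>
  have "image_fl C X fl (ic1 N) (pull C ?S (q g)) (pull C ?T (q' g)) g01 ((?S \<rhd> \<theta>) \<odot> (k01 \<lhd> Q'))"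
    using image_comp[OF d(2) P0(1) P0'(1) P1'(1) ci(1,4) t0 kim[OF q' pl']] by (simp add: v)
  moreover have "image_fl C X fl (ic1 N) (pull C ?S (q g)) (pull C ?T (q' g)) g01 ((k01 \<lhd> Q) \<odot> (?T \<rhd> \<theta>))"
    using image_comp[OF d(2) P0(1) P1(1) P1'(1) ci(3,2) kim[OF q pl] t1] by (simp add: v)
  ultimately have "(?S \<rhd> \<theta>) \<odot> (k01 \<lhd> Q') = (k01 \<lhd> Q) \<odot> (?T \<rhd> \<theta>)"
    by (rule ex1_unique[OF image_ex1(1)[OF d(2) P0(1) P1'(1) ci(5)]])
  from quotient_cell[OF Y Q Q' tc this] show ?thesis using t by blast
qed

text \<open>The comparisons in the two directions compose to images of identities within one choice
  of power objects, and these are identities. Whiskering with \<open>k\<close> detects this, since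
  2-cells out of a quotient are determined by it.\<close>

lemma power_like_unique:
  assumes n: "nerve_like C N X g g01" and Y: "strict_quotient C (icat_fl fl N) Y k k01"
    and q: "power_family C X q" and Q: "in_mor C Q Y X" and pl: "power_like C X fl N g g01 k k01 q Q"
    and q': "power_family C X q'" and Q': "in_mor C Q' Y X" and pl': "power_like C X fl N g g01 k k01 q' Q'"
  shows "isomorphic (hom C Y X) Q Q'"
proof -
  note d = nerve_likeD[OF n]
  note [simp] = in_morD[OF Q] in_morD[OF Q'] in_morD[OF d(10)]
  have cY: "is_cocone C (icat_fl fl N) Y k k01" using Y unfolding strict_quotient_def by blast
  have km: "in_mor C k (ic0 N) Y" using cY unfolding is_cocone_def by simp
  have kc: "in_cell C k01 (pi0 (icat_fl fl N) \<bullet> k) (pi1 (icat_fl fl N) \<bullet> k)" using cY unfolding is_cocone_def by simp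
  note [simp] = in_morD[OF km] in_cellD[OF kc] in_morD[OF nerve_like_fl(1)[OF n, of fl]] in_morD[OF nerve_like_fl(2)[OF n, of fl]]
  have inv: "\<beta> \<odot> \<gamma> = Id2 C R"
    if p: "power_family C X p" and p': "power_family C X p'" and R: "in_mor C R Y X" and R': "in_mor C R' Y X"
      and plR: "power_like C X fl N g g01 k k01 p R"
      and b: "in_cell C \<beta> R R'" "image_fl C X fl (ic0 N) (p g) (p' g) (Id2 C g) (k \<rhd> \<beta>)"
      and c: "in_cell C \<gamma> R' R" "image_fl C X fl (ic0 N) (p' g) (p g) (Id2 C g) (k \<rhd> \<gamma>)" for p p' R R' \<beta> \<gamma>
  proof -
    note G = power_familyD[OF p d(1,10)] and G' = power_familyD[OF p' d(1,10)]
    note [simp] = in_morD[OF R] in_morD[OF R'] in_cellD[OF b(1)] in_cellD[OF c(1)]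
    have ci: "cell_fl C fl (Id2 C g) (base C (p g)) (base C (p' g))" "cell_fl C fl (Id2 C g) (base C (p' g)) (base C (p g))"
      "cell_fl C fl (Id2 C g) (base C (p g)) (base C (p g))"
      by (simp_all add: cell_fl_def in_cell_def G(2) G'(2))
    have kR: "k \<bullet> R = power C (p g)"
      using in_cellD(2)[OF image_ex1(2)[OF d(1) G(1) G'(1) ci(1) b(2)]] by simp
    have "vcomp_fl C fl (Id2 C g) (Id2 C g) = Id2 C g" by (simp add: vcomp_fl_def)
    then have "image_fl C X fl (ic0 N) (p g) (p g) (Id2 C g) (k \<rhd> (\<beta> \<odot> \<gamma>))"
      using image_comp[OF d(1) G(1) G'(1) G(1) ci(1,2) b(2) c(2)] by (simp add: lwhisker_vcomp)
    moreover have "image_fl C X fl (ic0 N) (p g) (p g) (Id2 C g) (Id2 C (k \<bullet> R))"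
      using image_ide[OF d(1) G(1)] by (simp add: G(2) kR)
    ultimately have e: "k \<rhd> (\<beta> \<odot> \<gamma>) = Id2 C (k \<bullet> R)"
      by (rule ex1_unique[OF image_ex1(1)[OF d(1) G(1) G(1) ci(3)]])
    have "\<exists>!\<delta>. in_cell C \<delta> R R \<and> k \<rhd> \<delta> = Id2 C (k \<bullet> R)"
      by (rule quotient_cell[OF Y R R]) (simp_all add: in_cell_def)
    then show ?thesis by (rule ex1_unique) (use e in \<open>simp_all add: in_cell_def\<close>)
  qed
  obtain \<beta> where b: "in_cell C \<beta> Q Q'" "image_fl C X fl (ic0 N) (q g) (q' g) (Id2 C g) (k \<rhd> \<beta>)"
    using power_like_comparison[OF n Y q Q pl q' Q' pl'] by blast
  obtain \<gamma> where c: "in_cell C \<gamma> Q' Q" "image_fl C X fl (ic0 N) (q' g) (q g) (Id2 C g) (k \<rhd> \<gamma>)"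
    using power_like_comparison[OF n Y q' Q' pl' q Q pl] by blast
  have "is_iso (vert C) \<beta>"
    by (rule is_iso_vertI[OF b(1) c(1) inv[OF q q' Q Q' pl b c] inv[OF q' q Q' Q pl' c b]])
  then have "is_iso (hom C Y X) \<beta>" using in_cellD[OF b(1)] by (simp add: is_iso_hom)
  then show ?thesis
    unfolding isomorphic_def using b(1) by (intro exI[of _ \<beta>]) (simp add: in_hom_hom)
qed

text \<open>Every morphism from a groupoid to X is some h g, and every 2-cell between such morphisms
  is a restriction of \<open>g01\<close>, each in exactly one way; so testing on morphisms and
  2-cells amounts to testing on their lifts.\<close>

lemma covariant_iff_power_like:
  assumes n: "nerve_like C N X g g01"
  shows "covariant_power_morphism C X Q \<longleftrightarrow> in_mor C Q X X \<and> (\<exists>i XK ev j P. power_choice C X i XK ev j P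
    \<and> power_like C X False N g g01 g g01 (\<lambda>f. chosen_triple (chosen_diagram C i ev j P f)) Q)"
proof -
  note d = nerve_likeD[OF n]
  note [simp] = in_morD[OF d(4)] in_morD[OF d(5)] in_morD[OF d(10)] in_cellD[OF d(11)]
  have fl [simp]: "icat_fl False N = N" by (simp add: icat_fl_def)
  have "(\<forall>A f. groupoid_ob C A \<and> in_mor C f A X \<longrightarrow> f \<bullet> Q = fobj (chosen_diagram C i ev j P f) 1)
      \<and> (\<forall>A f f' \<alpha>. groupoid_ob C A \<and> in_mor C f A X \<and> in_mor C f' A X \<and> in_cell C \<alpha> f f' \<longrightarrow>
           is_direct_image (hom C A X) (chosen_diagram C i ev j P f) (chosen_diagram C i ev j P f') \<alpha> (\<alpha> \<lhd> Q))
    \<longleftrightarrow> power_like C X False N g g01 g g01 (\<lambda>f. chosen_triple (chosen_diagram C i ev j P f)) Q" (is "?A \<longleftrightarrow> ?B")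
    if Q: "in_mor C Q X X" and pc: "power_choice C X i XK ev j P" for i XK ev j P
  proof
    note [simp] = in_morD[OF Q]
    let ?C = "chosen_diagram C i ev j P"
    note cf = chosen_diagram_facts[OF pc]
    { assume A: ?A
      show ?B
        unfolding power_like_def fl
      proof (intro conjI allI impI; elim conjE)
        fix A h assume Ag: "groupoid_ob C A" and h: "in_mor C h A (ic0 N)"
        have hg: "in_mor C (h \<bullet> g) A X" using in_morD[OF h] by (simp add: in_mor_def)
        show "(h \<bullet> g) \<bullet> Q = power C (chosen_triple (?C (h \<bullet> g)))"
          using A Ag hg chosen_objects(2)[OF cf(1)[OF Ag hg]] by metis
      next
        fix A a assume Ag: "groupoid_ob C A" and a: "in_mor C a A (ic1 N)"
        note [simp] = in_morD[OF a]
        have m: "in_mor C (a \<bullet> (pi0 N \<bullet> g)) A X" "in_mor C (a \<bullet> (pi1 N \<bullet> g)) A X"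
          and c: "in_cell C (a \<rhd> g01) (a \<bullet> (pi0 N \<bullet> g)) (a \<bullet> (pi1 N \<bullet> g))" by (simp_all add: in_mor_def in_cell_def)
        have "is_direct_image (hom C A X) (?C (a \<bullet> (pi0 N \<bullet> g))) (?C (a \<bullet> (pi1 N \<bullet> g))) (a \<rhd> g01) ((a \<rhd> g01) \<lhd> Q)"
          using A Ag m c by blast
        then show "image_fl C X False A (chosen_triple (?C (a \<bullet> (pi0 N \<bullet> g)))) (chosen_triple (?C (a \<bullet> (pi1 N \<bullet> g))))
            (a \<rhd> g01) ((a \<rhd> g01) \<lhd> Q)"
          unfolding is_direct_image_iff[OF cf(1)[OF Ag m(1)] cf(1)[OF Ag m(2)]] by blast
      qed }
    { assume B: ?B
      show ?A
      proof (intro conjI allI impI; elim conjE)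
        fix A f assume Ag: "groupoid_ob C A" and f: "in_mor C f A X"
        obtain h where h: "in_mor C h A (ic0 N)" "h \<bullet> g = f" using d(15)[OF Ag f] by blast
        have "(h \<bullet> g) \<bullet> Q = power C (chosen_triple (?C (h \<bullet> g)))"
          using B Ag h(1) unfolding power_like_def by blast
        then show "f \<bullet> Q = fobj (?C f) 1" using chosen_objects(2)[OF cf(1)[OF Ag f]] by (simp add: h(2))
      next
        fix A f f' \<alpha> assume Ag: "groupoid_ob C A" and f: "in_mor C f A X" and f': "in_mor C f' A X" and \<alpha>: "in_cell C \<alpha> f f'"
        obtain a where a: "in_mor C a A (ic1 N)" "a \<rhd> g01 = \<alpha>"
          using d(16)[OF Ag in_cellD(1)[OF \<alpha>]] in_cellD(2)[OF \<alpha>] in_morD[OF f] by auto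
        note [simp] = in_morD[OF a(1)]
        have e: "a \<bullet> (pi0 N \<bullet> g) = f" "a \<bullet> (pi1 N \<bullet> g) = f'"
          using in_cellD[OF \<alpha>] by (simp_all add: a(2)[symmetric])
        have "image_fl C X False A (chosen_triple (?C (a \<bullet> (pi0 N \<bullet> g)))) (chosen_triple (?C (a \<bullet> (pi1 N \<bullet> g))))
            (a \<rhd> g01) ((a \<rhd> g01) \<lhd> Q)"
          using B Ag a(1) unfolding power_like_def fl by blast
        then show "is_direct_image (hom C A X) (?C f) (?C f') \<alpha> (\<alpha> \<lhd> Q)"
          unfolding is_direct_image_iff[OF cf(1)[OF Ag f] cf(1)[OF Ag f']] e a(2)
          using \<alpha> in_morD[OF f] by (simp add: in_hom_hom cf(2)[OF Ag f] cf(2)[OF Ag f'])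
      qed }
  qed
  then show ?thesis unfolding covariant_power_morphism_def by blast
qed

text \<open>\<open>op_mor\<close> and \<open>op_cell\<close> are themselves defined through lifts,
  so on a lifted morphism or 2-cell they reduce to composition with \<open>k\<close> and whiskering
  of \<open>k01\<close>.\<close>

lemma contravariant_iff_power_like:
  assumes n: "nerve_like C N X g g01" and Y: "strict_quotient C (icat_op N) Y k k01"
  shows "contravariant_power_morphism C N X g g01 Y k k01 Q \<longleftrightarrow> in_mor C Q Y X \<and> (\<exists>i XK ev j P. power_choice C X i XK ev j P
    \<and> power_like C X True N g g01 k k01 (\<lambda>f. chosen_triple (chosen_diagram C i ev j P f)) Q)"
proof -
  note d = nerve_likeD[OF n]
  note [simp] = in_morD[OF d(4)] in_morD[OF d(5)] in_morD[OF d(10)] in_cellD[OF d(11)]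
  have fl [simp]: "icat_fl True N = icat_op N" by (simp add: icat_fl_def)
  have ops [simp]: "pi0 (icat_op N) = pi1 N" "pi1 (icat_op N) = pi0 N" by (simp_all add: icat_op_def)
  have opm: "op_mor C g k (h \<bullet> g) = h \<bullet> k" if A: "groupoid_ob C A" and h: "in_mor C h A (ic0 N)" for A h
  proof -
    note [simp] = in_morD[OF h]
    have "\<exists>!k. in_mor C k (Src C (h \<bullet> g)) (Src C g) \<and> k \<bullet> g = h \<bullet> g"
      using d(15)[OF A, of "h \<bullet> g"] by (simp add: in_mor_def)
    from lift_along_eq(3)[OF this, of h] h show ?thesis by (simp add: op_mor_def)
  qed
  have opc: "op_cell C N g01 k01 (a \<rhd> g01) = a \<rhd> k01" if A: "groupoid_ob C A" and a: "in_mor C a A (ic1 N)" for A a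
  proof -
    note [simp] = in_morD[OF a]
    have ex: "\<exists>!b. in_mor C b A (ic1 N) \<and> b \<rhd> g01 = a \<rhd> g01" by (rule d(16)[OF A]) simp_all
    have "(THE b. in_mor C b A (ic1 N) \<and> b \<rhd> g01 = a \<rhd> g01) = a"
      using a by (intro the1_equality[OF ex]) simp
    then show ?thesis by (simp add: op_cell_def)
  qed
  have "(\<forall>A f. groupoid_ob C A \<and> in_mor C f A X \<longrightarrow> op_mor C g k f \<bullet> Q = fobj (chosen_diagram C i ev j P f) 1)
      \<and> (\<forall>A f f' \<alpha>. groupoid_ob C A \<and> in_mor C f A X \<and> in_mor C f' A X \<and> in_cell C \<alpha> f f' \<longrightarrow>
           is_inverse_image (hom C A X) (chosen_diagram C i ev j P f) (chosen_diagram C i ev j P f') \<alpha> (op_cell C N g01 k01 \<alpha> \<lhd> Q))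
    \<longleftrightarrow> power_like C X True N g g01 k k01 (\<lambda>f. chosen_triple (chosen_diagram C i ev j P f)) Q" (is "?A \<longleftrightarrow> ?B")
    if pc: "power_choice C X i XK ev j P" for i XK ev j P
  proof
    let ?C = "chosen_diagram C i ev j P"
    note cf = chosen_diagram_facts[OF pc]
    { assume A: ?A
      show ?B
        unfolding power_like_def fl ops
      proof (intro conjI allI impI; elim conjE)
        fix A h assume Ag: "groupoid_ob C A" and h: "in_mor C h A (ic0 N)"
        have hg: "in_mor C (h \<bullet> g) A X" using in_morD[OF h] by (simp add: in_mor_def)
        show "(h \<bullet> k) \<bullet> Q = power C (chosen_triple (?C (h \<bullet> g)))"
          using A Ag hg chosen_objects(2)[OF cf(1)[OF Ag hg]] opm[OF Ag h] by metis
      next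
        fix A a assume Ag: "groupoid_ob C A" and a: "in_mor C a A (ic1 N)"
        note [simp] = in_morD[OF a]
        have m: "in_mor C (a \<bullet> (pi0 N \<bullet> g)) A X" "in_mor C (a \<bullet> (pi1 N \<bullet> g)) A X"
          and c: "in_cell C (a \<rhd> g01) (a \<bullet> (pi0 N \<bullet> g)) (a \<bullet> (pi1 N \<bullet> g))" by (simp_all add: in_mor_def in_cell_def)
        have "is_inverse_image (hom C A X) (?C (a \<bullet> (pi0 N \<bullet> g))) (?C (a \<bullet> (pi1 N \<bullet> g))) (a \<rhd> g01) (op_cell C N g01 k01 (a \<rhd> g01) \<lhd> Q)"
          using A Ag m c by blast
        then show "image_fl C X True A (chosen_triple (?C (a \<bullet> (pi1 N \<bullet> g)))) (chosen_triple (?C (a \<bullet> (pi0 N \<bullet> g))))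
            (a \<rhd> g01) ((a \<rhd> k01) \<lhd> Q)"
          unfolding is_inverse_image_iff[OF cf(1)[OF Ag m(1)] cf(1)[OF Ag m(2)]] opc[OF Ag a] by blast
      qed }
    { assume B: ?B
      show ?A
      proof (intro conjI allI impI; elim conjE)
        fix A f assume Ag: "groupoid_ob C A" and f: "in_mor C f A X"
        obtain h where h: "in_mor C h A (ic0 N)" "h \<bullet> g = f" using d(15)[OF Ag f] by blast
        have "(h \<bullet> k) \<bullet> Q = power C (chosen_triple (?C (h \<bullet> g)))"
          using B Ag h(1) unfolding power_like_def by blast
        then show "op_mor C g k f \<bullet> Q = fobj (?C f) 1"
          using chosen_objects(2)[OF cf(1)[OF Ag f]] opm[OF Ag h(1)] by (simp add: h(2))
      next
        fix A f f' \<alpha> assume Ag: "groupoid_ob C A" and f: "in_mor C f A X" and f': "in_mor C f' A X" and \<alpha>: "in_cell C \<alpha> f f'"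
        obtain a where a: "in_mor C a A (ic1 N)" "a \<rhd> g01 = \<alpha>"
          using d(16)[OF Ag in_cellD(1)[OF \<alpha>]] in_cellD(2)[OF \<alpha>] in_morD[OF f] by auto
        note [simp] = in_morD[OF a(1)]
        have e: "a \<bullet> (pi0 N \<bullet> g) = f" "a \<bullet> (pi1 N \<bullet> g) = f'"
          using in_cellD[OF \<alpha>] by (simp_all add: a(2)[symmetric])
        have "image_fl C X True A (chosen_triple (?C (a \<bullet> (pi1 N \<bullet> g)))) (chosen_triple (?C (a \<bullet> (pi0 N \<bullet> g))))
            (a \<rhd> g01) ((a \<rhd> k01) \<lhd> Q)"
          using B Ag a(1) unfolding power_like_def fl ops by blast
        then show "is_inverse_image (hom C A X) (?C f) (?C f') \<alpha> (op_cell C N g01 k01 \<alpha> \<lhd> Q)"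
          unfolding is_inverse_image_iff[OF cf(1)[OF Ag f] cf(1)[OF Ag f']] e opc[OF Ag a(1), symmetric] a(2)
          using \<alpha> in_morD[OF f] by (simp add: in_hom_hom cf(2)[OF Ag f] cf(2)[OF Ag f'])
      qed }
  qed
  then show ?thesis unfolding contravariant_power_morphism_def by blast
qed

end

theorem propositionB2p3:
  fixes C :: "('o, 'm, 'c) twocat" and X :: 'o
  assumes "groupoidant C"
    and "X \<in> Ob C"
    and "internal_elementary_topos C X"
  shows "(\<exists>Q. covariant_power_morphism C X Q)
    \<and> (\<forall>Q Q'. covariant_power_morphism C X Q \<and> covariant_power_morphism C X Q' \<longrightarrow>
         isomorphic (hom C X X) Q Q')
    \<and> (\<forall>D g g01 Xop gop gop01. opposition C D X g g01 Xop gop gop01 \<longrightarrow>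
         (\<exists>Q. contravariant_power_morphism C D X g g01 Xop gop gop01 Q)
       \<and> (\<forall>Q Q'. contravariant_power_morphism C D X g g01 Xop gop gop01 Q
                 \<and> contravariant_power_morphism C D X g g01 Xop gop gop01 Q' \<longrightarrow>
            isomorphic (hom C Xop X) Q Q'))"
proof -
  have pita: "pita C" using assms(1) unfolding groupoidant_def by blast
  then have two: "two_category C" unfolding pita_def by blast
  interpret internal_topos C X
    by (intro internal_topos.intro groupoidant_category.intro pita_category.intro two
        pita_category_axioms.intro groupoidant_category_axioms.intro internal_topos_axioms.intro assms pita)
  obtain i XK ev j P where pc: "power_choice C X i XK ev j P" using power_choice_ex by blast
  note pf = chosen_power_family
  show ?thesis
  proof (intro conjI allI impI; (elim conjE)?)
    obtain N g g01 where N: "is_nerve C X N g g01" using nerve_ex[OF X_Ob] by blast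
    have n: "nerve_like C N X g g01" by (rule nerve_is_nerve_like[OF X_Ob N])
    \<comment> \<open>In the covariant case the source of the power morphism is \<open>X\<close> as
      the quotient of its own nerve.\<close>
    have q: "strict_quotient C (icat_fl False N) X g g01"
      using nerve_quotient[OF X_Ob N] by (simp add: icat_fl_def)
    show "\<exists>Q. covariant_power_morphism C X Q"
      unfolding covariant_iff_power_like[OF n] using power_like_ex[OF n q pf[OF pc]] pc by blast
    fix Q Q' assume "covariant_power_morphism C X Q" "covariant_power_morphism C X Q'"
    then show "isomorphic (hom C X X) Q Q'"
      unfolding covariant_iff_power_like[OF n] using power_like_unique[OF n q pf _ _ pf] by blast
  next
    fix D g g01 Xop gop gop01 assume "opposition C D X g g01 Xop gop gop01"
    then have cc: "complete_congruence C D" and qX: "strict_quotient C D X g g01"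
      and qop: "strict_quotient C (icat_op D) Xop gop gop01"
      unfolding opposition_def by blast+
    \<comment> \<open>The congruence of the opposition is a nerve of some \<open>Y\<close>, which is
      then a quotient of it just as \<open>X\<close> is; this is what transports the lifting
      properties to \<open>X\<close>.\<close>
    obtain Y k k01 where Y: "Y \<in> Ob C" and N: "is_nerve C Y D k k01"
      using assms(1) cc unfolding groupoidant_def by blast
    have n: "nerve_like C D X g g01"
      by (rule nerve_like_transport[OF nerve_is_nerve_like[OF Y N] nerve_quotient[OF Y N] qX])
    have q: "strict_quotient C (icat_fl True D) Xop gop gop01"
      using qop by (simp add: icat_fl_def)
    show "\<exists>Q. contravariant_power_morphism C D X g g01 Xop gop gop01 Q"
      unfolding contravariant_iff_power_like[OF n qop] using power_like_ex[OF n q pf[OF pc]] pc by blast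
    fix Q Q' assume "contravariant_power_morphism C D X g g01 Xop gop gop01 Q" "contravariant_power_morphism C D X g g01 Xop gop gop01 Q'"
    then show "isomorphic (hom C Xop X) Q Q'"
      unfolding contravariant_iff_power_like[OF n qop] using power_like_unique[OF n q pf _ _ pf] by blast
  qed
qed

end
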